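(* Let $f_0$ be a probability density on $\mathbb{R}$, let $\mu_0(dv)=f_0(v)\,dv$, let $\sigma^2=\int_{\mathbb{R}}v^2f_0(v)\,dv$, and let $f(\cdot,t)$ be the solution of Kac's equation with initial datum $f_0$. Suppose that $\int_{\mathbb{R}}|v|^{4+\delta}f_0(v)\,dv<+\infty$ for some $\delta\in[0,2)$, that $\kappa_4(\tilde\mu_0)=0$, and that the Fourier transform $\varphi_0(\xi)=\int_{\mathbb{R}}e^{i\xi x}f_0(x)\,dx$ satisfies $\varphi_0(\xi)=o(|\xi|^{-p})$ as $|\xi|\to+\infty$ for some strictly positive $p$. Then there exist a strictly positive constant $\overline C_\delta=\overline C_\delta(f_0;p)$ and a function $\rho_\delta:[0,+\infty)\to[0,+\infty)$ with $\rho_\delta(t)\to0$ as $t\to+\infty$ such that $$\int_{\mathbb{R}}\left|f(v,t)-\frac{1}{\sigma\sqrt{2\pi}}e^{-v^2/(2\sigma^2)}\right|dv\ \le\ \overline C_\delta\,e^{-t/4}\,\rho_\delta(t)\qquad(t\ge0).$$ In particular, if $\delta\in(0,2)$, one can take $$\rho_\delta(t)=\exp\{(-3/4+2\alpha_{4+\delta})\,t\},\qquad \alpha_s:=\frac1{2\pi}\int_0^{2\pi}|\sin\theta|^s\,d\theta .$$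
   Context: Kac's equation is $$\frac{\partial f}{\partial t}(v,t)=\frac1{2\pi}\int_0^{2\pi}\int_{\mathbb{R}}\left[f(v\cos\theta-w\sin\theta,t)\,f(v\sin\theta+w\cos\theta,t)-f(v,t)f(w,t)\right]dw\,d\theta\qquad(v\in\mathbb{R},\,t>0),$$ with a probability density $f_0$ as initial datum. The Cauchy problem has a unique solution within the class of probability density functions on $\mathbb{R}$. The Fourier transform $\varphi(\xi,t)=\int e^{i\xi v}f(v,t)\,dv$ solves $\partial_t\varphi(\xi,t)=\frac1{2\pi}\int_0^{2\pi}\varphi(\xi\cos\theta,t)\varphi(\xi\sin\theta,t)\,d\theta-\varphi(\xi,t)$ with $\varphi(\cdot,0)=\varphi_0$, and is given by the Wild series $\varphi(\xi,t)=\sum_{n\ge1}e^{-t}(1-e^{-t})^{n-1}\hat q_n(\xi;\varphi_0)$ with $\hat q_1=\varphi_0$, $\hat q_n=\frac{1}{n-1}\sum_{k=1}^{n-1}\hat q_k\star\hat q_{n-k}$ $(n\ge2)$, where $(g_1\star g_2)(\xi)=\frac1{2\pi}\int_0^{2\pi}g_1(\xi\cos\theta)g_2(\xi\sin\theta)\,d\theta$. The symmetrized form of $\mu_0$ is $\tilde\mu_0(B)=\{\mu_0(B)+\mu_0(-B)\}/2$ for Borel $B\subset\mathbb{R}$, with $-B=\{x:-x\in B\}$. The fourth cumulant of a probability $Q$ with finite fourth moment is $\kappa_4(Q)=\int(x-\overline Q)^4Q(dx)-3\left(\int(x-\overline Q)^2Q(dx)\right)^2$, where $\overline Q=\int x\,Q(dx)$.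 *)

theory Defs
  imports "HOL-Probability.Probability" "HOL-Library.Landau_Symbols"
begin

definition prob_density :: "(real \<Rightarrow> real) \<Rightarrow> bool" where
  "prob_density g \<longleftrightarrow>
     g \<in> borel_measurable borel \<and> (\<forall>v. 0 \<le> g v) \<and> prob_space (density lborel g)"

definition kac_integrand :: "(real \<Rightarrow> real) \<Rightarrow> real \<Rightarrow> real \<Rightarrow> real \<Rightarrow> real" where
  "kac_integrand g v \<theta> w =
     g (v * cos \<theta> - w * sin \<theta>) * g (v * sin \<theta> + w * cos \<theta>) - g v * g w"

definition kac_collision :: "(real \<Rightarrow> real) \<Rightarrow> real \<Rightarrow> real" where
  "kac_collision g v =
     1 / (2 * pi) * (LINT \<theta>:{0..2*pi}|lborel. LINT w|lborel. kac_integrand g v \<theta> w)"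

text \<open>For a general density \<^term>\<open>g\<close> the double integral in \<^const>\<open>kac_collision\<close> may diverge for \<^term>\<open>v\<close> in
  a null set, where the Bochner integral would silently return a default value. The equation is
  therefore required for almost every \<^term>\<open>v\<close> (with one null set for all times), together with
  absolute convergence of the double integral. The initial datum is attained continuously as
  time tends to zero from the right. The first argument of \<^term>\<open>f\<close> is the velocity, the second
  the time; only nonnegative times matter.\<close>

definition kac_solution :: "(real \<Rightarrow> real) \<Rightarrow> (real \<Rightarrow> real \<Rightarrow> real) \<Rightarrow> bool" where
  "kac_solution f0 f \<longleftrightarrow>
     (\<forall>t\<ge>0. prob_density (\<lambda>v. f v t)) \<and>
     (AE v in lborel.
        f v 0 = f0 v \<and>
        continuous_on {0..} (f v) \<and>
        (\<forall>t>0. set_integrable (lborel \<Otimes>\<^sub>M lborel) ({0..2*pi} \<times> UNIV)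
                  (\<lambda>(\<theta>, w). kac_integrand (\<lambda>u. f u t) v \<theta> w) \<and>
               (f v has_real_derivative kac_collision (\<lambda>u. f u t) v) (at t)))"

definition symmetrized :: "real measure \<Rightarrow> real measure" where
  "symmetrized M =
     measure_of UNIV (sets borel) (\<lambda>B. (emeasure M B + emeasure M {x. - x \<in> B}) / 2)"

definition mean :: "real measure \<Rightarrow> real" where
  "mean Q = (LINT x|Q. x)"

definition kappa4 :: "real measure \<Rightarrow> real" where
  "kappa4 Q = (LINT x|Q. (x - mean Q) ^ 4) - 3 * (LINT x|Q. (x - mean Q)\<^sup>2)\<^sup>2"

definition alpha :: "real \<Rightarrow> real" where
  "alpha s = 1 / (2 * pi) * (LINT \<theta>:{0..2*pi}|lborel. \<bar>sin \<theta>\<bar> powr s)"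

text \<open>The set function in \<^const>\<open>symmetrized\<close> is indeed a measure, so \<^const>\<open>measure_of\<close> does not
  fall back to the null measure.\<close>

lemma sets_symmetrized [simp]: "sets (symmetrized M) = sets borel"
  unfolding symmetrized_def using sets.sigma_sets_eq[of "borel :: real measure"] by simp

lemma emeasure_symmetrized:
  assumes M: "sets M = sets borel" and B: "B \<in> sets borel"
  shows "emeasure (symmetrized M) B = (emeasure M B + emeasure M {x. - x \<in> B}) / 2"
proof (rule emeasure_measure_of[OF symmetrized_def])
  show "B \<in> sets (symmetrized M)" using B by simp
  have neg: "{x. - x \<in> A} \<in> sets M" if "A \<in> sets borel" for A :: "real set"
    using measurable_sets[of "uminus :: real \<Rightarrow> real" borel borel A] that
    by (simp add: M vimage_def)
  show "countably_additive (sets (symmetrized M))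
          (\<lambda>B. (emeasure M B + emeasure M {x. - x \<in> B}) / 2)"
  proof (rule countably_additiveI)
    fix A :: "nat \<Rightarrow> real set"
    assume A: "range A \<subseteq> sets (symmetrized M)" "disjoint_family A"
    have 1: "(\<Sum>i. emeasure M (A i)) = emeasure M (\<Union>i. A i)"
      using A by (intro suminf_emeasure) (auto simp: M)
    have 2: "(\<Sum>i. emeasure M {x. - x \<in> A i}) = emeasure M (\<Union>i. {x. - x \<in> A i})"
      using A neg by (intro suminf_emeasure) (auto simp: disjoint_family_on_def)
    have 3: "(\<Union>i. {x. - x \<in> A i}) = {x. - x \<in> (\<Union>i. A i)}" by auto
    show "(\<Sum>i. (emeasure M (A i) + emeasure M {x. - x \<in> A i}) / 2) =
        (emeasure M (\<Union>i. A i) + emeasure M {x. - x \<in> (\<Union>i. A i)}) / 2"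
      unfolding 1[symmetric] 3[symmetric] 2[symmetric]
      by (simp add: divide_ennreal_def suminf_add)
  qed
qed (auto simp: positive_def)

end

theory Submission
  imports Defs
begin

text \<open>
  Write \<open>Q(F)\<close> for the gain term of Kac's equation, so that the mild form of the equation is
  \<open>F(t) = e\<^sup>-\<^sup>t F(0) + \<integral>\<^sub>0\<^sup>t e\<^sup>r\<^sup>-\<^sup>t Q(F(r)) dr\<close>. As \<open>Q(F)\<close> depends only on the even part of \<open>F\<close>, the odd part
  decays like \<open>e\<^sup>-\<^sup>t\<close>, and one may take \<open>F\<close> even. The levels \<open>F\<^sub>0 = F\<close>, \<open>F\<^sub>d\<^sub>+\<^sub>1(t) = \<integral>\<^sub>0\<^sup>t e\<^sup>r\<^sup>-\<^sup>t Q(F\<^sub>d(r)) dr\<close>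
  decrease in \<open>d\<close>; \<open>F\<^sub>d\<close> collects the trees of the Wild expansion whose leaves all have depth at least \<open>d\<close>.
  The integrals of \<open>cos (\<xi>v)\<close>, \<open>v sin (\<xi>v)\<close>, \<open>v\<^sup>2 cos (\<xi>v)\<close> against \<open>F\<^sub>d\<close> satisfy closed
  equations averaged over the angle, of which the Gaussian amplitudes are a stationary solution.

  For \<open>d = 0\<close> the difference to the Gaussian is \<open>O(\<bar>\<xi>\<bar>\<^sup>s\<^sup>-\<^sup>j)\<close> initially, since the cumulants up to order four
  agree, and a comparison argument propagates this bound with the factor
  \<open>exp (-(1 - 2 \<alpha>\<^sub>s) t)\<close>: the algebraic decay of the characteristic function, which is conserved, makes the angular average contract
  at large \<open>\<xi>\<close>. Each level gains a fixed power of decay in \<open>\<xi>\<close> by the angular average, so that for some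
  fixed \<open>d\<close> the difference is integrable in \<open>\<xi>\<close> at the same rate. Fourier inversion applied to
  \<open>(1 + v\<^sup>2) (F\<^sub>d - Gaussian)\<close> then bounds the \<open>L\<^sup>1\<close> distance of \<open>F\<^sub>d\<close> to the Gaussian, and the mass of \<open>F - F\<^sub>d\<close>
  is the value of the same difference at \<open>\<xi> = 0\<close>.
\<close>

section \<open>Angular averages and the time kernel\<close>

text \<open>This obstacle is what makes the levels necessary. The rate is a matter of homogeneity.
  With the undifferentiated factor bounded by 1, the linearised angular average sends
  \<open>\<bar>\<xi>\<bar> powr s\<close> to \<open>2 * alpha s\<close> times itself, and
  \<open>alpha 4 = 3/8\<close> gives the rate 1/4. After symmetrization the odd moments vanish, and
  \<open>kappa4 = 0\<close> gives the datum the fourth moment of the Gaussian, so that s = 4 +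
  \<delta> is admissible. For \<delta> = 0 the power 4 alone yields the rate without a vanishing
  factor. Therefore every estimate is kept uniform in two coefficients \<open>A1\<close> and
  \<open>A2\<close>: the first belongs to the power 4 and can be made small by splitting the datum,
  the second belongs to a larger power with a strictly faster rate. Index 1 is carried along only
  because the equation for index 2 contains it.\<close>

definition ang :: "real measure" where
  "ang = density lborel (\<lambda>\<theta>. ennreal (indicator {0..2*pi} \<theta> / (2*pi)))"

definition ker :: "real \<Rightarrow> real measure" where
  "ker t = density lborel (\<lambda>r. ennreal (indicator {0..t} r * exp (r - t)))"

lemma sets_ang [measurable_cong, simp]: "sets ang = sets borel" by (simp add: ang_def)
lemma space_ang [simp]: "space ang = UNIV" by (simp add: ang_def)
lemma sets_ker [measurable_cong, simp]: "sets (ker t) = sets borel" by (simp add: ker_def)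
lemma space_ker [simp]: "space (ker t) = UNIV" by (simp add: ker_def)

text \<open>A non-integrable \<open>f\<close> has Bochner integral 0, which is below the integral of
  a nonnegative \<open>g\<close>. In return neither integrability nor measurability of
  \<open>f\<close> has to be checked in the estimates.\<close>

lemma integral_le_bound:
  fixes f g :: "'a \<Rightarrow> real"
  assumes "integrable M g" "AE x in M. f x \<le> g x" "AE x in M. 0 \<le> g x"
  shows "(LINT x|M. f x) \<le> (LINT x|M. g x)"
proof (cases "integrable M f")
  case True then show ?thesis using assms by (intro integral_mono_AE) auto
next
  case False then show ?thesis using assms by (simp add: not_integrable_integral_eq integral_nonneg_AE)
qed

lemma abs_integral_le_bound:
  fixes f g :: "'a \<Rightarrow> real"
  assumes "integrable M g" "AE x in M. \<bar>f x\<bar> \<le> g x"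
  shows "\<bar>LINT x|M. f x\<bar> \<le> (LINT x|M. g x)"
proof -
  have 1: "AE x in M. 0 \<le> g x" using assms(2) by eventually_elim auto
  have 2: "AE x in M. f x \<le> g x" using assms(2) by eventually_elim auto
  have 3: "AE x in M. - f x \<le> g x" using assms(2) by eventually_elim auto
  show ?thesis
    using integral_le_bound[OF assms(1) 2 1] integral_le_bound[OF assms(1) 3 1] by simp
qed

section \<open>The uniform measure on angles and its symmetries\<close>

lemma nn_integral_ang:
  assumes [measurable]: "u \<in> borel_measurable borel"
  shows "(\<integral>\<^sup>+\<theta>. u \<theta> \<partial>ang) = ennreal (1/(2*pi)) * (\<integral>\<^sup>+\<theta>. indicator {0..2*pi} \<theta> * u \<theta> \<partial>lborel)"
proof -
  have "(\<integral>\<^sup>+\<theta>. u \<theta> \<partial>ang) = (\<integral>\<^sup>+\<theta>. ennreal (1/(2*pi)) * (indicator {0..2*pi} \<theta> * u \<theta>) \<partial>lborel)"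
    unfolding ang_def by (subst nn_integral_density) (auto intro!: nn_integral_cong split: split_indicator)
  then show ?thesis by (simp add: nn_integral_cmult)
qed

lemma prob_space_ang: "prob_space ang"
proof
  have "emeasure ang (space ang) = (\<integral>\<^sup>+\<theta>. 1 \<partial>ang)" by simp
  also have "\<dots> = ennreal (1/(2*pi)) * ennreal (2*pi)"
    by (subst nn_integral_ang) auto
  also have "\<dots> = 1" by (simp flip: ennreal_mult)
  finally show "emeasure ang (space ang) = 1" .
qed

interpretation ang: prob_space ang by (rule prob_space_ang)

lemma AE_ang: "AE \<theta> in lborel. P \<theta> \<Longrightarrow> AE \<theta> in ang. P \<theta>"
  unfolding ang_def by (subst AE_density) auto

lemma AE_ang_nonzero: "AE \<theta> in ang. cos \<theta> \<noteq> 0 \<and> sin \<theta> \<noteq> 0"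
proof (rule AE_ang)
  have c: "countable {\<theta>::real. sin \<theta> = 0}"
  proof (rule countable_subset)
    show "{\<theta>. sin \<theta> = 0} \<subseteq> range (\<lambda>i::int. of_int i * pi)"
      using sin_zero_iff_int2 by blast
  qed simp
  have "{\<theta>::real. cos \<theta> = 0} \<subseteq> (\<lambda>x. x - pi/2) ` {\<theta>. sin \<theta> = 0}"
  proof
    fix x :: real assume "x \<in> {\<theta>. cos \<theta> = 0}"
    then have "sin (x + pi/2) = 0" by (simp add: sin_add)
    then show "x \<in> (\<lambda>x. x - pi/2) ` {\<theta>. sin \<theta> = 0}"
      by (intro image_eqI[of _ _ "x + pi/2"]) simp_all
  qed
  then have "countable {\<theta>::real. cos \<theta> = 0}"
    by (rule countable_subset) (intro countable_image c)
  then have "countable ({\<theta>::real. cos \<theta> = 0} \<union> {\<theta>. sin \<theta> = 0})" using c by simp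
  from AE_not_in[OF countable_imp_null_set_lborel[OF this]]
  show "AE \<theta>::real in lborel. cos \<theta> \<noteq> 0 \<and> sin \<theta> \<noteq> 0"
    by eventually_elim auto
qed

lemma nn_integral_ang_shift:
  fixes u :: "real \<Rightarrow> ennreal"
  assumes [measurable]: "u \<in> borel_measurable borel" and per: "\<And>x. u (x + 2*pi) = u x"
    and a: "0 \<le> a" "a \<le> 2*pi"
  shows "(\<integral>\<^sup>+\<theta>. u (\<theta> + a) \<partial>ang) = (\<integral>\<^sup>+\<theta>. u \<theta> \<partial>ang)"
proof -
  have sh: "(\<integral>\<^sup>+\<theta>. indicator {b..c} \<theta> * u (\<theta> + d) \<partial>lborel) = (\<integral>\<^sup>+\<theta>. indicator {b+d..c+d} \<theta> * u \<theta> \<partial>lborel)" for b c d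
    by (subst (2) nn_integral_real_affine[where c=1 and t=d])
       (auto intro!: nn_integral_cong simp: add.commute split: split_indicator)
  have sp: "(\<integral>\<^sup>+\<theta>. indicator {b..d} \<theta> * u \<theta> \<partial>lborel) =
      (\<integral>\<^sup>+\<theta>. indicator {b..c} \<theta> * u \<theta> \<partial>lborel) + (\<integral>\<^sup>+\<theta>. indicator {c..d} \<theta> * u \<theta> \<partial>lborel)"
    if "b \<le> c" "c \<le> d" for b c d
  proof -
    have "AE x in lborel. x \<noteq> c" by (rule AE_lborel_singleton)
    then have "AE \<theta> in lborel. indicator {b..d} \<theta> * u \<theta> =
        indicator {b..c} \<theta> * u \<theta> + indicator {c..d} \<theta> * u \<theta>"
      by eventually_elim (use that in \<open>auto split: split_indicator\<close>)
    then show ?thesis by (subst nn_integral_add[symmetric]) (auto intro!: nn_integral_cong_AE)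
  qed
  have "(\<integral>\<^sup>+\<theta>. indicator {0..2*pi} \<theta> * u (\<theta> + a) \<partial>lborel) = (\<integral>\<^sup>+\<theta>. indicator {a..2*pi+a} \<theta> * u \<theta> \<partial>lborel)"
    by (subst sh) simp
  also have "\<dots> = (\<integral>\<^sup>+\<theta>. indicator {a..2*pi} \<theta> * u \<theta> \<partial>lborel) + (\<integral>\<^sup>+\<theta>. indicator {0+2*pi..a+2*pi} \<theta> * u \<theta> \<partial>lborel)"
    using a by (subst sp[where c="2*pi"]) (auto simp: add.commute)
  also have "(\<integral>\<^sup>+\<theta>. indicator {0+2*pi..a+2*pi} \<theta> * u \<theta> \<partial>lborel) = (\<integral>\<^sup>+\<theta>. indicator {0..a} \<theta> * u \<theta> \<partial>lborel)"
    by (subst sh[symmetric]) (simp add: per)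
  also have "(\<integral>\<^sup>+\<theta>. indicator {a..2*pi} \<theta> * u \<theta> \<partial>lborel) + \<dots> = (\<integral>\<^sup>+\<theta>. indicator {0..2*pi} \<theta> * u \<theta> \<partial>lborel)"
    using a by (subst sp[where b=0 and c=a and d="2*pi"]) (auto simp: add.commute)
  finally show ?thesis by (subst (1 2) nn_integral_ang) auto
qed

lemma nn_integral_ang_reflect:
  fixes u :: "real \<Rightarrow> ennreal"
  assumes [measurable]: "u \<in> borel_measurable borel" and per: "\<And>x. u (x + 2*pi) = u x"
  shows "(\<integral>\<^sup>+\<theta>. u (- \<theta>) \<partial>ang) = (\<integral>\<^sup>+\<theta>. u \<theta> \<partial>ang)"
proof -
  have "(\<integral>\<^sup>+\<theta>. indicator {0..2*pi} \<theta> * u (- \<theta>) \<partial>lborel) = (\<integral>\<^sup>+\<theta>. indicator {0..2*pi} (2*pi + -1 * \<theta>) * u (\<theta> - 2*pi) \<partial>lborel)"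
    by (subst nn_integral_real_affine[where c="-1" and t="2*pi"]) auto
  also have "\<dots> = (\<integral>\<^sup>+\<theta>. indicator {0..2*pi} \<theta> * u \<theta> \<partial>lborel)"
  proof (intro nn_integral_cong)
    fix x show "indicator {0..2*pi} (2*pi + -1 * x) * u (x - 2*pi) = indicator {0..2*pi} x * u x"
      using per[of "x - 2*pi"] by (auto split: split_indicator)
  qed
  finally show ?thesis by (subst (1 2) nn_integral_ang) auto
qed

lemma integrable_ang_bounded:
  fixes f :: "real \<Rightarrow> real"
  assumes "f \<in> borel_measurable borel" "\<And>x. \<bar>f x\<bar> \<le> B"
  shows "integrable ang f"
  by (rule ang.integrable_const_bound[where B=B]) (use assms in auto)

section \<open>The constants \<open>alpha\<close>\<close>

lemma alpha_eq: "alpha s = (LINT \<theta>|ang. \<bar>sin \<theta>\<bar> powr s)"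
  unfolding alpha_def ang_def set_lebesgue_integral_def
  by (subst integral_density)
     (auto simp: integral_mult_right_zero[symmetric] simp del: integral_mult_right_zero intro!: Bochner_Integration.integral_cong)

lemma alpha_cos: "(LINT \<theta>|ang. \<bar>cos \<theta>\<bar> powr s) = alpha s"
proof -
  have "(\<integral>\<^sup>+\<theta>. ennreal (\<bar>sin (\<theta> + pi/2)\<bar> powr s) \<partial>ang) = (\<integral>\<^sup>+\<theta>. ennreal (\<bar>sin \<theta>\<bar> powr s) \<partial>ang)"
    by (rule nn_integral_ang_shift) (auto simp: sin_add pi_ge_zero)
  then show ?thesis unfolding alpha_eq by (subst (1 2) integral_eq_nn_integral) (auto simp: sin_add)
qed

lemma integrable_sin_powr: "0 \<le> s \<Longrightarrow> integrable ang (\<lambda>\<theta>. \<bar>sin \<theta>\<bar> powr s)"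
  by (rule integrable_ang_bounded[where B=1]) (auto intro!: powr_le1)
lemma integrable_cos_powr: "0 \<le> s \<Longrightarrow> integrable ang (\<lambda>\<theta>. \<bar>cos \<theta>\<bar> powr s)"
  by (rule integrable_ang_bounded[where B=1]) (auto intro!: powr_le1)

lemma alpha_nonneg: "0 \<le> alpha s" unfolding alpha_eq by (rule integral_nonneg_AE) auto

lemma alpha_pos: assumes "0 \<le> s" shows "0 < alpha s"
proof (rule ccontr)
  assume "\<not> 0 < alpha s"
  then have "(LINT \<theta>|ang. \<bar>sin \<theta>\<bar> powr s) = 0" using alpha_nonneg[of s] unfolding alpha_eq by linarith
  then have "AE \<theta> in ang. \<bar>sin \<theta>\<bar> powr s = 0"
    by (subst (asm) integral_nonneg_eq_0_iff_AE) (auto intro: integrable_sin_powr assms)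
  with AE_ang_nonzero have "AE \<theta> in ang. False" by eventually_elim auto
  then show False by simp
qed

text \<open>Almost everywhere \<open>\<bar>sin \<theta>\<bar>\<close> lies strictly between 0 and 1,
  so a larger exponent strictly lowers the integrand. The strict gap absorbs the source terms in
  \<open>envelope_propagates\<close> and makes the final \<rho> tend to 0.\<close>

lemma alpha_strict_antimono: assumes "0 \<le> s" "s < s'" shows "alpha s' < alpha s"
proof (rule ccontr)
  assume n: "\<not> alpha s' < alpha s"
  have le: "\<bar>sin \<theta>\<bar> powr s' \<le> \<bar>sin \<theta>\<bar> powr s" for \<theta> :: real
    using assms by (intro powr_mono') auto
  have i: "integrable ang (\<lambda>\<theta>. \<bar>sin \<theta>\<bar> powr s - \<bar>sin \<theta>\<bar> powr s')"
    using assms by (intro Bochner_Integration.integrable_diff integrable_sin_powr) auto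
  have "(LINT \<theta>|ang. \<bar>sin \<theta>\<bar> powr s - \<bar>sin \<theta>\<bar> powr s') = alpha s - alpha s'"
    unfolding alpha_eq using assms by (intro Bochner_Integration.integral_diff integrable_sin_powr) auto
  moreover have "0 \<le> (LINT \<theta>|ang. \<bar>sin \<theta>\<bar> powr s - \<bar>sin \<theta>\<bar> powr s')"
    using le by (intro integral_nonneg_AE) auto
  ultimately have "(LINT \<theta>|ang. \<bar>sin \<theta>\<bar> powr s - \<bar>sin \<theta>\<bar> powr s') = 0" using n by linarith
  then have "AE \<theta> in ang. \<bar>sin \<theta>\<bar> powr s - \<bar>sin \<theta>\<bar> powr s' = 0"
    by (subst (asm) integral_nonneg_eq_0_iff_AE) (use i le in auto)
  with AE_ang_nonzero have "AE \<theta> in ang. False"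
  proof eventually_elim
    case (elim \<theta>)
    have "0 < (cos \<theta>)\<^sup>2" using elim by simp
    then have "(sin \<theta>)\<^sup>2 < 1" using sin_cos_squared_add[of \<theta>] by linarith
    then have "\<bar>sin \<theta>\<bar> < 1" by (simp add: abs_square_less_1)
    then have "\<bar>sin \<theta>\<bar> powr s' < \<bar>sin \<theta>\<bar> powr s"
      using elim assms by (intro powr_less_mono') auto
    then show False using elim by simp
  qed
  then show False by simp
qed

lemma alpha_antimono: assumes "0 \<le> s" "s \<le> s'" shows "alpha s' \<le> alpha s"
  using alpha_strict_antimono[of s s'] assms by (cases "s = s'") auto

text \<open>Makes \<open>1 - 2 * alpha 4\<close> equal to 1/4, the rate in the theorem.\<close>

lemma alpha_4: "alpha 4 = 3/8"
proof -
  have "(LINT \<theta>|lborel. indicator {0..2*pi} \<theta> *\<^sub>R (sin \<theta>)^4) =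
     (3 * (2*pi) / 8 - sin (2*(2*pi)) / 4 + sin (4*(2*pi)) / 32) - (3 * 0 / 8 - sin (2*0) / 4 + sin (4*0) / 32)"
  proof (rule integral_FTC_Icc)
    show "0 \<le> 2*pi" by simp
    fix x :: real
    have c4: "cos (4*x) = 2 * (cos (2*x))^2 - 1" using cos_double_cos[of "2*x"] by simp
    have "(sin x)^4 = 3/8 - cos (2*x) / 2 + cos (4*x) / 8"
      unfolding c4 cos_double_sin by (simp add: power2_eq_square power4_eq_xxxx field_simps)
    then show "((\<lambda>x. 3*x/8 - sin (2*x)/4 + sin (4*x)/32) has_vector_derivative (sin x)^4) (at x within {0..2*pi})"
      unfolding has_real_derivative_iff_has_vector_derivative[symmetric]
      by (auto intro!: derivative_eq_intros)
  next
    show "continuous_on {0..2*pi} (\<lambda>x. (sin x)^4)" by (intro continuous_intros)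
  qed
  moreover have "sin (2*(2*pi)) = 0" "sin (4*(2*pi)) = 0"
    using sin_npi[of 4] sin_npi[of 8] by (simp_all add: mult.assoc[symmetric])
  ultimately have "(LINT \<theta>|lborel. indicator {0..2*pi} \<theta> *\<^sub>R (sin \<theta>)^4) = 3 * (2*pi) / 8" by simp
  moreover have "\<bar>sin \<theta>\<bar> powr 4 = (sin \<theta>)^4" for \<theta> :: real
    by (cases "sin \<theta> = 0") (auto simp: powr_numeral)
  ultimately show ?thesis unfolding alpha_def set_lebesgue_integral_def by (simp add: field_simps)
qed

section \<open>Decay weights under rotation of the frequency\<close>

definition om :: "real \<Rightarrow> real \<Rightarrow> real" where "om e \<xi> = (1 + \<xi>\<^sup>2) powr (- e)"

text \<open>An integrable singular weight: averaging a decaying function over a rotation costs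
  this factor but gains decay.\<close>

definition sing :: "real \<Rightarrow> real" where "sing \<theta> = \<bar>cos \<theta> * sin \<theta>\<bar> powr (- 1/2)"

lemma om_measurable [measurable]: "om e \<in> borel_measurable borel"
proof -
  have "1 + x\<^sup>2 \<noteq> 0" for x :: real by (smt (verit) zero_le_power2)
  then show ?thesis unfolding om_def by (intro borel_measurable_continuous_onI continuous_intros) auto
qed

lemma one_plus_square_pos [simp]: "0 < 1 + (x::real)\<^sup>2" "1 + (x::real)\<^sup>2 \<noteq> 0"
  by (smt (verit) zero_le_power2)+

lemma om_pos: "0 < om e \<xi>" unfolding om_def by simp
lemma om_nonneg [simp]: "0 \<le> om e \<xi>" using om_pos[of e \<xi>] by simp
lemma om_le_1: "0 \<le> e \<Longrightarrow> om e \<xi> \<le> 1"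
  unfolding om_def by (simp add: powr_minus divide_simps ge_one_powr_ge_zero)
lemma om_0 [simp]: "om 0 \<xi> = 1" unfolding om_def using add_pos_nonneg[of 1 "\<xi>\<^sup>2"] by simp
lemma om_antimono: "e \<le> e' \<Longrightarrow> om e' \<xi> \<le> om e \<xi>"
  unfolding om_def by (intro powr_mono) auto
lemma om_add: "om (e + e') \<xi> = om e \<xi> * om e' \<xi>"
  unfolding om_def by (simp add: powr_add[symmetric])

text \<open>The squares of the two rotated frequencies add up to \<open>\<xi>\<^sup>2\<close>, so
  the product of the two bases is \<open>1 + \<xi>\<^sup>2\<close> plus a nonnegative term. The
  constant is exactly 1, which is why an algebraic bound \<open>om q\<close> is conserved in
  time.\<close>

lemma om_pair: assumes "0 \<le> e" shows "om e (\<xi> * cos \<theta>) * om e (\<xi> * sin \<theta>) \<le> om e \<xi>"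
proof -
  have "\<xi>\<^sup>2 = (\<xi> * cos \<theta>)\<^sup>2 + (\<xi> * sin \<theta>)\<^sup>2"
    by (simp add: power_mult_distrib flip: distrib_left)
  moreover have "0 \<le> (\<xi> * cos \<theta>)\<^sup>2 * (\<xi> * sin \<theta>)\<^sup>2" by simp
  ultimately have "1 + \<xi>\<^sup>2 \<le> (1 + (\<xi> * cos \<theta>)\<^sup>2) * (1 + (\<xi> * sin \<theta>)\<^sup>2)"
    unfolding distrib_left distrib_right by simp
  then have "((1 + (\<xi> * cos \<theta>)\<^sup>2) * (1 + (\<xi> * sin \<theta>)\<^sup>2)) powr (- e) \<le> (1 + \<xi>\<^sup>2) powr (- e)"
    using assms by (intro powr_mono2') (auto simp: add_pos_nonneg)
  then show ?thesis unfolding om_def by (simp add: powr_mult)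
qed

lemma sing_nonneg [simp]: "0 \<le> sing \<theta>" by (simp add: sing_def)
lemma sing_measurable [measurable]: "sing \<in> borel_measurable borel" unfolding sing_def by measurable

text \<open>Since \<open>s^2 \<le> 1\<close>, the base at \<open>\<xi> * s\<close> is at least
  \<open>(1 + \<xi>^2) * s^2\<close>. The price is \<open>\<bar>s\<bar> powr (- 2 * \<eta>)\<close>,
  and \<eta> \<le> 1/4 keeps it below the integrable power -1/2.\<close>

lemma om_scale:
  assumes s: "s \<noteq> 0" "\<bar>s\<bar> \<le> 1" and eta: "0 \<le> \<eta>" "\<eta> \<le> 1/4"
  shows "om \<eta> (\<xi> * s) \<le> om \<eta> \<xi> * \<bar>s\<bar> powr (-1/2)"
proof -
  have "s\<^sup>2 \<le> 1" using s by (simp add: abs_square_le_1)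
  then have "(1 + \<xi>\<^sup>2) * s\<^sup>2 \<le> 1 + (\<xi> * s)\<^sup>2"
    by (simp add: algebra_simps power_mult_distrib)
  then have "om \<eta> (\<xi> * s) \<le> ((1 + \<xi>\<^sup>2) * s\<^sup>2) powr (-\<eta>)"
    unfolding om_def using s eta by (intro powr_mono2') (auto simp: add_pos_nonneg)
  also have "\<dots> = om \<eta> \<xi> * (s\<^sup>2) powr (-\<eta>)" unfolding om_def by (simp add: powr_mult)
  also have "(s\<^sup>2) powr (-\<eta>) = \<bar>s\<bar> powr (- 2 * \<eta>)"
  proof -
    have eq: "s\<^sup>2 = \<bar>s\<bar> powr 2" using s by (simp add: powr_numeral)
    show ?thesis unfolding eq powr_powr by simp
  qed
  also have "om \<eta> \<xi> * \<dots> \<le> om \<eta> \<xi> * \<bar>s\<bar> powr (-1/2)"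
    using s eta by (intro mult_left_mono powr_mono') auto
  finally show ?thesis .
qed

lemma powr_le_sing:
  assumes "cos \<theta> \<noteq> 0" "sin \<theta> \<noteq> 0"
  shows "\<bar>sin \<theta>\<bar> powr (-1/2) \<le> sing \<theta>" "\<bar>cos \<theta>\<bar> powr (-1/2) \<le> sing \<theta>" "1 \<le> sing \<theta>"
proof -
  have *: "1 \<le> x powr (-1/2)" if "0 < x" "x \<le> 1" for x :: real
    using powr_mono2'[of "-1/2" x 1] that by simp
  have c: "1 \<le> \<bar>cos \<theta>\<bar> powr (-1/2)" using assms by (intro *) auto
  have s: "1 \<le> \<bar>sin \<theta>\<bar> powr (-1/2)" using assms by (intro *) auto
  have eq: "sing \<theta> = \<bar>cos \<theta>\<bar> powr (-1/2) * \<bar>sin \<theta>\<bar> powr (-1/2)"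
    unfolding sing_def by (simp add: abs_mult powr_mult)
  show "\<bar>sin \<theta>\<bar> powr (-1/2) \<le> sing \<theta>" unfolding eq using mult_right_mono[OF c, of "\<bar>sin \<theta>\<bar> powr (-1/2)"] by simp
  show "\<bar>cos \<theta>\<bar> powr (-1/2) \<le> sing \<theta>" unfolding eq using mult_left_mono[OF s, of "\<bar>cos \<theta>\<bar> powr (-1/2)"] by simp
  then show "1 \<le> sing \<theta>" using c by linarith
qed

text \<open>\<open>om_pair\<close> handles the exponent \<open>e\<close> common to both factors; the
  surplus \<eta> of the better factor is transferred to \<xi> by \<open>om_scale\<close>.\<close>

lemma om_simple:
  assumes "cos \<theta> \<noteq> 0" "sin \<theta> \<noteq> 0" "0 \<le> e" "0 \<le> \<eta>" "\<eta> \<le> 1/4"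
  shows "om e (\<xi> * cos \<theta>) * om (e + \<eta>) (\<xi> * sin \<theta>) \<le> om (e + \<eta>) \<xi> * sing \<theta>"
    "om (e + \<eta>) (\<xi> * cos \<theta>) * om e (\<xi> * sin \<theta>) \<le> om (e + \<eta>) \<xi> * sing \<theta>"
proof -
  have s: "om \<eta> (\<xi> * sin \<theta>) \<le> om \<eta> \<xi> * sing \<theta>"
    by (rule order_trans[OF om_scale[of "sin \<theta>" \<eta> \<xi>] mult_left_mono]) (use powr_le_sing[of \<theta>] assms in auto)
  have c: "om \<eta> (\<xi> * cos \<theta>) \<le> om \<eta> \<xi> * sing \<theta>"
    by (rule order_trans[OF om_scale[of "cos \<theta>" \<eta> \<xi>] mult_left_mono]) (use powr_le_sing[of \<theta>] assms in auto)
  have p: "om e (\<xi> * cos \<theta>) * om e (\<xi> * sin \<theta>) \<le> om e \<xi>" using om_pair assms by simp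
  show "om e (\<xi> * cos \<theta>) * om (e + \<eta>) (\<xi> * sin \<theta>) \<le> om (e + \<eta>) \<xi> * sing \<theta>"
    using mult_mono[OF p s] by (simp add: om_add mult_ac)
  show "om (e + \<eta>) (\<xi> * cos \<theta>) * om e (\<xi> * sin \<theta>) \<le> om (e + \<eta>) \<xi> * sing \<theta>"
    using mult_mono[OF p c] by (simp add: om_add mult_ac)
qed

text \<open>Beyond \<open>om_pair\<close>, the product of the bases also contains
  \<open>\<xi>^4 * (cos \<theta>)^2 * (sin \<theta>)^2\<close>. Up to the factor 4/5 it therefore
  dominates \<open>(1 + \<xi>^2) * (1 + (\<xi> * p)^2)\<close> with
  \<open>p = cos \<theta> * sin \<theta>\<close>, and the second factor supplies the gain. The 4/5
  stems from \<open>p^2 \<le> 1/4\<close>.\<close>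

lemma om_gain:
  assumes cs: "cos \<theta> \<noteq> 0" "sin \<theta> \<noteq> 0" and e: "0 \<le> \<eta>" "\<eta> \<le> 1/4" "\<eta> \<le> e"
  shows "om e (\<xi> * cos \<theta>) * om e (\<xi> * sin \<theta>) \<le> (4/5) powr (-e) * om (e + \<eta>) \<xi> * sing \<theta>"
proof -
  define p where "p = cos \<theta> * sin \<theta>"
  have p: "p \<noteq> 0" "\<bar>p\<bar> \<le> 1" using cs mult_mono[of "\<bar>cos \<theta>\<bar>" 1 "\<bar>sin \<theta>\<bar>" 1] unfolding p_def by (auto simp: abs_mult)
  have p2: "4 * p\<^sup>2 \<le> 1"
  proof -
    have "(2 * p)\<^sup>2 = (sin (2*\<theta>))\<^sup>2" unfolding sin_double by (simp add: p_def mult_ac)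
    also have "\<dots> \<le> 1" by (simp add: abs_square_le_1)
    finally show ?thesis by (simp add: power_mult_distrib)
  qed
  have "\<xi>\<^sup>2 = (\<xi> * cos \<theta>)\<^sup>2 + (\<xi> * sin \<theta>)\<^sup>2" by (simp add: power_mult_distrib flip: distrib_left)
  then have eq: "(1 + (\<xi> * cos \<theta>)\<^sup>2) * (1 + (\<xi> * sin \<theta>)\<^sup>2) = 1 + \<xi>\<^sup>2 + \<xi>\<^sup>2 * (\<xi> * p)\<^sup>2"
  proof -
    have "(\<xi> * cos \<theta>)\<^sup>2 * (\<xi> * sin \<theta>)\<^sup>2 = \<xi>\<^sup>2 * (\<xi> * p)\<^sup>2"
      by (simp add: p_def power_mult_distrib power4_eq_xxxx power2_eq_square)
    then show ?thesis using \<open>\<xi>\<^sup>2 = _\<close> unfolding distrib_left distrib_right by simp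
  qed
  have "\<xi>\<^sup>2 * (4 * p\<^sup>2) \<le> \<xi>\<^sup>2 * 1" using p2 by (intro mult_left_mono) auto
  moreover have "0 \<le> \<xi>\<^sup>2 * (\<xi> * p)\<^sup>2" by simp
  moreover have "4/5 * ((1 + \<xi>\<^sup>2) * (1 + (\<xi> * p)\<^sup>2)) =
      4/5 + 4/5 * \<xi>\<^sup>2 + 1/5 * (\<xi>\<^sup>2 * (4 * p\<^sup>2)) + 4/5 * (\<xi>\<^sup>2 * (\<xi> * p)\<^sup>2)"
    by (simp add: algebra_simps power_mult_distrib)
  moreover have "0 \<le> \<xi>\<^sup>2" by simp
  ultimately have "4/5 * ((1 + \<xi>\<^sup>2) * (1 + (\<xi> * p)\<^sup>2)) \<le> (1 + (\<xi> * cos \<theta>)\<^sup>2) * (1 + (\<xi> * sin \<theta>)\<^sup>2)"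
    unfolding eq by linarith
  then have "((1 + (\<xi> * cos \<theta>)\<^sup>2) * (1 + (\<xi> * sin \<theta>)\<^sup>2)) powr (-e) \<le> (4/5 * ((1 + \<xi>\<^sup>2) * (1 + (\<xi> * p)\<^sup>2))) powr (-e)"
    using e by (intro powr_mono2') (auto simp: add_pos_nonneg)
  then have "om e (\<xi> * cos \<theta>) * om e (\<xi> * sin \<theta>) \<le> (4/5) powr (-e) * (om e \<xi> * om e (\<xi> * p))"
    by (simp only: om_def powr_mult)
  also have "\<dots> \<le> (4/5) powr (-e) * (om e \<xi> * (om \<eta> \<xi> * sing \<theta>))"
  proof (intro mult_left_mono)
    have "om e (\<xi> * p) \<le> om \<eta> (\<xi> * p)" by (rule om_antimono) fact
    also have "\<dots> \<le> om \<eta> \<xi> * sing \<theta>" using om_scale[OF p e(1,2)] by (simp add: sing_def p_def)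
    finally show "om e (\<xi> * p) \<le> om \<eta> \<xi> * sing \<theta>" .
  qed auto
  finally show ?thesis by (simp add: om_add mult_ac)
qed

text \<open>The majorant \<open>f\<close> is the derivative of
  \<open>2 * sqrt (sin \<theta>) - 2 * sqrt (cos \<theta>)\<close>, which increases by 4 over the
  quarter. It dominates \<open>sing\<close>: if a and b are the square roots of cosine and sine,
  then \<open>a^4 + b^4 = 1\<close> and a, b \<le> 1 give \<open>1 \<le> a^3 + b^3\<close>.\<close>

lemma nn_integral_sing_quarter: "(\<integral>\<^sup>+\<theta>. indicator {0..pi/2} \<theta> * ennreal (sing \<theta>) \<partial>lborel) \<le> ennreal 4"
proof -
  define f where "f \<theta> = (if 0 < \<theta> \<and> \<theta> < pi/2 then cos \<theta> / sqrt (sin \<theta>) + sin \<theta> / sqrt (cos \<theta>) else 0)" for \<theta>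
  have [measurable]: "f \<in> borel_measurable borel" unfolding f_def by measurable
  have pos: "0 < sin \<theta>" "0 < cos \<theta>" if "0 < \<theta>" "\<theta> < pi/2" for \<theta>
    using that by (auto intro!: sin_gt_zero2 cos_gt_zero_pi)
  have fnn: "0 \<le> f \<theta>" for \<theta> using pos[of \<theta>] unfolding f_def by (auto intro!: add_nonneg_nonneg divide_nonneg_nonneg)
  have "(f has_integral (2 * sqrt (sin (pi/2)) - 2 * sqrt (cos (pi/2))) - (2 * sqrt (sin 0) - 2 * sqrt (cos 0))) {0..pi/2}"
  proof (rule fundamental_theorem_of_calculus_interior)
    show "0 \<le> pi/2" by simp
    show "continuous_on {0..pi/2} (\<lambda>\<theta>. 2 * sqrt (sin \<theta>) - 2 * sqrt (cos \<theta>))" by (intro continuous_intros)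
    fix x :: real assume "x \<in> {0<..<pi/2}"
    then have x: "0 < x" "x < pi/2" by auto
    show "((\<lambda>\<theta>. 2 * sqrt (sin \<theta>) - 2 * sqrt (cos \<theta>)) has_vector_derivative f x) (at x)"
      unfolding has_real_derivative_iff_has_vector_derivative[symmetric] using pos[OF x] x
      by (auto intro!: derivative_eq_intros simp: f_def divide_simps)
  qed
  then have "((\<lambda>\<theta>. if \<theta> \<in> {0..pi/2} then f \<theta> else 0) has_integral 4) UNIV"
    by (subst has_integral_restrict_UNIV) simp
  also have "(\<lambda>\<theta>. if \<theta> \<in> {0..pi/2} then f \<theta> else 0) = (\<lambda>\<theta>. f \<theta> * indicator {0..pi/2} \<theta>)"
    by (auto simp: fun_eq_iff)
  finally have "(\<integral>\<^sup>+\<theta>. ennreal (f \<theta> * indicator {0..pi/2} \<theta>) \<partial>lborel) = ennreal 4"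
    using fnn by (intro nn_integral_has_integral_lborel) auto
  moreover have "(\<integral>\<^sup>+\<theta>. indicator {0..pi/2} \<theta> * ennreal (sing \<theta>) \<partial>lborel) \<le> (\<integral>\<^sup>+\<theta>. ennreal (f \<theta> * indicator {0..pi/2} \<theta>) \<partial>lborel)"
  proof (intro nn_integral_mono)
    fix \<theta> :: real
    have "sing \<theta> \<le> f \<theta>" if "0 \<le> \<theta>" "\<theta> \<le> pi/2"
    proof (cases "0 < \<theta> \<and> \<theta> < pi/2")
      case True
      define a b where "a = sqrt (cos \<theta>)" "b = sqrt (sin \<theta>)"
      have ab: "0 < a" "0 < b" "cos \<theta> = a\<^sup>2" "sin \<theta> = b\<^sup>2" "a \<le> 1" "b \<le> 1" using pos[of \<theta>] True by (auto simp: a_b_def)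
      have "a^4 + b^4 = 1" using sin_cos_squared_add[of \<theta>] unfolding ab(3,4) by simp
      moreover have "a^4 \<le> a^3" "b^4 \<le> b^3" using ab by (auto intro!: power_decreasing)
      ultimately have le: "1 \<le> a^3 + b^3" by linarith
      have "sing \<theta> = 1 / sqrt (cos \<theta> * sin \<theta>)" unfolding sing_def using pos[of \<theta>] True
        by (simp add: powr_minus_divide powr_half_sqrt abs_mult)
      also have "\<dots> = 1 / (a * b)" by (simp add: a_b_def real_sqrt_mult)
      also have "\<dots> \<le> (a^3 + b^3) / (a * b)" using le ab by (intro divide_right_mono) auto
      also have "\<dots> = a\<^sup>2 / b + b\<^sup>2 / a" using ab by (simp add: field_simps power2_eq_square power3_eq_cube)
      also have "\<dots> = f \<theta>" using True by (simp add: f_def ab(3,4) a_b_def[symmetric] del: real_sqrt_abs) (use ab in simp)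
      finally show ?thesis .
    next
      case False
      then have "\<theta> = 0 \<or> \<theta> = pi/2" using that by auto
      \<comment> \<open>A power of 0 is 0 by convention, so \<open>sing\<close> does not blow up at
        the endpoints themselves.\<close>
      moreover have "sing 0 = 0" "sing (pi/2) = 0" by (simp_all add: sing_def)
      ultimately show ?thesis using fnn[of \<theta>] by metis
    qed
    then show "indicator {0..pi/2} \<theta> * ennreal (sing \<theta>) \<le> ennreal (f \<theta> * indicator {0..pi/2} \<theta>)"
      by (auto split: split_indicator intro!: ennreal_leI)
  qed
  ultimately show ?thesis by simp
qed

text \<open>A quarter turn exchanges sine and cosine up to sign, so \<open>sing\<close> has period
  pi/2 and the bound on one quarter serves all four.\<close>

lemma integrable_sing: "integrable ang sing"
proof (rule integrableI_nonneg)
  have per: "sing (\<theta> + pi/2) = sing \<theta>" for \<theta> by (simp add: sing_def sin_add cos_add abs_mult mult.commute)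
  have per2: "sing (\<theta> + real k * (pi/2)) = sing \<theta>" for \<theta> k
  proof (induction k)
    case (Suc k)
    have "\<theta> + real (Suc k) * (pi/2) = (\<theta> + real k * (pi/2)) + pi/2" by (simp add: field_simps)
    then show ?case using per[of "\<theta> + real k * (pi/2)"] Suc by (simp only:)
  qed simp
  let ?I = "\<lambda>k::nat. (\<integral>\<^sup>+\<theta>. indicator {real k * (pi/2)..(real k + 1) * (pi/2)} \<theta> * ennreal (sing \<theta>) \<partial>lborel)"
  have I: "?I k \<le> ennreal 4" for k
  proof -
    have "?I k = (\<integral>\<^sup>+\<theta>. indicator {real k * (pi/2)..(real k + 1) * (pi/2)} (real k * (pi/2) + 1 * \<theta>) * ennreal (sing (real k * (pi/2) + 1 * \<theta>)) \<partial>lborel)"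
      by (subst nn_integral_real_affine[where c=1 and t="real k * (pi/2)"]) auto
    also have "\<dots> = (\<integral>\<^sup>+\<theta>. indicator {0..pi/2} \<theta> * ennreal (sing \<theta>) \<partial>lborel)"
    proof (intro nn_integral_cong)
      fix \<theta> :: real
      have "sing (real k * (pi/2) + 1 * \<theta>) = sing \<theta>" using per2[of \<theta> k] by (simp add: add.commute)
      moreover have "indicator {real k * (pi/2)..(real k + 1) * (pi/2)} (real k * (pi/2) + 1 * \<theta>) = (indicator {0..pi/2} \<theta> :: ennreal)"
        by (auto simp: distrib_right split: split_indicator)
      ultimately show "indicator {real k * (pi/2)..(real k + 1) * (pi/2)} (real k * (pi/2) + 1 * \<theta>) * ennreal (sing (real k * (pi/2) + 1 * \<theta>))
          = indicator {0..pi/2} \<theta> * ennreal (sing \<theta>)" by simp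
    qed
    finally show ?thesis using nn_integral_sing_quarter by simp
  qed
  have "(\<integral>\<^sup>+\<theta>. indicator {0..2*pi} \<theta> * ennreal (sing \<theta>) \<partial>lborel) \<le>
      (\<integral>\<^sup>+\<theta>. (\<Sum>k<4. indicator {real k * (pi/2)..(real k + 1) * (pi/2)} \<theta> * ennreal (sing \<theta>)) \<partial>lborel)"
  proof (intro nn_integral_mono)
    fix \<theta> :: real
    have "(1::ennreal) \<le> (\<Sum>k<4. indicator {real k * (pi/2)..(real k + 1) * (pi/2)} \<theta>)" if "0 \<le> \<theta>" "\<theta> \<le> 2*pi"
    proof -
      have "\<exists>k<4. \<theta> \<in> {real k * (pi/2)..(real k + 1) * (pi/2)}"
      proof -
        consider "\<theta> \<le> pi/2" | "pi/2 \<le> \<theta>" "\<theta> \<le> pi" | "pi \<le> \<theta>" "\<theta> \<le> 3*pi/2" | "3*pi/2 \<le> \<theta>" by linarith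
        then show ?thesis
        proof cases
          case 1 then show ?thesis using that by (intro exI[of _ 0]) auto
        next
          case 2 then show ?thesis by (intro exI[of _ 1]) auto
        next
          case 3 then show ?thesis by (intro exI[of _ 2]) auto
        next
          case 4 then show ?thesis using that by (intro exI[of _ 3]) auto
        qed
      qed
      then obtain k where k: "k < 4" "\<theta> \<in> {real k * (pi/2)..(real k + 1) * (pi/2)}" by blast
      have "(1::ennreal) = indicator {real k * (pi/2)..(real k + 1) * (pi/2)} \<theta>" using k by simp
      also have "\<dots> \<le> (\<Sum>k<4. indicator {real k * (pi/2)..(real k + 1) * (pi/2)} \<theta>)"
        using k(1) by (intro member_le_sum[where f="\<lambda>k. indicator {real k * (pi/2)..(real k + 1) * (pi/2)} \<theta>"]) auto
      finally show ?thesis .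
    qed
    then have "indicator {0..2*pi} \<theta> \<le> (\<Sum>k<4. indicator {real k * (pi/2)..(real k + 1) * (pi/2)} \<theta> :: ennreal)"
      by (auto split: split_indicator)
    then show "indicator {0..2*pi} \<theta> * ennreal (sing \<theta>) \<le> (\<Sum>k<4. indicator {real k * (pi/2)..(real k + 1) * (pi/2)} \<theta> * ennreal (sing \<theta>))"
      by (simp only: sum_distrib_right[symmetric]) (intro mult_right_mono; simp)
  qed
  also have "\<dots> = (\<Sum>k<4. ?I k)" by (subst nn_integral_sum) auto
  also have "\<dots> \<le> (\<Sum>k<4::nat. ennreal 4)" by (intro sum_mono I)
  also have "\<dots> < \<infinity>" by simp
  finally show "(\<integral>\<^sup>+\<theta>. ennreal (sing \<theta>) \<partial>ang) < \<infinity>"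
    by (subst nn_integral_ang) (auto simp: ennreal_mult_less_top)
qed auto

lemma integral_ang_swap:
  fixes g :: "real \<Rightarrow> real \<Rightarrow> real"
  assumes [measurable]: "(\<lambda>x. g (fst x) (snd x)) \<in> borel_measurable (borel \<Otimes>\<^sub>M borel)" and nn: "\<And>x y. 0 \<le> g x y"
  shows "(LINT \<theta>|ang. g (sin \<theta>) (cos \<theta>)) = (LINT \<theta>|ang. g (cos \<theta>) (sin \<theta>))"
proof -
  have [measurable]: "(\<lambda>\<theta>. g (p \<theta>) (q \<theta>)) \<in> borel_measurable borel" if "p \<in> borel_measurable borel" "q \<in> borel_measurable borel" for p q :: "real \<Rightarrow> real"
    using measurable_compose[OF measurable_Pair[OF that] assms(1)] by simp
  have "(\<integral>\<^sup>+\<theta>. ennreal (g (sin \<theta>) (cos \<theta>)) \<partial>ang) = (\<integral>\<^sup>+\<theta>. ennreal (g (sin (- \<theta>)) (cos (- \<theta>))) \<partial>ang)"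
    by (rule nn_integral_ang_reflect[where u="\<lambda>\<theta>. ennreal (g (sin \<theta>) (cos \<theta>))", symmetric]) auto
  \<comment> \<open>The substitution of \<open>- (\<theta> + 3*pi/2)\<close> for \<theta> exchanges
    sine and cosine without any change of sign.\<close>
  also have "\<dots> = (\<integral>\<^sup>+\<theta>. ennreal (g (sin (- (\<theta> + 3*pi/2))) (cos (- (\<theta> + 3*pi/2)))) \<partial>ang)"
    by (rule nn_integral_ang_shift[where u="\<lambda>\<theta>. ennreal (g (sin (- \<theta>)) (cos (- \<theta>)))", symmetric])
       (simp_all only: sin_minus cos_minus sin_periodic cos_periodic, auto)
  also have "\<dots> = (\<integral>\<^sup>+\<theta>. ennreal (g (cos \<theta>) (sin \<theta>)) \<partial>ang)"
  proof -
    have "sin (- (\<theta> + 3*pi/2)) = cos \<theta>" "cos (- (\<theta> + 3*pi/2)) = sin \<theta>" for \<theta> :: real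
      using sin_3over2_pi cos_3over2_pi by (simp_all only: sin_minus cos_minus sin_add cos_add, simp_all)
    then show ?thesis by simp
  qed
  finally show ?thesis by (subst (1 2) integral_eq_nn_integral) (auto simp: nn)
qed

text \<open>The average is at most \<open>om \<eta> \<xi>\<close> times the integral of
  \<open>sing\<close>, which tends to 0 for large frequencies. With \<epsilon> =
  \<open>alpha 7\<close> the region beyond \<open>R\<close> contracts at least as strongly as any
  homogeneous power up to 7.\<close>

lemma choose_R:
  assumes q: "0 < q" and eps: "0 < \<epsilon>"
  obtains R where "1 \<le> R" "\<And>\<xi>. R \<le> \<bar>\<xi>\<bar> \<Longrightarrow> (LINT \<theta>|ang. om q (\<xi> * sin \<theta>)) \<le> \<epsilon>"
proof -
  define \<eta> where "\<eta> = min q (1/4)"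
  have eta: "0 < \<eta>" "\<eta> \<le> 1/4" "\<eta> \<le> q" using q by (auto simp: \<eta>_def)
  define S where "S = (LINT \<theta>|ang. sing \<theta>)"
  have "((\<lambda>x. om \<eta> x) \<longlongrightarrow> 0) at_top"
    unfolding om_def using eta
    by (intro tendsto_neg_powr filterlim_tendsto_add_at_top[OF tendsto_const] filterlim_pow_at_top filterlim_ident) auto
  then have "((\<lambda>x. om \<eta> x * S) \<longlongrightarrow> 0) at_top" by (rule tendsto_mult_left_zero)
  then have "eventually (\<lambda>x. om \<eta> x * S < \<epsilon>) at_top" using eps by (rule order_tendstoD)
  then obtain R0 where R0: "\<And>x. R0 \<le> x \<Longrightarrow> om \<eta> x * S < \<epsilon>" by (auto simp: eventually_at_top_linorder)
  show ?thesis
  proof (rule that[of "max 1 R0"])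
    fix \<xi> :: real assume \<xi>: "max 1 R0 \<le> \<bar>\<xi>\<bar>"
    have "(LINT \<theta>|ang. om q (\<xi> * sin \<theta>)) \<le> (LINT \<theta>|ang. om \<eta> \<xi> * sing \<theta>)"
    proof (rule integral_le_bound)
      show "AE \<theta> in ang. om q (\<xi> * sin \<theta>) \<le> om \<eta> \<xi> * sing \<theta>"
        using AE_ang_nonzero
      proof eventually_elim
        case (elim \<theta>)
        have "om q (\<xi> * sin \<theta>) \<le> om \<eta> (\<xi> * sin \<theta>)" by (rule om_antimono) fact
        also have "\<dots> \<le> om \<eta> \<xi> * sing \<theta>" using om_simple(1)[of \<theta> 0 \<eta> \<xi>] elim eta by simp
        finally show ?case .
      qed
    qed (auto intro: integrable_sing)
    also have "\<dots> = om \<eta> \<bar>\<xi>\<bar> * S" by (simp add: S_def om_def)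
    finally show "(LINT \<theta>|ang. om q (\<xi> * sin \<theta>)) \<le> \<epsilon>" using R0[of "\<bar>\<xi>\<bar>"] \<xi> by simp
  qed simp
qed

text \<open>The frequency is truncated because \<open>\<bar>\<xi>\<bar> powr s\<close> itself is not a bounded weight; beyond the cutoff the decay \<open>om q\<close>
  takes over the role of the contraction factor \<open>alpha\<close>.\<close>

definition mw :: "real \<Rightarrow> real \<Rightarrow> real" where "mw R \<xi> = min \<bar>\<xi>\<bar> R"

lemma mw_measurable [measurable]: "mw R \<in> borel_measurable borel" unfolding mw_def by measurable

lemma mw_mult_le: "\<bar>c\<bar> \<le> 1 \<Longrightarrow> mw R (\<xi> * c) \<le> mw R \<xi>"
  unfolding mw_def abs_mult using mult_left_le[of "\<bar>c\<bar>" "\<bar>\<xi>\<bar>"] by auto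
lemma mw_nonneg [simp]: "0 \<le> R \<Longrightarrow> 0 \<le> mw R \<xi>" by (simp add: mw_def)
lemma mw_le: "mw R \<xi> \<le> R" by (simp add: mw_def)

text \<open>For \<open>\<bar>\<xi>\<bar> \<le> R\<close> homogeneity produces
  \<open>alpha (\<tau> + j)\<close>, with \<open>om q\<close> bounded by 1. For larger \<xi> the
  weight is at most the constant \<open>R powr \<tau>\<close>, and the average of
  \<open>om q\<close> provides \<open>alpha \<beta>\<close>, which is below
  \<open>alpha (\<tau> + j)\<close> by monotonicity.\<close>

lemma mw_average:
  assumes R: "1 \<le> R" "\<And>\<xi>. R \<le> \<bar>\<xi>\<bar> \<Longrightarrow> (LINT \<theta>|ang. om q (\<xi> * sin \<theta>)) \<le> alpha \<beta>"
    and q: "0 \<le> q" and \<tau>: "0 \<le> \<tau>" "\<tau> + real j \<le> \<beta>"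
  shows "(LINT \<theta>|ang. \<bar>cos \<theta>\<bar>^j * mw R (\<xi> * cos \<theta>) powr \<tau> * om q (\<xi> * sin \<theta>)) \<le> alpha (\<tau> + j) * mw R \<xi> powr \<tau>" (is "?L \<le> _")
    "(LINT \<theta>|ang. \<bar>sin \<theta>\<bar>^j * mw R (\<xi> * sin \<theta>) powr \<tau> * om q (\<xi> * cos \<theta>)) \<le> alpha (\<tau> + j) * mw R \<xi> powr \<tau>" (is "?L' \<le> _")
    "integrable ang (\<lambda>\<theta>. \<bar>cos \<theta>\<bar>^j * mw R (\<xi> * cos \<theta>) powr \<tau> * om q (\<xi> * sin \<theta>))"
    "integrable ang (\<lambda>\<theta>. \<bar>sin \<theta>\<bar>^j * mw R (\<xi> * sin \<theta>) powr \<tau> * om q (\<xi> * cos \<theta>))"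
proof -
  have L: "?L \<le> alpha (\<tau> + j) * mw R \<xi> powr \<tau>"
  proof (cases "\<bar>\<xi>\<bar> \<le> R")
    case True
    have "?L \<le> (LINT \<theta>|ang. \<bar>\<xi>\<bar> powr \<tau> * \<bar>cos \<theta>\<bar> powr (\<tau> + j))"
    proof (rule integral_le_bound)
      show "AE \<theta> in ang. \<bar>cos \<theta>\<bar>^j * mw R (\<xi> * cos \<theta>) powr \<tau> * om q (\<xi> * sin \<theta>) \<le> \<bar>\<xi>\<bar> powr \<tau> * \<bar>cos \<theta>\<bar> powr (\<tau> + j)"
        using AE_ang_nonzero
      proof eventually_elim
        case (elim \<theta>)
        have "mw R (\<xi> * cos \<theta>) powr \<tau> \<le> (\<bar>\<xi>\<bar> * \<bar>cos \<theta>\<bar>) powr \<tau>"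
          using R \<tau> by (intro powr_mono2) (auto simp: mw_def abs_mult)
        then have "\<bar>cos \<theta>\<bar>^j * mw R (\<xi> * cos \<theta>) powr \<tau> * om q (\<xi> * sin \<theta>) \<le> \<bar>cos \<theta>\<bar>^j * (\<bar>\<xi>\<bar> * \<bar>cos \<theta>\<bar>) powr \<tau> * 1"
          using om_le_1[OF q] by (intro mult_mono mult_left_mono) auto
        also have "\<dots> = \<bar>\<xi>\<bar> powr \<tau> * \<bar>cos \<theta>\<bar> powr (\<tau> + j)"
          using elim by (simp add: powr_add powr_mult powr_realpow mult_ac)
        finally show ?case .
      qed
    qed (use \<tau> in \<open>auto intro!: integrable_mult_right integrable_cos_powr\<close>)
    also have "\<dots> = alpha (\<tau> + j) * mw R \<xi> powr \<tau>" using True by (simp add: alpha_cos mw_def)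
    finally show ?thesis .
  next
    case False
    have "?L \<le> (LINT \<theta>|ang. R powr \<tau> * om q (\<xi> * sin \<theta>))"
    proof (rule integral_le_bound)
      show "integrable ang (\<lambda>\<theta>. R powr \<tau> * om q (\<xi> * sin \<theta>))"
        using om_le_1[OF q] by (intro integrable_mult_right integrable_ang_bounded[where B=1]) auto
      have "\<bar>cos \<theta>\<bar>^j * mw R (\<xi> * cos \<theta>) powr \<tau> * om q (\<xi> * sin \<theta>) \<le> 1 * R powr \<tau> * om q (\<xi> * sin \<theta>)" for \<theta>
        using R \<tau> mw_le by (intro mult_right_mono mult_mono powr_mono2) (auto intro: power_le_one)
      then show "AE \<theta> in ang. \<bar>cos \<theta>\<bar>^j * mw R (\<xi> * cos \<theta>) powr \<tau> * om q (\<xi> * sin \<theta>) \<le> R powr \<tau> * om q (\<xi> * sin \<theta>)" by simp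
    qed auto
    also have "\<dots> \<le> R powr \<tau> * alpha \<beta>" using R(2)[of \<xi>] False by (simp add: mult_left_mono)
    also have "\<dots> \<le> R powr \<tau> * alpha (\<tau> + j)" using \<tau> by (intro mult_left_mono alpha_antimono) auto
    finally show ?thesis using False by (simp add: mw_def mult.commute)
  qed
  then show "?L \<le> alpha (\<tau> + j) * mw R \<xi> powr \<tau>" .
  have "?L' = ?L"
    by (rule integral_ang_swap[of "\<lambda>x y. \<bar>x\<bar>^j * mw R (\<xi> * x) powr \<tau> * om q (\<xi> * y)"]) auto
  then show "?L' \<le> alpha (\<tau> + j) * mw R \<xi> powr \<tau>" using L by simp
  have "\<bar>\<bar>x\<bar>^j * mw R (\<xi> * x) powr \<tau> * om q y\<bar> \<le> 1 * R powr \<tau> * 1" if "\<bar>x\<bar> \<le> 1" for x y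
    unfolding abs_mult using that R \<tau> mw_le om_le_1[OF q]
    by (intro mult_mono) (auto intro!: power_le_one powr_mono2)
  then show "integrable ang (\<lambda>\<theta>. \<bar>cos \<theta>\<bar>^j * mw R (\<xi> * cos \<theta>) powr \<tau> * om q (\<xi> * sin \<theta>))"
    "integrable ang (\<lambda>\<theta>. \<bar>sin \<theta>\<bar>^j * mw R (\<xi> * sin \<theta>) powr \<tau> * om q (\<xi> * cos \<theta>))"
    by (auto intro!: integrable_ang_bounded[where B="1 * R powr \<tau> * 1"])
qed

section \<open>Integrals against the exponential time kernel\<close>

lemma ker_integral_FTC:
  assumes t: "0 \<le> t" and F: "\<And>r. (F has_real_derivative exp (r - t) * X r) (at r)" and X: "continuous_on UNIV X"
  shows "integrable (ker t) X" "(LINT r|ker t. X r) = F t - F 0"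
proof -
  have [measurable]: "X \<in> borel_measurable borel" using X by (rule borel_measurable_continuous_onI)
  have c: "continuous_on {0..t} (\<lambda>r. exp (r - t) * X r)"
    by (intro continuous_intros continuous_on_subset[OF X]) auto
  have "integrable lborel (\<lambda>r. indicator {0..t} r *\<^sub>R (exp (r - t) * X r))"
    using borel_integrable_atLeastAtMost'[OF c] by (simp add: set_integrable_def)
  then show "integrable (ker t) X" unfolding ker_def
    by (subst integrable_density) (auto simp: mult_ac)
  have "(LINT r|lborel. indicator {0..t} r *\<^sub>R (exp (r - t) * X r)) = F t - F 0"
    using t c F by (intro integral_FTC_Icc) 
     (auto simp: has_real_derivative_iff_has_vector_derivative[symmetric] intro: has_field_derivative_at_within)
  then show "(LINT r|ker t. X r) = F t - F 0" unfolding ker_def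
    by (subst integral_density) (auto simp: mult_ac)
qed

lemma ker_exp:
  assumes "0 \<le> t" "l < 1"
  shows "integrable (ker t) (\<lambda>r. exp (- l * r))"
    "(LINT r|ker t. exp (- l * r)) = (exp (- l * t) - exp (- t)) / (1 - l)"
proof -
  have d: "((\<lambda>r. exp (r * (1 - l) - t) / (1 - l)) has_real_derivative exp (r - t) * exp (- l * r)) (at r)" for r
  proof -
    have "((\<lambda>r. exp (r * (1 - l) - t) / (1 - l)) has_real_derivative exp (r * (1 - l) - t) * (1 - l) / (1 - l)) (at r)"
      by (auto intro!: derivative_eq_intros)
    moreover have "exp (r * (1 - l) - t) = exp (r - t) * exp (- l * r)" by (simp add: algebra_simps flip: exp_add)
    ultimately show ?thesis using assms by simp
  qed
  have c: "continuous_on UNIV (\<lambda>r. exp (- l * r))" by (intro continuous_intros)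
  show "integrable (ker t) (\<lambda>r. exp (- l * r))" by (rule ker_integral_FTC[OF assms(1) d c])
  show "(LINT r|ker t. exp (- l * r)) = (exp (- l * t) - exp (- t)) / (1 - l)"
    by (subst ker_integral_FTC[OF assms(1) d c]) (simp add: diff_divide_distrib algebra_simps)
qed

lemma ker_1: assumes "0 \<le> t" shows "integrable (ker t) (\<lambda>r. c::real)" "(LINT r|ker t. c) = (1 - exp (-t)) * c"
  using ker_exp[OF assms, of 0] integrable_mult_right[of c "ker t" "\<lambda>_. 1"] integral_mult_right_zero[of "ker t" c "\<lambda>_. 1"] by simp_all

lemma finite_measure_ker: "finite_measure (ker t)"
proof
  have "emeasure (ker t) (space (ker t)) = (\<integral>\<^sup>+r. 1 \<partial>ker t)" by simp
  also have "\<dots> = (\<integral>\<^sup>+r. ennreal (indicator {0..t} r * exp (r - t)) \<partial>lborel)"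
    unfolding ker_def by (subst nn_integral_density) auto
  also have "\<dots> \<le> (\<integral>\<^sup>+r. indicator {0..t} r \<partial>lborel)"
    by (intro nn_integral_mono) (auto split: split_indicator simp: ennreal_le_1)
  also have "\<dots> < \<infinity>" by (cases "0 \<le> t") auto
  finally show "emeasure (ker t) (space (ker t)) \<noteq> \<infinity>" by simp
qed

lemma AE_ker: "AE r in ker t. 0 \<le> r \<and> r \<le> t"
  unfolding ker_def by (subst AE_density) (auto split: split_indicator)

lemma ker_pow:
  assumes "0 \<le> t"
  shows "integrable (ker t) (\<lambda>r. r^n)" "(LINT r|ker t. r^n) \<le> t^(n+1) / (n+1)"
proof -
  have c: "continuous_on {0..t} (\<lambda>r. exp (r - t) * r^n)" by (intro continuous_intros)
  have "integrable lborel (\<lambda>r. indicator {0..t} r *\<^sub>R (exp (r - t) * r^n))"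
    using borel_integrable_atLeastAtMost'[OF c] by (simp add: set_integrable_def)
  then show i: "integrable (ker t) (\<lambda>r. r^n)" unfolding ker_def
    by (subst integrable_density) (auto simp: mult_ac)
  have i2: "integrable lborel (\<lambda>r. indicator {0..t} r *\<^sub>R (r^n))"
    using borel_integrable_atLeastAtMost'[of 0 t "\<lambda>r. r^n"] by (simp add: set_integrable_def continuous_intros)
  have "(LINT r|ker t. r^n) = (LINT r|lborel. indicator {0..t} r *\<^sub>R (exp (r - t) * r^n))"
    unfolding ker_def by (subst integral_density) (auto simp: mult_ac)
  also have "\<dots> \<le> (LINT r|lborel. indicator {0..t} r *\<^sub>R (r^n))"
    using i2 by (intro integral_le_bound) (auto split: split_indicator simp: mult_left_le_one_le)
  also have "\<dots> = t^(n+1) / (n+1) - 0^(n+1) / (n+1)"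
  proof (rule integral_FTC_Icc)
    fix x :: real show "((\<lambda>x. x^(n+1) / (n+1)) has_vector_derivative x^n) (at x within {0..t})"
      unfolding has_real_derivative_iff_has_vector_derivative[symmetric]
      using DERIV_cdivide[OF DERIV_pow[of "n + 1" x], of "real (n + 1)"]
      by (simp add: has_field_derivative_at_within del: of_nat_Suc of_nat_add)
  qed (use assms in \<open>auto intro!: continuous_intros\<close>)
  finally show "(LINT r|ker t. r^n) \<le> t^(n+1) / (n+1)" by simp
qed

section \<open>The equation in Fourier variables\<close>

text \<open>With \<open>a j\<close> the integrals of \<open>cos (\<xi>v)\<close>, \<open>v sin (\<xi>v)\<close>, \<open>v\<^sup>2 cos (\<xi>v)\<close> for \<open>j = 0, 1, 2\<close> against an even law, these are the same
  integrals for the law of \<open>X cos \<theta> + Y sin \<theta>\<close> with \<open>X\<close>, \<open>Y\<close> independent.\<close>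

definition nonlin :: "nat \<Rightarrow> (nat \<Rightarrow> real \<Rightarrow> real) \<Rightarrow> real \<Rightarrow> real \<Rightarrow> real" where
  "nonlin j a \<xi> \<theta> =
     (if j = 0 then a 0 (\<xi> * cos \<theta>) * a 0 (\<xi> * sin \<theta>)
      else if j = 1 then cos \<theta> * (a 1 (\<xi> * cos \<theta>) * a 0 (\<xi> * sin \<theta>)) + sin \<theta> * (a 0 (\<xi> * cos \<theta>) * a 1 (\<xi> * sin \<theta>))
      else (cos \<theta>)\<^sup>2 * (a 2 (\<xi> * cos \<theta>) * a 0 (\<xi> * sin \<theta>)) + (sin \<theta>)\<^sup>2 * (a 0 (\<xi> * cos \<theta>) * a 2 (\<xi> * sin \<theta>))
         - 2 * (cos \<theta> * sin \<theta>) * (a 1 (\<xi> * cos \<theta>) * a 1 (\<xi> * sin \<theta>)))"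

lemma nat_less_3: "j < (3::nat) \<longleftrightarrow> j = 0 \<or> j = 1 \<or> j = 2" by auto

lemma abs_mult_le: "\<bar>x\<bar> \<le> (a::real) \<Longrightarrow> \<bar>y\<bar> \<le> b \<Longrightarrow> \<bar>x * y\<bar> \<le> a * b"
  unfolding abs_mult by (intro mult_mono) auto

lemma abs_weight_le: "\<bar>c\<bar> \<le> 1 \<Longrightarrow> \<bar>x\<bar> \<le> (b::real) \<Longrightarrow> \<bar>c * x\<bar> \<le> b"
  using abs_mult_le[of c 1 x b] by simp

lemma nonlin_bound_0: assumes "\<And>\<eta>. \<bar>a 0 \<eta>\<bar> \<le> Y0 \<eta>"
  shows "\<bar>nonlin 0 a \<xi> \<theta>\<bar> \<le> Y0 (\<xi> * cos \<theta>) * Y0 (\<xi> * sin \<theta>)"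
  unfolding nonlin_def using assms by (auto intro!: abs_mult_le)

lemma nonlin_bound_1: assumes "\<And>\<eta>. \<bar>a 0 \<eta>\<bar> \<le> Y0 \<eta>" "\<And>\<eta>. \<bar>a 1 \<eta>\<bar> \<le> Y1 \<eta>"
  shows "\<bar>nonlin 1 a \<xi> \<theta>\<bar> \<le> Y1 (\<xi> * cos \<theta>) * Y0 (\<xi> * sin \<theta>) + Y0 (\<xi> * cos \<theta>) * Y1 (\<xi> * sin \<theta>)"
proof -
  have "\<bar>cos \<theta> * (a 1 (\<xi> * cos \<theta>) * a 0 (\<xi> * sin \<theta>))\<bar> \<le> Y1 (\<xi> * cos \<theta>) * Y0 (\<xi> * sin \<theta>)"
    by (intro abs_weight_le abs_mult_le assms) auto
  moreover have "\<bar>sin \<theta> * (a 0 (\<xi> * cos \<theta>) * a 1 (\<xi> * sin \<theta>))\<bar> \<le> Y0 (\<xi> * cos \<theta>) * Y1 (\<xi> * sin \<theta>)"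
    by (intro abs_weight_le abs_mult_le assms) auto
  ultimately show ?thesis unfolding nonlin_def by simp
qed

lemma nonlin_bound_2: assumes "\<And>\<eta>. \<bar>a 0 \<eta>\<bar> \<le> Y0 \<eta>" "\<And>\<eta>. \<bar>a 1 \<eta>\<bar> \<le> Y1 \<eta>" "\<And>\<eta>. \<bar>a 2 \<eta>\<bar> \<le> Y2 \<eta>"
  shows "\<bar>nonlin 2 a \<xi> \<theta>\<bar> \<le> Y2 (\<xi> * cos \<theta>) * Y0 (\<xi> * sin \<theta>) + Y0 (\<xi> * cos \<theta>) * Y2 (\<xi> * sin \<theta>)
      + 2 * (Y1 (\<xi> * cos \<theta>) * Y1 (\<xi> * sin \<theta>))"
proof -
  have sq: "\<bar>(cos \<theta>)\<^sup>2\<bar> \<le> 1" "\<bar>(sin \<theta>)\<^sup>2\<bar> \<le> 1" "\<bar>cos \<theta> * sin \<theta>\<bar> \<le> 1"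
    using abs_mult_le[of "cos \<theta>" 1 "sin \<theta>" 1] by (auto simp: abs_square_le_1)
  have "\<bar>(cos \<theta>)\<^sup>2 * (a 2 (\<xi> * cos \<theta>) * a 0 (\<xi> * sin \<theta>))\<bar> \<le> Y2 (\<xi> * cos \<theta>) * Y0 (\<xi> * sin \<theta>)"
    by (intro abs_weight_le abs_mult_le assms sq)
  moreover have "\<bar>(sin \<theta>)\<^sup>2 * (a 0 (\<xi> * cos \<theta>) * a 2 (\<xi> * sin \<theta>))\<bar> \<le> Y0 (\<xi> * cos \<theta>) * Y2 (\<xi> * sin \<theta>)"
    by (intro abs_weight_le abs_mult_le assms sq)
  moreover have "\<bar>(cos \<theta> * sin \<theta>) * (a 1 (\<xi> * cos \<theta>) * a 1 (\<xi> * sin \<theta>))\<bar> \<le> Y1 (\<xi> * cos \<theta>) * Y1 (\<xi> * sin \<theta>)"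
    by (intro abs_weight_le abs_mult_le assms sq)
  ultimately show ?thesis unfolding nonlin_def by simp
qed

lemma abs_prod_diff:
  fixes a a' b b' :: real
  assumes "\<bar>a - a'\<bar> \<le> X1" "\<bar>b\<bar> \<le> Y2" "\<bar>a'\<bar> \<le> Y1" "\<bar>b - b'\<bar> \<le> X2"
  shows "\<bar>a * b - a' * b'\<bar> \<le> X1 * Y2 + Y1 * X2"
proof -
  have "a * b - a' * b' = (a - a') * b + a' * (b - b')" by (simp add: algebra_simps)
  moreover have "\<bar>(a - a') * b\<bar> \<le> X1 * Y2" "\<bar>a' * (b - b')\<bar> \<le> Y1 * X2" by (intro abs_mult_le assms)+
  ultimately show ?thesis by linarith
qed

text \<open>Each product is telescoped so that one factor is a difference. The 4 counts the products
  in index 2, where the mixed one has multiplicity two.\<close>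

lemma nonlin_diff:
  assumes X: "\<And>i \<eta>. i < 3 \<Longrightarrow> \<bar>a i \<eta> - g i \<eta>\<bar> \<le> X \<eta>" and Y: "\<And>i \<eta>. i < 3 \<Longrightarrow> \<bar>a i \<eta>\<bar> \<le> Y \<eta>" "\<And>i \<eta>. i < 3 \<Longrightarrow> \<bar>g i \<eta>\<bar> \<le> Y \<eta>"
    and j: "j < (3::nat)"
  shows "\<bar>nonlin j a \<xi> \<theta> - nonlin j g \<xi> \<theta>\<bar> \<le> 4 * (X (\<xi> * cos \<theta>) * Y (\<xi> * sin \<theta>) + Y (\<xi> * cos \<theta>) * X (\<xi> * sin \<theta>))"
proof -
  let ?x = "\<xi> * cos \<theta>" and ?y = "\<xi> * sin \<theta>"
  let ?B = "X ?x * Y ?y + Y ?x * X ?y"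
  have *: "\<bar>c * (a i ?x * a k ?y - g i ?x * g k ?y)\<bar> \<le> ?B" if "\<bar>c\<bar> \<le> 1" "i < 3" "k < 3" for c i k
    by (intro abs_weight_le abs_prod_diff X Y that)
  have B: "0 \<le> ?B" using *[of 0 0 0] by simp
  have sq: "\<bar>(cos \<theta>)\<^sup>2\<bar> \<le> 1" "\<bar>(sin \<theta>)\<^sup>2\<bar> \<le> 1" "\<bar>cos \<theta> * sin \<theta>\<bar> \<le> 1"
    using abs_mult_le[of "cos \<theta>" 1 "sin \<theta>" 1] by (auto simp: abs_square_le_1)
  consider "j = 0" | "j = 1" | "j = 2" using j by (auto simp: nat_less_3)
  then show ?thesis
  proof cases
    case 1
    then show ?thesis using *[of 1 0 0] B by (simp add: nonlin_def)
  next
    case 2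
    have "nonlin j a \<xi> \<theta> - nonlin j g \<xi> \<theta> = cos \<theta> * (a 1 ?x * a 0 ?y - g 1 ?x * g 0 ?y) + sin \<theta> * (a 0 ?x * a 1 ?y - g 0 ?x * g 1 ?y)"
      unfolding nonlin_def 2 by (simp add: right_diff_distrib)
    then show ?thesis using *[of "cos \<theta>" 1 0] *[of "sin \<theta>" 0 1] B by simp
  next
    case 3
    have d: "nonlin j a \<xi> \<theta> - nonlin j g \<xi> \<theta> = (cos \<theta>)\<^sup>2 * (a 2 ?x * a 0 ?y - g 2 ?x * g 0 ?y) + (sin \<theta>)\<^sup>2 * (a 0 ?x * a 2 ?y - g 0 ?x * g 2 ?y)
       - 2 * ((cos \<theta> * sin \<theta>) * (a 1 ?x * a 1 ?y - g 1 ?x * g 1 ?y))"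
      unfolding nonlin_def 3 by (simp add: right_diff_distrib)
    have gen: "\<bar>p1 + p2 - 2 * p3\<bar> \<le> 4 * b" if "\<bar>p1\<bar> \<le> b" "\<bar>p2\<bar> \<le> b" "\<bar>p3\<bar> \<le> b" "0 \<le> b" for p1 p2 p3 b :: real
      using that by linarith
    show ?thesis unfolding d by (intro gen B * sq) auto
  qed
qed

lemma measure_ang_UNIV [simp]: "measure ang UNIV = 1" using ang.prob_space by simp

lemma iteration_limit:
  fixes x z c t :: real
  assumes "\<And>n. x \<le> z + c * ((2 * t)^n / fact n)"
  shows "x \<le> z"
proof -
  have "(\<lambda>n. (2 * t)^n / fact n) \<longlonglongrightarrow> 0"
    using summable_LIMSEQ_zero[OF summable_exp[of "2 * t"]] by (simp add: divide_inverse mult.commute)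
  then have "(\<lambda>n. z + c * ((2 * t)^n / fact n)) \<longlonglongrightarrow> z + c * 0" by (intro tendsto_intros)
  then show ?thesis using assms by (intro LIMSEQ_le_const[of _ z]) auto
qed

text \<open>\<open>A d j\<close> are the amplitudes of the level \<open>d\<close>, and \<open>g j\<close> those of the Gaussian.\<close>

locale kac_fourier =
  fixes A :: "nat \<Rightarrow> nat \<Rightarrow> real \<Rightarrow> real \<Rightarrow> real" and g :: "nat \<Rightarrow> real \<Rightarrow> real" and C q :: real
  assumes base: "\<And>j \<xi> t. j < 3 \<Longrightarrow> 0 \<le> t \<Longrightarrow> A 0 j \<xi> t = exp (- t) * A 0 j \<xi> 0 +
      (LINT r|ker t. LINT \<theta>|ang. nonlin j (\<lambda>i \<eta>. A 0 i \<eta> r) \<xi> \<theta>)"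
    and level: "\<And>d j \<xi> t. j < 3 \<Longrightarrow> 0 \<le> t \<Longrightarrow> A (Suc d) j \<xi> t =
      (LINT r|ker t. LINT \<theta>|ang. nonlin j (\<lambda>i \<eta>. A d i \<eta> r) \<xi> \<theta>)"
    and int_r: "\<And>d j \<xi> t. j < 3 \<Longrightarrow> 0 \<le> t \<Longrightarrow> integrable (ker t) (\<lambda>r. LINT \<theta>|ang. nonlin j (\<lambda>i \<eta>. A d i \<eta> r) \<xi> \<theta>)"
    and int_\<theta>: "\<And>d j \<xi> r. j < 3 \<Longrightarrow> 0 \<le> r \<Longrightarrow> integrable ang (nonlin j (\<lambda>i \<eta>. A d i \<eta> r) \<xi>)"
    and stat: "\<And>j \<xi> \<theta>. j < 3 \<Longrightarrow> nonlin j g \<xi> \<theta> = g j \<xi>"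
    and C: "1 \<le> C" and A_bound: "\<And>j \<xi> t. j < 3 \<Longrightarrow> 0 \<le> t \<Longrightarrow> \<bar>A 0 j \<xi> t\<bar> \<le> C"
    and g_bound: "\<And>j \<xi>. j < 3 \<Longrightarrow> \<bar>g j \<xi>\<bar> \<le> C"
    and q: "0 < q" and A_decay: "\<And>\<xi> t. 0 \<le> t \<Longrightarrow> \<bar>A 0 0 \<xi> t\<bar> \<le> om q \<xi>" and g0_decay: "\<And>\<xi>. \<bar>g 0 \<xi>\<bar> \<le> om q \<xi>"
    and g_decay: "\<And>e. 0 \<le> e \<Longrightarrow> \<exists>K\<ge>0. \<forall>j<3. \<forall>\<xi>. \<bar>g j \<xi>\<bar> \<le> K * om e \<xi>"
begin

definition S where "S = (LINT \<theta>|ang. sing \<theta>)"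

lemma S_nonneg: "0 \<le> S" unfolding S_def by (rule integral_nonneg_AE) simp

lemma ker_avg_bound:
  assumes t: "0 \<le> t" and E: "integrable (ker t) E" "\<And>r. 0 \<le> r \<Longrightarrow> 0 \<le> E r" and B: "0 \<le> B"
    and P: "\<And>r \<theta>. 0 \<le> r \<Longrightarrow> cos \<theta> \<noteq> 0 \<Longrightarrow> sin \<theta> \<noteq> 0 \<Longrightarrow> \<bar>P r \<theta>\<bar> \<le> E r * (B * sing \<theta>)"
  shows "\<bar>LINT r|ker t. LINT \<theta>|ang. P r \<theta>\<bar> \<le> (LINT r|ker t. E r) * (B * S)"
proof -
  have "\<bar>LINT \<theta>|ang. P r \<theta>\<bar> \<le> E r * (B * S)" if "0 \<le> r" for r
  proof -
    have "\<bar>LINT \<theta>|ang. P r \<theta>\<bar> \<le> (LINT \<theta>|ang. E r * (B * sing \<theta>))"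
    proof (rule abs_integral_le_bound)
      show "AE \<theta> in ang. \<bar>P r \<theta>\<bar> \<le> E r * (B * sing \<theta>)" using AE_ang_nonzero
        by eventually_elim (use P[OF that] in auto)
    qed (intro integrable_mult_right integrable_sing)
    then show ?thesis by (simp add: S_def)
  qed
  then have "\<bar>LINT r|ker t. LINT \<theta>|ang. P r \<theta>\<bar> \<le> (LINT r|ker t. E r * (B * S))"
    using AE_ker[of t] by (intro abs_integral_le_bound integrable_mult_left E) (auto elim!: eventually_mono)
  then show ?thesis by simp
qed

lemma level_bound:
  assumes "j < 3" "0 \<le> t" "0 \<le> B"
    and P: "\<And>r \<theta>. 0 \<le> r \<Longrightarrow> cos \<theta> \<noteq> 0 \<Longrightarrow> sin \<theta> \<noteq> 0 \<Longrightarrow> \<bar>nonlin j (\<lambda>i \<eta>. A d i \<eta> r) \<xi> \<theta>\<bar> \<le> B * sing \<theta>"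
  shows "\<bar>A (Suc d) j \<xi> t\<bar> \<le> B * S"
proof -
  have "\<bar>A (Suc d) j \<xi> t\<bar> \<le> (LINT r|ker t. 1) * (B * S)" unfolding level[OF assms(1,2)]
    using P by (intro ker_avg_bound assms ker_1) auto
  also have "\<dots> \<le> 1 * (B * S)" using assms S_nonneg ker_1(2)[of t 1]
    by (intro mult_right_mono mult_nonneg_nonneg) auto
  finally show ?thesis by simp
qed

section \<open>Decay in frequency gained from level to level\<close>

definition \<eta> where "\<eta> = min q (1/4)"
lemma eta: "0 < \<eta>" "\<eta> \<le> 1/4" "\<eta> \<le> q" using q by (auto simp: \<eta>_def)

text \<open>The indices 1 and 2 start at decay exponent 0: an estimate for \<open>j\<close> uses those for smaller \<open>j\<close>.\<close>

definition decay where "decay d e0 e1 e2 \<longleftrightarrow> (\<exists>K\<ge>0. \<forall>\<xi>. \<forall>t\<ge>0. \<bar>A d 0 \<xi> t\<bar> \<le> K * om e0 \<xi> \<and> \<bar>A d 1 \<xi> t\<bar> \<le> K * om e1 \<xi> \<and> \<bar>A d 2 \<xi> t\<bar> \<le> K * om e2 \<xi>)"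

lemma decay_0: "decay 0 \<eta> 0 0"
  unfolding decay_def
proof (intro exI[of _ C] conjI allI impI)
  fix \<xi> t :: real assume "0 \<le> t"
  have "\<bar>A 0 0 \<xi> t\<bar> \<le> om q \<xi>" using \<open>0 \<le> t\<close> by (rule A_decay)
  also have "\<dots> \<le> 1 * om \<eta> \<xi>" using om_antimono[OF eta(3)] by simp
  also have "\<dots> \<le> C * om \<eta> \<xi>" using C by (intro mult_right_mono) auto
  finally show "\<bar>A 0 0 \<xi> t\<bar> \<le> C * om \<eta> \<xi>" .
qed (use A_bound C in auto)

lemma level_bound_um:
  assumes "j < 3" "0 \<le> t" "0 \<le> K" "0 \<le> M"
    and P: "\<And>r \<theta>. 0 \<le> r \<Longrightarrow> cos \<theta> \<noteq> 0 \<Longrightarrow> sin \<theta> \<noteq> 0 \<Longrightarrow> \<bar>nonlin j (\<lambda>i \<eta>. A d i \<eta> r) \<xi> \<theta>\<bar> \<le> K * U r \<theta>"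
    and U: "\<And>r \<theta>. 0 \<le> r \<Longrightarrow> cos \<theta> \<noteq> 0 \<Longrightarrow> sin \<theta> \<noteq> 0 \<Longrightarrow> U r \<theta> \<le> M * om e \<xi> * sing \<theta>"
  shows "\<bar>A (Suc d) j \<xi> t\<bar> \<le> (K * M * S) * om e \<xi>"
proof -
  have "\<bar>A (Suc d) j \<xi> t\<bar> \<le> (K * M * om e \<xi>) * S"
  proof (rule level_bound)
    fix r \<theta> :: real assume a: "0 \<le> r" "cos \<theta> \<noteq> 0" "sin \<theta> \<noteq> 0"
    have "K * U r \<theta> \<le> K * (M * om e \<xi> * sing \<theta>)" using U[OF a] assms by (intro mult_left_mono) auto
    then show "\<bar>nonlin j (\<lambda>i \<eta>. A d i \<eta> r) \<xi> \<theta>\<bar> \<le> K * M * om e \<xi> * sing \<theta>" using P[OF a] by (simp add: mult_ac)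
  qed (use assms in auto)
  then show ?thesis by (simp add: mult_ac)
qed

lemma om_product_le_sing: "0 \<le> e \<Longrightarrow> cos \<theta> \<noteq> 0 \<Longrightarrow> sin \<theta> \<noteq> 0 \<Longrightarrow> om e (\<xi> * cos \<theta>) * om e (\<xi> * sin \<theta>) \<le> om e \<xi> * sing \<theta>"
  using om_pair[of e \<xi> \<theta>] powr_le_sing(3)[of \<theta>] mult_left_mono[of 1 "sing \<theta>" "om e \<xi>"] by auto

text \<open>In every term of index 1 one factor has index 0 and decays like
  \<open>om \<eta>\<close>, so index 1 gains \<eta> at once. Index 2 contains the product of two
  index-1 amplitudes of level 0, for which no decay is known yet; it is only kept bounded.\<close>

lemma decay_1: "decay 1 \<eta> \<eta> 0"
proof -
  from decay_0 obtain K where K: "0 \<le> K" and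
    K0: "\<And>\<xi> t. 0 \<le> t \<Longrightarrow> \<bar>A 0 0 \<xi> t\<bar> \<le> K * om \<eta> \<xi>" and
    K1: "\<And>\<xi> t. 0 \<le> t \<Longrightarrow> \<bar>A 0 1 \<xi> t\<bar> \<le> K * om 0 \<xi>" and
    K2: "\<And>\<xi> t. 0 \<le> t \<Longrightarrow> \<bar>A 0 2 \<xi> t\<bar> \<le> K * om 0 \<xi>" unfolding decay_def by blast
  note eta' = eta less_imp_le[OF eta(1)]
  show ?thesis unfolding decay_def One_nat_def
  proof (intro exI[of _ "K * (K * 4) * S"] conjI allI impI)
    fix \<xi> t :: real assume t: "0 \<le> t"
    have 0: "\<bar>A (Suc 0) 0 \<xi> t\<bar> \<le> K * (K * 1) * S * om \<eta> \<xi>"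
    proof (rule level_bound_um[OF _ t K])
      fix r \<theta> :: real assume a: "0 \<le> r" "cos \<theta> \<noteq> 0" "sin \<theta> \<noteq> 0"
      show "\<bar>nonlin 0 (\<lambda>i \<eta>. A 0 i \<eta> r) \<xi> \<theta>\<bar> \<le> K * (K * (om \<eta> (\<xi> * cos \<theta>) * om \<eta> (\<xi> * sin \<theta>)))"
        using nonlin_bound_0[of "\<lambda>i \<eta>. A 0 i \<eta> r" "\<lambda>x. K * om \<eta> x", OF K0[OF a(1)], of \<xi> \<theta>] by (simp add: mult_ac)
      show "K * (om \<eta> (\<xi> * cos \<theta>) * om \<eta> (\<xi> * sin \<theta>)) \<le> K * 1 * om \<eta> \<xi> * sing \<theta>"
        using mult_left_mono[OF om_product_le_sing[OF eta'(4) a(2,3), of \<xi>] K] by (simp add: mult_ac)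
    qed (use K in auto)
    have 1: "\<bar>A (Suc 0) 1 \<xi> t\<bar> \<le> K * (K * 2) * S * om \<eta> \<xi>"
    proof (rule level_bound_um[OF _ t K])
      fix r \<theta> :: real assume a: "0 \<le> r" "cos \<theta> \<noteq> 0" "sin \<theta> \<noteq> 0"
      show "\<bar>nonlin 1 (\<lambda>i \<eta>. A 0 i \<eta> r) \<xi> \<theta>\<bar> \<le> K * (K * (om 0 (\<xi> * cos \<theta>) * om (0 + \<eta>) (\<xi> * sin \<theta>) + om (0 + \<eta>) (\<xi> * cos \<theta>) * om 0 (\<xi> * sin \<theta>)))"
        using nonlin_bound_1[of "\<lambda>i \<eta>. A 0 i \<eta> r" "\<lambda>x. K * om \<eta> x" "\<lambda>x. K * om 0 x", OF K0[OF a(1)] K1[OF a(1)], of \<xi> \<theta>] by (simp add: algebra_simps)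
      have "om 0 (\<xi> * cos \<theta>) * om (0 + \<eta>) (\<xi> * sin \<theta>) + om (0 + \<eta>) (\<xi> * cos \<theta>) * om 0 (\<xi> * sin \<theta>) \<le> om (0 + \<eta>) \<xi> * sing \<theta> + om (0 + \<eta>) \<xi> * sing \<theta>"
        using eta' a by (intro add_mono om_simple) auto
      from mult_left_mono[OF this K]
      show "K * (om 0 (\<xi> * cos \<theta>) * om (0 + \<eta>) (\<xi> * sin \<theta>) + om (0 + \<eta>) (\<xi> * cos \<theta>) * om 0 (\<xi> * sin \<theta>)) \<le> K * 2 * om \<eta> \<xi> * sing \<theta>"
        by (simp add: algebra_simps)
    qed (use K in auto)
    have 2: "\<bar>A (Suc 0) 2 \<xi> t\<bar> \<le> K * (K * 4) * S * om 0 \<xi>"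
    proof (rule level_bound_um[OF _ t K])
      fix r \<theta> :: real assume a: "0 \<le> r" "cos \<theta> \<noteq> 0" "sin \<theta> \<noteq> 0"
      have K0': "\<bar>A 0 0 \<xi> r\<bar> \<le> K * om 0 \<xi>" for \<xi>
        using K0[OF a(1), of \<xi>] mult_left_mono[OF om_antimono[OF eta'(4)] K, of \<xi>] by linarith
      show "\<bar>nonlin 2 (\<lambda>i \<eta>. A 0 i \<eta> r) \<xi> \<theta>\<bar> \<le> K * (K * 4)"
        using nonlin_bound_2[of "\<lambda>i \<eta>. A 0 i \<eta> r" "\<lambda>x. K * om 0 x" "\<lambda>x. K * om 0 x" "\<lambda>x. K * om 0 x", OF K0' K1[OF a(1)] K2[OF a(1)], of \<xi> \<theta>] by (simp add: algebra_simps)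
      show "K * 4 \<le> K * 4 * om 0 \<xi> * sing \<theta>" using mult_left_mono[OF powr_le_sing(3)[OF a(2,3)], of "K * 4"] K by simp
    qed (use K in auto)
    have up: "K * (K * c) * S * x \<le> K * (K * 4) * S * x" if "c \<le> 4" "0 \<le> x" for c x
      using that K S_nonneg by (intro mult_right_mono mult_left_mono) auto
    show "\<bar>A (Suc 0) 0 \<xi> t\<bar> \<le> K * (K * 4) * S * om \<eta> \<xi>" using 0 up[of 1 "om \<eta> \<xi>"] by auto
    show "\<bar>A (Suc 0) (Suc 0) \<xi> t\<bar> \<le> K * (K * 4) * S * om \<eta> \<xi>" using 1 up[of 2 "om \<eta> \<xi>"] by auto
    show "\<bar>A (Suc 0) 2 \<xi> t\<bar> \<le> K * (K * 4) * S * om 0 \<xi>" using 2 .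
  qed (use K S_nonneg in auto)
qed

text \<open>The product of two index-1 amplitudes now decays, and the other terms pair index 2 with
  a decaying index 0, so index 2 catches up.\<close>

lemma decay_2: "decay 2 \<eta> \<eta> \<eta>"
proof -
  from decay_1 obtain K where K: "0 \<le> K" and
    K0: "\<And>\<xi> t. 0 \<le> t \<Longrightarrow> \<bar>A 1 0 \<xi> t\<bar> \<le> K * om \<eta> \<xi>" and
    K1: "\<And>\<xi> t. 0 \<le> t \<Longrightarrow> \<bar>A 1 1 \<xi> t\<bar> \<le> K * om \<eta> \<xi>" and
    K2: "\<And>\<xi> t. 0 \<le> t \<Longrightarrow> \<bar>A 1 2 \<xi> t\<bar> \<le> K * om 0 \<xi>" unfolding decay_def by blast
  note eta' = eta less_imp_le[OF eta(1)]
  have two: "(2::nat) = Suc 1" by simp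
  show ?thesis unfolding decay_def
  proof (intro exI[of _ "K * (K * 4) * S"] conjI allI impI)
    fix \<xi> t :: real assume t: "0 \<le> t"
    have 0: "\<bar>A (Suc 1) 0 \<xi> t\<bar> \<le> K * (K * 1) * S * om \<eta> \<xi>"
    proof (rule level_bound_um[OF _ t K])
      fix r \<theta> :: real assume a: "0 \<le> r" "cos \<theta> \<noteq> 0" "sin \<theta> \<noteq> 0"
      show "\<bar>nonlin 0 (\<lambda>i \<eta>. A 1 i \<eta> r) \<xi> \<theta>\<bar> \<le> K * (K * (om \<eta> (\<xi> * cos \<theta>) * om \<eta> (\<xi> * sin \<theta>)))"
        using nonlin_bound_0[of "\<lambda>i \<eta>. A 1 i \<eta> r" "\<lambda>x. K * om \<eta> x", OF K0[OF a(1)], of \<xi> \<theta>] by (simp add: mult_ac)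
      show "K * (om \<eta> (\<xi> * cos \<theta>) * om \<eta> (\<xi> * sin \<theta>)) \<le> K * 1 * om \<eta> \<xi> * sing \<theta>"
        using mult_left_mono[OF om_product_le_sing[OF eta'(4) a(2,3), of \<xi>] K] by (simp add: mult_ac)
    qed (use K in auto)
    have 1: "\<bar>A (Suc 1) 1 \<xi> t\<bar> \<le> K * (K * 2) * S * om \<eta> \<xi>"
    proof (rule level_bound_um[OF _ t K])
      fix r \<theta> :: real assume a: "0 \<le> r" "cos \<theta> \<noteq> 0" "sin \<theta> \<noteq> 0"
      show "\<bar>nonlin 1 (\<lambda>i \<eta>. A 1 i \<eta> r) \<xi> \<theta>\<bar> \<le> K * (K * (2 * (om \<eta> (\<xi> * cos \<theta>) * om \<eta> (\<xi> * sin \<theta>))))"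
        using nonlin_bound_1[of "\<lambda>i \<eta>. A 1 i \<eta> r" "\<lambda>x. K * om \<eta> x" "\<lambda>x. K * om \<eta> x", OF K0[OF a(1)] K1[OF a(1)], of \<xi> \<theta>] by (simp add: algebra_simps)
      show "K * (2 * (om \<eta> (\<xi> * cos \<theta>) * om \<eta> (\<xi> * sin \<theta>))) \<le> K * 2 * om \<eta> \<xi> * sing \<theta>"
        using mult_left_mono[OF om_product_le_sing[OF eta'(4) a(2,3), of \<xi>] K] by (simp add: mult_ac)
    qed (use K in auto)
    have 2: "\<bar>A (Suc 1) 2 \<xi> t\<bar> \<le> K * (K * 4) * S * om \<eta> \<xi>"
    proof (rule level_bound_um[OF _ t K])
      fix r \<theta> :: real assume a: "0 \<le> r" "cos \<theta> \<noteq> 0" "sin \<theta> \<noteq> 0"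
      let ?U = "om 0 (\<xi> * cos \<theta>) * om (0 + \<eta>) (\<xi> * sin \<theta>) + om (0 + \<eta>) (\<xi> * cos \<theta>) * om 0 (\<xi> * sin \<theta>)
           + 2 * (om \<eta> (\<xi> * cos \<theta>) * om \<eta> (\<xi> * sin \<theta>))"
      show "\<bar>nonlin 2 (\<lambda>i \<eta>. A 1 i \<eta> r) \<xi> \<theta>\<bar> \<le> K * (K * ?U)"
        using nonlin_bound_2[of "\<lambda>i \<eta>. A 1 i \<eta> r" "\<lambda>x. K * om \<eta> x" "\<lambda>x. K * om \<eta> x" "\<lambda>x. K * om 0 x", OF K0[OF a(1)] K1[OF a(1)] K2[OF a(1)], of \<xi> \<theta>] by (simp add: algebra_simps)
      have "?U \<le> om (0 + \<eta>) \<xi> * sing \<theta> + om (0 + \<eta>) \<xi> * sing \<theta> + 2 * (om \<eta> \<xi> * sing \<theta>)"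
        using eta' a by (intro add_mono om_simple mult_left_mono om_product_le_sing) auto
      from mult_left_mono[OF this K]
      show "K * ?U \<le> K * 4 * om \<eta> \<xi> * sing \<theta>" by (simp add: algebra_simps)
    qed (use K in auto)
    have up: "K * (K * c) * S * x \<le> K * (K * 4) * S * x" if "c \<le> 4" "0 \<le> x" for c x
      using that K S_nonneg by (intro mult_right_mono mult_left_mono) auto
    show "\<bar>A 2 0 \<xi> t\<bar> \<le> K * (K * 4) * S * om \<eta> \<xi>" using 0 up[of 1 "om \<eta> \<xi>"] unfolding two by auto
    show "\<bar>A 2 1 \<xi> t\<bar> \<le> K * (K * 4) * S * om \<eta> \<xi>" using 1 up[of 2 "om \<eta> \<xi>"] unfolding two by auto
    show "\<bar>A 2 2 \<xi> t\<bar> \<le> K * (K * 4) * S * om \<eta> \<xi>" using 2 unfolding two by simp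
  qed (use K S_nonneg in auto)
qed

text \<open>Once all indices share the exponent \<open>e\<close>, both factors of every product
  decay and \<open>om_gain\<close> raises the exponent by \<eta>. The condition \<eta> \<le>
  \<open>e\<close> is the one of \<open>om_gain\<close>.\<close>

lemma decay_Suc:
  assumes "decay d e e e" "\<eta> \<le> e" shows "decay (Suc d) (e + \<eta>) (e + \<eta>) (e + \<eta>)"
proof -
  from assms(1) obtain K where K: "0 \<le> K" and
    K0: "\<And>\<xi> t. 0 \<le> t \<Longrightarrow> \<bar>A d 0 \<xi> t\<bar> \<le> K * om e \<xi>" and
    K1: "\<And>\<xi> t. 0 \<le> t \<Longrightarrow> \<bar>A d 1 \<xi> t\<bar> \<le> K * om e \<xi>" and
    K2: "\<And>\<xi> t. 0 \<le> t \<Longrightarrow> \<bar>A d 2 \<xi> t\<bar> \<le> K * om e \<xi>" unfolding decay_def by blast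
  let ?c = "(4/5) powr (-e) :: real"
  have main: "\<bar>A (Suc d) j \<xi> t\<bar> \<le> K * (4 * K * ?c) * S * om (e + \<eta>) \<xi>" if t: "0 \<le> t" and j: "j < 3" for j \<xi> t
  proof (rule level_bound_um[OF j t K])
    fix r \<theta> :: real assume a: "0 \<le> r" "cos \<theta> \<noteq> 0" "sin \<theta> \<noteq> 0"
    let ?O = "om e (\<xi> * cos \<theta>) * om e (\<xi> * sin \<theta>)"
    have O: "0 \<le> K * K * ?O" using K by simp
    have "\<bar>nonlin j (\<lambda>i \<eta>. A d i \<eta> r) \<xi> \<theta>\<bar> \<le> 4 * (K * K * ?O)"
    proof -
      have "\<bar>nonlin 0 (\<lambda>i \<eta>. A d i \<eta> r) \<xi> \<theta>\<bar> \<le> K * K * ?O"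
        using nonlin_bound_0[of "\<lambda>i \<eta>. A d i \<eta> r" "\<lambda>x. K * om e x", OF K0[OF a(1)], of \<xi> \<theta>] by (simp add: algebra_simps)
      moreover have "\<bar>nonlin 1 (\<lambda>i \<eta>. A d i \<eta> r) \<xi> \<theta>\<bar> \<le> 2 * (K * K * ?O)"
        using nonlin_bound_1[of "\<lambda>i \<eta>. A d i \<eta> r" "\<lambda>x. K * om e x" "\<lambda>x. K * om e x", OF K0[OF a(1)] K1[OF a(1)], of \<xi> \<theta>] by (simp add: algebra_simps)
      moreover have "\<bar>nonlin 2 (\<lambda>i \<eta>. A d i \<eta> r) \<xi> \<theta>\<bar> \<le> 4 * (K * K * ?O)"
        using nonlin_bound_2[of "\<lambda>i \<eta>. A d i \<eta> r" "\<lambda>x. K * om e x" "\<lambda>x. K * om e x" "\<lambda>x. K * om e x", OF K0[OF a(1)] K1[OF a(1)] K2[OF a(1)], of \<xi> \<theta>] by (simp add: algebra_simps)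
      ultimately show ?thesis using j O unfolding nat_less_3 by auto
    qed
    then show "\<bar>nonlin j (\<lambda>i \<eta>. A d i \<eta> r) \<xi> \<theta>\<bar> \<le> K * (4 * K * ?O)" by (simp add: mult_ac)
    show "4 * K * ?O \<le> 4 * K * ?c * om (e + \<eta>) \<xi> * sing \<theta>"
      using mult_left_mono[OF om_gain[OF a(2,3), of \<eta> e \<xi>], of "4 * K"] eta assms(2) K by (simp add: mult_ac)
  qed (use K in auto)
  show ?thesis unfolding decay_def
    using main[of _ 0] main[of _ 1] main[of _ 2] K S_nonneg by (intro exI[of _ "K * (4 * K * ?c) * S"]) auto
qed

lemma decay_all: "decay (2 + m) ((1 + real m) * \<eta>) ((1 + real m) * \<eta>) ((1 + real m) * \<eta>)"
proof (induction m)
  case 0 then show ?case using decay_2 by simp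
next
  case (Suc m)
  from decay_Suc[OF this] eta(1) show ?case by (simp add: algebra_simps)
qed

section \<open>Passing the decay to the difference from the Gaussian\<close>

definition h where "h d j \<xi> t = A d j \<xi> t - g j \<xi>"

text \<open>\<open>ker t\<close> has total mass \<open>1 - exp (- t)\<close>, and this deficit
  leaves the last term.\<close>

lemma diff_integral:
  assumes "j < 3" "0 \<le> t"
  shows "(LINT r|ker t. LINT \<theta>|ang. nonlin j (\<lambda>i \<eta>. A d i \<eta> r) \<xi> \<theta>) - g j \<xi> =
    (LINT r|ker t. (LINT \<theta>|ang. nonlin j (\<lambda>i \<eta>. A d i \<eta> r) \<xi> \<theta>) - g j \<xi>) - exp (- t) * g j \<xi>"
proof -
  have "(LINT r|ker t. (LINT \<theta>|ang. nonlin j (\<lambda>i \<eta>. A d i \<eta> r) \<xi> \<theta>) - g j \<xi>)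
      = (LINT r|ker t. LINT \<theta>|ang. nonlin j (\<lambda>i \<eta>. A d i \<eta> r) \<xi> \<theta>) - (LINT r|ker t. g j \<xi>)"
    by (intro Bochner_Integration.integral_diff int_r ker_1 assms)
  then show ?thesis using ker_1(2)[OF assms(2), of "g j \<xi>"] by (simp add: algebra_simps)
qed

text \<open>Stationarity of the Gaussian holds at each angle, not merely on average, so it can be
  subtracted inside the angular integral.\<close>

lemma avg_diff_bound:
  assumes "j < 3" "0 \<le> r" "integrable ang b"
    and "\<And>\<theta>. cos \<theta> \<noteq> 0 \<Longrightarrow> sin \<theta> \<noteq> 0 \<Longrightarrow> \<bar>nonlin j (\<lambda>i \<eta>. A d i \<eta> r) \<xi> \<theta> - nonlin j g \<xi> \<theta>\<bar> \<le> b \<theta>"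
  shows "\<bar>(LINT \<theta>|ang. nonlin j (\<lambda>i \<eta>. A d i \<eta> r) \<xi> \<theta>) - g j \<xi>\<bar> \<le> (LINT \<theta>|ang. b \<theta>)"
proof -
  have "(LINT \<theta>|ang. nonlin j (\<lambda>i \<eta>. A d i \<eta> r) \<xi> \<theta>) - g j \<xi> = (LINT \<theta>|ang. nonlin j (\<lambda>i \<eta>. A d i \<eta> r) \<xi> \<theta> - g j \<xi>)"
    using int_\<theta>[OF assms(1,2), of d \<xi>] by (subst Bochner_Integration.integral_diff) auto
  moreover have "\<bar>LINT \<theta>|ang. nonlin j (\<lambda>i \<eta>. A d i \<eta> r) \<xi> \<theta> - g j \<xi>\<bar> \<le> (LINT \<theta>|ang. b \<theta>)"
  proof (rule abs_integral_le_bound[OF assms(3)])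
    show "AE \<theta> in ang. \<bar>nonlin j (\<lambda>i \<eta>. A d i \<eta> r) \<xi> \<theta> - g j \<xi>\<bar> \<le> b \<theta>"
      using AE_ang_nonzero by eventually_elim (use assms(4) in \<open>simp add: stat[OF assms(1)]\<close>)
  qed
  ultimately show ?thesis by simp
qed

text \<open>Admissible error rates: integration against the kernel costs only a factor \<kappa>, and
  \<open>exp (- t)\<close>, the mass deficit of the kernel, is absorbed.\<close>

definition good :: "real \<Rightarrow> (real \<Rightarrow> real) \<Rightarrow> bool" where
  "good \<kappa> E \<longleftrightarrow> (\<forall>t\<ge>0. integrable (ker t) E \<and> (LINT r|ker t. E r) \<le> \<kappa> * E t \<and> exp (- t) \<le> E t)"

lemma good_pos: "good \<kappa> E \<Longrightarrow> 0 \<le> t \<Longrightarrow> 0 \<le> E t"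
  unfolding good_def by (meson exp_ge_zero order_trans)

text \<open>The constant \<open>K\<close> is quantified before the rate \<open>E\<close>. Later
  \<open>E\<close> carries coefficients that depend on how the datum is split, and the loss in
  passing to level \<open>d\<close> must be uniform in them.\<close>

definition hbound where "hbound \<kappa> d e \<longleftrightarrow> (\<exists>K\<ge>0. \<forall>E. good \<kappa> E \<longrightarrow> (\<forall>j<3. \<forall>\<xi>. \<forall>t\<ge>0. \<bar>h 0 j \<xi> t\<bar> \<le> E t) \<longrightarrow>
    (\<forall>j<3. \<forall>\<xi>. \<forall>t\<ge>0. \<bar>h d j \<xi> t\<bar> \<le> K * E t * om e \<xi>))"

text \<open>In each product the difference has decay \<open>e\<close>, while the other factor, an
  amplitude of level \<open>d\<close> or the Gaussian, has decay \<open>e + \<zeta>\<close>;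
  \<open>om_simple\<close> transfers the surplus. The mass deficit of the kernel contributes
  \<open>exp (- t) * g j \<xi>\<close>, which the decay of the Gaussian and \<open>good\<close>
  control.\<close>

lemma hbound_Suc:
  assumes \<kappa>: "0 \<le> \<kappa>" and H: "hbound \<kappa> d e" and D: "decay d (e + \<zeta>) (e + \<zeta>) (e + \<zeta>)" and e: "0 \<le> e" "0 \<le> \<zeta>" "\<zeta> \<le> 1/4"
  shows "hbound \<kappa> (Suc d) (e + \<zeta>)"
proof -
  from H[unfolded hbound_def] obtain K where K: "0 \<le> K" and K0: "\<forall>E. good \<kappa> E \<longrightarrow> (\<forall>j<3. \<forall>\<xi>. \<forall>t\<ge>0. \<bar>h 0 j \<xi> t\<bar> \<le> E t) \<longrightarrow>
    (\<forall>j<3. \<forall>\<xi>. \<forall>t\<ge>0. \<bar>h d j \<xi> t\<bar> \<le> K * E t * om e \<xi>)" by (elim exE conjE)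
  note K1 = K0[rule_format]
  from D obtain K' where K': "0 \<le> K'" and A1: "\<And>\<xi> t j. 0 \<le> t \<Longrightarrow> j < 3 \<Longrightarrow> \<bar>A d j \<xi> t\<bar> \<le> K' * om (e + \<zeta>) \<xi>"
    unfolding decay_def nat_less_3 by blast
  obtain Kg where Kg: "0 \<le> Kg" and g1: "\<And>\<xi> j. j < 3 \<Longrightarrow> \<bar>g j \<xi>\<bar> \<le> Kg * om (e + \<zeta>) \<xi>" using g_decay[of "e + \<zeta>"] e by auto
  define M where "M = max K' Kg"
  have M: "0 \<le> M" "K' \<le> M" "Kg \<le> M" using K' by (auto simp: M_def)
  have A2: "\<bar>A d j \<xi> t\<bar> \<le> M * om (e + \<zeta>) \<xi>" if "0 \<le> t" "j < 3" for \<xi> t j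
    using A1[OF that, of \<xi>] mult_right_mono[OF M(2), of "om (e + \<zeta>) \<xi>"] by simp
  have g2: "\<bar>g j \<xi>\<bar> \<le> M * om (e + \<zeta>) \<xi>" if "j < 3" for \<xi> j
    using g1[OF that, of \<xi>] mult_right_mono[OF M(3), of "om (e + \<zeta>) \<xi>"] by simp
  show ?thesis unfolding hbound_def
  proof (intro exI[of _ "8 * K * M * S * \<kappa> + M"] conjI allI impI)
    fix E j \<xi> t assume E: "good \<kappa> E" and h0: "\<forall>j<3. \<forall>\<xi>. \<forall>t\<ge>0. \<bar>h 0 j \<xi> t\<bar> \<le> E t" and j: "j < (3::nat)" and t: "(0::real) \<le> t"
    note hd = K1[OF E h0[rule_format]]
    have inner: "\<bar>(LINT \<theta>|ang. nonlin j (\<lambda>i \<eta>. A d i \<eta> r) \<xi> \<theta>) - g j \<xi>\<bar> \<le> E r * (8 * K * M * S * om (e + \<zeta>) \<xi>)" if r: "0 \<le> r" for r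
    proof -
      have "\<bar>(LINT \<theta>|ang. nonlin j (\<lambda>i \<eta>. A d i \<eta> r) \<xi> \<theta>) - g j \<xi>\<bar> \<le> (LINT \<theta>|ang. E r * (8 * K * M * om (e + \<zeta>) \<xi>) * sing \<theta>)"
      proof (rule avg_diff_bound[OF j r])
        fix \<theta> :: real assume a: "cos \<theta> \<noteq> 0" "sin \<theta> \<noteq> 0"
        have "\<bar>nonlin j (\<lambda>i \<eta>. A d i \<eta> r) \<xi> \<theta> - nonlin j g \<xi> \<theta>\<bar> \<le>
            4 * (K * E r * om e (\<xi> * cos \<theta>) * (M * om (e + \<zeta>) (\<xi> * sin \<theta>)) + M * om (e + \<zeta>) (\<xi> * cos \<theta>) * (K * E r * om e (\<xi> * sin \<theta>)))"
          using hd r by (intro nonlin_diff j A2 g2) (auto simp: h_def)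
        also have "\<dots> = 4 * (K * M * E r) * (om e (\<xi> * cos \<theta>) * om (e + \<zeta>) (\<xi> * sin \<theta>) + om (e + \<zeta>) (\<xi> * cos \<theta>) * om e (\<xi> * sin \<theta>))"
          by (simp add: algebra_simps)
        also have "\<dots> \<le> 4 * (K * M * E r) * (om (e + \<zeta>) \<xi> * sing \<theta> + om (e + \<zeta>) \<xi> * sing \<theta>)"
          using a e K M good_pos[OF E r] by (intro mult_left_mono add_mono om_simple) auto
        finally show "\<bar>nonlin j (\<lambda>i \<eta>. A d i \<eta> r) \<xi> \<theta> - nonlin j g \<xi> \<theta>\<bar> \<le> E r * (8 * K * M * om (e + \<zeta>) \<xi>) * sing \<theta>"
          by (simp add: algebra_simps)
      qed (intro integrable_mult_right integrable_sing)
      then show ?thesis by (simp add: S_def mult_ac)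
    qed
    have Ei: "integrable (ker t) E" "(LINT r|ker t. E r) \<le> \<kappa> * E t" "exp (-t) \<le> E t" using E t by (auto simp: good_def)
    have "\<bar>LINT r|ker t. (LINT \<theta>|ang. nonlin j (\<lambda>i \<eta>. A d i \<eta> r) \<xi> \<theta>) - g j \<xi>\<bar> \<le> (LINT r|ker t. E r * (8 * K * M * S * om (e + \<zeta>) \<xi>))"
      using AE_ker[of t] inner by (intro abs_integral_le_bound integrable_mult_left Ei) (auto elim!: eventually_mono)
    also have "\<dots> \<le> \<kappa> * E t * (8 * K * M * S * om (e + \<zeta>) \<xi>)"
      using Ei K M S_nonneg by (simp add: mult_right_mono)
    finally have 1: "\<bar>LINT r|ker t. (LINT \<theta>|ang. nonlin j (\<lambda>i \<eta>. A d i \<eta> r) \<xi> \<theta>) - g j \<xi>\<bar> \<le> \<kappa> * E t * (8 * K * M * S * om (e + \<zeta>) \<xi>)" .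
    have 2: "\<bar>exp (- t) * g j \<xi>\<bar> \<le> E t * (M * om (e + \<zeta>) \<xi>)"
      using Ei(3) g2[OF j, of \<xi>] by (intro abs_mult_le) auto
    have "h (Suc d) j \<xi> t = (LINT r|ker t. (LINT \<theta>|ang. nonlin j (\<lambda>i \<eta>. A d i \<eta> r) \<xi> \<theta>) - g j \<xi>) - exp (- t) * g j \<xi>"
      unfolding h_def level[OF j t] by (rule diff_integral[OF j t])
    then have "\<bar>h (Suc d) j \<xi> t\<bar> \<le> \<kappa> * E t * (8 * K * M * S * om (e + \<zeta>) \<xi>) + E t * (M * om (e + \<zeta>) \<xi>)"
      using 1 2 by linarith
    then show "\<bar>h (Suc d) j \<xi> t\<bar> \<le> (8 * K * M * S * \<kappa> + M) * E t * om (e + \<zeta>) \<xi>" by (simp add: algebra_simps)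
  qed (use K M \<kappa> S_nonneg in auto)
qed

lemma decay_zero: "decay d 0 0 0"
proof -
  consider "d = 0" | "d = 1" | "2 \<le> d" by linarith
  then obtain e0 e1 e2 where e: "decay d e0 e1 e2" "0 \<le> e0" "0 \<le> e1" "0 \<le> e2"
  proof cases
    case 1 then show ?thesis using decay_0 eta that[of \<eta> 0 0] by simp
  next
    case 2 then show ?thesis using decay_1 eta that[of \<eta> \<eta> 0] by simp
  next
    case 3
    then have "decay d ((1 + real (d - 2)) * \<eta>) ((1 + real (d - 2)) * \<eta>) ((1 + real (d - 2)) * \<eta>)"
      using decay_all[of "d - 2"] by (simp only: le_add_diff_inverse)
    moreover have "0 \<le> (1 + real (d - 2)) * \<eta>" using eta by (intro mult_nonneg_nonneg) auto
    ultimately show ?thesis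
      using that[of "(1 + real (d - 2)) * \<eta>" "(1 + real (d - 2)) * \<eta>" "(1 + real (d - 2)) * \<eta>"] by simp
  qed
  then obtain K where K: "0 \<le> K" "\<And>\<xi> t. 0 \<le> t \<Longrightarrow> \<bar>A d 0 \<xi> t\<bar> \<le> K * om e0 \<xi> \<and> \<bar>A d 1 \<xi> t\<bar> \<le> K * om e1 \<xi> \<and> \<bar>A d 2 \<xi> t\<bar> \<le> K * om e2 \<xi>"
    unfolding decay_def by blast
  have "K * om e' \<xi> \<le> K" if "0 \<le> e'" for e' \<xi> using mult_left_mono[OF om_le_1[OF that] K(1), of \<xi>] by simp
  then have le: "K * om e0 \<xi> \<le> K * om 0 \<xi>" "K * om e1 \<xi> \<le> K * om 0 \<xi>" "K * om e2 \<xi> \<le> K * om 0 \<xi>" for \<xi> using e by simp_all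
  show ?thesis unfolding decay_def
  proof (rule exI[of _ K], rule conjI[OF K(1)], intro allI impI)
    fix \<xi> t :: real assume "0 \<le> t"
    from K(2)[OF this, of \<xi>] le[of \<xi>]
    show "\<bar>A d 0 \<xi> t\<bar> \<le> K * om 0 \<xi> \<and> \<bar>A d 1 \<xi> t\<bar> \<le> K * om 0 \<xi> \<and> \<bar>A d 2 \<xi> t\<bar> \<le> K * om 0 \<xi>" by linarith
  qed
qed

lemma hbound_zero: "0 \<le> \<kappa> \<Longrightarrow> hbound \<kappa> d 0"
proof (induction d)
  case 0
  show ?case unfolding hbound_def by (intro exI[of _ 1]) auto
next
  case (Suc d)
  then show ?case using hbound_Suc[of \<kappa> d 0 0] decay_zero by simp
qed

text \<open>The target exponent is 1 because \<open>om 1\<close> is integrable over the line, as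
  Fourier inversion demands.\<close>

theorem hbound_one:
  assumes "0 \<le> \<kappa>"
  shows "\<exists>d\<ge>1. hbound \<kappa> d 1"
proof -
  \<comment> \<open>Amplitudes of level \<open>2 + m\<close> have decay
    \<open>(1 + m) * \<eta>\<close>, one step ahead of the difference, exactly as
    \<open>hbound_Suc\<close> requires.\<close>
  have *: "hbound \<kappa> (2 + m) (real m * \<eta>)" for m
  proof (induction m)
    case 0 show ?case using hbound_zero[OF assms, of 2] by simp
  next
    case (Suc m)
    have "hbound \<kappa> (Suc (2 + m)) (real m * \<eta> + \<eta>)"
      using decay_all[of m] eta by (intro hbound_Suc assms Suc) (auto simp: algebra_simps)
    then show ?case by (simp add: algebra_simps)
  qed
  obtain m where m: "1 \<le> real m * \<eta>" using reals_Archimedean3[OF eta(1), rule_format, of 1] by (auto intro: less_imp_le)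
  from *[of m, unfolded hbound_def] obtain K where K: "0 \<le> K" and K0: "\<forall>E. good \<kappa> E \<longrightarrow> (\<forall>j<3. \<forall>\<xi>. \<forall>t\<ge>0. \<bar>h 0 j \<xi> t\<bar> \<le> E t) \<longrightarrow>
    (\<forall>j<3. \<forall>\<xi>. \<forall>t\<ge>0. \<bar>h (2 + m) j \<xi> t\<bar> \<le> K * E t * om (real m * \<eta>) \<xi>)" by (elim exE conjE)
  note K1 = K0[rule_format]
  have "hbound \<kappa> (2 + m) 1" unfolding hbound_def
  proof (intro exI[of _ K] conjI allI impI K)
    fix E j \<xi> t assume E: "good \<kappa> E" and h0: "\<forall>j<3. \<forall>\<xi>. \<forall>t\<ge>0. \<bar>h 0 j \<xi> t\<bar> \<le> E t" and j: "j < (3::nat)" and t: "(0::real) \<le> t"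
    have "\<bar>h (2 + m) j \<xi> t\<bar> \<le> K * E t * om (real m * \<eta>) \<xi>" by (intro K1 E j t h0[rule_format])
    also have "\<dots> \<le> K * E t * om 1 \<xi>" using K good_pos[OF E t] om_antimono[OF m] by (intro mult_left_mono) auto
    finally show "\<bar>h (2 + m) j \<xi> t\<bar> \<le> K * E t * om 1 \<xi>" .
  qed
  then show ?thesis by (intro exI[of _ "2 + m"]) auto
qed

section \<open>Supersolutions of the linearised equation at level 0\<close>

definition majorant where "majorant j W \<xi> \<theta> = \<bar>cos \<theta>\<bar>^j * W (\<xi> * cos \<theta>) * om q (\<xi> * sin \<theta>) + \<bar>sin \<theta>\<bar>^j * W (\<xi> * sin \<theta>) * om q (\<xi> * cos \<theta>)"

lemma q_nonneg: "0 \<le> q" using q by simp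

text \<open>\<open>majorant\<close> is the integrand of the positive linear operator that governs
  \<open>h 0 j\<close>, its other factor being replaced by the bound \<open>om q\<close>. A constant
  \<rho> enters through both summands; this doubling is the origin of \<open>(2 t)^n\<close> in the
  iterated error.\<close>

lemma majorant_le:
  assumes W: "\<And>\<eta>. W \<eta> \<le> a1 * W1 \<eta> + a2 * W2 \<eta> + \<rho>" and \<rho>: "0 \<le> \<rho>"
  shows "majorant j W \<xi> \<theta> \<le> a1 * majorant j W1 \<xi> \<theta> + a2 * majorant j W2 \<xi> \<theta> + 2 * \<rho>"
proof -
  have *: "c * W x * o' \<le> a1 * (c * W1 x * o') + a2 * (c * W2 x * o') + \<rho>" if "0 \<le> c" "c \<le> 1" "0 \<le> o'" "o' \<le> 1" for c x o'
  proof -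
    have "c * W x * o' \<le> c * (a1 * W1 x + a2 * W2 x + \<rho>) * o'" using W that by (intro mult_right_mono mult_left_mono) auto
    also have "\<dots> = a1 * (c * W1 x * o') + a2 * (c * W2 x * o') + (c * o') * \<rho>" by (simp add: algebra_simps)
    also have "(c * o') * \<rho> \<le> 1 * \<rho>" using that \<rho> by (intro mult_right_mono mult_le_one) auto
    finally show ?thesis by simp
  qed
  have "\<bar>cos \<theta>\<bar>^j * W (\<xi> * cos \<theta>) * om q (\<xi> * sin \<theta>) \<le> a1 * (\<bar>cos \<theta>\<bar>^j * W1 (\<xi> * cos \<theta>) * om q (\<xi> * sin \<theta>)) + a2 * (\<bar>cos \<theta>\<bar>^j * W2 (\<xi> * cos \<theta>) * om q (\<xi> * sin \<theta>)) + \<rho>"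
    using om_le_1[OF q_nonneg] by (intro *) (auto intro: power_le_one)
  moreover have "\<bar>sin \<theta>\<bar>^j * W (\<xi> * sin \<theta>) * om q (\<xi> * cos \<theta>) \<le> a1 * (\<bar>sin \<theta>\<bar>^j * W1 (\<xi> * sin \<theta>) * om q (\<xi> * cos \<theta>)) + a2 * (\<bar>sin \<theta>\<bar>^j * W2 (\<xi> * sin \<theta>) * om q (\<xi> * cos \<theta>)) + \<rho>"
    using om_le_1[OF q_nonneg] by (intro *) (auto intro: power_le_one)
  ultimately show ?thesis unfolding majorant_def distrib_left by linarith
qed

lemma h_bound: "j < 3 \<Longrightarrow> 0 \<le> t \<Longrightarrow> \<bar>h 0 j \<xi> t\<bar> \<le> 2 * C"
  using A_bound[of j t \<xi>] g_bound[of j \<xi>] unfolding h_def by linarith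

text \<open>Iterating the crude bound \<open>h_bound\<close> \<open>n\<close> times leaves an error \<open>(2t)\<^sup>n / n!\<close>, which disappears in the limit.\<close>

lemma comparison:
  assumes j: "j < 3"
    and W: "\<And>\<xi>. 0 \<le> W1 \<xi>" "\<And>\<xi>. 0 \<le> W2 \<xi>" "\<And>\<xi>. integrable ang (majorant j W1 \<xi>)" "\<And>\<xi>. integrable ang (majorant j W2 \<xi>)"
    and \<kappa>: "0 < \<kappa>1" "0 < \<kappa>2"
    and sup: "\<And>\<xi>. (LINT \<theta>|ang. majorant j W1 \<xi> \<theta>) + S1 \<xi> \<le> \<kappa>1 * W1 \<xi>" "\<And>\<xi>. (LINT \<theta>|ang. majorant j W2 \<xi> \<theta>) + S2 \<xi> \<le> \<kappa>2 * W2 \<xi>"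
    and init: "\<And>\<xi>. \<bar>h 0 j \<xi> 0\<bar> \<le> W1 \<xi> + W2 \<xi>"
    and nl: "\<And>\<xi> r \<theta>. 0 \<le> r \<Longrightarrow> \<bar>nonlin j (\<lambda>i \<eta>. A 0 i \<eta> r) \<xi> \<theta> - nonlin j g \<xi> \<theta>\<bar> \<le>
       majorant j (\<lambda>\<eta>. \<bar>h 0 j \<eta> r\<bar>) \<xi> \<theta> + exp (- (1 - \<kappa>1) * r) * S1 \<xi> + exp (- (1 - \<kappa>2) * r) * S2 \<xi>"
    and t: "0 \<le> t"
  shows "\<bar>h 0 j \<xi> t\<bar> \<le> exp (- (1 - \<kappa>1) * t) * W1 \<xi> + exp (- (1 - \<kappa>2) * t) * W2 \<xi>"
proof -
  define Z where "Z \<xi> t = exp (- (1 - \<kappa>1) * t) * W1 \<xi> + exp (- (1 - \<kappa>2) * t) * W2 \<xi>" for \<xi> t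
  have Znn: "0 \<le> Z \<xi> t" for \<xi> t unfolding Z_def using W by simp
  have step: "\<bar>h 0 j \<xi> t\<bar> \<le> Z \<xi> t + 2 * C * ((2 * t)^n / fact n)" if "0 \<le> t" for \<xi> t n
    using that
  proof (induction n arbitrary: \<xi> t)
    case 0
    then show ?case using h_bound[OF j, of t \<xi>] Znn[of \<xi> t] by simp
  next
    case (Suc n)
    note t = \<open>0 \<le> t\<close>
    define c where "c = 2 * C * (2^n / fact n)"
    have c: "0 \<le> c" using C by (simp add: c_def)
    let ?e1 = "\<lambda>r. exp (- (1 - \<kappa>1) * r)" and ?e2 = "\<lambda>r. exp (- (1 - \<kappa>2) * r)"
    have IH: "\<bar>h 0 j \<eta> r\<bar> \<le> ?e1 r * W1 \<eta> + ?e2 r * W2 \<eta> + c * r^n" if "0 \<le> r" for \<eta> r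
      using Suc.IH[OF that, of \<eta>] by (simp add: Z_def c_def power_mult_distrib)
    have inner: "\<bar>(LINT \<theta>|ang. nonlin j (\<lambda>i \<eta>. A 0 i \<eta> r) \<xi> \<theta>) - g j \<xi>\<bar> \<le>
        ?e1 r * (\<kappa>1 * W1 \<xi>) + ?e2 r * (\<kappa>2 * W2 \<xi>) + r^n * (2 * c)" if r: "0 \<le> r" for r
    proof -
      let ?b = "\<lambda>\<theta>. ?e1 r * majorant j W1 \<xi> \<theta> + ?e2 r * majorant j W2 \<xi> \<theta> + (2 * (c * r^n) + ?e1 r * S1 \<xi> + ?e2 r * S2 \<xi>)"
      have "\<bar>(LINT \<theta>|ang. nonlin j (\<lambda>i \<eta>. A 0 i \<eta> r) \<xi> \<theta>) - g j \<xi>\<bar> \<le> (LINT \<theta>|ang. ?b \<theta>)"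
      proof (rule avg_diff_bound[OF j r])
        fix \<theta> :: real
        have "majorant j (\<lambda>\<eta>. \<bar>h 0 j \<eta> r\<bar>) \<xi> \<theta> \<le> ?e1 r * majorant j W1 \<xi> \<theta> + ?e2 r * majorant j W2 \<xi> \<theta> + 2 * (c * r^n)"
          by (intro majorant_le IH[OF r] mult_nonneg_nonneg c zero_le_power r)
        then show "\<bar>nonlin j (\<lambda>i \<eta>. A 0 i \<eta> r) \<xi> \<theta> - nonlin j g \<xi> \<theta>\<bar> \<le> ?b \<theta>" using nl[OF r, of \<xi> \<theta>] by linarith
      qed (intro Bochner_Integration.integrable_add integrable_mult_right W ang.integrable_const)
      also have "\<dots> = ?e1 r * (LINT \<theta>|ang. majorant j W1 \<xi> \<theta>) + ?e2 r * (LINT \<theta>|ang. majorant j W2 \<xi> \<theta>) + (2 * (c * r^n) + ?e1 r * S1 \<xi> + ?e2 r * S2 \<xi>)"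
        using W by (subst Bochner_Integration.integral_add Bochner_Integration.integral_add, (intro Bochner_Integration.integrable_add integrable_mult_right W ang.integrable_const)+)+
           simp
      also have "\<dots> = ?e1 r * ((LINT \<theta>|ang. majorant j W1 \<xi> \<theta>) + S1 \<xi>) + ?e2 r * ((LINT \<theta>|ang. majorant j W2 \<xi> \<theta>) + S2 \<xi>) + r^n * (2 * c)"
        by (simp add: algebra_simps)
      also have "\<dots> \<le> ?e1 r * (\<kappa>1 * W1 \<xi>) + ?e2 r * (\<kappa>2 * W2 \<xi>) + r^n * (2 * c)"
        using r by (intro add_mono mult_left_mono sup) auto
      finally show ?thesis .
    qed
    have i1: "integrable (ker t) ?e1" "integrable (ker t) ?e2" using \<kappa> t by (intro ker_exp(1); simp)+
    have v1: "(LINT r|ker t. ?e1 r) = (?e1 t - exp (- t)) / \<kappa>1" "(LINT r|ker t. ?e2 r) = (?e2 t - exp (- t)) / \<kappa>2"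
      using ker_exp(2)[of t "1 - \<kappa>1"] ker_exp(2)[of t "1 - \<kappa>2"] \<kappa> t by simp_all
    have "\<bar>LINT r|ker t. (LINT \<theta>|ang. nonlin j (\<lambda>i \<eta>. A 0 i \<eta> r) \<xi> \<theta>) - g j \<xi>\<bar> \<le>
       (LINT r|ker t. ?e1 r * (\<kappa>1 * W1 \<xi>) + ?e2 r * (\<kappa>2 * W2 \<xi>) + r^n * (2 * c))"
      using AE_ker[of t] inner by (intro abs_integral_le_bound Bochner_Integration.integrable_add integrable_mult_left i1 ker_pow t) (auto elim!: eventually_mono)
    also have "\<dots> = (LINT r|ker t. ?e1 r) * (\<kappa>1 * W1 \<xi>) + (LINT r|ker t. ?e2 r) * (\<kappa>2 * W2 \<xi>) + (LINT r|ker t. r^n) * (2 * c)"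
      using i1 ker_pow(1)[OF t, of n] by (subst Bochner_Integration.integral_add Bochner_Integration.integral_add, (intro Bochner_Integration.integrable_add integrable_mult_left i1 ker_pow t)+)+ simp
    \<comment> \<open>Division by \<kappa> cancels the factor from the supersolution inequality. The
      negative \<open>exp (- t)\<close> will cancel the contribution of the initial value, so the
      supersolution propagates with constant 1.\<close>
    also have "\<dots> \<le> (?e1 t - exp (- t)) * W1 \<xi> + (?e2 t - exp (- t)) * W2 \<xi> + t^(n+1) / (n+1) * (2 * c)"
      using \<kappa> c unfolding v1 by (intro add_mono mult_right_mono ker_pow t) (simp_all add: mult.assoc[symmetric])
    finally have I: "\<bar>LINT r|ker t. (LINT \<theta>|ang. nonlin j (\<lambda>i \<eta>. A 0 i \<eta> r) \<xi> \<theta>) - g j \<xi>\<bar> \<le>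
        (?e1 t - exp (- t)) * W1 \<xi> + (?e2 t - exp (- t)) * W2 \<xi> + t^(n+1) / (n+1) * (2 * c)" .
    have "h 0 j \<xi> t = exp (- t) * h 0 j \<xi> 0 + (LINT r|ker t. (LINT \<theta>|ang. nonlin j (\<lambda>i \<eta>. A 0 i \<eta> r) \<xi> \<theta>) - g j \<xi>)"
      using diff_integral[OF j t, of 0 \<xi>] base[OF j t, of \<xi>] unfolding h_def by (simp add: algebra_simps)
    moreover have "\<bar>exp (- t) * h 0 j \<xi> 0\<bar> \<le> exp (- t) * (W1 \<xi> + W2 \<xi>)" using init by (intro abs_mult_le) auto
    ultimately have "\<bar>h 0 j \<xi> t\<bar> \<le> exp (- t) * (W1 \<xi> + W2 \<xi>) + ((?e1 t - exp (- t)) * W1 \<xi> + (?e2 t - exp (- t)) * W2 \<xi> + t^(n+1) / (n+1) * (2 * c))"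
      using I by linarith
    also have "\<dots> = Z \<xi> t + t^(n+1) / (n+1) * (2 * c)" unfolding Z_def by (simp add: algebra_simps)
    also have "t^(n+1) / (n+1) * (2 * c) = 2 * C * ((2 * t)^(Suc n) / fact (Suc n))"
      unfolding c_def by (simp add: power_mult_distrib field_simps del: of_nat_Suc)
    finally show ?case .
  qed
  show ?thesis using iteration_limit[OF step[OF t]] unfolding Z_def .
qed

text \<open>The profile expected of a difference of order s: degree \<open>s - e\<close> in the
  truncated frequency with the time rate belonging to s, for two orders at once. The natural choice
  is \<open>e = j\<close>, as index j behaves like a j-th derivative; \<open>e = j - 1\<close>
  describes corrections of one degree more.\<close>

definition envelope where "envelope R s1 s2 A1 A2 e \<xi> r = exp (- (1 - 2 * alpha s1) * r) * (A1 * mw R \<xi> powr (s1 - e)) + exp (- (1 - 2 * alpha s2) * r) * (A2 * mw R \<xi> powr (s2 - e))"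

text \<open>The supersolution adds to the natural power a multiple \<open>k\<close> of the next one.
  The latter contracts with the smaller constant \<open>alpha (s + 1)\<close>, and the gap \<delta>
  times \<open>k\<close> absorbs a source of the size of \<open>envelope\<close> at
  \<open>j - 1\<close>. Exponents thus reach 6 + 1, which explains \<open>alpha 7\<close>.\<close>

lemma envelope_propagates:
  fixes s1 s2 :: real
  assumes R: "1 \<le> R" "\<And>\<xi>. R \<le> \<bar>\<xi>\<bar> \<Longrightarrow> (LINT \<theta>|ang. om q (\<xi> * sin \<theta>)) \<le> alpha 7"
    and s: "4 \<le> s1" "s1 \<le> 6" "4 \<le> s2" "s2 \<le> 6" and B: "0 \<le> B" and j: "j < 3"
  shows "\<exists>k\<ge>0. \<forall>A1\<ge>0. \<forall>A2\<ge>0. (\<forall>\<xi>. \<bar>h 0 j \<xi> 0\<bar> \<le> envelope R s1 s2 A1 A2 j \<xi> 0) \<longrightarrow>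
     (\<forall>\<xi>. \<forall>r\<ge>0. \<forall>\<theta>. \<bar>nonlin j (\<lambda>i \<eta>. A 0 i \<eta> r) \<xi> \<theta> - nonlin j g \<xi> \<theta>\<bar> \<le> majorant j (\<lambda>\<eta>. \<bar>h 0 j \<eta> r\<bar>) \<xi> \<theta> + B * envelope R s1 s2 A1 A2 (real j - 1) \<xi> r) \<longrightarrow>
     (\<forall>\<xi>. \<forall>t\<ge>0. \<bar>h 0 j \<xi> t\<bar> \<le> envelope R s1 s2 A1 A2 j \<xi> t + k * envelope R s1 s2 A1 A2 (real j - 1) \<xi> t)"
proof -
  define \<delta> where "\<delta> s = 2 * alpha s - 2 * alpha (s + 1)" for s
  have \<delta>: "0 < \<delta> s" if "4 \<le> s" for s using alpha_strict_antimono[of s "s+1"] that by (simp add: \<delta>_def)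
  define k where "k = max (B / \<delta> s1) (B / \<delta> s2)"
  have k: "0 \<le> k" using \<delta>[OF s(1)] B by (simp add: k_def le_max_iff_disj)
  have kB: "B \<le> k * \<delta> s1" "B \<le> k * \<delta> s2"
    using \<delta>[OF s(1)] \<delta>[OF s(3)] unfolding k_def by (simp_all flip: pos_divide_le_eq)
  define W where "W s Ai \<xi> = Ai * (mw R \<xi> powr (s - real j) + k * mw R \<xi> powr (s - (real j - 1)))" for s Ai \<xi> :: real
  define SS where "SS s Ai \<xi> = Ai * (B * mw R \<xi> powr (s - (real j - 1)))" for s Ai \<xi> :: real
  have j2: "real j \<le> 2" using j by auto
  have main: "integrable ang (majorant j (W s Ai) \<xi>)" "(LINT \<theta>|ang. majorant j (W s Ai) \<xi> \<theta>) + SS s Ai \<xi> \<le> 2 * alpha s * W s Ai \<xi>"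
    if s: "4 \<le> s" "s \<le> 6" "B \<le> k * \<delta> s" and Ai: "0 \<le> Ai" for s Ai \<xi> :: real
  proof -
    let ?p = "\<lambda>\<tau> \<theta>. \<bar>cos \<theta>\<bar>^j * mw R (\<xi> * cos \<theta>) powr \<tau> * om q (\<xi> * sin \<theta>)"
    let ?p' = "\<lambda>\<tau> \<theta>. \<bar>sin \<theta>\<bar>^j * mw R (\<xi> * sin \<theta>) powr \<tau> * om q (\<xi> * cos \<theta>)"
    let ?a = "s - real j" and ?b = "s - (real j - 1)"
    have eq: "majorant j (W s Ai) \<xi> = (\<lambda>\<theta>. Ai * ((?p ?a \<theta> + ?p' ?a \<theta>) + k * (?p ?b \<theta> + ?p' ?b \<theta>)))"
      by (rule ext) (simp add: majorant_def W_def algebra_simps)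
    have a: "0 \<le> ?a" "?a + real j \<le> 7" and b: "0 \<le> ?b" "?b + real j \<le> 7" using s j2 by auto
    note ma = mw_average[of R q 7, OF R q_nonneg a, of \<xi>] and mb = mw_average[of R q 7, OF R q_nonneg b, of \<xi>]
    show "integrable ang (majorant j (W s Ai) \<xi>)" unfolding eq
      by (intro integrable_mult_right Bochner_Integration.integrable_add ma mb)
    have "(LINT \<theta>|ang. majorant j (W s Ai) \<xi> \<theta>) = Ai * (((LINT \<theta>|ang. ?p ?a \<theta>) + (LINT \<theta>|ang. ?p' ?a \<theta>)) + k * ((LINT \<theta>|ang. ?p ?b \<theta>) + (LINT \<theta>|ang. ?p' ?b \<theta>)))"
      unfolding eq using ma(3,4) mb(3,4) by (simp add: Bochner_Integration.integral_add)
    also have "\<dots> \<le> Ai * ((alpha (?a + j) * mw R \<xi> powr ?a + alpha (?a + j) * mw R \<xi> powr ?a) + k * (alpha (?b + j) * mw R \<xi> powr ?b + alpha (?b + j) * mw R \<xi> powr ?b))"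
      by (intro mult_left_mono add_mono ma mb Ai k)
    also have "\<dots> + SS s Ai \<xi> = 2 * alpha s * W s Ai \<xi> - Ai * mw R \<xi> powr ?b * (k * \<delta> s - B)"
      by (simp add: SS_def W_def \<delta>_def algebra_simps)
    also have "\<dots> \<le> 2 * alpha s * W s Ai \<xi>" using s(3) Ai by simp
    finally show "(LINT \<theta>|ang. majorant j (W s Ai) \<xi> \<theta>) + SS s Ai \<xi> \<le> 2 * alpha s * W s Ai \<xi>" by simp
  qed
  show ?thesis
  proof (intro exI[of _ k] conjI allI impI k)
    fix A1 A2 \<xi> t :: real
    assume A: "0 \<le> A1" "0 \<le> A2" and init: "\<forall>\<xi>. \<bar>h 0 j \<xi> 0\<bar> \<le> envelope R s1 s2 A1 A2 j \<xi> 0"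
      and nl: "\<forall>\<xi>. \<forall>r\<ge>0. \<forall>\<theta>. \<bar>nonlin j (\<lambda>i \<eta>. A 0 i \<eta> r) \<xi> \<theta> - nonlin j g \<xi> \<theta>\<bar> \<le> majorant j (\<lambda>\<eta>. \<bar>h 0 j \<eta> r\<bar>) \<xi> \<theta> + B * envelope R s1 s2 A1 A2 (real j - 1) \<xi> r"
      and t: "0 \<le> t"
    have "\<bar>h 0 j \<xi> t\<bar> \<le> exp (- (1 - 2 * alpha s1) * t) * W s1 A1 \<xi> + exp (- (1 - 2 * alpha s2) * t) * W s2 A2 \<xi>"
    proof (rule comparison[OF j _ _ main(1) main(1) _ _ main(2) main(2)])
      show "0 \<le> W s1 A1 \<xi>" "0 \<le> W s2 A2 \<xi>" for \<xi> unfolding W_def using A k by simp_all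
      show "0 < 2 * alpha s1" "0 < 2 * alpha s2" using s alpha_pos by auto
      show "\<bar>h 0 j \<xi> 0\<bar> \<le> W s1 A1 \<xi> + W s2 A2 \<xi>" for \<xi>
      proof -
        have "envelope R s1 s2 A1 A2 j \<xi> 0 \<le> W s1 A1 \<xi> + W s2 A2 \<xi>" unfolding envelope_def W_def using A k by (simp add: algebra_simps)
        then show ?thesis using init by (meson order_trans)
      qed
      show "\<bar>nonlin j (\<lambda>i \<eta>. A 0 i \<eta> r) \<xi> \<theta> - nonlin j g \<xi> \<theta>\<bar> \<le>
       majorant j (\<lambda>\<eta>. \<bar>h 0 j \<eta> r\<bar>) \<xi> \<theta> + exp (- (1 - 2 * alpha s1) * r) * SS s1 A1 \<xi> + exp (- (1 - 2 * alpha s2) * r) * SS s2 A2 \<xi>" if "0 \<le> r" for \<xi> r \<theta>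
      proof -
        have "B * envelope R s1 s2 A1 A2 (real j - 1) \<xi> r = exp (- (1 - 2 * alpha s1) * r) * SS s1 A1 \<xi> + exp (- (1 - 2 * alpha s2) * r) * SS s2 A2 \<xi>"
          unfolding envelope_def SS_def by (simp add: algebra_simps)
        then show ?thesis using nl[rule_format, OF that, of \<xi> \<theta>] by linarith
      qed
    qed (use s kB A t in auto)
    also have "\<dots> = envelope R s1 s2 A1 A2 j \<xi> t + k * envelope R s1 s2 A1 A2 (real j - 1) \<xi> t"
      unfolding envelope_def W_def by (simp add: algebra_simps)
    finally show "\<bar>h 0 j \<xi> t\<bar> \<le> envelope R s1 s2 A1 A2 j \<xi> t + k * envelope R s1 s2 A1 A2 (real j - 1) \<xi> t" .
  qed
qed

lemma envelope_mono: assumes "0 \<le> R" "0 \<le> A1" "0 \<le> A2" "e \<le> s1" "e \<le> s2" "\<bar>c\<bar> \<le> 1"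
  shows "envelope R s1 s2 A1 A2 e (\<xi> * c) r \<le> envelope R s1 s2 A1 A2 e \<xi> r"
  unfolding envelope_def using assms by (intro add_mono mult_left_mono powr_mono2 mw_mult_le) auto

lemma envelope_shift: assumes "0 \<le> R" "0 \<le> A1" "0 \<le> A2"
  shows "envelope R s1 s2 A1 A2 (e - 1) \<xi> r \<le> R * envelope R s1 s2 A1 A2 e \<xi> r"
proof -
  have *: "mw R \<xi> powr (s - (e - 1)) \<le> R * mw R \<xi> powr (s - e)" for s
  proof (cases "mw R \<xi> = 0")
    case False
    then have p: "0 < mw R \<xi>" using mw_nonneg[OF assms(1), of \<xi>] by linarith
    have "mw R \<xi> powr (s - (e - 1)) = mw R \<xi> * mw R \<xi> powr (s - e)"
      using p by (simp add: powr_mult_base algebra_simps)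
    also have "\<dots> \<le> R * mw R \<xi> powr (s - e)" by (intro mult_right_mono mw_le) auto
    finally show ?thesis .
  qed simp
  have "envelope R s1 s2 A1 A2 (e - 1) \<xi> r \<le> exp (- (1 - 2 * alpha s1) * r) * (A1 * (R * mw R \<xi> powr (s1 - e))) + exp (- (1 - 2 * alpha s2) * r) * (A2 * (R * mw R \<xi> powr (s2 - e)))"
    unfolding envelope_def using assms by (intro add_mono mult_left_mono *) auto
  also have "\<dots> = R * envelope R s1 s2 A1 A2 e \<xi> r" unfolding envelope_def by (simp add: algebra_simps)
  finally show ?thesis .
qed

text \<open>The system is triangular: index 0 has no source, and the sources of indices 1 and 2 are
  differences of lower index times bounded factors, hence at least one degree better. The constants
  \<open>k0\<close>, \<open>k1\<close>, \<open>k2\<close> are fixed before \<open>A1\<close> and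
  \<open>A2\<close>, which makes \<open>K\<close> uniform in them.\<close>

lemma low_frequency:
  fixes s1 s2 :: real
  assumes R: "1 \<le> R" "\<And>\<xi>. R \<le> \<bar>\<xi>\<bar> \<Longrightarrow> (LINT \<theta>|ang. om q (\<xi> * sin \<theta>)) \<le> alpha 7"
    and s: "4 \<le> s1" "s1 \<le> 6" "4 \<le> s2" "s2 \<le> 6"
  shows "\<exists>K\<ge>0. \<forall>A1\<ge>0. \<forall>A2\<ge>0. (\<forall>j<3. \<forall>\<xi>. \<bar>h 0 j \<xi> 0\<bar> \<le> A1 * mw R \<xi> powr (s1 - real j) + A2 * mw R \<xi> powr (s2 - real j)) \<longrightarrow>
     (\<forall>j<3. \<forall>\<xi>. \<forall>t\<ge>0. \<bar>h 0 j \<xi> t\<bar> \<le> K * (A1 * exp (- (1 - 2 * alpha s1) * t) + A2 * exp (- (1 - 2 * alpha s2) * t)))"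
proof -
  have R0: "0 \<le> R" using R by simp
  let ?envelope = "\<lambda>A1 A2. envelope R s1 s2 A1 A2"
  obtain k0 where k0: "0 \<le> k0" and slot0: "\<forall>A1\<ge>0. \<forall>A2\<ge>0. (\<forall>\<xi>. \<bar>h 0 0 \<xi> 0\<bar> \<le> ?envelope A1 A2 (real 0) \<xi> 0) \<longrightarrow>
     (\<forall>\<xi>. \<forall>r\<ge>0. \<forall>\<theta>. \<bar>nonlin 0 (\<lambda>i \<eta>. A 0 i \<eta> r) \<xi> \<theta> - nonlin 0 g \<xi> \<theta>\<bar> \<le> majorant 0 (\<lambda>\<eta>. \<bar>h 0 0 \<eta> r\<bar>) \<xi> \<theta> + 0 * ?envelope A1 A2 (real 0 - 1) \<xi> r) \<longrightarrow>
     (\<forall>\<xi>. \<forall>t\<ge>0. \<bar>h 0 0 \<xi> t\<bar> \<le> ?envelope A1 A2 (real 0) \<xi> t + k0 * ?envelope A1 A2 (real 0 - 1) \<xi> t)"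
    using envelope_propagates[of R s1 s2 0 0, OF R s] by auto
  define L0 where "L0 = 1 + k0 * R"
  have L0: "0 \<le> L0" using k0 R0 by (simp add: L0_def)
  obtain k1 where k1: "0 \<le> k1" and slot1: "\<forall>A1\<ge>0. \<forall>A2\<ge>0. (\<forall>\<xi>. \<bar>h 0 1 \<xi> 0\<bar> \<le> ?envelope A1 A2 (real 1) \<xi> 0) \<longrightarrow>
     (\<forall>\<xi>. \<forall>r\<ge>0. \<forall>\<theta>. \<bar>nonlin 1 (\<lambda>i \<eta>. A 0 i \<eta> r) \<xi> \<theta> - nonlin 1 g \<xi> \<theta>\<bar> \<le> majorant 1 (\<lambda>\<eta>. \<bar>h 0 1 \<eta> r\<bar>) \<xi> \<theta> + 2 * C * L0 * ?envelope A1 A2 (real 1 - 1) \<xi> r) \<longrightarrow>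
     (\<forall>\<xi>. \<forall>t\<ge>0. \<bar>h 0 1 \<xi> t\<bar> \<le> ?envelope A1 A2 (real 1) \<xi> t + k1 * ?envelope A1 A2 (real 1 - 1) \<xi> t)"
    using envelope_propagates[of R s1 s2 "2 * C * L0" 1, OF R s] C L0 by auto
  define L1 where "L1 = 1 + k1 * R"
  have L1: "0 \<le> L1" using k1 R0 by (simp add: L1_def)
  obtain k2 where k2: "0 \<le> k2" and slot2: "\<forall>A1\<ge>0. \<forall>A2\<ge>0. (\<forall>\<xi>. \<bar>h 0 2 \<xi> 0\<bar> \<le> ?envelope A1 A2 (real 2) \<xi> 0) \<longrightarrow>
     (\<forall>\<xi>. \<forall>r\<ge>0. \<forall>\<theta>. \<bar>nonlin 2 (\<lambda>i \<eta>. A 0 i \<eta> r) \<xi> \<theta> - nonlin 2 g \<xi> \<theta>\<bar> \<le> majorant 2 (\<lambda>\<eta>. \<bar>h 0 2 \<eta> r\<bar>) \<xi> \<theta> + (2 * C * L0 * R + 4 * C * L1) * ?envelope A1 A2 (real 2 - 1) \<xi> r) \<longrightarrow>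
     (\<forall>\<xi>. \<forall>t\<ge>0. \<bar>h 0 2 \<xi> t\<bar> \<le> ?envelope A1 A2 (real 2) \<xi> t + k2 * ?envelope A1 A2 (real 2 - 1) \<xi> t)"
    using envelope_propagates[of R s1 s2 "2 * C * L0 * R + 4 * C * L1" 2, OF R s] C L0 L1 R0 by auto
  define L2 where "L2 = 1 + k2 * R"
  have L2: "0 \<le> L2" using k2 R0 by (simp add: L2_def)
  define K where "K = (L0 + L1 + L2) * R powr 6"
  show ?thesis
  proof (intro exI[of _ K] conjI allI impI)
    show "0 \<le> K" using L0 L1 L2 by (simp add: K_def)
    fix A1 A2 :: real and j :: nat and \<xi> t :: real
    assume A: "0 \<le> A1" "0 \<le> A2" and init: "\<forall>j<3. \<forall>\<xi>. \<bar>h 0 j \<xi> 0\<bar> \<le> A1 * mw R \<xi> powr (s1 - real j) + A2 * mw R \<xi> powr (s2 - real j)"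
      and j: "j < 3" and t: "0 \<le> t"
    let ?d = "?envelope A1 A2"
    have in': "\<bar>h 0 j \<xi> 0\<bar> \<le> ?d (real j) \<xi> 0" if "j < 3" for j \<xi> using init that by (simp add: envelope_def)
    have up: "\<bar>x\<bar> \<le> ?d e \<xi> r + k * ?d (e - 1) \<xi> r \<Longrightarrow> 0 \<le> k \<Longrightarrow> \<bar>x\<bar> \<le> (1 + k * R) * ?d e \<xi> r" for x e \<xi> r k
      using mult_left_mono[OF envelope_shift[OF R0 A, of s1 s2 e \<xi> r], of k] by (simp add: algebra_simps)
    have cb: "\<bar>A 0 i \<eta> r\<bar> \<le> C" "\<bar>g i \<eta>\<bar> \<le> C" if "i < 3" "0 \<le> r" for i \<eta> r using A_bound g_bound that by auto
    have h0: "\<bar>h 0 0 \<xi> r\<bar> \<le> L0 * ?d 0 \<xi> r" if "0 \<le> r" for \<xi> r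
    proof -
      have "\<bar>nonlin 0 (\<lambda>i \<eta>. A 0 i \<eta> r) \<xi> \<theta> - nonlin 0 g \<xi> \<theta>\<bar> \<le> majorant 0 (\<lambda>\<eta>. \<bar>h 0 0 \<eta> r\<bar>) \<xi> \<theta>" if r: "0 \<le> r" for \<xi> r \<theta>
      proof -
        have "\<bar>nonlin 0 (\<lambda>i \<eta>. A 0 i \<eta> r) \<xi> \<theta> - nonlin 0 g \<xi> \<theta>\<bar> \<le> \<bar>h 0 0 (\<xi> * cos \<theta>) r\<bar> * om q (\<xi> * sin \<theta>) + om q (\<xi> * cos \<theta>) * \<bar>h 0 0 (\<xi> * sin \<theta>) r\<bar>"
          unfolding nonlin_def using A_decay[OF r] g0_decay by (simp add: h_def) (intro abs_prod_diff; simp)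
        then show ?thesis by (simp add: majorant_def mult.commute)
      qed
      then have "\<bar>h 0 0 \<xi> r\<bar> \<le> ?d (real 0) \<xi> r + k0 * ?d (real 0 - 1) \<xi> r"
        using in'[of 0] by (intro slot0[rule_format] A that) auto
      from up[OF this k0] show ?thesis by (simp add: L0_def)
    qed
    have h0': "\<bar>h 0 0 (\<xi> * c) r\<bar> \<le> L0 * ?d 0 \<xi> r" if "0 \<le> r" "\<bar>c\<bar> \<le> 1" for \<xi> r c
      using h0[OF that(1), of "\<xi> * c"] mult_left_mono[OF envelope_mono[OF R0 A, of 0 s1 s2 c \<xi> r] L0] s that(2) by auto
    have h1: "\<bar>h 0 1 \<xi> r\<bar> \<le> L1 * ?d 1 \<xi> r" if "0 \<le> r" for \<xi> r
    proof -
      have "\<bar>nonlin 1 (\<lambda>i \<eta>. A 0 i \<eta> r) \<xi> \<theta> - nonlin 1 g \<xi> \<theta>\<bar> \<le> majorant 1 (\<lambda>\<eta>. \<bar>h 0 1 \<eta> r\<bar>) \<xi> \<theta> + 2 * C * L0 * ?d (real 1 - 1) \<xi> r" if r: "0 \<le> r" for \<xi> r \<theta>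
      proof -
        let ?x = "\<xi> * cos \<theta>" and ?y = "\<xi> * sin \<theta>"
        \<comment> \<open>Telescoped so that the index-1 difference always meets
          \<open>A 0 0\<close>, whose bound \<open>om q\<close> fits \<open>majorant\<close>; the
          index-0 difference meets the Gaussian and becomes the source.\<close>
        have eq: "nonlin 1 (\<lambda>i \<eta>. A 0 i \<eta> r) \<xi> \<theta> - nonlin 1 g \<xi> \<theta> =
            cos \<theta> * (h 0 1 ?x r * A 0 0 ?y r) + cos \<theta> * (g 1 ?x * h 0 0 ?y r) + sin \<theta> * (A 0 0 ?x r * h 0 1 ?y r) + sin \<theta> * (h 0 0 ?x r * g 1 ?y)"
          by (simp add: nonlin_def h_def algebra_simps)
        have 1: "\<bar>cos \<theta> * (h 0 1 ?x r * A 0 0 ?y r)\<bar> \<le> \<bar>cos \<theta>\<bar> * (\<bar>h 0 1 ?x r\<bar> * om q ?y)"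
          using A_decay[OF r] by (intro abs_mult_le) auto
        have 2: "\<bar>sin \<theta> * (A 0 0 ?x r * h 0 1 ?y r)\<bar> \<le> \<bar>sin \<theta>\<bar> * (om q ?x * \<bar>h 0 1 ?y r\<bar>)"
          using A_decay[OF r] by (intro abs_mult_le) auto
        have 3: "\<bar>cos \<theta> * (g 1 ?x * h 0 0 ?y r)\<bar> \<le> C * (L0 * ?d 0 \<xi> r)"
          using cb[OF _ r] h0'[OF r] by (intro abs_weight_le abs_mult_le) auto
        have 4: "\<bar>sin \<theta> * (h 0 0 ?x r * g 1 ?y)\<bar> \<le> (L0 * ?d 0 \<xi> r) * C"
          using cb[OF _ r] h0'[OF r] by (intro abs_weight_le abs_mult_le) auto
        have "majorant 1 (\<lambda>\<eta>. \<bar>h 0 1 \<eta> r\<bar>) \<xi> \<theta> + 2 * C * L0 * ?d (real 1 - 1) \<xi> r = \<bar>cos \<theta>\<bar> * (\<bar>h 0 1 ?x r\<bar> * om q ?y) + \<bar>sin \<theta>\<bar> * (om q ?x * \<bar>h 0 1 ?y r\<bar>) + C * (L0 * ?d 0 \<xi> r) + (L0 * ?d 0 \<xi> r) * C"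
          by (simp add: majorant_def algebra_simps)
        then show ?thesis unfolding eq using 1 2 3 4 by linarith
      qed
      then have "\<bar>h 0 1 \<xi> r\<bar> \<le> ?d (real 1) \<xi> r + k1 * ?d (real 1 - 1) \<xi> r"
        using in'[of 1] by (intro slot1[rule_format] A that) auto
      from up[OF this k1] show ?thesis by (simp add: L1_def)
    qed
    have h1': "\<bar>h 0 1 (\<xi> * c) r\<bar> \<le> L1 * ?d 1 \<xi> r" if "0 \<le> r" "\<bar>c\<bar> \<le> 1" for \<xi> r c
      using h1[OF that(1), of "\<xi> * c"] mult_left_mono[OF envelope_mono[OF R0 A, of 1 s1 s2 c \<xi> r] L1] s that(2) by auto
    have h0'': "\<bar>h 0 0 (\<xi> * c) r\<bar> \<le> L0 * (R * ?d 1 \<xi> r)" if "0 \<le> r" "\<bar>c\<bar> \<le> 1" for \<xi> r c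
      using h0'[OF that, of \<xi>] mult_left_mono[OF envelope_shift[OF R0 A, of s1 s2 1 \<xi> r] L0] by simp
    have h2: "\<bar>h 0 2 \<xi> r\<bar> \<le> L2 * ?d 2 \<xi> r" if "0 \<le> r" for \<xi> r
    proof -
      have "\<bar>nonlin 2 (\<lambda>i \<eta>. A 0 i \<eta> r) \<xi> \<theta> - nonlin 2 g \<xi> \<theta>\<bar> \<le> majorant 2 (\<lambda>\<eta>. \<bar>h 0 2 \<eta> r\<bar>) \<xi> \<theta> + (2 * C * L0 * R + 4 * C * L1) * ?d (real 2 - 1) \<xi> r" if r: "0 \<le> r" for \<xi> r \<theta>
      proof -
        let ?x = "\<xi> * cos \<theta>" and ?y = "\<xi> * sin \<theta>"
        have sq: "\<bar>(cos \<theta>)\<^sup>2\<bar> \<le> 1" "\<bar>(sin \<theta>)\<^sup>2\<bar> \<le> 1" "\<bar>cos \<theta> * sin \<theta>\<bar> \<le> 1"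
          using abs_mult_le[of "cos \<theta>" 1 "sin \<theta>" 1] by (auto simp: abs_square_le_1)
        \<comment> \<open>The same arrangement: the index-1 products become sources, and the terms
          with \<open>h 0 0\<close> are two degrees better, one of which is traded for a factor
          \<open>R\<close> by \<open>envelope_shift\<close>.\<close>
        have eq: "nonlin 2 (\<lambda>i \<eta>. A 0 i \<eta> r) \<xi> \<theta> - nonlin 2 g \<xi> \<theta> =
            (cos \<theta>)\<^sup>2 * (h 0 2 ?x r * A 0 0 ?y r) + (cos \<theta>)\<^sup>2 * (g 2 ?x * h 0 0 ?y r) + (sin \<theta>)\<^sup>2 * (A 0 0 ?x r * h 0 2 ?y r) + (sin \<theta>)\<^sup>2 * (h 0 0 ?x r * g 2 ?y)
            - 2 * ((cos \<theta> * sin \<theta>) * (h 0 1 ?x r * A 0 1 ?y r)) - 2 * ((cos \<theta> * sin \<theta>) * (g 1 ?x * h 0 1 ?y r))"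
          by (simp add: nonlin_def h_def algebra_simps)
        have 1: "\<bar>(cos \<theta>)\<^sup>2 * (h 0 2 ?x r * A 0 0 ?y r)\<bar> \<le> (cos \<theta>)\<^sup>2 * (\<bar>h 0 2 ?x r\<bar> * om q ?y)"
          using A_decay[OF r] by (intro abs_mult_le) auto
        have 2: "\<bar>(sin \<theta>)\<^sup>2 * (A 0 0 ?x r * h 0 2 ?y r)\<bar> \<le> (sin \<theta>)\<^sup>2 * (om q ?x * \<bar>h 0 2 ?y r\<bar>)"
          using A_decay[OF r] by (intro abs_mult_le) auto
        have 3: "\<bar>(cos \<theta>)\<^sup>2 * (g 2 ?x * h 0 0 ?y r)\<bar> \<le> C * (L0 * (R * ?d 1 \<xi> r))"
          using cb[OF _ r] h0''[OF r] sq by (intro abs_weight_le abs_mult_le) auto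
        have 4: "\<bar>(sin \<theta>)\<^sup>2 * (h 0 0 ?x r * g 2 ?y)\<bar> \<le> (L0 * (R * ?d 1 \<xi> r)) * C"
          using cb[OF _ r] h0''[OF r] sq by (intro abs_weight_le abs_mult_le) auto
        have 5: "\<bar>(cos \<theta> * sin \<theta>) * (h 0 1 ?x r * A 0 1 ?y r)\<bar> \<le> (L1 * ?d 1 \<xi> r) * C"
          using cb[OF _ r] h1'[OF r] sq by (intro abs_weight_le abs_mult_le) auto
        have 6: "\<bar>(cos \<theta> * sin \<theta>) * (g 1 ?x * h 0 1 ?y r)\<bar> \<le> C * (L1 * ?d 1 \<xi> r)"
          using cb[OF _ r] h1'[OF r] sq by (intro abs_weight_le abs_mult_le) auto
        have Peq: "majorant 2 (\<lambda>\<eta>. \<bar>h 0 2 \<eta> r\<bar>) \<xi> \<theta> + (2 * C * L0 * R + 4 * C * L1) * ?d (real 2 - 1) \<xi> r =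
            (cos \<theta>)\<^sup>2 * (\<bar>h 0 2 ?x r\<bar> * om q ?y) + (sin \<theta>)\<^sup>2 * (om q ?x * \<bar>h 0 2 ?y r\<bar>) + C * (L0 * (R * ?d 1 \<xi> r)) + (L0 * (R * ?d 1 \<xi> r)) * C
             + 2 * ((L1 * ?d 1 \<xi> r) * C) + 2 * (C * (L1 * ?d 1 \<xi> r))"
          by (simp add: majorant_def algebra_simps)
        have gen: "\<bar>p1 + p2 + p3 + p4 - 2 * p5 - 2 * p6\<bar> \<le> b1 + b3 + b2 + b4 + 2 * b5 + 2 * b6"
          if "\<bar>p1\<bar> \<le> b1" "\<bar>p2\<bar> \<le> b2" "\<bar>p3\<bar> \<le> b3" "\<bar>p4\<bar> \<le> b4" "\<bar>p5\<bar> \<le> b5" "\<bar>p6\<bar> \<le> b6" for p1 p2 p3 p4 p5 p6 b1 b2 b3 b4 b5 b6 :: real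
          using that by linarith
        show ?thesis unfolding eq Peq by (rule gen[OF 1 3 2 4 5 6])
      qed
      then have "\<bar>h 0 2 \<xi> r\<bar> \<le> ?d (real 2) \<xi> r + k2 * ?d (real 2 - 1) \<xi> r"
        using in'[of 2] by (intro slot2[rule_format] A that) auto
      from up[OF this k2] show ?thesis by (simp add: L2_def)
    qed
    let ?E = "A1 * exp (- (1 - 2 * alpha s1) * t) + A2 * exp (- (1 - 2 * alpha s2) * t)"
    have dE: "?d e \<xi> t \<le> R powr 6 * ?E" if "0 \<le> e" "e \<le> 4" for e
    proof -
      have "mw R \<xi> powr (s - e) \<le> R powr 6" if "4 \<le> s" "s \<le> 6" for s
      proof -
        have "mw R \<xi> powr (s - e) \<le> R powr (s - e)" using mw_le R0 that \<open>e \<le> 4\<close> by (intro powr_mono2) auto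
        also have "\<dots> \<le> R powr 6" using R that \<open>0 \<le> e\<close> by (intro powr_mono) auto
        finally show ?thesis .
      qed
      then have "?d e \<xi> t \<le> exp (- (1 - 2 * alpha s1) * t) * (A1 * R powr 6) + exp (- (1 - 2 * alpha s2) * t) * (A2 * R powr 6)"
        unfolding envelope_def using A s by (intro add_mono mult_left_mono) auto
      then show ?thesis by (simp add: algebra_simps)
    qed
    have En: "0 \<le> R powr 6 * ?E" using A by simp
    have fin: "L * ?d e \<xi> t \<le> K * ?E" if "0 \<le> L" "L \<le> L0 + L1 + L2" "0 \<le> e" "e \<le> 4" for L e
    proof -
      have "L * ?d e \<xi> t \<le> L * (R powr 6 * ?E)" using dE that by (intro mult_left_mono) auto
      also have "\<dots> \<le> (L0 + L1 + L2) * (R powr 6 * ?E)" using that En by (intro mult_right_mono) auto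
      finally show ?thesis by (simp add: K_def mult.assoc)
    qed
    show "\<bar>h 0 j \<xi> t\<bar> \<le> K * ?E"
      using j h0[OF t, of \<xi>] h1[OF t, of \<xi>] h2[OF t, of \<xi>] fin[of L0 0] fin[of L1 1] fin[of L2 2] L0 L1 L2
      unfolding nat_less_3 by auto
  qed
qed

end

section \<open>The gain operator\<close>

text \<open>Valued in \<open>ennreal\<close>, so that it makes sense at every velocity, also where
  the integral diverges.\<close>

definition gain :: "(real \<Rightarrow> ennreal) \<Rightarrow> real \<Rightarrow> ennreal" where
  "gain G v = (\<integral>\<^sup>+\<theta>. \<integral>\<^sup>+w. G (v * cos \<theta> - w * sin \<theta>) * G (v * sin \<theta> + w * cos \<theta>) \<partial>lborel \<partial>ang)"

interpretation ker: finite_measure "ker t" for t by (rule finite_measure_ker)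

lemma gain_measurable_pair [measurable]:
  assumes [measurable]: "(\<lambda>x. G (fst x) (snd x)) \<in> borel_measurable (borel \<Otimes>\<^sub>M borel)"
  shows "(\<lambda>x. gain (\<lambda>u. G u (snd x)) (fst x)) \<in> borel_measurable (borel \<Otimes>\<^sub>M borel)"
proof -
  have [measurable]: "(\<lambda>z. G (p z) (q z)) \<in> borel_measurable N" if "p \<in> borel_measurable N" "q \<in> borel_measurable N" for p q and N :: "'c measure"
    using measurable_compose[OF measurable_Pair[OF that] assms] by simp
  show ?thesis unfolding gain_def by measurable
qed

lemma gain_measurable [measurable]:
  assumes [measurable]: "G \<in> borel_measurable borel"
  shows "gain G \<in> borel_measurable borel"
  unfolding gain_def by measurable

text \<open>Two one-dimensional affine substitutions joined by Fubini: w is replaced by x at fixed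
  v, then v by y at fixed x. Their Jacobians \<open>1 / \<bar>s\<bar>\<close> and
  \<open>\<bar>s\<bar>\<close> cancel. For \<open>s = 0\<close> the map is plus or minus the
  identity.\<close>

lemma rotation:
  fixes K :: "real \<Rightarrow> real \<Rightarrow> ennreal"
  assumes K: "(\<lambda>x. K (fst x) (snd x)) \<in> borel_measurable (borel \<Otimes>\<^sub>M borel)" and cs: "c\<^sup>2 + s\<^sup>2 = (1::real)"
  shows "(\<integral>\<^sup>+v. \<integral>\<^sup>+w. K (v * c - w * s) (v * s + w * c) \<partial>lborel \<partial>lborel) = (\<integral>\<^sup>+x. \<integral>\<^sup>+y. K x y \<partial>lborel \<partial>lborel)"
proof -
  have [measurable]: "(\<lambda>z. K (p z) (q z)) \<in> borel_measurable N" if "p \<in> borel_measurable N" "q \<in> borel_measurable N" for p q and N :: "'c measure"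
    using measurable_compose[OF measurable_Pair[OF that] K] by simp
  show ?thesis
  proof (cases "s = 0")
    case True
    then have c: "c \<noteq> 0" "\<bar>c\<bar> = 1" using cs by (auto simp: power2_eq_1_iff)
    have "(\<integral>\<^sup>+x. \<integral>\<^sup>+y. K x y \<partial>lborel \<partial>lborel) = (\<integral>\<^sup>+v. \<integral>\<^sup>+y. K (0 + c * v) y \<partial>lborel \<partial>lborel)"
      using c by (subst nn_integral_real_affine[where c=c and t=0]) auto
    also have "\<dots> = (\<integral>\<^sup>+v. \<integral>\<^sup>+w. K (0 + c * v) (0 + c * w) \<partial>lborel \<partial>lborel)"
    proof (rule nn_integral_cong)
      fix v show "(\<integral>\<^sup>+y. K (0 + c * v) y \<partial>lborel) = (\<integral>\<^sup>+w. K (0 + c * v) (0 + c * w) \<partial>lborel)"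
        using nn_integral_real_affine[of "\<lambda>y. K (0 + c * v) y" c 0] c by simp
    qed
    finally show ?thesis using True by (simp add: mult.commute)
  next
    case False
    have y: "v * s + (v * c / s + (-1/s) * x) * c = (v - x * c) / s" for v x
    proof -
      have "v * s + (v * c / s + (-1/s) * x) * c = (v * (c\<^sup>2 + s\<^sup>2) - x * c) / s"
        using False by (simp add: field_simps power2_eq_square)
      then show ?thesis using cs by simp
    qed
    have x: "v * c - (v * c / s + (-1/s) * x) * s = x" for v x using False by (simp add: field_simps)
    have "(\<integral>\<^sup>+v. \<integral>\<^sup>+w. K (v * c - w * s) (v * s + w * c) \<partial>lborel \<partial>lborel) =
       (\<integral>\<^sup>+v. ennreal \<bar>-1/s\<bar> * (\<integral>\<^sup>+x. K x ((v - x * c) / s) \<partial>lborel) \<partial>lborel)"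
    proof (rule nn_integral_cong)
      fix v
      show "(\<integral>\<^sup>+w. K (v * c - w * s) (v * s + w * c) \<partial>lborel) = ennreal \<bar>-1/s\<bar> * (\<integral>\<^sup>+x. K x ((v - x * c) / s) \<partial>lborel)"
        using nn_integral_real_affine[of "\<lambda>w. K (v * c - w * s) (v * s + w * c)" "-1/s" "v * c / s"] False unfolding x y by simp
    qed
    also have "\<dots> = ennreal \<bar>-1/s\<bar> * (\<integral>\<^sup>+x. \<integral>\<^sup>+v. K x ((v - x * c) / s) \<partial>lborel \<partial>lborel)"
      by (subst nn_integral_cmult, measurable, subst lborel_pair.Fubini', measurable)
    also have "(\<integral>\<^sup>+x. \<integral>\<^sup>+v. K x ((v - x * c) / s) \<partial>lborel \<partial>lborel) = (\<integral>\<^sup>+x. ennreal \<bar>s\<bar> * (\<integral>\<^sup>+y. K x y \<partial>lborel) \<partial>lborel)"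
    proof (rule nn_integral_cong)
      fix x
      show "(\<integral>\<^sup>+v. K x ((v - x * c) / s) \<partial>lborel) = ennreal \<bar>s\<bar> * (\<integral>\<^sup>+y. K x y \<partial>lborel)"
        using nn_integral_real_affine[of "\<lambda>v. K x ((v - x * c) / s)" s "x * c"] False by simp
    qed
    also have "ennreal \<bar>-1/s\<bar> * \<dots> = (ennreal \<bar>-1/s\<bar> * ennreal \<bar>s\<bar>) * (\<integral>\<^sup>+x. \<integral>\<^sup>+y. K x y \<partial>lborel \<partial>lborel)"
      by (subst nn_integral_cmult) (auto simp: mult.assoc)
    also have "ennreal \<bar>-1/s\<bar> * ennreal \<bar>s\<bar> = 1" using False by (simp flip: ennreal_mult)
    finally show ?thesis by simp
  qed
qed

text \<open>Rotating the pair of velocities decouples the two densities. This exhibits the gain as a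
  mixture over angles of laws of rotated sums, on which all amplitude equations rest.\<close>

lemma nn_integral_gain:
  assumes [measurable]: "G \<in> borel_measurable borel" "\<Psi> \<in> borel_measurable borel"
  shows "(\<integral>\<^sup>+v. \<Psi> v * gain G v \<partial>lborel) = (\<integral>\<^sup>+\<theta>. \<integral>\<^sup>+x. \<integral>\<^sup>+y. \<Psi> (x * cos \<theta> + y * sin \<theta>) * (G x * G y) \<partial>lborel \<partial>lborel \<partial>ang)"
proof -
  interpret L: pair_sigma_finite ang lborel by unfold_locales
  have "(\<integral>\<^sup>+v. \<Psi> v * gain G v \<partial>lborel) = (\<integral>\<^sup>+v. \<integral>\<^sup>+\<theta>. \<integral>\<^sup>+w. \<Psi> v * (G (v * cos \<theta> - w * sin \<theta>) * G (v * sin \<theta> + w * cos \<theta>)) \<partial>lborel \<partial>ang \<partial>lborel)"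
    unfolding gain_def by (simp add: nn_integral_cmult)
  also have "\<dots> = (\<integral>\<^sup>+\<theta>. \<integral>\<^sup>+v. \<integral>\<^sup>+w. \<Psi> v * (G (v * cos \<theta> - w * sin \<theta>) * G (v * sin \<theta> + w * cos \<theta>)) \<partial>lborel \<partial>lborel \<partial>ang)"
    by (rule L.Fubini') measurable
  also have "\<dots> = (\<integral>\<^sup>+\<theta>. \<integral>\<^sup>+x. \<integral>\<^sup>+y. \<Psi> (x * cos \<theta> + y * sin \<theta>) * (G x * G y) \<partial>lborel \<partial>lborel \<partial>ang)"
  proof (rule nn_integral_cong)
    fix \<theta> :: real
    have v: "(v * cos \<theta> - w * sin \<theta>) * cos \<theta> + (v * sin \<theta> + w * cos \<theta>) * sin \<theta> = v" for v w
    proof -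
      have "(v * c - w * s) * c + (v * s + w * c) * s = v * (c\<^sup>2 + s\<^sup>2)" for c s :: real
        by (simp add: algebra_simps power2_eq_square)
      from this[of "cos \<theta>" "sin \<theta>"] show ?thesis by simp
    qed
    show "(\<integral>\<^sup>+v. \<integral>\<^sup>+w. \<Psi> v * (G (v * cos \<theta> - w * sin \<theta>) * G (v * sin \<theta> + w * cos \<theta>)) \<partial>lborel \<partial>lborel) =
       (\<integral>\<^sup>+x. \<integral>\<^sup>+y. \<Psi> (x * cos \<theta> + y * sin \<theta>) * (G x * G y) \<partial>lborel \<partial>lborel)"
      using rotation[of "\<lambda>x y. \<Psi> (x * cos \<theta> + y * sin \<theta>) * (G x * G y)" "cos \<theta>" "sin \<theta>"] by (simp add: v)
  qed
  finally show ?thesis .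
qed

text \<open>When sine and cosine are nonzero, both arguments are nonconstant affine functions of w
  and pull null sets back to null sets. This is true at every v, so \<open>gain\<close> is
  determined pointwise by the almost-everywhere class of its argument.\<close>

lemma AE_gain:
  assumes "AE v in lborel. P v"
  shows "AE \<theta> in ang. AE w in lborel. P (v * cos \<theta> - w * sin \<theta>) \<and> P (v * sin \<theta> + w * cos \<theta>)"
  using AE_ang_nonzero
proof eventually_elim
  case (elim \<theta>)
  obtain N where N: "{v \<in> space lborel. \<not> P v} \<subseteq> N" "emeasure lborel N = 0" "N \<in> sets lborel" using assms by (rule AE_E)
  have aff: "AE w in lborel. P (a + b * w)" if b: "b \<noteq> 0" for a b :: real
  proof -
    have "0 = (\<integral>\<^sup>+x. indicator N x \<partial>lborel)" using N by simp
    also have "\<dots> = ennreal \<bar>b\<bar> * (\<integral>\<^sup>+w. indicator N (a + b * w) \<partial>lborel)"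
      using N b by (intro nn_integral_real_affine) auto
    finally have "(\<integral>\<^sup>+w. indicator N (a + b * w) \<partial>lborel) = 0" using b by auto
    then have "AE w in lborel. indicator N (a + b * w) = (0::ennreal)"
      using N by (subst (asm) nn_integral_0_iff_AE) auto
    then show ?thesis by eventually_elim (use N(1) in \<open>auto split: split_indicator_asm\<close>)
  qed
  show ?case using aff[of "- sin \<theta>" "v * cos \<theta>"] aff[of "cos \<theta>" "v * sin \<theta>"] elim
    by (auto simp: mult.commute)
qed

lemma gain_mono_AE:
  assumes "AE v in lborel. G v \<le> G' v"
  shows "gain G v \<le> gain G' v"
  unfolding gain_def
proof (rule nn_integral_mono_AE)
  show "AE \<theta> in ang. (\<integral>\<^sup>+w. G (v * cos \<theta> - w * sin \<theta>) * G (v * sin \<theta> + w * cos \<theta>) \<partial>lborel) \<le>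
      (\<integral>\<^sup>+w. G' (v * cos \<theta> - w * sin \<theta>) * G' (v * sin \<theta> + w * cos \<theta>) \<partial>lborel)"
    using AE_gain[OF assms, of v]
  proof eventually_elim
    case (elim \<theta>)
    show ?case by (rule nn_integral_mono_AE) (use elim in \<open>eventually_elim, auto intro: mult_mono\<close>)
  qed
qed

lemma gain_cong_AE: "AE v in lborel. G v = G' v \<Longrightarrow> gain G v = gain G' v"
  by (intro antisym gain_mono_AE) (auto elim: eventually_mono)

section \<open>Sign symmetries of the gain\<close>

lemma nn_integral_lborel_neg:
  fixes f :: "real \<Rightarrow> ennreal"
  assumes [measurable]: "f \<in> borel_measurable borel" shows "(\<integral>\<^sup>+w. f (- w) \<partial>lborel) = (\<integral>\<^sup>+w. f w \<partial>lborel)"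
  by (subst (2) nn_integral_real_affine[where c="-1" and t=0]) auto

text \<open>For a and b equal to 1 or -1 all four values agree, which yields both the evenness of
  the gain and its dependence on the even part alone.\<close>

definition gain_sgn where "gain_sgn a b G v = (\<integral>\<^sup>+\<theta>. \<integral>\<^sup>+w. G (a * (v * cos \<theta> - w * sin \<theta>)) * G (b * (v * sin \<theta> + w * cos \<theta>)) \<partial>lborel \<partial>ang)"

text \<open>Half a turn of the angle changes the sign of both arguments.\<close>

lemma gain_sgn_rot:
  assumes [measurable]: "G \<in> borel_measurable borel"
  shows "gain_sgn (- a) (- b) G v = gain_sgn a b G v"
proof -
  have "gain_sgn (- a) (- b) G v = (\<integral>\<^sup>+\<theta>. \<integral>\<^sup>+w. G (a * (v * cos (\<theta> + pi) - w * sin (\<theta> + pi))) * G (b * (v * sin (\<theta> + pi) + w * cos (\<theta> + pi))) \<partial>lborel \<partial>ang)"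
  proof -
    have "- a * (v * cos \<theta> - w * sin \<theta>) = a * (v * cos (\<theta> + pi) - w * sin (\<theta> + pi))"
      "- b * (v * sin \<theta> + w * cos \<theta>) = b * (v * sin (\<theta> + pi) + w * cos (\<theta> + pi))" for \<theta> w
      by (simp_all add: algebra_simps)
    then show ?thesis unfolding gain_sgn_def by (simp only:)
  qed
  also have "\<dots> = gain_sgn a b G v" unfolding gain_sgn_def
    by (rule nn_integral_ang_shift[where u="\<lambda>\<theta>. \<integral>\<^sup>+w. G (a * (v * cos \<theta> - w * sin \<theta>)) * G (b * (v * sin \<theta> + w * cos \<theta>)) \<partial>lborel"]) auto
  finally show ?thesis .
qed

text \<open>Reflecting w and replacing \<theta> by \<open>- (\<theta> + pi)\<close> changes the sign
  of the first argument only.\<close>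

lemma gain_sgn_flip:
  assumes [measurable]: "G \<in> borel_measurable borel"
  shows "gain_sgn (- a) b G v = gain_sgn a b G v"
proof -
  let ?u = "\<lambda>\<theta>. \<integral>\<^sup>+w. G (a * (v * cos \<theta> - w * sin \<theta>)) * G (b * (v * sin \<theta> + w * cos \<theta>)) \<partial>lborel"
  have "gain_sgn (- a) b G v = (\<integral>\<^sup>+\<theta>. \<integral>\<^sup>+w. G (- a * (v * cos \<theta> - (- w) * sin \<theta>)) * G (b * (v * sin \<theta> + (- w) * cos \<theta>)) \<partial>lborel \<partial>ang)"
    unfolding gain_sgn_def
    by (rule nn_integral_cong, rule nn_integral_lborel_neg[of "\<lambda>w. G (- a * (v * cos \<theta> - w * sin \<theta>)) * G (b * (v * sin \<theta> + w * cos \<theta>))" for \<theta>, symmetric]) measurable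
  also have "\<dots> = (\<integral>\<^sup>+\<theta>. ?u (- (\<theta> + pi)) \<partial>ang)"
  proof -
    have "- a * (v * cos \<theta> - (- w) * sin \<theta>) = a * (v * cos (- (\<theta> + pi)) - w * sin (- (\<theta> + pi)))"
      "b * (v * sin \<theta> + (- w) * cos \<theta>) = b * (v * sin (- (\<theta> + pi)) + w * cos (- (\<theta> + pi)))" for \<theta> w
      by (simp_all only: sin_minus cos_minus sin_periodic_pi cos_periodic_pi, simp_all add: algebra_simps)
    then show ?thesis by (simp only:)
  qed
  also have "\<dots> = (\<integral>\<^sup>+\<theta>. ?u (- \<theta>) \<partial>ang)"
    by (rule nn_integral_ang_shift[where u="\<lambda>\<theta>. ?u (- \<theta>)"]) (simp_all only: sin_minus cos_minus sin_periodic cos_periodic, auto)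
  also have "\<dots> = (\<integral>\<^sup>+\<theta>. ?u \<theta> \<partial>ang)"
    by (rule nn_integral_ang_reflect) auto
  finally show ?thesis by (simp add: gain_sgn_def)
qed

lemma gain_sgn_all:
  assumes [measurable]: "G \<in> borel_measurable borel"
  shows "gain_sgn 1 1 G v = gain G v" "gain_sgn (-1) 1 G v = gain G v" "gain_sgn 1 (-1) G v = gain G v" "gain_sgn (-1) (-1) G v = gain G v"
  using gain_sgn_rot[OF assms, of 1 1 v] gain_sgn_rot[OF assms, of "-1" 1 v] gain_sgn_flip[OF assms, of 1 1 v]
  by (simp_all add: gain_sgn_def gain_def)

lemma gain_even:
  assumes [measurable]: "G \<in> borel_measurable borel"
  shows "gain G (- v) = gain G v"
proof -
  have "gain G (- v) = (\<integral>\<^sup>+\<theta>. \<integral>\<^sup>+w. G (- v * cos \<theta> - (- w) * sin \<theta>) * G (- v * sin \<theta> + (- w) * cos \<theta>) \<partial>lborel \<partial>ang)"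
    unfolding gain_def
    by (rule nn_integral_cong, rule nn_integral_lborel_neg[of "\<lambda>w. G (- v * cos \<theta> - w * sin \<theta>) * G (- v * sin \<theta> + w * cos \<theta>)" for \<theta>, symmetric]) measurable
  also have "\<dots> = gain_sgn (-1) (-1) G v"
  proof -
    have "- v * cos \<theta> - (- w) * sin \<theta> = -1 * (v * cos \<theta> - w * sin \<theta>)"
      "- v * sin \<theta> + (- w) * cos \<theta> = -1 * (v * sin \<theta> + w * cos \<theta>)" for \<theta> w
      by simp_all
    then show ?thesis unfolding gain_sgn_def by (simp only:)
  qed
  finally show ?thesis using gain_sgn_all(4)[OF assms] by simp
qed

lemma quarter_ennreal: "(1/4::ennreal) = ennreal (1/4)"
  using inverse_ennreal[of 4] by (simp add: divide_ennreal_def inverse_eq_divide)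

text \<open>Expanding the product of the two even parts gives the four sign choices of
  \<open>gain_sgn\<close>, each with weight 1/4.\<close>

lemma gain_symmetrize:
  assumes [measurable]: "G \<in> borel_measurable borel"
  shows "gain (\<lambda>v. (G v + G (- v)) / 2) v = gain G v"
proof -
  have h: "(a + b) / 2 * ((c + d) / 2) = (1/4) * (a * c) + (1/4) * (b * c) + (1/4) * (a * d) + (1/4) * (b * (d::ennreal))" for a b c d
  proof -
    have "inverse (2::ennreal) = ennreal (1/2)" using inverse_ennreal[of 2] by (simp add: inverse_eq_divide)
    then have "inverse 2 * inverse 2 = ennreal (1/2 * (1/2))" by (simp only: ennreal_mult[of "1/2" "1/2"])
    then have q: "(1/4::ennreal) = inverse 2 * inverse 2" unfolding quarter_ennreal by simp
    show ?thesis unfolding q unfolding divide_ennreal_def by (simp add: algebra_simps)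
  qed
  have "gain (\<lambda>v. (G v + G (- v)) / 2) v = (1/4) * gain_sgn 1 1 G v + (1/4) * gain_sgn (-1) 1 G v + (1/4) * gain_sgn 1 (-1) G v + (1/4) * gain_sgn (-1) (-1) G v"
    unfolding gain_def gain_sgn_def h
    by (simp add: nn_integral_add nn_integral_cmult)
  also have "\<dots> = ((1/4) + (1/4) + (1/4) + (1/4)) * gain G v" unfolding gain_sgn_all[OF assms] by (simp only: distrib_right)
  also have "(1/4) + (1/4) + (1/4) + (1/4) = (1::ennreal)"
    unfolding quarter_ennreal
    using ennreal_plus[of "1/4" "1/4"] ennreal_plus[of "1/2" "1/4"] ennreal_plus[of "3/4" "1/4"] by simp
  finally show ?thesis by simp
qed

text \<open>A mixture identity known for nonnegative functions passes to a signed
  \<open>\<psi>\<close> through positive and negative parts. It serves the mixture over angles and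
  the mixture over times.\<close>

lemma kernel_integral:
  fixes \<psi> :: "real \<Rightarrow> real"
  assumes test: "\<And>\<Psi>. \<Psi> \<in> borel_measurable borel \<Longrightarrow> (\<integral>\<^sup>+v. \<Psi> v \<partial>\<mu>) = (\<integral>\<^sup>+\<omega>. \<integral>\<^sup>+v. \<Psi> v \<partial>\<kappa> \<omega> \<partial>N)"
    and meas: "\<And>\<Psi>. \<Psi> \<in> borel_measurable borel \<Longrightarrow> (\<lambda>\<omega>. \<integral>\<^sup>+v. \<Psi> v \<partial>\<kappa> \<omega>) \<in> borel_measurable N"
    and \<psi>: "\<psi> \<in> borel_measurable borel" and i: "integrable \<mu> \<psi>" "\<And>\<omega>. integrable (\<kappa> \<omega>) \<psi>"
  shows "integrable N (\<lambda>\<omega>. LINT v|\<kappa> \<omega>. \<psi> v)" "(LINT v|\<mu>. \<psi> v) = (LINT \<omega>|N. LINT v|\<kappa> \<omega>. \<psi> v)"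
proof -
  have [measurable]: "(\<lambda>v. ennreal (\<psi> v)) \<in> borel_measurable borel" "(\<lambda>v. ennreal (- \<psi> v)) \<in> borel_measurable borel" using \<psi> by auto
  define P where "P \<omega> = (\<integral>\<^sup>+v. ennreal (\<psi> v) \<partial>\<kappa> \<omega>)" for \<omega>
  define Q where "Q \<omega> = (\<integral>\<^sup>+v. ennreal (- \<psi> v) \<partial>\<kappa> \<omega>)" for \<omega>
  have [measurable]: "P \<in> borel_measurable N" "Q \<in> borel_measurable N" unfolding P_def Q_def by (auto intro!: meas)
  have fin: "P \<omega> < \<infinity>" "Q \<omega> < \<infinity>" for \<omega> using i(2)[of \<omega>] unfolding P_def Q_def real_integrable_def by (auto simp: less_top)
  have inner: "(LINT v|\<kappa> \<omega>. \<psi> v) = enn2real (P \<omega>) - enn2real (Q \<omega>)" for \<omega>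
    using real_lebesgue_integral_def[OF i(2)[of \<omega>]] by (simp add: P_def Q_def)
  have PQ: "(\<integral>\<^sup>+\<omega>. P \<omega> \<partial>N) = (\<integral>\<^sup>+v. ennreal (\<psi> v) \<partial>\<mu>)" "(\<integral>\<^sup>+\<omega>. Q \<omega> \<partial>N) = (\<integral>\<^sup>+v. ennreal (- \<psi> v) \<partial>\<mu>)"
    unfolding P_def Q_def by (auto intro!: test[symmetric])
  have fin2: "(\<integral>\<^sup>+\<omega>. P \<omega> \<partial>N) < \<infinity>" "(\<integral>\<^sup>+\<omega>. Q \<omega> \<partial>N) < \<infinity>"
    unfolding PQ using i(1) by (auto simp: real_integrable_def less_top)
  have iP: "integrable N (\<lambda>\<omega>. enn2real (P \<omega>))" "integrable N (\<lambda>\<omega>. enn2real (Q \<omega>))"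
    using fin fin2 by (auto intro!: integrableI_nonneg)
  have vP: "(LINT \<omega>|N. enn2real (P \<omega>)) = enn2real (\<integral>\<^sup>+\<omega>. P \<omega> \<partial>N)" "(LINT \<omega>|N. enn2real (Q \<omega>)) = enn2real (\<integral>\<^sup>+\<omega>. Q \<omega> \<partial>N)"
    using fin by (auto simp: integral_eq_nn_integral)
  show "integrable N (\<lambda>\<omega>. LINT v|\<kappa> \<omega>. \<psi> v)" unfolding inner by (intro Bochner_Integration.integrable_diff iP)
  show "(LINT v|\<mu>. \<psi> v) = (LINT \<omega>|N. LINT v|\<kappa> \<omega>. \<psi> v)"
    unfolding inner real_lebesgue_integral_def[OF i(1)] PQ[symmetric] vP[symmetric] by (intro Bochner_Integration.integral_diff[symmetric] iP)
qed

section \<open>Levels of a symmetric solution\<close>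

text \<open>Up to sign the j-th derivative of \<open>cos (\<xi> * v)\<close> in \<xi>. Real test
  functions suffice because the laws to be tested are even.\<close>

definition tr :: "nat \<Rightarrow> real \<Rightarrow> real \<Rightarrow> real" where
  "tr j \<xi> v = (if j = 0 then cos (\<xi> * v) else if j = 1 then v * sin (\<xi> * v) else v\<^sup>2 * cos (\<xi> * v))"

lemma tr_measurable [measurable]: "tr j \<xi> \<in> borel_measurable borel"
  unfolding tr_def by measurable

lemma tr_0_bound: "\<bar>tr 0 \<xi> v\<bar> \<le> 1" by (simp add: tr_def)

lemma abs_le_one_plus_square: "\<bar>v\<bar> \<le> 1 + (v::real)\<^sup>2"
  using zero_le_power2[of "\<bar>v\<bar> - 1/2"] by (simp add: power2_eq_square algebra_simps)

lemma tr_bound: "\<bar>tr j \<xi> v\<bar> \<le> 1 + v\<^sup>2"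
proof -
  have "\<bar>cos (\<xi> * v)\<bar> \<le> 1 + v\<^sup>2" using abs_cos_le_one[of "\<xi> * v"] zero_le_power2[of v] by linarith
  moreover have "\<bar>v * sin (\<xi> * v)\<bar> \<le> \<bar>v\<bar>" using mult_left_mono[OF abs_sin_le_one[of "\<xi> * v"], of "\<bar>v\<bar>"] by (simp add: abs_mult)
  moreover have "\<bar>v\<^sup>2 * cos (\<xi> * v)\<bar> \<le> v\<^sup>2" using mult_left_mono[OF abs_cos_le_one[of "\<xi> * v"], of "v\<^sup>2"] by (simp add: abs_mult)
  ultimately show ?thesis using abs_le_one_plus_square[of v] unfolding tr_def by auto
qed

lemma prod_integral:
  fixes p q :: "real \<Rightarrow> real"
  assumes "finite_measure \<mu>" and p: "integrable \<mu> p" and q: "integrable \<mu> q"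
  shows "integrable (\<mu> \<Otimes>\<^sub>M \<mu>) (\<lambda>z. p (fst z) * q (snd z))"
    "(LINT z|(\<mu> \<Otimes>\<^sub>M \<mu>). p (fst z) * q (snd z)) = (LINT x|\<mu>. p x) * (LINT y|\<mu>. q y)"
proof -
  interpret finite_measure \<mu> by fact
  interpret P: pair_sigma_finite \<mu> \<mu> by unfold_locales
  have [measurable]: "p \<in> borel_measurable \<mu>" "q \<in> borel_measurable \<mu>" using p q by auto
  show i: "integrable (\<mu> \<Otimes>\<^sub>M \<mu>) (\<lambda>z. p (fst z) * q (snd z))"
  proof (rule P.Fubini_integrable)
    show "integrable \<mu> (\<lambda>x. LINT y|\<mu>. norm (p (fst (x, y)) * q (snd (x, y))))"
      using p q by (simp add: abs_mult)
    show "AE x in \<mu>. integrable \<mu> (\<lambda>y. p (fst (x, y)) * q (snd (x, y)))"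
      using q by simp
  qed measurable
  show "(LINT z|(\<mu> \<Otimes>\<^sub>M \<mu>). p (fst z) * q (snd z)) = (LINT x|\<mu>. p x) * (LINT y|\<mu>. q y)"
    using P.integral_fst'[OF i] by simp
qed

lemma odd_integral:
  fixes f :: "real \<Rightarrow> real"
  assumes sym: "distr \<mu> borel uminus = \<mu>" and s: "sets \<mu> = sets borel" and f: "f \<in> borel_measurable borel" "\<And>x. f (- x) = - f x"
  shows "(LINT x|\<mu>. f x) = 0"
proof -
  have m: "uminus \<in> measurable \<mu> (borel :: real measure)" using s by (simp add: measurable_cong_sets[OF s refl])
  have "(LINT x|\<mu>. f x) = (LINT x|distr \<mu> borel uminus. f x)" by (simp add: sym)
  also have "\<dots> = (LINT x|\<mu>. f (- x))" by (rule integral_distr[OF m f(1)])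
  finally show ?thesis using f(2) by simp
qed

lemma integrable_weight:
  fixes f :: "real \<Rightarrow> real"
  assumes "integrable \<mu> w" "f \<in> borel_measurable borel" "sets \<mu> = sets borel" "\<And>x. \<bar>f x\<bar> \<le> w x"
  shows "integrable \<mu> f"
  by (rule Bochner_Integration.integrable_bound[OF assms(1)])
     (use assms(2-4) measurable_cong_sets[OF assms(3) refl] in \<open>auto intro: order_trans[OF _ abs_ge_self]\<close>)

text \<open>The addition theorems expand the test function into products in the two variables.
  Products of odd factors integrate to 0 by symmetry of \<mu>, and the remaining ones are
  \<open>nonlin\<close>. Index 0 asks for no moment, so it is available before second moments are
  known to be finite.\<close>

lemma integral_tr_rotate:
  assumes fin: "finite_measure \<mu>" and s: "sets \<mu> = sets borel" and sym: "distr \<mu> borel uminus = \<mu>"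
    and j: "j = 0 \<or> j < 3 \<and> integrable \<mu> (\<lambda>x. 1 + x\<^sup>2)"
  shows "(LINT z|(\<mu> \<Otimes>\<^sub>M \<mu>). tr j \<xi> (fst z * cos \<theta> + snd z * sin \<theta>)) = nonlin j (\<lambda>i \<eta>. LINT x|\<mu>. tr i \<eta> x) \<xi> \<theta>"
proof -
  interpret finite_measure \<mu> by fact
  let ?c = "cos \<theta>" and ?s = "sin \<theta>"
  let ?a = "\<lambda>i \<eta>. LINT x|\<mu>. tr i \<eta> x"
  have one: "integrable \<mu> (\<lambda>x. 1)" by simp
  have cosi: "integrable \<mu> (\<lambda>x. cos (\<eta> * x))" "integrable \<mu> (\<lambda>x. sin (\<eta> * x))" for \<eta>
    by (intro integrable_weight[OF one _ s]; auto)+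
  have sin0: "(LINT x|\<mu>. sin (\<eta> * x)) = 0" for \<eta> by (rule odd_integral[OF sym s]) auto
  have hb: "has_bochner_integral (\<mu> \<Otimes>\<^sub>M \<mu>) (\<lambda>z. p (fst z) * q (snd z)) ((LINT x|\<mu>. p x) * (LINT y|\<mu>. q y))"
    if "integrable \<mu> p" "integrable \<mu> q" for p q :: "real \<Rightarrow> real"
    using prod_integral[OF fin that] by (simp add: has_bochner_integral_iff)
  note lin = has_bochner_integral_add has_bochner_integral_diff has_bochner_integral_mult_right
  have cos_add': "cos (\<xi> * (x * ?c + y * ?s)) = cos (\<xi> * ?c * x) * cos (\<xi> * ?s * y) - sin (\<xi> * ?c * x) * sin (\<xi> * ?s * y)" for x y
    using cos_add[of "\<xi> * ?c * x" "\<xi> * ?s * y"] by (simp add: algebra_simps)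
  have sin_add': "sin (\<xi> * (x * ?c + y * ?s)) = sin (\<xi> * ?c * x) * cos (\<xi> * ?s * y) + cos (\<xi> * ?c * x) * sin (\<xi> * ?s * y)" for x y
    using sin_add[of "\<xi> * ?c * x" "\<xi> * ?s * y"] by (simp add: algebra_simps)
  show ?thesis
  proof (cases "j = 0")
    case True
    have "has_bochner_integral (\<mu> \<Otimes>\<^sub>M \<mu>) (\<lambda>z. cos (\<xi> * ?c * fst z) * cos (\<xi> * ?s * snd z) - sin (\<xi> * ?c * fst z) * sin (\<xi> * ?s * snd z))
       ((LINT x|\<mu>. cos (\<xi> * ?c * x)) * (LINT x|\<mu>. cos (\<xi> * ?s * x)) - (LINT x|\<mu>. sin (\<xi> * ?c * x)) * (LINT x|\<mu>. sin (\<xi> * ?s * x)))"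
      by (intro lin hb[of "\<lambda>x. cos (\<xi> * ?c * x)" "\<lambda>x. cos (\<xi> * ?s * x)"] hb[of "\<lambda>x. sin (\<xi> * ?c * x)" "\<lambda>x. sin (\<xi> * ?s * x)"] cosi)
    from has_bochner_integral_integral_eq[OF this] show ?thesis
      unfolding True nonlin_def tr_def cos_add' sin0 by simp
  next
    case False
    then have sq: "integrable \<mu> (\<lambda>x. 1 + x\<^sup>2)" and j12: "j = 1 \<or> j = 2" using j by auto
    have tb: "\<bar>x * cos y\<bar> \<le> 1 + x\<^sup>2" "\<bar>x * sin y\<bar> \<le> 1 + x\<^sup>2" "\<bar>x\<^sup>2 * cos y\<bar> \<le> 1 + x\<^sup>2" "\<bar>x\<^sup>2 * sin y\<bar> \<le> 1 + x\<^sup>2" for x y :: real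
    proof -
      have "\<bar>x * cos y\<bar> \<le> \<bar>x\<bar> * 1" "\<bar>x * sin y\<bar> \<le> \<bar>x\<bar> * 1" "\<bar>x\<^sup>2 * cos y\<bar> \<le> x\<^sup>2 * 1" "\<bar>x\<^sup>2 * sin y\<bar> \<le> x\<^sup>2 * 1"
        unfolding abs_mult by (intro mult_mono; simp)+
      then show "\<bar>x * cos y\<bar> \<le> 1 + x\<^sup>2" "\<bar>x * sin y\<bar> \<le> 1 + x\<^sup>2" "\<bar>x\<^sup>2 * cos y\<bar> \<le> 1 + x\<^sup>2" "\<bar>x\<^sup>2 * sin y\<bar> \<le> 1 + x\<^sup>2"
        using abs_le_one_plus_square[of x] by simp_all
    qed
    have i: "integrable \<mu> (\<lambda>x. x * cos (\<eta> * x))" "integrable \<mu> (\<lambda>x. x * sin (\<eta> * x))" "integrable \<mu> (\<lambda>x. x\<^sup>2 * cos (\<eta> * x))" "integrable \<mu> (\<lambda>x. x\<^sup>2 * sin (\<eta> * x))" for \<eta>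
      by (intro integrable_weight[OF sq _ s] tb; measurable)+
    have z: "(LINT x|\<mu>. x * cos (\<eta> * x)) = 0" "(LINT x|\<mu>. x\<^sup>2 * sin (\<eta> * x)) = 0" for \<eta>
      by (rule odd_integral[OF sym s]; auto)+
    show ?thesis using j12
    proof
      assume j1: "j = 1"
      have "has_bochner_integral (\<mu> \<Otimes>\<^sub>M \<mu>) (\<lambda>z. ?c * (((fst z) * sin (\<xi> * ?c * (fst z))) * (cos (\<xi> * ?s * (snd z)))) + ?s * ((cos (\<xi> * ?c * (fst z))) * ((snd z) * sin (\<xi> * ?s * (snd z)))) + ?c * (((fst z) * cos (\<xi> * ?c * (fst z))) * (sin (\<xi> * ?s * (snd z)))) + ?s * ((sin (\<xi> * ?c * (fst z))) * ((snd z) * cos (\<xi> * ?s * (snd z)))))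
         (?c * ((LINT x|\<mu>. x * sin (\<xi> * ?c * x)) * (LINT x|\<mu>. cos (\<xi> * ?s * x))) + ?s * ((LINT x|\<mu>. cos (\<xi> * ?c * x)) * (LINT x|\<mu>. x * sin (\<xi> * ?s * x))) + ?c * ((LINT x|\<mu>. x * cos (\<xi> * ?c * x)) * (LINT x|\<mu>. sin (\<xi> * ?s * x))) + ?s * ((LINT x|\<mu>. sin (\<xi> * ?c * x)) * (LINT x|\<mu>. x * cos (\<xi> * ?s * x))))"
        by (intro lin
          hb[of "\<lambda>x. x * sin (\<xi> * ?c * x)" "\<lambda>x. cos (\<xi> * ?s * x)"]
          hb[of "\<lambda>x. cos (\<xi> * ?c * x)" "\<lambda>x. x * sin (\<xi> * ?s * x)"]
          hb[of "\<lambda>x. x * cos (\<xi> * ?c * x)" "\<lambda>x. sin (\<xi> * ?s * x)"]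
          hb[of "\<lambda>x. sin (\<xi> * ?c * x)" "\<lambda>x. x * cos (\<xi> * ?s * x)"] i cosi)
      moreover have "(\<lambda>z. tr j \<xi> (fst z * cos \<theta> + snd z * sin \<theta>)) = (\<lambda>z. ?c * (((fst z) * sin (\<xi> * ?c * (fst z))) * (cos (\<xi> * ?s * (snd z)))) + ?s * ((cos (\<xi> * ?c * (fst z))) * ((snd z) * sin (\<xi> * ?s * (snd z)))) + ?c * (((fst z) * cos (\<xi> * ?c * (fst z))) * (sin (\<xi> * ?s * (snd z)))) + ?s * ((sin (\<xi> * ?c * (fst z))) * ((snd z) * cos (\<xi> * ?s * (snd z)))))"
        unfolding tr_def sin_add' j1 by (rule ext) (simp add: algebra_simps)
      ultimately have "(LINT z|(\<mu> \<Otimes>\<^sub>M \<mu>). tr j \<xi> (fst z * cos \<theta> + snd z * sin \<theta>)) = ?c * ((LINT x|\<mu>. x * sin (\<xi> * ?c * x)) * (LINT x|\<mu>. cos (\<xi> * ?s * x))) + ?s * ((LINT x|\<mu>. cos (\<xi> * ?c * x)) * (LINT x|\<mu>. x * sin (\<xi> * ?s * x))) + ?c * ((LINT x|\<mu>. x * cos (\<xi> * ?c * x)) * (LINT x|\<mu>. sin (\<xi> * ?s * x))) + ?s * ((LINT x|\<mu>. sin (\<xi> * ?c * x)) * (LINT x|\<mu>. x * cos (\<xi> * ?s * x)))"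
        by (simp only: has_bochner_integral_integral_eq)
      then show ?thesis unfolding sin0 z j1 nonlin_def tr_def by simp
    next
      assume j2: "j = 2"
      have "has_bochner_integral (\<mu> \<Otimes>\<^sub>M \<mu>) (\<lambda>z. ?c\<^sup>2 * (((fst z)\<^sup>2 * cos (\<xi> * ?c * (fst z))) * (cos (\<xi> * ?s * (snd z)))) + ?s\<^sup>2 * ((cos (\<xi> * ?c * (fst z))) * ((snd z)\<^sup>2 * cos (\<xi> * ?s * (snd z)))) - (2 * ?c * ?s) * (((fst z) * sin (\<xi> * ?c * (fst z))) * ((snd z) * sin (\<xi> * ?s * (snd z)))) + (2 * ?c * ?s) * (((fst z) * cos (\<xi> * ?c * (fst z))) * ((snd z) * cos (\<xi> * ?s * (snd z)))) - ?c\<^sup>2 * (((fst z)\<^sup>2 * sin (\<xi> * ?c * (fst z))) * (sin (\<xi> * ?s * (snd z)))) - ?s\<^sup>2 * ((sin (\<xi> * ?c * (fst z))) * ((snd z)\<^sup>2 * sin (\<xi> * ?s * (snd z)))))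
         (?c\<^sup>2 * ((LINT x|\<mu>. x\<^sup>2 * cos (\<xi> * ?c * x)) * (LINT x|\<mu>. cos (\<xi> * ?s * x))) + ?s\<^sup>2 * ((LINT x|\<mu>. cos (\<xi> * ?c * x)) * (LINT x|\<mu>. x\<^sup>2 * cos (\<xi> * ?s * x))) - (2 * ?c * ?s) * ((LINT x|\<mu>. x * sin (\<xi> * ?c * x)) * (LINT x|\<mu>. x * sin (\<xi> * ?s * x))) + (2 * ?c * ?s) * ((LINT x|\<mu>. x * cos (\<xi> * ?c * x)) * (LINT x|\<mu>. x * cos (\<xi> * ?s * x))) - ?c\<^sup>2 * ((LINT x|\<mu>. x\<^sup>2 * sin (\<xi> * ?c * x)) * (LINT x|\<mu>. sin (\<xi> * ?s * x))) - ?s\<^sup>2 * ((LINT x|\<mu>. sin (\<xi> * ?c * x)) * (LINT x|\<mu>. x\<^sup>2 * sin (\<xi> * ?s * x))))"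
        by (intro lin
          hb[of "\<lambda>x. x\<^sup>2 * cos (\<xi> * ?c * x)" "\<lambda>x. cos (\<xi> * ?s * x)"]
          hb[of "\<lambda>x. cos (\<xi> * ?c * x)" "\<lambda>x. x\<^sup>2 * cos (\<xi> * ?s * x)"]
          hb[of "\<lambda>x. x * sin (\<xi> * ?c * x)" "\<lambda>x. x * sin (\<xi> * ?s * x)"]
          hb[of "\<lambda>x. x * cos (\<xi> * ?c * x)" "\<lambda>x. x * cos (\<xi> * ?s * x)"]
          hb[of "\<lambda>x. x\<^sup>2 * sin (\<xi> * ?c * x)" "\<lambda>x. sin (\<xi> * ?s * x)"]
          hb[of "\<lambda>x. sin (\<xi> * ?c * x)" "\<lambda>x. x\<^sup>2 * sin (\<xi> * ?s * x)"] i cosi)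
      moreover have "(\<lambda>z. tr j \<xi> (fst z * cos \<theta> + snd z * sin \<theta>)) = (\<lambda>z. ?c\<^sup>2 * (((fst z)\<^sup>2 * cos (\<xi> * ?c * (fst z))) * (cos (\<xi> * ?s * (snd z)))) + ?s\<^sup>2 * ((cos (\<xi> * ?c * (fst z))) * ((snd z)\<^sup>2 * cos (\<xi> * ?s * (snd z)))) - (2 * ?c * ?s) * (((fst z) * sin (\<xi> * ?c * (fst z))) * ((snd z) * sin (\<xi> * ?s * (snd z)))) + (2 * ?c * ?s) * (((fst z) * cos (\<xi> * ?c * (fst z))) * ((snd z) * cos (\<xi> * ?s * (snd z)))) - ?c\<^sup>2 * (((fst z)\<^sup>2 * sin (\<xi> * ?c * (fst z))) * (sin (\<xi> * ?s * (snd z)))) - ?s\<^sup>2 * ((sin (\<xi> * ?c * (fst z))) * ((snd z)\<^sup>2 * sin (\<xi> * ?s * (snd z)))))"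
        unfolding tr_def cos_add' j2 by (rule ext) (simp add: algebra_simps power2_sum power_mult_distrib)
      ultimately have "(LINT z|(\<mu> \<Otimes>\<^sub>M \<mu>). tr j \<xi> (fst z * cos \<theta> + snd z * sin \<theta>)) = ?c\<^sup>2 * ((LINT x|\<mu>. x\<^sup>2 * cos (\<xi> * ?c * x)) * (LINT x|\<mu>. cos (\<xi> * ?s * x))) + ?s\<^sup>2 * ((LINT x|\<mu>. cos (\<xi> * ?c * x)) * (LINT x|\<mu>. x\<^sup>2 * cos (\<xi> * ?s * x))) - (2 * ?c * ?s) * ((LINT x|\<mu>. x * sin (\<xi> * ?c * x)) * (LINT x|\<mu>. x * sin (\<xi> * ?s * x))) + (2 * ?c * ?s) * ((LINT x|\<mu>. x * cos (\<xi> * ?c * x)) * (LINT x|\<mu>. x * cos (\<xi> * ?s * x))) - ?c\<^sup>2 * ((LINT x|\<mu>. x\<^sup>2 * sin (\<xi> * ?c * x)) * (LINT x|\<mu>. sin (\<xi> * ?s * x))) - ?s\<^sup>2 * ((LINT x|\<mu>. sin (\<xi> * ?c * x)) * (LINT x|\<mu>. x\<^sup>2 * sin (\<xi> * ?s * x)))"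
        by (simp only: has_bochner_integral_integral_eq)
      then show ?thesis unfolding sin0 z j2 nonlin_def tr_def by simp
    qed
  qed
qed

lemma distr_density_even:
  fixes G :: "real \<Rightarrow> ennreal"
  assumes [measurable]: "G \<in> borel_measurable borel" and even: "\<And>v. G (- v) = G v"
  shows "distr (density lborel G) borel uminus = density lborel G"
proof (rule measure_eqI)
  fix A assume "A \<in> sets (distr (density lborel G) borel (uminus :: real \<Rightarrow> real))"
  then have A[measurable]: "A \<in> sets borel" by simp
  have "emeasure (distr (density lborel G) borel uminus) A = (\<integral>\<^sup>+v. indicator A v \<partial>distr (density lborel G) borel uminus)" by simp
  also have "\<dots> = (\<integral>\<^sup>+v. G v * indicator A (- v) \<partial>lborel)"
    by (subst nn_integral_distr) (auto simp: nn_integral_density)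
  also have "\<dots> = (\<integral>\<^sup>+v. G v * indicator A v \<partial>lborel)"
    using nn_integral_lborel_neg[of "\<lambda>v. G v * indicator A v"] by (simp add: even)
  also have "\<dots> = emeasure (density lborel G) A" by (simp add: emeasure_density)
  finally show "emeasure (distr (density lborel G) borel uminus) A = emeasure (density lborel G) A" .
qed simp

definition rot_conv :: "real measure \<Rightarrow> real \<Rightarrow> real measure" where
  "rot_conv \<mu> \<theta> = distr (\<mu> \<Otimes>\<^sub>M \<mu>) borel (\<lambda>z. fst z * cos \<theta> + snd z * sin \<theta>)"

lemma finite_density:
  assumes [measurable]: "G \<in> borel_measurable borel" and "(\<integral>\<^sup>+v. G v \<partial>lborel) < \<infinity>"
  shows "finite_measure (density lborel (G :: real \<Rightarrow> ennreal))"
  by (rule finite_measureI) (use assms in \<open>auto simp: emeasure_density\<close>)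

lemma nn_integral_rot_conv:
  assumes [measurable]: "G \<in> borel_measurable borel" "\<Psi> \<in> borel_measurable borel" and fin: "(\<integral>\<^sup>+v. G v \<partial>lborel) < \<infinity>"
  shows "(\<integral>\<^sup>+v. \<Psi> v \<partial>rot_conv (density lborel G) \<theta>) = (\<integral>\<^sup>+x. \<integral>\<^sup>+y. \<Psi> (x * cos \<theta> + y * sin \<theta>) * (G x * G y) \<partial>lborel \<partial>lborel)"
proof -
  interpret finite_measure "density lborel G" by (rule finite_density) (use fin in auto)
  have "(\<integral>\<^sup>+v. \<Psi> v \<partial>rot_conv (density lborel G) \<theta>) = (\<integral>\<^sup>+z. \<Psi> (fst z * cos \<theta> + snd z * sin \<theta>) \<partial>(density lborel G \<Otimes>\<^sub>M density lborel G))"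
    unfolding rot_conv_def by (rule nn_integral_distr) auto
  also have "\<dots> = (\<integral>\<^sup>+x. \<integral>\<^sup>+y. \<Psi> (x * cos \<theta> + y * sin \<theta>) \<partial>density lborel G \<partial>density lborel G)"
    by (subst nn_integral_fst[symmetric]) auto
  also have "\<dots> = (\<integral>\<^sup>+x. G x * (\<integral>\<^sup>+y. G y * \<Psi> (x * cos \<theta> + y * sin \<theta>) \<partial>lborel) \<partial>lborel)"
    by (simp add: nn_integral_density)
  also have "\<dots> = (\<integral>\<^sup>+x. \<integral>\<^sup>+y. \<Psi> (x * cos \<theta> + y * sin \<theta>) * (G x * G y) \<partial>lborel \<partial>lborel)"
    by (simp add: nn_integral_cmult[symmetric] mult_ac)
  finally show ?thesis .
qed

text \<open>In the mild form a single null set serves all times. The constant extension to negative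
  times lets mass and joint measurability be stated for all real t.\<close>

locale kac_levels =
  fixes F :: "real \<Rightarrow> real \<Rightarrow> ennreal"
  assumes F_meas: "(\<lambda>x. F (fst x) (snd x)) \<in> borel_measurable (borel \<Otimes>\<^sub>M borel)"
    and F_even: "\<And>v t. F (- v) t = F v t"
    and F_mass: "\<And>t. (\<integral>\<^sup>+v. F v t \<partial>lborel) = 1"
    and F_neg: "\<And>v t. t < 0 \<Longrightarrow> F v t = F v 0"
    and F_mild: "AE v in lborel. \<forall>t\<ge>0. F v t = ennreal (exp (- t)) * F v 0 + (\<integral>\<^sup>+r. gain (\<lambda>u. F u r) v \<partial>ker t)"
begin

primrec lev :: "nat \<Rightarrow> real \<Rightarrow> real \<Rightarrow> ennreal" where
  "lev 0 v t = F v t"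
| "lev (Suc d) v t = (\<integral>\<^sup>+r. gain (\<lambda>u. lev d u r) v \<partial>ker t)"

lemma lev_meas: "(\<lambda>x. lev d (fst x) (snd x)) \<in> borel_measurable (borel \<Otimes>\<^sub>M borel)"
proof (induction d)
  case 0 then show ?case using F_meas by simp
next
  case (Suc d)
  have [measurable]: "(\<lambda>z. gain (\<lambda>u. lev d u (q z)) (p z)) \<in> borel_measurable N" if "p \<in> borel_measurable N" "q \<in> borel_measurable N" for p q and N :: "'c measure"
    using measurable_compose[OF measurable_Pair[OF that] gain_measurable_pair[OF Suc]] by simp
  \<comment> \<open>The time occurs inside the measure \<open>ker\<close>; moving it into an
    integrand over \<open>lborel\<close> makes joint measurability visible.\<close>
  have "(\<lambda>x. lev (Suc d) (fst x) (snd x)) = (\<lambda>x. \<integral>\<^sup>+r. ennreal (if 0 \<le> r \<and> r \<le> snd x then exp (r - snd x) else 0) * gain (\<lambda>u. lev d u r) (fst x) \<partial>lborel)"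
  proof
    fix x :: "real \<times> real"
    have "lev (Suc d) (fst x) (snd x) = (\<integral>\<^sup>+r. ennreal (indicator {0..snd x} r * exp (r - snd x)) * gain (\<lambda>u. lev d u r) (fst x) \<partial>lborel)"
      unfolding lev.simps ker_def by (subst nn_integral_density) auto
    also have "\<dots> = (\<integral>\<^sup>+r. ennreal (if 0 \<le> r \<and> r \<le> snd x then exp (r - snd x) else 0) * gain (\<lambda>u. lev d u r) (fst x) \<partial>lborel)"
      by (intro nn_integral_cong) (auto split: split_indicator)
    finally show "lev (Suc d) (fst x) (snd x) = (\<integral>\<^sup>+r. ennreal (if 0 \<le> r \<and> r \<le> snd x then exp (r - snd x) else 0) * gain (\<lambda>u. lev d u r) (fst x) \<partial>lborel)" .
  qed
  then show ?case by simp
qed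

lemma lev_meas_1 [measurable]: "(\<lambda>v. lev d v t) \<in> borel_measurable borel"
  using measurable_compose[OF measurable_Pair[OF measurable_ident measurable_const] lev_meas[of d], of t] by simp

lemma gain_lev_meas [measurable]: "(\<lambda>z. gain (\<lambda>u. lev d u (q z)) (p z)) \<in> borel_measurable N" if "p \<in> borel_measurable N" "q \<in> borel_measurable N" for p q and N :: "'c measure"
  using measurable_compose[OF measurable_Pair[OF that] gain_measurable_pair[OF lev_meas[of d]]] by simp

lemma lev_even: "lev d (- v) t = lev d v t"
  by (cases d) (simp_all add: F_even gain_even)

lemma lev_neg: "t < 0 \<Longrightarrow> lev (Suc d) v t = 0"
  unfolding lev.simps ker_def by (subst nn_integral_density) auto

text \<open>Monotonicity of the gain carries the induction, and each step drops the term with the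
  initial value from the mild form.\<close>

lemma lev_le_F: "AE v in lborel. \<forall>t\<ge>0. lev d v t \<le> F v t"
proof (induction d)
  case (Suc d)
  have g: "gain (\<lambda>u. lev d u r) v \<le> gain (\<lambda>u. F u r) v" if "0 \<le> r" for r v
    by (rule gain_mono_AE) (use Suc that in \<open>auto elim: eventually_mono\<close>)
  show ?case using F_mild
  proof eventually_elim
    case (elim v)
    show ?case
    proof (intro allI impI)
      fix t :: real assume t: "0 \<le> t"
      have "lev (Suc d) v t \<le> (\<integral>\<^sup>+r. gain (\<lambda>u. F u r) v \<partial>ker t)"
        unfolding lev.simps
      proof (rule nn_integral_mono_AE)
        show "AE r in ker t. gain (\<lambda>u. lev d u r) v \<le> gain (\<lambda>u. F u r) v"
          using AE_ker[of t] by eventually_elim (use g in auto)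
      qed
      also have "\<dots> \<le> ennreal (exp (- t)) * F v 0 + (\<integral>\<^sup>+r. gain (\<lambda>u. F u r) v \<partial>ker t)"
        by (rule add_increasing) auto
      also have "\<dots> = F v t" using elim[rule_format, OF t] by (rule sym)
      finally show "lev (Suc d) v t \<le> F v t" .
    qed
  qed
qed simp

definition mu where "mu d t = density lborel (\<lambda>v. lev d v t)"
definition gm where "gm d r = density lborel (gain (\<lambda>u. lev d u r))"

lemma sets_mu [simp, measurable_cong]: "sets (mu d t) = sets borel" by (simp add: mu_def)
lemma sets_gm [simp, measurable_cong]: "sets (gm d t) = sets borel" by (simp add: gm_def)
lemma sets_rot_conv [simp, measurable_cong]: "sets (rot_conv \<mu> \<theta>) = sets borel" by (simp add: rot_conv_def)

lemma nn_mu: "\<Psi> \<in> borel_measurable borel \<Longrightarrow> (\<integral>\<^sup>+v. \<Psi> v \<partial>mu d t) = (\<integral>\<^sup>+v. \<Psi> v * lev d v t \<partial>lborel)"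
  unfolding mu_def by (subst nn_integral_density) (auto simp: mult.commute)
lemma nn_gm: "\<Psi> \<in> borel_measurable borel \<Longrightarrow> (\<integral>\<^sup>+v. \<Psi> v \<partial>gm d t) = (\<integral>\<^sup>+v. \<Psi> v * gain (\<lambda>u. lev d u t) v \<partial>lborel)"
  unfolding gm_def by (subst nn_integral_density) (auto simp: mult.commute)

lemma nn_mu_le:
  assumes [measurable]: "\<Psi> \<in> borel_measurable borel" and M: "\<And>t. 0 \<le> t \<Longrightarrow> (\<integral>\<^sup>+v. \<Psi> v \<partial>mu 0 t) \<le> M"
  shows "(\<integral>\<^sup>+v. \<Psi> v \<partial>mu d t) \<le> M"
proof (cases "0 \<le> t")
  case True
  have "(\<integral>\<^sup>+v. \<Psi> v \<partial>mu d t) \<le> (\<integral>\<^sup>+v. \<Psi> v \<partial>mu 0 t)"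
    unfolding nn_mu[OF assms(1)] using lev_le_F[of d] True
    by (intro nn_integral_mono_AE) (auto elim!: eventually_mono intro!: mult_left_mono)
  then show ?thesis using M[OF True] by simp
next
  case False
  show ?thesis
  proof (cases d)
    case 0
    then have "(\<integral>\<^sup>+v. \<Psi> v \<partial>mu d t) = (\<integral>\<^sup>+v. \<Psi> v \<partial>mu 0 0)" using False by (simp add: nn_mu F_neg)
    then show ?thesis using M[of 0] by simp
  next
    case (Suc d') then show ?thesis using False by (simp only: nn_mu[OF assms(1)]) (simp add: lev_neg del: lev.simps)
  qed
qed

lemma mass_le_1: "(\<integral>\<^sup>+v. lev d v t \<partial>lborel) \<le> 1"
proof -
  have m: "(\<lambda>_::real. 1::ennreal) \<in> borel_measurable borel" by simp
  have "(\<integral>\<^sup>+v. 1 \<partial>mu d t) \<le> 1"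
  proof (rule nn_mu_le[OF m])
    fix t show "(\<integral>\<^sup>+v. 1 \<partial>mu 0 t) \<le> 1" unfolding nn_mu[OF m] by (simp add: F_mass)
  qed
  then show ?thesis unfolding nn_mu[OF m] by simp
qed

lemma lev_fin: "(\<integral>\<^sup>+v. lev d v t \<partial>lborel) < \<infinity>" using mass_le_1[of d t] by (rule le_less_trans) simp

lemma finite_mu: "finite_measure (mu d t)" unfolding mu_def
  by (rule finite_density[OF lev_meas_1 lev_fin])

lemma nn_integral_gm:
  assumes [measurable]: "\<Psi> \<in> borel_measurable borel"
  shows "(\<integral>\<^sup>+v. \<Psi> v \<partial>gm d r) = (\<integral>\<^sup>+\<theta>. \<integral>\<^sup>+v. \<Psi> v \<partial>rot_conv (mu d r) \<theta> \<partial>ang)"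
  unfolding nn_gm[OF assms] mu_def nn_integral_rot_conv[OF lev_meas_1 assms lev_fin]
  by (rule nn_integral_gain[OF lev_meas_1 assms])

lemma nn_integral_gm_measurable:
  assumes [measurable]: "\<Psi> \<in> borel_measurable borel"
  shows "(\<lambda>\<theta>. \<integral>\<^sup>+v. \<Psi> v \<partial>rot_conv (mu d r) \<theta>) \<in> borel_measurable ang"
  unfolding mu_def nn_integral_rot_conv[OF lev_meas_1 assms lev_fin] by measurable

lemma nn_integral_mu_Suc:
  assumes [measurable]: "\<Psi> \<in> borel_measurable borel"
  shows "(\<integral>\<^sup>+v. \<Psi> v \<partial>mu (Suc d) t) = (\<integral>\<^sup>+r. \<integral>\<^sup>+v. \<Psi> v \<partial>gm d r \<partial>ker t)"
    "(\<lambda>r. \<integral>\<^sup>+v. \<Psi> v \<partial>gm d r) \<in> borel_measurable (ker t)"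
proof -
  interpret L: pair_sigma_finite "ker t" lborel by unfold_locales
  have "(\<integral>\<^sup>+v. \<Psi> v \<partial>mu (Suc d) t) = (\<integral>\<^sup>+v. \<integral>\<^sup>+r. \<Psi> v * gain (\<lambda>u. lev d u r) v \<partial>ker t \<partial>lborel)"
    unfolding nn_mu[OF assms] by (simp add: nn_integral_cmult)
  also have "\<dots> = (\<integral>\<^sup>+r. \<integral>\<^sup>+v. \<Psi> v * gain (\<lambda>u. lev d u r) v \<partial>lborel \<partial>ker t)"
    by (rule L.Fubini') measurable
  finally show "(\<integral>\<^sup>+v. \<Psi> v \<partial>mu (Suc d) t) = (\<integral>\<^sup>+r. \<integral>\<^sup>+v. \<Psi> v \<partial>gm d r \<partial>ker t)"
    by (simp add: nn_gm)
  show "(\<lambda>r. \<integral>\<^sup>+v. \<Psi> v \<partial>gm d r) \<in> borel_measurable (ker t)"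
    unfolding nn_gm[OF assms] by measurable
qed

end

lemma rot_le: "(x * cos \<theta> + y * sin \<theta>)\<^sup>2 \<le> x\<^sup>2 + (y::real)\<^sup>2"
proof -
  have "(x * c + y * s)\<^sup>2 + (x * s - y * c)\<^sup>2 = (x\<^sup>2 + y\<^sup>2) * (c\<^sup>2 + s\<^sup>2)" for c s :: real
    by (simp add: power2_eq_square algebra_simps)
  from this[of "cos \<theta>" "sin \<theta>"] have "(x * cos \<theta> + y * sin \<theta>)\<^sup>2 + (x * sin \<theta> - y * cos \<theta>)\<^sup>2 = x\<^sup>2 + y\<^sup>2" by simp
  moreover have "0 \<le> (x * sin \<theta> - y * cos \<theta>)\<^sup>2" by simp
  ultimately show ?thesis by linarith
qed

text \<open>Submultiplicativity under rotated sums is what passes finiteness of a weighted integral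
  from a law to its \<open>rot_conv\<close>, and from there to the gain. The instances are 1 and
  \<open>1 + x^2\<close>.\<close>

definition weight :: "(real \<Rightarrow> real) \<Rightarrow> bool" where
  "weight w \<longleftrightarrow> w \<in> borel_measurable borel \<and> (\<forall>x. 0 \<le> w x) \<and> (\<forall>x y \<theta>. w (x * cos \<theta> + y * sin \<theta>) \<le> w x * w y)"

lemma weight_1: "weight (\<lambda>_. 1)" by (simp add: weight_def)
lemma weight_2: "weight (\<lambda>x. 1 + x\<^sup>2)"
  unfolding weight_def
proof (intro conjI allI)
  fix x y \<theta> :: real
  have "1 + (x * cos \<theta> + y * sin \<theta>)\<^sup>2 \<le> 1 + (x\<^sup>2 + y\<^sup>2)" using rot_le by simp
  also have "\<dots> \<le> (1 + x\<^sup>2) * (1 + y\<^sup>2)" by (simp add: algebra_simps)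
  finally show "1 + (x * cos \<theta> + y * sin \<theta>)\<^sup>2 \<le> (1 + x\<^sup>2) * (1 + y\<^sup>2)" .
qed auto

lemma integrable_weight_nn:
  fixes \<psi> w :: "real \<Rightarrow> real"
  assumes s: "sets \<mu> = sets borel" and \<psi>: "\<psi> \<in> borel_measurable borel" "\<And>x. \<bar>\<psi> x\<bar> \<le> w x" and fin: "(\<integral>\<^sup>+x. ennreal (w x) \<partial>\<mu>) < \<infinity>"
  shows "integrable \<mu> \<psi>"
proof (rule integrableI_bounded)
  show "\<psi> \<in> borel_measurable \<mu>" using \<psi>(1) measurable_cong_sets[OF s refl] by auto
  have "(\<integral>\<^sup>+x. ennreal (norm (\<psi> x)) \<partial>\<mu>) \<le> (\<integral>\<^sup>+x. ennreal (w x) \<partial>\<mu>)"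
    using \<psi>(2) by (intro nn_integral_mono ennreal_leI) simp
  then show "(\<integral>\<^sup>+x. ennreal (norm (\<psi> x)) \<partial>\<mu>) < \<infinity>" using fin by (rule le_less_trans)
qed

lemma integral_rot_conv:
  assumes s: "sets \<mu> = sets borel" and [measurable]: "\<psi> \<in> borel_measurable borel"
  shows "(LINT v|rot_conv \<mu> \<theta>. \<psi> v) = (LINT z|(\<mu> \<Otimes>\<^sub>M \<mu>). (\<psi> (fst z * cos \<theta> + snd z * sin \<theta>) :: real))"
proof -
  have "sets (\<mu> \<Otimes>\<^sub>M \<mu>) = sets (borel \<Otimes>\<^sub>M borel)" by (rule sets_pair_measure_cong[OF s s])
  then have "(\<lambda>z. fst z * cos \<theta> + snd z * sin \<theta>) \<in> measurable (\<mu> \<Otimes>\<^sub>M \<mu>) borel"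
    by (subst measurable_cong_sets[OF _ refl, where M'="borel \<Otimes>\<^sub>M borel"]) auto
  then show ?thesis unfolding rot_conv_def by (rule integral_distr) simp
qed

section \<open>Real-valued equations for the amplitudes\<close>

context kac_levels begin

lemma weight_bounds:
  assumes w: "weight w" and M: "\<And>t. 0 \<le> t \<Longrightarrow> (\<integral>\<^sup>+v. ennreal (w v) \<partial>mu 0 t) \<le> ennreal M"
  shows "(\<integral>\<^sup>+v. ennreal (w v) \<partial>mu d t) < \<infinity>" "(\<integral>\<^sup>+v. ennreal (w v) \<partial>rot_conv (mu d r) \<theta>) < \<infinity>" "(\<integral>\<^sup>+v. ennreal (w v) \<partial>gm d r) < \<infinity>"
proof -
  have [measurable]: "w \<in> borel_measurable borel" and nn: "\<And>x. 0 \<le> w x" and sub: "\<And>x y \<theta>. w (x * cos \<theta> + y * sin \<theta>) \<le> w x * w y"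
    using w by (auto simp: weight_def)
  have le: "(\<integral>\<^sup>+v. ennreal (w v) \<partial>mu d t) \<le> ennreal M" for t by (rule nn_mu_le) (use M in auto)
  then show "(\<integral>\<^sup>+v. ennreal (w v) \<partial>mu d t) < \<infinity>" by (rule le_less_trans) simp
  have rc: "(\<integral>\<^sup>+v. ennreal (w v) \<partial>rot_conv (mu d r) \<theta>) \<le> ennreal M * ennreal M" for \<theta>
  proof -
    have "(\<integral>\<^sup>+v. ennreal (w v) \<partial>rot_conv (mu d r) \<theta>) = (\<integral>\<^sup>+x. \<integral>\<^sup>+y. ennreal (w (x * cos \<theta> + y * sin \<theta>)) * (lev d x r * lev d y r) \<partial>lborel \<partial>lborel)"
      unfolding mu_def by (rule nn_integral_rot_conv[OF lev_meas_1 _ lev_fin]) measurable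
    also have "\<dots> \<le> (\<integral>\<^sup>+x. \<integral>\<^sup>+y. (ennreal (w x) * lev d x r) * (ennreal (w y) * lev d y r) \<partial>lborel \<partial>lborel)"
    proof (rule nn_integral_mono, rule nn_integral_mono)
      fix x y
      have "ennreal (w (x * cos \<theta> + y * sin \<theta>)) \<le> ennreal (w x) * ennreal (w y)"
        using sub nn by (simp add: ennreal_mult[symmetric] ennreal_leI)
      then have "ennreal (w (x * cos \<theta> + y * sin \<theta>)) * (lev d x r * lev d y r) \<le> ennreal (w x) * ennreal (w y) * (lev d x r * lev d y r)"
        by (rule mult_right_mono) simp
      then show "ennreal (w (x * cos \<theta> + y * sin \<theta>)) * (lev d x r * lev d y r) \<le> ennreal (w x) * lev d x r * (ennreal (w y) * lev d y r)"
        by (simp add: mult_ac)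
    qed
    also have "\<dots> = (\<integral>\<^sup>+x. ennreal (w x) * lev d x r \<partial>lborel) * (\<integral>\<^sup>+y. ennreal (w y) * lev d y r \<partial>lborel)"
      by (simp add: nn_integral_cmult nn_integral_multc)
    also have "\<dots> \<le> ennreal M * ennreal M" using le[of r] by (intro mult_mono) (simp_all add: nn_mu)
    finally show ?thesis .
  qed
  have fM: "ennreal M * ennreal M < \<infinity>" by (simp add: ennreal_mult_less_top)
  show "(\<integral>\<^sup>+v. ennreal (w v) \<partial>rot_conv (mu d r) \<theta>) < \<infinity>" using rc fM by (rule le_less_trans)
  have "(\<integral>\<^sup>+v. ennreal (w v) \<partial>gm d r) \<le> (\<integral>\<^sup>+\<theta>. ennreal M * ennreal M \<partial>ang)"
    by (subst nn_integral_gm, measurable, intro nn_integral_mono rc)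
  also have "\<dots> = ennreal M * ennreal M" using ang.emeasure_space_1 by simp
  finally show "(\<integral>\<^sup>+v. ennreal (w v) \<partial>gm d r) < \<infinity>" using fM by (rule le_less_trans)
qed

lemma level_integrals:
  fixes \<psi> :: "real \<Rightarrow> real"
  assumes w: "weight w" and M: "\<And>t. 0 \<le> t \<Longrightarrow> (\<integral>\<^sup>+v. ennreal (w v) \<partial>mu 0 t) \<le> ennreal M"
    and \<psi>: "\<psi> \<in> borel_measurable borel" "\<And>x. \<bar>\<psi> x\<bar> \<le> w x"
  shows "integrable (mu d t) \<psi>"
    "integrable ang (\<lambda>\<theta>. LINT v|rot_conv (mu d r) \<theta>. \<psi> v)"
    "integrable (ker t) (\<lambda>r. LINT \<theta>|ang. LINT v|rot_conv (mu d r) \<theta>. \<psi> v)"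
    "(LINT v|mu (Suc d) t. \<psi> v) = (LINT r|ker t. LINT \<theta>|ang. LINT v|rot_conv (mu d r) \<theta>. \<psi> v)"
    "0 \<le> t \<Longrightarrow> (LINT v|mu 0 t. \<psi> v) = exp (- t) * (LINT v|mu 0 0. \<psi> v) + (LINT v|mu (Suc 0) t. \<psi> v)"
proof -
  note wb = weight_bounds[OF w M]
  have i1: "integrable (mu d t) \<psi>" for d t by (rule integrable_weight_nn[OF _ \<psi> wb(1)]) auto
  then show "integrable (mu d t) \<psi>" .
  have i2: "integrable (gm d r) \<psi>" for d r by (rule integrable_weight_nn[OF _ \<psi> wb(3)]) auto
  have i3: "integrable (rot_conv (mu d r) \<theta>) \<psi>" for d r \<theta> by (rule integrable_weight_nn[OF _ \<psi> wb(2)]) auto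
  have kg: "integrable ang (\<lambda>\<theta>. LINT v|rot_conv (mu d r) \<theta>. \<psi> v)" "(LINT v|gm d r. \<psi> v) = (LINT \<theta>|ang. LINT v|rot_conv (mu d r) \<theta>. \<psi> v)" for d r
    by (rule kernel_integral[OF nn_integral_gm[where d=d and r=r] nn_integral_gm_measurable[where d=d and r=r] \<psi>(1) i2 i3], assumption+)+
  show "integrable ang (\<lambda>\<theta>. LINT v|rot_conv (mu d r) \<theta>. \<psi> v)" by (rule kg(1))
  have km: "integrable (ker t) (\<lambda>r. LINT v|gm d r. \<psi> v)" "(LINT v|mu (Suc d) t. \<psi> v) = (LINT r|ker t. LINT v|gm d r. \<psi> v)"
    by (rule kernel_integral[OF nn_integral_mu_Suc[where d=d and t=t] \<psi>(1) i1 i2], assumption+)+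
  show "integrable (ker t) (\<lambda>r. LINT \<theta>|ang. LINT v|rot_conv (mu d r) \<theta>. \<psi> v)"
    using km(1) unfolding kg(2) .
  show "(LINT v|mu (Suc d) t. \<psi> v) = (LINT r|ker t. LINT \<theta>|ang. LINT v|rot_conv (mu d r) \<theta>. \<psi> v)"
    using km(2) unfolding kg(2) .
  assume t: "0 \<le> t"
  have split: "(\<integral>\<^sup>+v. \<Psi> v \<partial>mu 0 t) = ennreal (exp (- t)) * (\<integral>\<^sup>+v. \<Psi> v \<partial>mu 0 0) + (\<integral>\<^sup>+v. \<Psi> v \<partial>mu (Suc 0) t)"
    if [measurable]: "\<Psi> \<in> borel_measurable borel" for \<Psi>
  proof -
    have "(\<integral>\<^sup>+v. \<Psi> v \<partial>mu 0 t) = (\<integral>\<^sup>+v. ennreal (exp (- t)) * (\<Psi> v * lev 0 v 0) + \<Psi> v * lev (Suc 0) v t \<partial>lborel)"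
      unfolding nn_mu[OF that]
    proof (rule nn_integral_cong_AE)
      show "AE v in lborel. \<Psi> v * lev 0 v t = ennreal (exp (- t)) * (\<Psi> v * lev 0 v 0) + \<Psi> v * lev (Suc 0) v t"
        using F_mild
      proof eventually_elim
        case (elim v)
        have "lev 0 v t = ennreal (exp (- t)) * lev 0 v 0 + lev (Suc 0) v t" unfolding lev.simps by (rule elim[rule_format, OF t])
        then show ?case by (simp only: distrib_left mult_ac)
      qed
    qed
    also have "\<dots> = ennreal (exp (- t)) * (\<integral>\<^sup>+v. \<Psi> v \<partial>mu 0 0) + (\<integral>\<^sup>+v. \<Psi> v \<partial>mu (Suc 0) t)"
      unfolding nn_mu[OF that] by (subst nn_integral_add) (simp_all add: nn_integral_cmult del: lev.simps)
    finally show ?thesis .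
  qed
  have pm: "(\<lambda>v. ennreal (\<psi> v)) \<in> borel_measurable borel" "(\<lambda>v. ennreal (- \<psi> v)) \<in> borel_measurable borel" using \<psi> by auto
  have fin: "(\<integral>\<^sup>+v. ennreal (\<psi> v) \<partial>mu d t) < \<infinity>" "(\<integral>\<^sup>+v. ennreal (- \<psi> v) \<partial>mu d t) < \<infinity>" for d t
    using i1[of d t] by (auto simp: real_integrable_def less_top)
  have e: "enn2real (\<integral>\<^sup>+v. \<Psi> v \<partial>mu 0 t) = exp (- t) * enn2real (\<integral>\<^sup>+v. \<Psi> v \<partial>mu 0 0) + enn2real (\<integral>\<^sup>+v. \<Psi> v \<partial>mu (Suc 0) t)"
    if "\<Psi> \<in> borel_measurable borel" "(\<integral>\<^sup>+v. \<Psi> v \<partial>mu 0 0) < \<infinity>" "(\<integral>\<^sup>+v. \<Psi> v \<partial>mu (Suc 0) t) < \<infinity>" for \<Psi>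
    unfolding split[OF that(1)] using that(2,3)
    by (subst enn2real_plus) (auto simp: enn2real_mult ennreal_mult_less_top)
  show "(LINT v|mu 0 t. \<psi> v) = exp (- t) * (LINT v|mu 0 0. \<psi> v) + (LINT v|mu (Suc 0) t. \<psi> v)"
    unfolding real_lebesgue_integral_def[OF i1] e[OF pm(1) fin(1) fin(1)] e[OF pm(2) fin(2) fin(2)]
    by (simp add: algebra_simps)
qed

definition Amp where "Amp d j \<xi> t = (LINT v|mu d t. tr j \<xi> v)"

lemma mu_sym: "distr (mu d t) borel uminus = mu d t"
  unfolding mu_def by (rule distr_density_even) (auto simp: lev_even simp del: lev.simps)

definition second where "second s2 \<longleftrightarrow> (\<forall>t\<ge>0. (\<integral>\<^sup>+v. ennreal (1 + v\<^sup>2) \<partial>mu 0 t) \<le> ennreal (1 + s2))"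

lemma mass_0: "(\<integral>\<^sup>+v. ennreal 1 \<partial>mu 0 t) \<le> ennreal 1"
proof -
  have m: "(\<lambda>_::real. ennreal 1) \<in> borel_measurable borel" by simp
  show ?thesis unfolding nn_mu[OF m] using F_mass[of t] by simp
qed

lemma Amp_rot:
  assumes "j = 0 \<or> j < 3 \<and> second s2"
  shows "(LINT v|rot_conv (mu d r) \<theta>. tr j \<xi> v) = nonlin j (\<lambda>i \<eta>. Amp d i \<eta> r) \<xi> \<theta>"
proof -
  have "j = 0 \<or> j < 3 \<and> integrable (mu d r) (\<lambda>x. 1 + x\<^sup>2)"
    using assms weight_bounds(1)[OF weight_2, of "1 + s2" d r]
    by (auto simp: second_def intro!: integrable_weight_nn[where w="\<lambda>x. 1 + x\<^sup>2"])
  from integral_tr_rotate[OF finite_mu sets_mu mu_sym this, of \<xi> \<theta>]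
  show ?thesis unfolding Amp_def by (simp add: integral_rot_conv)
qed

lemma Amp_eqs:
  assumes "j = 0 \<or> j < 3 \<and> second s2"
  shows "integrable (mu d t) (tr j \<xi>)"
    "integrable ang (nonlin j (\<lambda>i \<eta>. Amp d i \<eta> r) \<xi>)"
    "integrable (ker t) (\<lambda>r. LINT \<theta>|ang. nonlin j (\<lambda>i \<eta>. Amp d i \<eta> r) \<xi> \<theta>)"
    "Amp (Suc d) j \<xi> t = (LINT r|ker t. LINT \<theta>|ang. nonlin j (\<lambda>i \<eta>. Amp d i \<eta> r) \<xi> \<theta>)"
    "0 \<le> t \<Longrightarrow> Amp 0 j \<xi> t = exp (- t) * Amp 0 j \<xi> 0 + Amp (Suc 0) j \<xi> t"
proof -
  obtain w M where w: "weight w" "\<And>t. 0 \<le> t \<Longrightarrow> (\<integral>\<^sup>+v. ennreal (w v) \<partial>mu 0 t) \<le> ennreal M" "\<And>x. \<bar>tr j \<xi> x\<bar> \<le> w x"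
  proof (cases "j = 0")
    case True
    show ?thesis by (rule that[of "\<lambda>_. 1" 1]) (use True mass_0 in \<open>auto simp: weight_1 tr_0_bound\<close>)
  next
    case False
    then show ?thesis using assms by (intro that[of "\<lambda>x. 1 + x\<^sup>2" "1 + s2"]) (auto simp: weight_2 tr_bound second_def)
  qed
  note L = level_integrals[OF w(1,2) tr_measurable w(3)]
  show "integrable (mu d t) (tr j \<xi>)" by (rule L(1))
  show "integrable ang (nonlin j (\<lambda>i \<eta>. Amp d i \<eta> r) \<xi>)" using L(2)[of d r] unfolding Amp_rot[OF assms] .
  show "integrable (ker t) (\<lambda>r. LINT \<theta>|ang. nonlin j (\<lambda>i \<eta>. Amp d i \<eta> r) \<xi> \<theta>)" using L(3)[of t d] unfolding Amp_rot[OF assms] .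
  show "Amp (Suc d) j \<xi> t = (LINT r|ker t. LINT \<theta>|ang. nonlin j (\<lambda>i \<eta>. Amp d i \<eta> r) \<xi> \<theta>)"
    using L(4)[of d t] unfolding Amp_rot[OF assms] Amp_def .
  show "0 \<le> t \<Longrightarrow> Amp 0 j \<xi> t = exp (- t) * Amp 0 j \<xi> 0 + Amp (Suc 0) j \<xi> t"
    using L(5)[of t] unfolding Amp_def .
qed

section \<open>Bounds conserved by the evolution\<close>

lemma prob_mu_0: "prob_space (mu 0 t)"
proof
  have "emeasure (mu 0 t) (space (mu 0 t)) = (\<integral>\<^sup>+v. F v t \<partial>lborel)" unfolding mu_def using lev_meas_1[of 0 t] by (simp add: emeasure_density)
  then show "emeasure (mu 0 t) (space (mu 0 t)) = 1" by (simp add: F_mass)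
qed

lemma Amp_0_bound: "\<bar>Amp 0 0 \<xi> t\<bar> \<le> 1"
proof -
  interpret prob_space "mu 0 t" by (rule prob_mu_0)
  have "\<bar>Amp 0 0 \<xi> t\<bar> \<le> (LINT v|mu 0 t. 1)" unfolding Amp_def by (rule abs_integral_le_bound) (auto simp: tr_0_bound)
  then show ?thesis using prob_space by simp
qed

text \<open>The weight \<open>exp (- t)\<close> and the kernel mass add up to 1, so the bound
  \<open>z\<close> is reproduced. The kernel sends \<open>r^n\<close> to at most
  \<open>t^(n+1) / (n+1)\<close>, which completes the factorial, and the doubled error in
  \<open>f\<close> supplies the power of 2.\<close>

lemma iteration_step:
  assumes t: "0 \<le> t" and z: "0 \<le> z" and a: "a \<le> z"
    and f: "\<And>r. 0 \<le> r \<Longrightarrow> f r \<le> z + 2 * (c * ((2 * r)^n / fact n))" and c: "0 \<le> c"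
  shows "exp (- t) * a + (LINT r|ker t. f r) \<le> z + c * ((2 * t)^Suc n / fact (Suc n))"
proof -
  let ?k = "2 * (c * (2^n / fact n))"
  have "(LINT r|ker t. f r) \<le> (LINT r|ker t. z + ?k * r^n)"
  proof (rule integral_le_bound)
    show "integrable (ker t) (\<lambda>r. z + ?k * r^n)"
      by (intro Bochner_Integration.integrable_add ker_1 ker_pow integrable_mult_right t)
    show "AE r in ker t. f r \<le> z + ?k * r^n" using AE_ker[of t]
      by eventually_elim (use f in \<open>auto simp: power_mult_distrib mult_ac\<close>)
    show "AE r in ker t. 0 \<le> z + ?k * r^n" using AE_ker[of t]
      by eventually_elim (use z c in auto)
  qed
  also have "\<dots> = (LINT r|ker t. z) + ?k * (LINT r|ker t. r^n)"
    using ker_1(1)[OF t, of z] ker_pow(1)[OF t, of n] by (subst Bochner_Integration.integral_add) auto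
  also have "\<dots> \<le> (1 - exp (- t)) * z + ?k * (t^(n+1) / (n+1))"
    using ker_1(2)[OF t, of z] ker_pow(2)[OF t, of n] c by (intro add_mono mult_left_mono) auto
  also have "?k * (t^(n+1) / (n+1)) = c * ((2 * t)^Suc n / fact (Suc n))"
    by (simp add: power_mult_distrib field_simps del: of_nat_Suc)
  finally have "(LINT r|ker t. f r) \<le> (1 - exp (- t)) * z + c * ((2 * t)^Suc n / fact (Suc n))" .
  moreover have "exp (- t) * a \<le> exp (- t) * z" using a by simp
  moreover have "(1 - exp (- t)) * z = z - exp (- t) * z" by (simp add: algebra_simps)
  ultimately show ?thesis by linarith
qed

lemma Amp_0_mild:
  "0 \<le> t \<Longrightarrow> Amp 0 0 \<xi> t = exp (- t) * Amp 0 0 \<xi> 0 + (LINT r|ker t. LINT \<theta>|ang. nonlin 0 (\<lambda>i \<eta>. Amp 0 i \<eta> r) \<xi> \<theta>)"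
  using Amp_eqs(5)[of 0 0 t \<xi>] Amp_eqs(4)[of 0 0 0 \<xi> t] by simp

text \<open>By \<open>om_pair\<close> a product of two functions below \<open>om q\<close> stays
  below \<open>om q\<close>. The iteration starts from the trivial bound 1, whose excess dies out
  with the factorial.\<close>

lemma decay_preserved:
  assumes q: "0 \<le> q" and init: "\<And>\<xi>. \<bar>Amp 0 0 \<xi> 0\<bar> \<le> om q \<xi>" and t: "0 \<le> t"
  shows "\<bar>Amp 0 0 \<xi> t\<bar> \<le> om q \<xi>"
proof -
  have "\<bar>Amp 0 0 \<xi> t\<bar> \<le> om q \<xi> + 1 * ((2 * t)^n / fact n)" if "0 \<le> t" for \<xi> t n
    using that
  proof (induction n arbitrary: \<xi> t)
    case 0
    have "\<bar>Amp 0 0 \<xi> t\<bar> \<le> 1" by (rule Amp_0_bound)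
    also have "1 \<le> om q \<xi> + 1 * ((2 * t)^0 / fact 0)" by simp
    finally show ?case .
  next
    case (Suc n)
    have inner: "\<bar>LINT \<theta>|ang. nonlin 0 (\<lambda>i \<eta>. Amp 0 i \<eta> r) \<xi> \<theta>\<bar> \<le> om q \<xi> + 2 * (1 * ((2 * r)^n / fact n))" if r: "0 \<le> r" for r
    proof -
      let ?\<rho> = "1 * ((2 * r)^n / fact n)"
      have \<rho>: "0 \<le> ?\<rho>" using r by simp
      have "\<bar>LINT \<theta>|ang. nonlin 0 (\<lambda>i \<eta>. Amp 0 i \<eta> r) \<xi> \<theta>\<bar> \<le> (LINT \<theta>|ang. om q \<xi> + 2 * ?\<rho>)"
      proof (rule abs_integral_le_bound)
        have "\<bar>nonlin 0 (\<lambda>i \<eta>. Amp 0 i \<eta> r) \<xi> \<theta>\<bar> \<le> om q \<xi> + 2 * ?\<rho>" for \<theta>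
        proof -
          let ?x = "\<bar>Amp 0 0 (\<xi> * cos \<theta>) r\<bar>" and ?y = "\<bar>Amp 0 0 (\<xi> * sin \<theta>) r\<bar>" and ?a = "om q (\<xi> * cos \<theta>)" and ?b = "om q (\<xi> * sin \<theta>)"
          have 1: "?x \<le> ?a + ?\<rho>" "?y \<le> ?b + ?\<rho>" by (intro Suc.IH r)+
          have "?x * ?y \<le> (?a + ?\<rho>) * ?y" by (intro mult_right_mono 1) simp
          also have "\<dots> = ?a * ?y + ?\<rho> * ?y" by (simp add: distrib_right)
          also have "\<dots> \<le> ?a * (?b + ?\<rho>) + ?\<rho> * 1" using Amp_0_bound \<rho> by (intro add_mono mult_left_mono 1) auto
          also have "\<dots> = ?a * ?b + ?a * ?\<rho> + ?\<rho>" by (simp add: algebra_simps)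
          also have "\<dots> \<le> om q \<xi> + 1 * ?\<rho> + ?\<rho>" using om_pair[OF q] om_le_1[OF q] \<rho> by (intro add_mono mult_right_mono) auto
          also have "\<dots> = om q \<xi> + 2 * ?\<rho>" by linarith
          finally have *: "?x * ?y \<le> om q \<xi> + 2 * ?\<rho>" .
          have eq: "nonlin 0 (\<lambda>i \<eta>. Amp 0 i \<eta> r) \<xi> \<theta> = Amp 0 0 (\<xi> * cos \<theta>) r * Amp 0 0 (\<xi> * sin \<theta>) r"
            by (simp add: nonlin_def)
          show ?thesis unfolding eq abs_mult by (rule *)
        qed
        then show "AE \<theta> in ang. \<bar>nonlin 0 (\<lambda>i \<eta>. Amp 0 i \<eta> r) \<xi> \<theta>\<bar> \<le> om q \<xi> + 2 * ?\<rho>" by simp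
      qed simp
      then show ?thesis by simp
    qed
    have "\<bar>Amp 0 0 \<xi> t\<bar> \<le> exp (- t) * \<bar>Amp 0 0 \<xi> 0\<bar> + (LINT r|ker t. \<bar>LINT \<theta>|ang. nonlin 0 (\<lambda>i \<eta>. Amp 0 i \<eta> r) \<xi> \<theta>\<bar>)"
      unfolding Amp_0_mild[OF Suc.prems, of \<xi>] using integral_abs_bound[of "ker t" "\<lambda>r. LINT \<theta>|ang. nonlin 0 (\<lambda>i \<eta>. Amp 0 i \<eta> r) \<xi> \<theta>"]
      by (intro order_trans[OF abs_triangle_ineq] add_mono) (auto simp: abs_mult)
    also have "\<dots> \<le> om q \<xi> + 1 * ((2 * t)^Suc n / fact (Suc n))"
      by (rule iteration_step[OF Suc.prems _ init inner]) auto
    finally show ?case .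
  qed
  from iteration_limit[OF this[OF t]] show ?thesis .
qed

text \<open>For x, y \<le> 1 one has \<open>1 - x * y \<le> (1 - x) + (1 - y)\<close>, and the
  squares of the two rotated frequencies add up to \<open>\<xi>\<^sup>2\<close>.\<close>

lemma one_minus_preserved:
  assumes s2: "0 \<le> s2" and init: "\<And>\<xi>. 1 - Amp 0 0 \<xi> 0 \<le> s2 * \<xi>\<^sup>2" and t: "0 \<le> t"
  shows "1 - Amp 0 0 \<xi> t \<le> s2 * \<xi>\<^sup>2"
proof -
  have "1 - Amp 0 0 \<xi> t \<le> s2 * \<xi>\<^sup>2 + 2 * ((2 * t)^n / fact n)" if "0 \<le> t" for \<xi> t n
    using that
  proof (induction n arbitrary: \<xi> t)
    case 0 then show ?case using Amp_0_bound[of \<xi> t] s2 by (simp add: add_increasing)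
  next
    case (Suc n)
    have inner: "1 - (LINT \<theta>|ang. nonlin 0 (\<lambda>i \<eta>. Amp 0 i \<eta> r) \<xi> \<theta>) \<le> s2 * \<xi>\<^sup>2 + 2 * (2 * ((2 * r)^n / fact n))" if r: "0 \<le> r" for r
    proof -
      let ?\<rho> = "2 * ((2 * r)^n / fact n)"
      have "1 - (LINT \<theta>|ang. nonlin 0 (\<lambda>i \<eta>. Amp 0 i \<eta> r) \<xi> \<theta>) = (LINT \<theta>|ang. 1 - nonlin 0 (\<lambda>i \<eta>. Amp 0 i \<eta> r) \<xi> \<theta>)"
        using Amp_eqs(2)[of 0 0 0 r \<xi>] by (subst Bochner_Integration.integral_diff) auto
      also have "\<dots> \<le> (LINT \<theta>|ang. s2 * \<xi>\<^sup>2 + 2 * ?\<rho>)"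
      proof (rule integral_le_bound)
        have "1 - nonlin 0 (\<lambda>i \<eta>. Amp 0 i \<eta> r) \<xi> \<theta> \<le> s2 * \<xi>\<^sup>2 + 2 * ?\<rho>" for \<theta>
        proof -
          let ?x = "Amp 0 0 (\<xi> * cos \<theta>) r" and ?y = "Amp 0 0 (\<xi> * sin \<theta>) r"
          have 1: "1 - ?x \<le> s2 * (\<xi> * cos \<theta>)\<^sup>2 + ?\<rho>" "1 - ?y \<le> s2 * (\<xi> * sin \<theta>)\<^sup>2 + ?\<rho>" by (intro Suc.IH r)+
          have "0 \<le> (1 - ?x) * (1 - ?y)" using Amp_0_bound[of "\<xi> * cos \<theta>" r] Amp_0_bound[of "\<xi> * sin \<theta>" r] by (intro mult_nonneg_nonneg) auto
          then have "1 - ?x * ?y \<le> (1 - ?x) + (1 - ?y)" by (simp add: algebra_simps)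
          also have "\<dots> \<le> (s2 * (\<xi> * cos \<theta>)\<^sup>2 + s2 * (\<xi> * sin \<theta>)\<^sup>2) + 2 * ?\<rho>" using 1 by linarith
          also have "s2 * (\<xi> * cos \<theta>)\<^sup>2 + s2 * (\<xi> * sin \<theta>)\<^sup>2 = s2 * (\<xi>\<^sup>2 * ((cos \<theta>)\<^sup>2 + (sin \<theta>)\<^sup>2))"
            by (simp only: power_mult_distrib distrib_left)
          finally show ?thesis by (simp add: nonlin_def)
        qed
        then show "AE \<theta> in ang. 1 - nonlin 0 (\<lambda>i \<eta>. Amp 0 i \<eta> r) \<xi> \<theta> \<le> s2 * \<xi>\<^sup>2 + 2 * ?\<rho>" by simp
      qed (use s2 r in auto)
      finally show ?thesis by simp
    qed
    have "1 - Amp 0 0 \<xi> t = exp (- t) * (1 - Amp 0 0 \<xi> 0) + (LINT r|ker t. 1 - (LINT \<theta>|ang. nonlin 0 (\<lambda>i \<eta>. Amp 0 i \<eta> r) \<xi> \<theta>))"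
      using Amp_eqs(3)[of 0 0 t 0 \<xi>] ker_1[OF Suc.prems, of 1] unfolding Amp_0_mild[OF Suc.prems, of \<xi>]
      by (subst Bochner_Integration.integral_diff) (auto simp: algebra_simps)
    also have "\<dots> \<le> s2 * \<xi>\<^sup>2 + 2 * ((2 * t)^Suc n / fact (Suc n))"
      by (rule iteration_step[OF Suc.prems _ init inner]) (use s2 in auto)
    finally show ?case .
  qed
  from iteration_limit[OF this[OF t]] show ?thesis .
qed

text \<open>The notion of solution says nothing about moments at later times; they are recovered
  from the transform. \<open>1 - Amp 0 0 \<xi> t\<close> stays below
  \<open>(s2 / 2) * \<xi>^2\<close>, and Fatou applied to
  \<open>2 * N^2 * (1 - cos (v / N))\<close>, which tends to \<open>v^2\<close>, bounds the second
  moment.\<close>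

lemma second_moment:
  assumes s2: "0 \<le> s2" and init: "(\<integral>\<^sup>+v. ennreal (v\<^sup>2) \<partial>mu 0 0) \<le> ennreal s2"
  shows "second s2"
  unfolding second_def
proof (intro allI impI)
  fix t :: real assume t: "0 \<le> t"
  have cosb: "1 - cos x \<le> x\<^sup>2 / 2" for x :: real
  proof -
    have "1 - cos x = 2 * (sin (x/2))\<^sup>2" using cos_double_sin[of "x/2"] by simp
    also have "(sin (x/2))\<^sup>2 \<le> (x/2)\<^sup>2" using abs_sin_x_le_abs_x[of "x/2"] by (simp only: abs_le_square_iff)
    finally show ?thesis by (simp add: power_divide)
  qed
  have eq: "ennreal (1 - Amp 0 0 \<xi> t) = (\<integral>\<^sup>+v. ennreal (1 - cos (\<xi> * v)) \<partial>mu 0 t)" for \<xi> t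
  proof -
    interpret prob_space "mu 0 t" by (rule prob_mu_0)
    have tr0: "tr 0 \<xi> = (\<lambda>v. cos (\<xi> * v))" by (simp add: fun_eq_iff tr_def)
    have i: "integrable (mu 0 t) (\<lambda>v. cos (\<xi> * v))" using Amp_eqs(1)[of 0 0 0 t \<xi>] by (simp add: tr0)
    have "1 - Amp 0 0 \<xi> t = (LINT v|mu 0 t. 1 - cos (\<xi> * v))"
      using i prob_space by (subst Bochner_Integration.integral_diff) (auto simp: Amp_def tr_def)
    then show ?thesis using i by (subst nn_integral_eq_integral) auto
  qed
  have "1 - Amp 0 0 \<xi> 0 \<le> (s2 / 2) * \<xi>\<^sup>2" for \<xi>
  proof -
    have "ennreal (1 - Amp 0 0 \<xi> 0) \<le> (\<integral>\<^sup>+v. ennreal (\<xi>\<^sup>2 / 2) * ennreal (v\<^sup>2) \<partial>mu 0 0)"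
      unfolding eq
    proof (rule nn_integral_mono)
      fix v
      have "ennreal (1 - cos (\<xi> * v)) \<le> ennreal ((\<xi>\<^sup>2 / 2) * v\<^sup>2)"
        using cosb[of "\<xi> * v"] by (intro ennreal_leI) (simp add: power_mult_distrib)
      then show "ennreal (1 - cos (\<xi> * v)) \<le> ennreal (\<xi>\<^sup>2 / 2) * ennreal (v\<^sup>2)"
        by (subst ennreal_mult[symmetric]) auto
    qed
    also have "\<dots> = ennreal (\<xi>\<^sup>2 / 2) * (\<integral>\<^sup>+v. ennreal (v\<^sup>2) \<partial>mu 0 0)" by (rule nn_integral_cmult) simp
    also have "\<dots> \<le> ennreal (\<xi>\<^sup>2 / 2) * ennreal s2" by (intro mult_left_mono init) simp
    also have "\<dots> = ennreal ((s2 / 2) * \<xi>\<^sup>2)" using s2 by (simp add: mult_ac flip: ennreal_mult)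
    finally show ?thesis using s2 by (simp add: ennreal_le_iff)
  qed
  from one_minus_preserved[OF _ this t] s2
  have b: "1 - Amp 0 0 \<xi> t \<le> (s2 / 2) * \<xi>\<^sup>2" for \<xi> by simp
  have lim: "(\<lambda>n. (1 - cos (v / real (Suc n))) * (2 * (real (Suc n))\<^sup>2)) \<longlonglongrightarrow> v\<^sup>2" for v :: real
  proof (cases "v = 0")
    case False
    have c: "((\<lambda>x::real. (1 - cos x) / x\<^sup>2) \<longlongrightarrow> 1/2) (at 0)"
    proof -
      have "((\<lambda>x::real. sin x / x) \<longlongrightarrow> 1) (at 0)" using DERIV_sin[of 0] by (simp add: DERIV_def)
      moreover have "filterlim (\<lambda>x::real. x/2) (at 0) (at 0)"
      proof -
        have "((\<lambda>x::real. x/2) \<longlongrightarrow> 0/2) (at 0)" by (intro tendsto_intros) simp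
        moreover have "\<forall>\<^sub>F x::real in at 0. x/2 \<noteq> 0" unfolding eventually_at_filter by (intro always_eventually) auto
        ultimately show ?thesis unfolding filterlim_at by simp
      qed
      ultimately have "((\<lambda>x::real. sin (x/2) / (x/2)) \<longlongrightarrow> 1) (at 0)" by (rule filterlim_compose)
      then have "((\<lambda>x::real. 1/2 * (sin (x/2) / (x/2))\<^sup>2) \<longlongrightarrow> 1/2 * 1\<^sup>2) (at 0)" by (intro tendsto_intros)
      moreover have "(\<lambda>x::real. 1/2 * (sin (x/2) / (x/2))\<^sup>2) = (\<lambda>x. (1 - cos x) / x\<^sup>2)"
      proof
        fix x :: real
        show "1/2 * (sin (x/2) / (x/2))\<^sup>2 = (1 - cos x) / x\<^sup>2"
          using cos_double_sin[of "x/2"] by (simp add: power_divide)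
      qed
      ultimately show ?thesis by (simp only: power_one mult_1_right)
    qed
    have "filterlim (\<lambda>n. v / real (Suc n)) (at 0) sequentially"
    proof -
      have "v / real (Suc n) \<noteq> 0" for n using False by simp
      moreover have "(\<lambda>n. v / real (Suc n)) \<longlonglongrightarrow> 0" using LIMSEQ_Suc[OF lim_const_over_n[of v]] .
      ultimately show ?thesis unfolding filterlim_at by (simp del: of_nat_Suc)
    qed
    from tendsto_mult_left[OF filterlim_compose[OF c this], of "2 * v\<^sup>2"]
    have "(\<lambda>n. 2 * v\<^sup>2 * ((1 - cos (v / real (Suc n))) / (v / real (Suc n))\<^sup>2)) \<longlonglongrightarrow> 2 * v\<^sup>2 * (1/2)" .
    moreover have "2 * v\<^sup>2 * ((1 - cos (v / real (Suc n))) / (v / real (Suc n))\<^sup>2) = (1 - cos (v / real (Suc n))) * (2 * (real (Suc n))\<^sup>2)" for n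
      using False by (simp add: power_divide field_simps del: of_nat_Suc)
    ultimately show ?thesis by (simp del: of_nat_Suc)
  qed simp
  have "(\<integral>\<^sup>+v. ennreal (v\<^sup>2) \<partial>mu 0 t) = (\<integral>\<^sup>+v. liminf (\<lambda>n. ennreal ((1 - cos (v / real (Suc n))) * (2 * (real (Suc n))\<^sup>2))) \<partial>mu 0 t)"
  proof (rule nn_integral_cong)
    fix v
    show "ennreal (v\<^sup>2) = liminf (\<lambda>n. ennreal ((1 - cos (v / real (Suc n))) * (2 * (real (Suc n))\<^sup>2)))"
      by (rule lim_imp_Liminf[symmetric]) (auto intro!: tendsto_ennrealI lim simp del: of_nat_Suc)
  qed
  also have "\<dots> \<le> liminf (\<lambda>n. \<integral>\<^sup>+v. ennreal ((1 - cos (v / real (Suc n))) * (2 * (real (Suc n))\<^sup>2)) \<partial>mu 0 t)"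
    by (rule nn_integral_liminf) (auto simp del: of_nat_Suc)
  also have "\<dots> \<le> liminf (\<lambda>n. ennreal s2)"
  proof (intro Liminf_mono always_eventually allI)
    fix n
    let ?N = "real (Suc n)"
    have "(\<integral>\<^sup>+v. ennreal ((1 - cos (v / ?N)) * (2 * ?N\<^sup>2)) \<partial>mu 0 t) = (\<integral>\<^sup>+v. ennreal (1 - cos ((1 / ?N) * v)) * ennreal (2 * ?N\<^sup>2) \<partial>mu 0 t)"
      by (intro nn_integral_cong) (simp add: ennreal_mult del: of_nat_Suc)
    also have "\<dots> = ennreal (1 - Amp 0 0 (1 / ?N) t) * ennreal (2 * ?N\<^sup>2)"
      by (subst nn_integral_multc) (auto simp: eq simp del: of_nat_Suc)
    also have "\<dots> \<le> ennreal ((s2 / 2) * (1 / ?N)\<^sup>2) * ennreal (2 * ?N\<^sup>2)" by (intro mult_right_mono ennreal_leI b) simp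
    also have "\<dots> = ennreal s2" using s2 by (simp add: power_divide field_simps del: of_nat_Suc flip: ennreal_mult)
    finally show "(\<integral>\<^sup>+v. ennreal ((1 - cos (v / ?N)) * (2 * ?N\<^sup>2)) \<partial>mu 0 t) \<le> ennreal s2" .
  qed
  also have "\<dots> = ennreal s2" by (rule Liminf_const) simp
  finally have v2: "(\<integral>\<^sup>+v. ennreal (v\<^sup>2) \<partial>mu 0 t) \<le> ennreal s2" .
  have "(\<integral>\<^sup>+v. ennreal (1 + v\<^sup>2) \<partial>mu 0 t) = (\<integral>\<^sup>+v. ennreal 1 + ennreal (v\<^sup>2) \<partial>mu 0 t)" by (intro nn_integral_cong) simp
  also have "\<dots> = (\<integral>\<^sup>+v. ennreal 1 \<partial>mu 0 t) + (\<integral>\<^sup>+v. ennreal (v\<^sup>2) \<partial>mu 0 t)" by (rule nn_integral_add) auto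
  also have "\<dots> \<le> ennreal 1 + ennreal s2" by (intro add_mono mass_0 v2)
  also have "\<dots> = ennreal (1 + s2)" using s2 by (simp add: ennreal_plus)
  finally show "(\<integral>\<^sup>+v. ennreal (1 + v\<^sup>2) \<partial>mu 0 t) \<le> ennreal (1 + s2)" .
qed

end

section \<open>Bounding densities by Fourier inversion\<close>

text \<open>The function \<open>F\<close> is nondecreasing and right-continuous, hence generates a
  measure, which on Borel subsets of a bounded window agrees with integration of
  \<open>M - k\<close>. Nonnegativity of this measure on the set where \<open>k\<close> exceeds
  \<open>M\<close> forces that set to be null.\<close>

lemma interval_bound_imp_AE:
  fixes k :: "real \<Rightarrow> real"
  assumes k: "integrable lborel k" and M: "0 \<le> M"
    and bnd: "\<And>a b. a \<le> b \<Longrightarrow> (LINT v|lborel. indicator {a<..b} v * k v) \<le> M * (b - a)"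
  shows "AE v in lborel. k v \<le> M"
proof -
  have [measurable]: "k \<in> borel_measurable borel" using k by auto
  define F where "F x = M * x - (LINT v|lborel. indicator {..x} v * k v)" for x
  have ik: "integrable lborel (\<lambda>v. indicator A v * k v)" if "A \<in> sets borel" for A
    using integrable_mult_indicator[of A lborel k] k that by simp
  have diff: "F b - F a = M * (b - a) - (LINT v|lborel. indicator {a<..b} v * k v)" if "a \<le> b" for a b
  proof -
    have "(\<lambda>v. indicator {..b} v * k v) = (\<lambda>v. indicator {..a} v * k v + indicator {a<..b} v * k v)"
      using that by (auto simp: fun_eq_iff split: split_indicator)
    then have "(LINT v|lborel. indicator {..b} v * k v) = (LINT v|lborel. indicator {..a} v * k v) + (LINT v|lborel. indicator {a<..b} v * k v)"
      using ik by simp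
    then show ?thesis by (simp add: F_def algebra_simps)
  qed
  have mono: "F a \<le> F b" if "a \<le> b" for a b using diff[OF that] bnd[OF that] by linarith
  have cont: "continuous (at_right a) F" for a
  proof -
    have "((\<lambda>x. LINT v|lborel. indicator {..x} v * k v) \<longlongrightarrow> (LINT v|lborel. indicator {..a} v * k v)) (at_right a)"
    proof (rule tendsto_at_right_sequentially[where b="a+1"])
      fix S assume S: "\<And>n. a < S n" "\<And>n. S n < a + 1" "decseq S" "S \<longlonglongrightarrow> a"
      show "(\<lambda>n. LINT v|lborel. indicator {..S n} v * k v) \<longlonglongrightarrow> (LINT v|lborel. indicator {..a} v * k v)"
      proof (rule integral_dominated_convergence[where w="\<lambda>v. norm (k v)"])
        show "AE v in lborel. (\<lambda>n. indicator {..S n} v * k v) \<longlonglongrightarrow> indicator {..a} v * k v"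
        proof (rule AE_I2)
          fix v
          have "\<forall>\<^sub>F n in sequentially. indicator {..S n} v * k v = indicator {..a} v * k v"
          proof (cases "v \<le> a")
            case True
            then show ?thesis using S(1) by (intro always_eventually allI) (auto split: split_indicator simp: less_imp_le order_trans[OF True])
          next
            case False
            then have "\<forall>\<^sub>F n in sequentially. S n < v" using order_tendstoD(2)[OF S(4), of v] by simp
            then show ?thesis by eventually_elim (use False in \<open>auto split: split_indicator\<close>)
          qed
          then show "(\<lambda>n. indicator {..S n} v * k v) \<longlonglongrightarrow> indicator {..a} v * k v" by (rule tendsto_eventually)
        qed
      qed (use k in \<open>auto split: split_indicator\<close>)
    qed simp
    then show ?thesis unfolding F_def continuous_within by (intro tendsto_intros)
  qed
  let ?\<nu> = "interval_measure F"
  have \<nu>: "emeasure ?\<nu> {a<..b} = ennreal (F b - F a)" if "a \<le> b" for a b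
    using that by (intro emeasure_interval_measure_Ioc mono cont) auto
  define J where "J A = (LINT v|lborel. indicator A v * (M - k v))" for A
  \<comment> \<open>Inside a bounded window the measure is finite, so the complement step of the
    induction may subtract.\<close>
  have main: "AE v in lborel. v \<in> {- real n<..real n} \<longrightarrow> k v \<le> M" for n :: nat
  proof -
    define B where "B = {- real n<..real n}"
    have B[measurable]: "B \<in> sets borel" by (simp add: B_def)
    have iB: "integrable lborel (\<lambda>v. indicator (A \<inter> B) v * (M - k v))" if [measurable]: "A \<in> sets borel" for A
    proof -
      have "integrable lborel (\<lambda>v. indicator (A \<inter> B) v * M - indicator (A \<inter> B) v * k v)"
      proof (intro Bochner_Integration.integrable_diff ik integrable_mult_left)
        have "emeasure lborel (A \<inter> B) \<le> emeasure lborel B" by (intro emeasure_mono) auto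
        also have "\<dots> < \<infinity>" by (simp add: B_def)
        finally show "integrable lborel (indicator (A \<inter> B) :: real \<Rightarrow> real)" by (intro integrable_real_indicator) auto
      qed auto
      then show ?thesis by (simp add: right_diff_distrib)
    qed
    have Bfin: "emeasure ?\<nu> B < \<infinity>" unfolding B_def by (subst \<nu>) auto
    have fin: "emeasure ?\<nu> (A \<inter> B) \<noteq> \<infinity>" for A
    proof -
      have "emeasure ?\<nu> (A \<inter> B) \<le> emeasure ?\<nu> B" using B by (intro emeasure_mono) auto
      then show ?thesis using Bfin by auto
    qed
    have JIoc: "J {a<..b} = F b - F a" if "a \<le> b" for a b
    proof -
      have "J {a<..b} = (LINT v|lborel. indicator {a<..b} v * M - indicator {a<..b} v * k v)" unfolding J_def by (simp add: right_diff_distrib)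
      also have "\<dots> = (b - a) * M - (LINT v|lborel. indicator {a<..b} v * k v)"
        using that ik[of "{a<..b}"] by (subst Bochner_Integration.integral_diff) (auto intro!: integrable_mult_left integrable_real_indicator)
      finally show ?thesis using diff[OF that] by (simp add: mult.commute)
    qed
    have eq: "measure ?\<nu> (A \<inter> B) = J (A \<inter> B)" if "A \<in> sets borel" for A
    proof -
      have gen: "sets borel = sigma_sets UNIV (range (\<lambda>(a, b). {a<..b::real}))"
        by (subst borel_sigma_sets_Ioc) simp
      have A: "A \<in> sigma_sets UNIV (range (\<lambda>(a, b). {a<..b::real}))" using that gen by simp
      have st: "Int_stable (range (\<lambda>(a, b). {a<..b::real}))"
      proof (rule Int_stableI)
        fix X Y assume "X \<in> range (\<lambda>(a, b). {a<..b::real})" "Y \<in> range (\<lambda>(a, b). {a<..b::real})"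
        then obtain a b c d where "X = {a<..b}" "Y = {c<..d}" by auto
        then show "X \<inter> Y \<in> range (\<lambda>(a, b). {a<..b::real})"
          by (intro range_eqI[of _ _ "(max a c, min b d)"]) auto
      qed
      have "range (\<lambda>(a, b). {a<..b::real}) \<subseteq> Pow UNIV" by simp
      from st this A show ?thesis
      proof (induction rule: sigma_sets_induct_disjoint)
        case empty
        show "measure ?\<nu> ({} \<inter> B) = J ({} \<inter> B)" by (simp add: J_def)
      next
        case (basic X)
        then obtain a b where "X = {a<..b}" by auto
        then have X: "X \<inter> B = {max a (- real n)<..min b (real n)}" by (auto simp: B_def)
        show "measure ?\<nu> (X \<inter> B) = J (X \<inter> B)"
        proof (cases "max a (- real n) \<le> min b (real n)")
          case True
          then show ?thesis unfolding X using mono[OF True] by (simp add: measure_def \<nu> JIoc del: max.bounded_iff min.bounded_iff)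
        next
          case False
          then have "X \<inter> B = {}" unfolding X by auto
          then show ?thesis by (simp add: J_def)
        qed
      next
        case (compl X)
        note X = compl(1) and IH = compl(2)
        have Xb[measurable]: "X \<in> sets borel" using X gen by simp
        have "(UNIV - X) \<inter> B = B - X \<inter> B" by auto
        then have "measure ?\<nu> ((UNIV - X) \<inter> B) = measure ?\<nu> B - measure ?\<nu> (X \<inter> B)"
          using Bfin by (simp only:) (intro measure_Diff; auto)
        also have "measure ?\<nu> B = J B" unfolding B_def using mono[of "- real n" "real n"] by (simp add: measure_def \<nu> JIoc)
        also have "J B - measure ?\<nu> (X \<inter> B) = (LINT v|lborel. indicator (UNIV \<inter> B) v * (M - k v) - indicator (X \<inter> B) v * (M - k v))"
          unfolding IH J_def using iB[of UNIV] iB[of X] by (subst Bochner_Integration.integral_diff) auto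
        also have "\<dots> = J ((UNIV - X) \<inter> B)" unfolding J_def by (intro Bochner_Integration.integral_cong) (auto split: split_indicator)
        finally show "measure ?\<nu> ((UNIV - X) \<inter> B) = J ((UNIV - X) \<inter> B)" .
      next
        case (union X)
        note dis = union(1) and X = union(2) and IH = union(3)
        have Xb[measurable]: "X i \<in> sets borel" for i using X gen by auto
        have un: "(\<Union>i. X i) \<inter> B = (\<Union>i. X i \<inter> B)" by auto
        have d: "disjoint_family (\<lambda>i. X i \<inter> B)" using dis by (auto simp: disjoint_family_on_def)
        have s1: "(\<lambda>i. measure ?\<nu> (X i \<inter> B)) sums measure ?\<nu> ((\<Union>i. X i) \<inter> B)"
          unfolding un
        proof (rule measure_UNION[OF _ d])
          show "range (\<lambda>i. X i \<inter> B) \<subseteq> sets ?\<nu>" using Xb B by auto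
          show "emeasure ?\<nu> (\<Union>i. X i \<inter> B) \<noteq> \<infinity>" using fin[of "\<Union>i. X i"] unfolding un .
        qed
        have s2: "(\<lambda>i. J (X i \<inter> B)) sums J ((\<Union>i. X i) \<inter> B)"
        proof -
          have si: "set_integrable lborel (\<Union>i. X i \<inter> B) (\<lambda>v. M - k v)"
            using iB[of "\<Union>i. X i"] unfolding set_integrable_def un by simp
          have "set_lebesgue_integral lborel (\<Union>i. X i \<inter> B) (\<lambda>v. M - k v) = (\<Sum>i. set_lebesgue_integral lborel (X i \<inter> B) (\<lambda>v. M - k v))"
            using d si by (intro lebesgue_integral_countable_add) (auto simp: disjoint_family_on_def)
          moreover have "summable (\<lambda>i. J (X i \<inter> B))" using s1 unfolding IH by (rule sums_summable)
          ultimately show ?thesis unfolding sums_iff J_def set_lebesgue_integral_def un by simp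
        qed
        show "measure ?\<nu> ((\<Union>i. X i) \<inter> B) = J ((\<Union>i. X i) \<inter> B)"
          using s1 s2 unfolding IH by (rule sums_unique2)
      qed
    qed
    define A where "A = {v. M < k v}"
    have A[measurable]: "A \<in> sets borel" unfolding A_def by measurable
    have "0 \<le> J (A \<inter> B)" using eq[OF A] by (metis measure_nonneg)
    moreover have "AE v in lborel. 0 \<le> indicator (A \<inter> B) v * (k v - M)" by (rule AE_I2) (auto simp: A_def split: split_indicator)
    moreover have "(LINT v|lborel. indicator (A \<inter> B) v * (k v - M)) = - J (A \<inter> B)"
      unfolding J_def by (subst Bochner_Integration.integral_minus[symmetric]) (intro Bochner_Integration.integral_cong; auto split: split_indicator)
    moreover have i: "integrable lborel (\<lambda>v. indicator (A \<inter> B) v * (k v - M))"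
      using Bochner_Integration.integrable_minus[OF iB[OF A]] by (rule Bochner_Integration.integrable_cong[THEN iffD1, rotated -1]) (auto split: split_indicator)
    ultimately have "(LINT v|lborel. indicator (A \<inter> B) v * (k v - M)) = 0"
      using integral_nonneg_AE[of "\<lambda>v. indicator (A \<inter> B) v * (k v - M)" lborel] by simp
    then have "AE v in lborel. indicator (A \<inter> B) v * (k v - M) = 0"
      by (subst (asm) integral_nonneg_eq_0_iff_AE[OF i]) (auto simp: A_def split: split_indicator)
    then show ?thesis by eventually_elim (auto simp: A_def B_def split: split_indicator_asm)
  qed
  have "AE v in lborel. \<forall>n. v \<in> {- real n<..real n} \<longrightarrow> k v \<le> M" using main by (subst AE_all_countable) auto
  then show ?thesis
  proof eventually_elim
    case (elim v)
    obtain n where "\<bar>v\<bar> < real n" using reals_Archimedean2 by blast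
    then have "v \<in> {- real n<..real n}" by (auto simp: abs_less_iff)
    then show ?case using elim by blast
  qed
qed

text \<open>Levy inversion concerns probability laws, so \<open>p\<close> is divided by its mass. A
  density has no atoms, which settles the condition on the endpoints.\<close>

lemma Levy_density:
  fixes p :: "real \<Rightarrow> real"
  assumes p: "integrable lborel p" "\<And>v. 0 \<le> p v" and pos: "0 < (LINT v|lborel. p v)" and ab: "a \<le> b"
  shows "(\<lambda>T::nat. 1 / (2 * pi) * (CLBINT t=-real T..real T. (iexp (-(t * a)) - iexp (-(t * b))) / (\<i> * t) * (CLINT v|lborel. p v *\<^sub>R iexp (t * v))))
    \<longlonglongrightarrow> complex_of_real (LINT v|lborel. indicator {a<..b} v * p v)"
proof -
  define m where "m = (LINT v|lborel. p v)"
  have [measurable]: "p \<in> borel_measurable borel" using p by auto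
  define P where "P = density lborel (\<lambda>v. ennreal (p v / m))"
  have m: "0 < m" using pos by (simp add: m_def)
  have nnp: "(\<integral>\<^sup>+v. ennreal (p v) \<partial>lborel) = ennreal m" unfolding m_def using p by (intro nn_integral_eq_integral) auto
  have prob: "prob_space P"
  proof
    have "emeasure P (space P) = (\<integral>\<^sup>+v. ennreal (1/m) * ennreal (p v) \<partial>lborel)"
      unfolding P_def using m p by (subst emeasure_density) (auto simp: ennreal_mult[symmetric] intro!: nn_integral_cong)
    also have "\<dots> = ennreal (1/m) * ennreal m" using m by (simp add: nn_integral_cmult nnp)
    also have "\<dots> = 1" using m by (simp flip: ennreal_mult)
    finally show "emeasure P (space P) = 1" .
  qed
  interpret prob_space P by (rule prob)
  interpret real_distribution P by unfold_locales (auto simp: P_def)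
  have chr: "char P t = complex_of_real (1/m) * (CLINT v|lborel. p v *\<^sub>R iexp (t * v))" for t
  proof -
    have "char P t = (CLINT v|lborel. (p v / m) *\<^sub>R iexp (t * v))"
      unfolding char_def P_def using m p by (subst integral_density) auto
    also have "\<dots> = (CLINT v|lborel. complex_of_real (1/m) * (p v *\<^sub>R iexp (t * v)))"
      by (intro Bochner_Integration.integral_cong) (auto simp: scaleR_conv_of_real)
    also have "\<dots> = complex_of_real (1/m) * (CLINT v|lborel. p v *\<^sub>R iexp (t * v))" by (rule integral_mult_right_zero)
    finally show ?thesis .
  qed
  have null: "measure P {x} = 0" for x
  proof -
    have "(\<integral>\<^sup>+v. ennreal (p v / m) * indicator {x} v \<partial>lborel) = (\<integral>\<^sup>+v. 0 \<partial>(lborel :: real measure))"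
    proof (rule nn_integral_cong_AE)
      show "AE v in lborel. ennreal (p v / m) * indicator {x} v = 0"
        using AE_lborel_singleton[of x] by eventually_elim auto
    qed
    then show ?thesis unfolding P_def measure_def by (subst emeasure_density) auto
  qed
  have meas: "measure P {a<..b} = (1/m) * (LINT v|lborel. indicator {a<..b} v * p v)"
  proof -
    have "emeasure P {a<..b} = (\<integral>\<^sup>+v. ennreal ((1/m) * (indicator {a<..b} v * p v)) \<partial>lborel)"
      unfolding P_def by (subst emeasure_density) (auto intro!: nn_integral_cong split: split_indicator)
    also have "\<dots> = ennreal (LINT v|lborel. (1/m) * (indicator {a<..b} v * p v))"
      using integrable_mult_indicator[of "{a<..b}" lborel p] p m by (intro nn_integral_eq_integral integrable_mult_right) auto
    finally show ?thesis using m p by (simp add: measure_def integral_nonneg_AE)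
  qed
  have "(\<lambda>T::nat. 1 / (2 * pi) * (CLBINT t=-real T..real T. (iexp (-(t * a)) - iexp (-(t * b))) / (\<i> * t) * char P t)) \<longlonglongrightarrow> complex_of_real (measure P {a<..b})"
    using Levy_Inversion[OF ab null null] by simp
  then have "(\<lambda>T::nat. complex_of_real m * (1 / (2 * pi) * (CLBINT t=-real T..real T. (iexp (-(t * a)) - iexp (-(t * b))) / (\<i> * t) * char P t))) \<longlonglongrightarrow> complex_of_real m * complex_of_real (measure P {a<..b})"
    by (rule tendsto_mult_left)
  moreover have "complex_of_real m * (1 / (2 * pi) * (CLBINT t=-real T..real T. (iexp (-(t * a)) - iexp (-(t * b))) / (\<i> * t) * char P t)) =
     1 / (2 * pi) * (CLBINT t=-real T..real T. (iexp (-(t * a)) - iexp (-(t * b))) / (\<i> * t) * (CLINT v|lborel. p v *\<^sub>R iexp (t * v)))" for T :: nat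
  proof -
    have "(CLBINT t=-real T..real T. (iexp (-(t * a)) - iexp (-(t * b))) / (\<i> * t) * char P t) =
      (CLBINT t=-real T..real T. complex_of_real (1/m) * ((iexp (-(t * a)) - iexp (-(t * b))) / (\<i> * t) * (CLINT v|lborel. p v *\<^sub>R iexp (t * v))))"
      unfolding chr by (intro interval_integral_cong) (simp add: mult_ac)
    also have "\<dots> = complex_of_real (1/m) * (CLBINT t=-real T..real T. (iexp (-(t * a)) - iexp (-(t * b))) / (\<i> * t) * (CLINT v|lborel. p v *\<^sub>R iexp (t * v)))"
      by (rule interval_lebesgue_integral_mult_right)
    finally show ?thesis using m by simp
  qed
  moreover have "complex_of_real m * complex_of_real (measure P {a<..b}) = complex_of_real (LINT v|lborel. indicator {a<..b} v * p v)"
    unfolding meas using m by simp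
  ultimately show ?thesis by simp
qed

definition FT :: "(real \<Rightarrow> real) \<Rightarrow> real \<Rightarrow> complex" where
  "FT p t = (CLINT v|lborel. p v *\<^sub>R iexp (t * v))"

lemma integrable_FT: "integrable lborel p \<Longrightarrow> integrable lborel (\<lambda>v. p v *\<^sub>R iexp (t * v))"
  by (rule Bochner_Integration.integrable_bound[of lborel p]) (auto simp: norm_exp_i_times)

lemma FT_measurable [measurable]: assumes [measurable]: "p \<in> borel_measurable borel" shows "FT p \<in> borel_measurable borel"
  unfolding FT_def by measurable

lemma norm_FT: "integrable lborel p \<Longrightarrow> norm (FT p t) \<le> (LINT v|lborel. \<bar>p v\<bar>)"
  unfolding FT_def by (rule order_trans[OF integral_norm_bound]) (simp add: norm_exp_i_times)

lemma FT_add: "integrable lborel p \<Longrightarrow> integrable lborel q \<Longrightarrow> FT (\<lambda>v. p v + q v) t = FT p t + FT q t"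
  unfolding FT_def using integrable_FT[of p t] integrable_FT[of q t]
  by (simp only: scaleR_add_left Bochner_Integration.integral_add)

lemma FT_even:
  assumes p: "integrable lborel p" and e: "\<And>v. p (- v) = p v"
  shows "FT p t = complex_of_real (LINT v|lborel. p v * cos (t * v))"
proof -
  have [measurable]: "p \<in> borel_measurable borel" using p by auto
  have ic: "integrable lborel (\<lambda>v. p v * cos (t * v))"
    by (rule Bochner_Integration.integrable_bound[OF p]) (auto simp: abs_mult intro!: mult_left_le)
  have isn: "integrable lborel (\<lambda>v. p v * sin (t * v))"
    by (rule Bochner_Integration.integrable_bound[OF p]) (auto simp: abs_mult intro!: mult_left_le)
  have "(LINT v|lborel. p v * sin (t * v)) = (LINT v|lborel. p (0 + -1 * v) * sin (t * (0 + -1 * v)))"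
    by (subst lborel_integral_real_affine[where c="-1" and t=0]) auto
  then have s0: "(LINT v|lborel. p v * sin (t * v)) = 0" by (simp add: e)
  have "FT p t = (CLINT v|lborel. complex_of_real (p v * cos (t * v)) + \<i> * complex_of_real (p v * sin (t * v)))"
    unfolding FT_def by (intro Bochner_Integration.integral_cong) (simp_all add: complex_eq_iff Re_exp Im_exp)
  also have "\<dots> = complex_of_real (LINT v|lborel. p v * cos (t * v)) + \<i> * complex_of_real (LINT v|lborel. p v * sin (t * v))"
    using ic isn by (subst Bochner_Integration.integral_add) (auto simp del: of_real_mult)
  finally show ?thesis by (simp add: s0)
qed

text \<open>Inversion is carried out for each function on a finite range of frequencies; only the
  difference of the transforms, dominated by \<open>b\<close>, is estimated uniformly as the range
  grows. The factor \<open>?F\<close> is bounded by the length of the interval.\<close>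

lemma AE_bound_FT_aux:
  fixes p n :: "real \<Rightarrow> real"
  assumes p: "integrable lborel p" "\<And>v. 0 \<le> p v" "0 < (LINT v|lborel. p v)"
    and n: "integrable lborel n" "\<And>v. 0 \<le> n v" "0 < (LINT v|lborel. n v)"
    and b: "integrable lborel b" "\<And>t. norm (FT p t - FT n t) \<le> b t" and ab: "a \<le> c"
  shows "(LINT v|lborel. indicator {a<..c} v * (p v - n v)) \<le> (1 / (2 * pi)) * (LINT t|lborel. b t) * (c - a)"
proof -
  let ?F = "\<lambda>t::real. (iexp (-(t * a)) - iexp (-(t * c))) / (\<i> * t)"
  have [measurable]: "p \<in> borel_measurable borel" "n \<in> borel_measurable borel" "b \<in> borel_measurable borel" using p n b by auto
  have b0: "0 \<le> b t" for t using b(2)[of t] norm_ge_zero order_trans by blast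
  have Fb: "norm (?F t) \<le> c - a" for t
  proof (cases "t = 0")
    case False
    have "?F t = - ((iexp (t * (- c)) - iexp (t * (- a))) / (\<i> * t))" by (simp add: minus_divide_left)
    then show ?thesis using Levy_Inversion_aux2[of "- c" "- a" t] False ab
      by (simp add: norm_minus_commute norm_divide)
  qed (use ab in simp)
  have si: "set_integrable lborel (einterval (- ereal (real T)) (ereal (real T))) (\<lambda>t. ?F t * FT q t)" if q: "integrable lborel q" for q and T :: nat
    unfolding set_integrable_def
  proof (rule Bochner_Integration.integrable_bound)
    have [measurable]: "q \<in> borel_measurable borel" using q by auto
    show "integrable lborel (\<lambda>t. indicator {- real T..real T} t * ((c - a) * (LINT v|lborel. \<bar>q v\<bar>)))"
      by (intro integrable_mult_left integrable_real_indicator) auto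
    show "(\<lambda>t. indicator (einterval (- ereal (real T)) (ereal (real T))) t *\<^sub>R (?F t * FT q t)) \<in> borel_measurable lborel" by measurable
    show "AE t in lborel. norm (indicator (einterval (- ereal (real T)) (ereal (real T))) t *\<^sub>R (?F t * FT q t)) \<le> norm (indicator {- real T..real T} t * ((c - a) * (LINT v|lborel. \<bar>q v\<bar>)))"
    proof (rule AE_I2)
      fix t
      have "norm (?F t * FT q t) \<le> (c - a) * (LINT v|lborel. \<bar>q v\<bar>)"
        unfolding norm_mult using Fb norm_FT[OF q] ab by (intro mult_mono) auto
      moreover have "t \<in> einterval (- ereal (real T)) (ereal (real T)) \<Longrightarrow> t \<in> {- real T..real T}" by (auto simp: einterval_iff)
      ultimately show "norm (indicator (einterval (- ereal (real T)) (ereal (real T))) t *\<^sub>R (?F t * FT q t)) \<le> norm (indicator {- real T..real T} t * ((c - a) * (LINT v|lborel. \<bar>q v\<bar>)))"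
        by (auto split: split_indicator simp: abs_of_nonneg order_trans[OF norm_ge_zero])
    qed
  qed
  let ?I = "\<lambda>q T. CLBINT t=-real T..real T. ?F t * FT q t"
  have "(\<lambda>T::nat. 1 / (2 * pi) * ?I p T - 1 / (2 * pi) * ?I n T) \<longlonglongrightarrow> complex_of_real (LINT v|lborel. indicator {a<..c} v * p v) - complex_of_real (LINT v|lborel. indicator {a<..c} v * n v)"
    using Levy_density[OF p ab] Levy_density[OF n ab] unfolding FT_def by (intro tendsto_diff)
  moreover have "complex_of_real (LINT v|lborel. indicator {a<..c} v * p v) - complex_of_real (LINT v|lborel. indicator {a<..c} v * n v) = complex_of_real (LINT v|lborel. indicator {a<..c} v * (p v - n v))"
    using integrable_mult_indicator[of "{a<..c}" lborel p] integrable_mult_indicator[of "{a<..c}" lborel n] p n by (simp add: right_diff_distrib)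
  ultimately have lim: "(\<lambda>T::nat. norm (1 / (2 * pi) * ?I p T - 1 / (2 * pi) * ?I n T)) \<longlonglongrightarrow> norm (complex_of_real (LINT v|lborel. indicator {a<..c} v * (p v - n v)))"
    by (intro tendsto_norm) simp
  have bd: "norm (1 / (2 * pi) * ?I p T - 1 / (2 * pi) * ?I n T) \<le> (1 / (2 * pi)) * (LINT t|lborel. b t) * (c - a)" for T :: nat
  proof -
    have eq: "1 / (2 * pi) * ?I p T - 1 / (2 * pi) * ?I n T = complex_of_real (1 / (2 * pi)) * (CLINT t|lborel. indicator (einterval (- ereal (real T)) (ereal (real T))) t *\<^sub>R (?F t * (FT p t - FT n t)))"
    proof -
      have "?I p T - ?I n T = (CLINT t|lborel. indicator (einterval (- ereal (real T)) (ereal (real T))) t *\<^sub>R (?F t * FT p t)) - (CLINT t|lborel. indicator (einterval (- ereal (real T)) (ereal (real T))) t *\<^sub>R (?F t * FT n t))"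
        by (simp add: interval_lebesgue_integral_le_eq set_lebesgue_integral_def)
      also have "\<dots> = (CLINT t|lborel. indicator (einterval (- ereal (real T)) (ereal (real T))) t *\<^sub>R (?F t * FT p t) - indicator (einterval (- ereal (real T)) (ereal (real T))) t *\<^sub>R (?F t * FT n t))"
        using si[OF p(1), of T] si[OF n(1), of T] unfolding set_integrable_def by (intro Bochner_Integration.integral_diff[symmetric])
      also have "\<dots> = (CLINT t|lborel. indicator (einterval (- ereal (real T)) (ereal (real T))) t *\<^sub>R (?F t * (FT p t - FT n t)))"
        by (intro Bochner_Integration.integral_cong) (auto simp: right_diff_distrib split: split_indicator)
      finally have d: "?I p T - ?I n T = (CLINT t|lborel. indicator (einterval (- ereal (real T)) (ereal (real T))) t *\<^sub>R (?F t * (FT p t - FT n t)))" .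
      show ?thesis unfolding d[symmetric] by (simp only: right_diff_distrib)
    qed
    have "norm (CLINT t|lborel. indicator (einterval (- ereal (real T)) (ereal (real T))) t *\<^sub>R (?F t * (FT p t - FT n t))) \<le> (LINT t|lborel. b t * (c - a))"
    proof (rule order_trans[OF integral_norm_bound integral_le_bound])
      show "integrable lborel (\<lambda>t. b t * (c - a))" using b(1) by simp
      show "AE t in lborel. norm (indicator (einterval (- ereal (real T)) (ereal (real T))) t *\<^sub>R (?F t * (FT p t - FT n t))) \<le> b t * (c - a)"
      proof (rule AE_I2)
        fix t
        have "norm (?F t * (FT p t - FT n t)) \<le> (c - a) * b t"
          unfolding norm_mult using Fb b(2) ab by (intro mult_mono) auto
        moreover have "0 \<le> (c - a) * b t" using ab b0 by simp
        ultimately show "norm (indicator (einterval (- ereal (real T)) (ereal (real T))) t *\<^sub>R (?F t * (FT p t - FT n t))) \<le> b t * (c - a)"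
          by (auto split: split_indicator simp: mult.commute)
      qed
      show "AE t in lborel. 0 \<le> b t * (c - a)" using ab b0 by simp
    qed
    from mult_left_mono[OF this, of "1 / (2 * pi)"] show ?thesis unfolding eq norm_mult norm_of_real by (simp add: mult.assoc)
  qed
  have "norm (complex_of_real (LINT v|lborel. indicator {a<..c} v * (p v - n v))) \<le> (1 / (2 * pi)) * (LINT t|lborel. b t) * (c - a)"
    using lim bd by (intro LIMSEQ_le_const2[OF lim]) auto
  then show ?thesis by simp
qed

lemma AE_bound_FT:
  fixes p n :: "real \<Rightarrow> real"
  assumes p: "integrable lborel p" "\<And>v. 0 \<le> p v" and n: "integrable lborel n" "\<And>v. 0 \<le> n v"
    and b: "integrable lborel b" "\<And>t. norm (FT p t - FT n t) \<le> b t"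
  shows "AE v in lborel. \<bar>p v - n v\<bar> \<le> (1 / (2 * pi)) * (LINT t|lborel. b t)"
proof -
  define M where "M = (1 / (2 * pi)) * (LINT t|lborel. b t)"
  have "0 \<le> b t" for t using b(2)[of t] norm_ge_zero order_trans by blast
  then have M: "0 \<le> M" by (simp add: M_def integral_nonneg_AE)
  \<comment> \<open>Added to both functions: it makes their masses positive, as the normalisation in
    Levy inversion requires, and cancels in the difference.\<close>
  define \<phi> where "\<phi> = std_normal_density"
  have \<phi>: "integrable lborel \<phi>" "\<And>v. 0 < \<phi> v" unfolding \<phi>_def by (auto simp: normal_density_pos)
  have pos: "0 < (LINT v|lborel. q v + \<phi> v)" if q: "integrable lborel q" "\<And>v. 0 \<le> q v" for q
  proof -
    have "0 \<le> (LINT v|lborel. q v)" using q by (simp add: integral_nonneg_AE)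
    moreover have "(LINT v|lborel. \<phi> v) = 1" unfolding \<phi>_def by (simp add: integral_normal_density)
    moreover have "(LINT v|lborel. q v + \<phi> v) = (LINT v|lborel. q v) + (LINT v|lborel. \<phi> v)" using q \<phi> by simp
    ultimately show ?thesis by linarith
  qed
  have up: "AE v in lborel. p v - n v \<le> M"
    if p: "integrable lborel p" "\<And>v. 0 \<le> p v" and n: "integrable lborel n" "\<And>v. 0 \<le> n v" and b2: "\<And>t. norm (FT p t - FT n t) \<le> b t" for p n
  proof (rule interval_bound_imp_AE)
    show "integrable lborel (\<lambda>v. p v - n v)" using p n by simp
    fix a c :: real assume "a \<le> c"
    have "(LINT v|lborel. indicator {a<..c} v * ((p v + \<phi> v) - (n v + \<phi> v))) \<le> M * (c - a)"
      unfolding M_def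
    proof (rule AE_bound_FT_aux[OF _ _ pos[OF p] _ _ pos[OF n] b(1) _ \<open>a \<le> c\<close>])
      show "norm (FT (\<lambda>v. p v + \<phi> v) t - FT (\<lambda>v. n v + \<phi> v) t) \<le> b t" for t
        using b2 p n \<phi> by (simp add: FT_add)
    qed (use p n \<phi> \<phi>(2)[THEN less_imp_le] in \<open>auto intro: add_nonneg_nonneg\<close>)
    then show "(LINT v|lborel. indicator {a<..c} v * (p v - n v)) \<le> M * (c - a)" by simp
  qed (rule M)
  have "AE v in lborel. p v - n v \<le> M" using b(2) by (intro up p n)
  moreover have "AE v in lborel. n v - p v \<le> M" using b(2) by (intro up p n) (simp add: norm_minus_commute)
  ultimately show ?thesis unfolding M_def[symmetric] by eventually_elim auto
qed

lemma om_1: "om 1 t = inverse (1 + t\<^sup>2)" unfolding om_def by (simp add: powr_minus)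

lemma integrable_om_1: "integrable lborel (om 1)"
proof -
  have "set_integrable lborel (einterval (-\<infinity>) \<infinity>) (\<lambda>x. inverse (1 + x^2))"
    by (rule integrable_inverse_1_plus_square)
  then show ?thesis unfolding set_integrable_def by (simp add: om_1[abs_def])
qed

definition om_1_mass where "om_1_mass = (LINT t|lborel. om 1 t)"

text \<open>Inversion bounds \<open>(1 + v^2) * (p v - n v)\<close> uniformly at the cost of one
  integral of \<open>om 1\<close> in frequency. Dividing by \<open>1 + v^2\<close> and integrating
  over v costs another, hence the square.\<close>

lemma L1_from_FT:
  fixes p n :: "real \<Rightarrow> real"
  assumes p: "integrable lborel (\<lambda>v. (1 + v\<^sup>2) * p v)" "\<And>v. 0 \<le> p v" and n: "integrable lborel (\<lambda>v. (1 + v\<^sup>2) * n v)" "\<And>v. 0 \<le> n v"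
    and E: "\<And>t. norm (FT (\<lambda>v. (1 + v\<^sup>2) * p v) t - FT (\<lambda>v. (1 + v\<^sup>2) * n v) t) \<le> E * om 1 t"
    and m[measurable]: "p \<in> borel_measurable borel" "n \<in> borel_measurable borel"
  shows "(LINT v|lborel. \<bar>p v - n v\<bar>) \<le> (1 / (2 * pi)) * om_1_mass\<^sup>2 * E"
proof -
  have "AE v in lborel. \<bar>(1 + v\<^sup>2) * p v - (1 + v\<^sup>2) * n v\<bar> \<le> (1 / (2 * pi)) * (LINT t|lborel. E * om 1 t)"
    using p n E by (intro AE_bound_FT integrable_mult_right integrable_om_1) auto
  then have "AE v in lborel. \<bar>p v - n v\<bar> \<le> (1 / (2 * pi)) * (E * om_1_mass) * om 1 v"
  proof eventually_elim
    case (elim v)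
    have "\<bar>p v - n v\<bar> = ((1 + v\<^sup>2) * \<bar>p v - n v\<bar>) * inverse (1 + v\<^sup>2)" by simp
    also have "(1 + v\<^sup>2) * \<bar>p v - n v\<bar> = \<bar>(1 + v\<^sup>2) * p v - (1 + v\<^sup>2) * n v\<bar>" by (simp add: right_diff_distrib[symmetric] abs_mult)
    also have "\<dots> * inverse (1 + v\<^sup>2) \<le> (1 / (2 * pi)) * (E * om_1_mass) * inverse (1 + v\<^sup>2)"
      using elim by (intro mult_right_mono) (simp_all add: om_1_mass_def)
    finally show ?case unfolding om_1 .
  qed
  then have "(LINT v|lborel. \<bar>p v - n v\<bar>) \<le> (LINT v|lborel. (1 / (2 * pi)) * (E * om_1_mass) * om 1 v)"
    by (intro integral_le_bound integrable_mult_right integrable_om_1) (auto elim: eventually_mono intro: order_trans[OF abs_ge_zero])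
  then show ?thesis by (simp add: om_1_mass_def power2_eq_square mult_ac)
qed

section \<open>The Gaussian\<close>

definition gauss :: "real \<Rightarrow> real measure" where "gauss \<sigma> = density lborel (\<lambda>v. ennreal (normal_density 0 \<sigma> v))"

definition gs :: "real \<Rightarrow> nat \<Rightarrow> real \<Rightarrow> real" where "gs \<sigma> j \<xi> = (LINT v|gauss \<sigma>. tr j \<xi> v)"

lemma sets_gauss [simp, measurable_cong]: "sets (gauss \<sigma>) = sets borel" by (simp add: gauss_def)

lemma prob_gauss: "0 < \<sigma> \<Longrightarrow> prob_space (gauss \<sigma>)"
  unfolding gauss_def by (rule prob_space_normal_density)

lemma finite_gauss: "0 < \<sigma> \<Longrightarrow> finite_measure (gauss \<sigma>)"
  using prob_gauss by (simp add: prob_space.finite_measure)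

lemma gauss_sym: "distr (gauss \<sigma>) borel uminus = gauss \<sigma>"
  unfolding gauss_def by (rule distr_density_even) (auto simp: normal_density_def)

lemma integral_gauss: "f \<in> borel_measurable borel \<Longrightarrow> (LINT v|gauss \<sigma>. f v) = (LINT v|lborel. normal_density 0 \<sigma> v * (f v :: real))"
  unfolding gauss_def by (subst integral_density) auto
lemma integrable_gauss: "f \<in> borel_measurable borel \<Longrightarrow> integrable (gauss \<sigma>) f \<longleftrightarrow> integrable lborel (\<lambda>v. normal_density 0 \<sigma> v * (f v :: real))"
  unfolding gauss_def by (subst integrable_density) auto

lemma gauss_moment:
  assumes "0 < \<sigma>"
  shows "integrable (gauss \<sigma>) (\<lambda>v. v ^ (2 * k))" "(LINT v|gauss \<sigma>. v ^ (2 * k)) = fact (2 * k) / ((2 / \<sigma>\<^sup>2) ^ k * fact k)"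
  using normal_moment_even[OF assms, of 0 k] by (auto simp: integral_gauss integrable_gauss has_bochner_integral_iff)

lemma gauss_moment_2:
  assumes "0 < \<sigma>" shows "integrable (gauss \<sigma>) (\<lambda>v. v\<^sup>2)" "(LINT v|gauss \<sigma>. v\<^sup>2) = \<sigma>\<^sup>2"
  using gauss_moment[OF assms, of 1] assms unfolding mult_1_right by (simp_all only:, simp)

lemma gauss_moment_4:
  assumes "0 < \<sigma>" shows "integrable (gauss \<sigma>) (\<lambda>v. v^4)" "(LINT v|gauss \<sigma>. v^4) = 3 * \<sigma>^4"
proof -
  have e: "2 * 2 = (4::nat)" by simp
  note m = gauss_moment[OF assms, of 2, unfolded e]
  show "integrable (gauss \<sigma>) (\<lambda>v. v^4)" by (rule m(1))
  show "(LINT v|gauss \<sigma>. v^4) = 3 * \<sigma>^4" unfolding m(2) using assms by (simp add: fact_numeral power_divide)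
qed

lemma gauss_weight:
  assumes "0 < \<sigma>"
  shows "integrable (gauss \<sigma>) (\<lambda>v. 1 + v\<^sup>2)" "(LINT v|gauss \<sigma>. 1 + v\<^sup>2) = 1 + \<sigma>\<^sup>2"
proof -
  interpret prob_space "gauss \<sigma>" by (rule prob_gauss) fact
  show "integrable (gauss \<sigma>) (\<lambda>v. 1 + v\<^sup>2)" "(LINT v|gauss \<sigma>. 1 + v\<^sup>2) = 1 + \<sigma>\<^sup>2"
    using gauss_moment_2[OF assms] prob_space by simp_all
qed

lemma gauss_tr: assumes "0 < \<sigma>" shows "integrable (gauss \<sigma>) (tr j \<xi>)"
  by (rule integrable_weight[OF gauss_weight(1)[OF assms]]) (auto simp: tr_bound)

text \<open>The product of two centred normal densities of equal variance depends only on the sum of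
  the squares, which a rotation preserves.\<close>

lemma rot_conv_gauss:
  assumes s: "0 < \<sigma>" shows "rot_conv (gauss \<sigma>) \<theta> = gauss \<sigma>"
proof (rule measure_eqI)
  show "sets (rot_conv (gauss \<sigma>) \<theta>) = sets (gauss \<sigma>)" by (simp add: rot_conv_def)
  fix A assume "A \<in> sets (rot_conv (gauss \<sigma>) \<theta>)"
  then have A[measurable]: "A \<in> sets borel" by (simp add: rot_conv_def)
  let ?n = "normal_density 0 \<sigma>"
  have one: "(\<integral>\<^sup>+v. ennreal (?n v) \<partial>lborel) = 1"
    using prob_space.emeasure_space_1[OF prob_gauss[OF s]] by (simp add: gauss_def emeasure_density)
  have rot: "?n (v * cos \<theta> - w * sin \<theta>) * ?n (v * sin \<theta> + w * cos \<theta>) = ?n v * ?n w" for v w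
  proof -
    have "(v * c - w * z)\<^sup>2 + (v * z + w * c)\<^sup>2 = (v\<^sup>2 + w\<^sup>2) * (c\<^sup>2 + z\<^sup>2)" for c z :: real
      by (simp add: power2_eq_square algebra_simps)
    from this[of "cos \<theta>" "sin \<theta>"]
    have "(v * cos \<theta> - w * sin \<theta>)\<^sup>2 + (v * sin \<theta> + w * cos \<theta>)\<^sup>2 = v\<^sup>2 + w\<^sup>2" by simp
    then have e: "- (v * cos \<theta> - w * sin \<theta>)\<^sup>2 / (2 * \<sigma>\<^sup>2) + - (v * sin \<theta> + w * cos \<theta>)\<^sup>2 / (2 * \<sigma>\<^sup>2) = - v\<^sup>2 / (2 * \<sigma>\<^sup>2) + - w\<^sup>2 / (2 * \<sigma>\<^sup>2)"
    proof -
      have gen: "- x / d + - y / d = - (x + y) / d" for x y d :: real by (simp add: diff_divide_distrib add_divide_distrib)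
      show ?thesis unfolding gen \<open>_ = v\<^sup>2 + w\<^sup>2\<close> ..
    qed
    have m: "?n x * ?n y = (1 / sqrt (2 * pi * \<sigma>\<^sup>2))\<^sup>2 * exp (- x\<^sup>2 / (2 * \<sigma>\<^sup>2) + - y\<^sup>2 / (2 * \<sigma>\<^sup>2))" for x y
      unfolding normal_density_def by (simp only: exp_add diff_zero power2_eq_square mult_ac)
    show ?thesis unfolding m e ..
  qed
  have rot': "(v * cos \<theta> - w * sin \<theta>) * cos \<theta> + (v * sin \<theta> + w * cos \<theta>) * sin \<theta> = v" for v w
  proof -
    have "(v * c - w * z) * c + (v * z + w * c) * z = v * (c\<^sup>2 + z\<^sup>2)" for c z :: real
      by (simp add: power2_eq_square algebra_simps)
    from this[of "cos \<theta>" "sin \<theta>"] show ?thesis by simp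
  qed
  have "emeasure (rot_conv (gauss \<sigma>) \<theta>) A = (\<integral>\<^sup>+v. indicator A v \<partial>rot_conv (gauss \<sigma>) \<theta>)" by (simp add: rot_conv_def)
  also have "\<dots> = (\<integral>\<^sup>+x. \<integral>\<^sup>+y. indicator A (x * cos \<theta> + y * sin \<theta>) * (ennreal (?n x) * ennreal (?n y)) \<partial>lborel \<partial>lborel)"
    unfolding gauss_def by (rule nn_integral_rot_conv) (auto simp: one)
  also have "\<dots> = (\<integral>\<^sup>+v. \<integral>\<^sup>+w. indicator A ((v * cos \<theta> - w * sin \<theta>) * cos \<theta> + (v * sin \<theta> + w * cos \<theta>) * sin \<theta>)
       * (ennreal (?n (v * cos \<theta> - w * sin \<theta>)) * ennreal (?n (v * sin \<theta> + w * cos \<theta>))) \<partial>lborel \<partial>lborel)"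
    by (rule rotation[symmetric, where K="\<lambda>x y. indicator A (x * cos \<theta> + y * sin \<theta>) * (ennreal (?n x) * ennreal (?n y))"]) auto
  also have "\<dots> = (\<integral>\<^sup>+v. \<integral>\<^sup>+w. (indicator A v * ennreal (?n v)) * ennreal (?n w) \<partial>lborel \<partial>lborel)"
    unfolding rot' by (simp add: ennreal_mult[symmetric] rot) (simp add: ennreal_mult mult.assoc)
  also have "\<dots> = (\<integral>\<^sup>+v. indicator A v * ennreal (?n v) \<partial>lborel)" by (simp add: nn_integral_cmult one)
  also have "\<dots> = emeasure (gauss \<sigma>) A" unfolding gauss_def by (simp add: emeasure_density mult.commute)
  finally show "emeasure (rot_conv (gauss \<sigma>) \<theta>) A = emeasure (gauss \<sigma>) A" .
qed

lemma gs_stat: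
  assumes s: "0 < \<sigma>" and j: "j < 3"
  shows "nonlin j (gs \<sigma>) \<xi> \<theta> = gs \<sigma> j \<xi>"
proof -
  have g: "gs \<sigma> = (\<lambda>i \<eta>. LINT x|gauss \<sigma>. tr i \<eta> x)" by (simp add: gs_def fun_eq_iff)
  have "(LINT v|rot_conv (gauss \<sigma>) \<theta>. tr j \<xi> v) = nonlin j (gs \<sigma>) \<xi> \<theta>"
    unfolding g using integral_tr_rotate[OF finite_gauss[OF s] sets_gauss gauss_sym, of j \<xi> \<theta>] j gauss_weight(1)[OF s]
    by (simp add: integral_rot_conv)
  then show ?thesis unfolding rot_conv_gauss[OF s] by (simp add: gs_def)
qed

lemma gs_bound: assumes s: "0 < \<sigma>" shows "\<bar>gs \<sigma> j \<xi>\<bar> \<le> 1 + \<sigma>\<^sup>2"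
proof -
  have "\<bar>gs \<sigma> j \<xi>\<bar> \<le> (LINT v|gauss \<sigma>. 1 + v\<^sup>2)" unfolding gs_def
    by (rule abs_integral_le_bound[OF gauss_weight(1)[OF s]]) (simp add: tr_bound)
  then show ?thesis using gauss_weight(2)[OF s] by simp
qed

lemma gs_0: assumes s: "0 < \<sigma>" shows "gs \<sigma> 0 \<xi> = exp (- (\<sigma> * \<xi>)\<^sup>2 / 2)"
proof -
  have [measurable]: "tr 0 \<xi> \<in> borel_measurable borel" by simp
  have "gs \<sigma> 0 \<xi> = (LINT v|lborel. normal_density 0 \<sigma> v * cos (\<xi> * v))"
    unfolding gs_def by (subst integral_gauss) (auto simp: tr_def)
  also have "\<dots> = \<bar>\<sigma>\<bar> *\<^sub>R (LINT x|lborel. normal_density 0 \<sigma> (0 + \<sigma> * x) * cos (\<xi> * (0 + \<sigma> * x)))"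
    using s by (intro lborel_integral_real_affine) auto
  also have "\<dots> = (LINT x|lborel. std_normal_density x * cos (\<sigma> * \<xi> * x))"
  proof -
    have nd: "\<sigma> * normal_density 0 \<sigma> (0 + \<sigma> * x) = std_normal_density x" for x
      using s by (simp add: normal_density_def power_mult_distrib real_sqrt_mult)
    then have "\<sigma> * (normal_density 0 \<sigma> (0 + \<sigma> * x) * cos (\<xi> * (0 + \<sigma> * x))) = std_normal_density x * cos (\<sigma> * \<xi> * x)" for x
    proof -
      have "\<sigma> * (normal_density 0 \<sigma> (0 + \<sigma> * x) * cos (\<xi> * (0 + \<sigma> * x))) = (\<sigma> * normal_density 0 \<sigma> (0 + \<sigma> * x)) * cos (\<xi> * (0 + \<sigma> * x))"
        by (simp only: mult.assoc)
      also have "\<dots> = std_normal_density x * cos (\<sigma> * \<xi> * x)" unfolding nd by (simp add: mult_ac)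
      finally show ?thesis .
    qed
    then have "(LINT x|lborel. \<sigma> * (normal_density 0 \<sigma> (0 + \<sigma> * x) * cos (\<xi> * (0 + \<sigma> * x)))) = (LINT x|lborel. std_normal_density x * cos (\<sigma> * \<xi> * x))"
      by (simp only:)
    then show ?thesis using s by (simp only: integral_mult_right_zero real_scaleR_def abs_of_pos)
  qed
  also have "\<dots> = Re (complex_of_real (LINT x|lborel. std_normal_density x * cos (\<sigma> * \<xi> * x)))" by simp
  also have "complex_of_real (LINT x|lborel. std_normal_density x * cos (\<sigma> * \<xi> * x)) = FT std_normal_density (\<sigma> * \<xi>)"
    by (rule FT_even[symmetric], simp, simp add: normal_density_def)
  also have "\<dots> = char std_normal_distribution (\<sigma> * \<xi>)"
    unfolding FT_def char_def by (subst integral_density) auto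
  also have "\<dots> = complex_of_real (exp (- (\<sigma> * \<xi>)\<^sup>2 / 2))" by (simp add: char_std_normal_distribution)
  finally show ?thesis by simp
qed

text \<open>From \<open>x \<le> exp x\<close> with \<open>x = (1 + \<xi>^2) * a / e\<close>, raised
  to the power \<open>e\<close>.\<close>

lemma exp_le_om:
  assumes a: "0 < a" and e: "0 \<le> e"
  shows "\<exists>K\<ge>0. \<forall>\<xi>. exp (- a * \<xi>\<^sup>2) \<le> K * om e \<xi>"
proof (cases "e = 0")
  case True then show ?thesis using a by (intro exI[of _ 1]) auto
next
  case False
  then have e: "0 < e" using e by simp
  show ?thesis
  proof (intro exI[of _ "(e / a) powr e * exp a"] conjI allI)
    fix \<xi> :: real
    let ?u = "1 + \<xi>\<^sup>2"
    have u: "0 < ?u" by simp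
    have "?u * a / e \<le> exp (?u * a / e)" using exp_ge_add_one_self[of "?u * a / e"] by linarith
    then have "?u \<le> (e / a) * exp (?u * a / e)" using a e by (simp add: field_simps)
    then have "?u powr e \<le> ((e / a) * exp (?u * a / e)) powr e" using u e by (intro powr_mono2) auto
    also have "\<dots> = (e / a) powr e * exp (?u * a / e) powr e" by (simp only: powr_mult)
    also have "\<dots> = (e / a) powr e * exp (?u * a)" using e by (simp add: exp_powr_real)
    also have "\<dots> = (e / a) powr e * exp a * exp (a * \<xi>\<^sup>2)" by (simp add: exp_add[symmetric] algebra_simps)
    finally have "?u powr e * exp (- a * \<xi>\<^sup>2) \<le> (e / a) powr e * exp a * exp (a * \<xi>\<^sup>2) * exp (- a * \<xi>\<^sup>2)" by (intro mult_right_mono) auto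
    also have "\<dots> = (e / a) powr e * exp a" by (simp add: mult.assoc flip: exp_add)
    finally have "?u powr e * exp (- a * \<xi>\<^sup>2) * om e \<xi> \<le> (e / a) powr e * exp a * om e \<xi>" by (intro mult_right_mono) auto
    moreover have "?u powr e * exp (- a * \<xi>\<^sup>2) * om e \<xi> = exp (- a * \<xi>\<^sup>2)" unfolding om_def by (simp add: powr_minus)
    ultimately show "exp (- a * \<xi>\<^sup>2) \<le> (e / a) powr e * exp a * om e \<xi>" by (simp only:)
  qed auto
qed

text \<open>For \<open>j > 0\<close> the stationarity identity at \<open>\<theta> = pi/4\<close> transfers the decay from \<open>gs \<sigma> 0\<close>.\<close>

lemma gs_decay:
  assumes s: "0 < \<sigma>" and e: "0 \<le> e"
  shows "\<exists>K\<ge>0. \<forall>j<3. \<forall>\<xi>. \<bar>gs \<sigma> j \<xi>\<bar> \<le> K * om e \<xi>"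
proof -
  let ?C = "1 + \<sigma>\<^sup>2"
  \<comment> \<open>The constant 1/8 is that of \<open>gs \<sigma> 0\<close> at half the frequency:
    index 2 refers to index 1 and index 1 to index 0, and each reference at pi/4 divides the
    frequency by sqrt 2.\<close>
  define G where "G \<xi> = exp (- (\<sigma>\<^sup>2 / 8) * \<xi>\<^sup>2)" for \<xi> :: real
  have G: "0 \<le> G \<xi>" for \<xi> by (simp add: G_def)
  have C: "1 \<le> ?C" by simp
  let ?c = "cos (pi/4)"
  have c2: "?c\<^sup>2 = 1/2" by (simp add: cos_45 power_divide)
  have cs: "sin (pi/4) = ?c" by (simp add: sin_45 cos_45)
  have cle: "\<bar>?c\<bar> \<le> 1" by simp
  have g0: "\<bar>gs \<sigma> 0 (\<xi> * ?c)\<bar> \<le> G \<xi>" "\<bar>gs \<sigma> 0 (\<xi> * ?c * ?c)\<bar> \<le> G \<xi>" for \<xi>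
  proof -
    have 0: "0 \<le> \<sigma>\<^sup>2 * \<xi>\<^sup>2" by simp
    have eq: "(\<sigma> * (\<xi> * ?c))\<^sup>2 = \<sigma>\<^sup>2 * \<xi>\<^sup>2 / 2" unfolding power_mult_distrib c2 by simp
    show "\<bar>gs \<sigma> 0 (\<xi> * ?c)\<bar> \<le> G \<xi>" unfolding gs_0[OF s] G_def eq using 0 by simp
    have "\<xi> * ?c * ?c = \<xi> / 2" using c2 by (simp add: power2_eq_square mult.assoc)
    then have eq: "(\<sigma> * (\<xi> * ?c * ?c))\<^sup>2 = \<sigma>\<^sup>2 * \<xi>\<^sup>2 / 4" by (simp only: power_mult_distrib power_divide) simp
    show "\<bar>gs \<sigma> 0 (\<xi> * ?c * ?c)\<bar> \<le> G \<xi>" unfolding gs_0[OF s] G_def eq by simp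
  qed
  have b0: "\<bar>gs \<sigma> 0 \<xi>\<bar> \<le> ?C * G \<xi>" for \<xi>
  proof -
    have "\<bar>gs \<sigma> 0 \<xi>\<bar> \<le> G \<xi>" unfolding gs_0[OF s] G_def by (simp add: power_mult_distrib)
    then show ?thesis using mult_right_mono[OF C G[of \<xi>]] by simp
  qed
  have st1: "gs \<sigma> 1 \<xi> = ?c * (gs \<sigma> 1 (\<xi> * ?c) * gs \<sigma> 0 (\<xi> * ?c)) + ?c * (gs \<sigma> 0 (\<xi> * ?c) * gs \<sigma> 1 (\<xi> * ?c))" for \<xi>
    using gs_stat[OF s, of 1 \<xi> "pi/4"] by (simp add: nonlin_def cs)
  have st2: "gs \<sigma> 2 \<xi> = ?c\<^sup>2 * (gs \<sigma> 2 (\<xi> * ?c) * gs \<sigma> 0 (\<xi> * ?c)) + ?c\<^sup>2 * (gs \<sigma> 0 (\<xi> * ?c) * gs \<sigma> 2 (\<xi> * ?c)) - 2 * ((?c * ?c) * (gs \<sigma> 1 (\<xi> * ?c) * gs \<sigma> 1 (\<xi> * ?c)))" for \<xi>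
    using gs_stat[OF s, of 2 \<xi> "pi/4"] by (simp add: nonlin_def cs)
  have gb: "\<bar>gs \<sigma> j \<xi>\<bar> \<le> ?C" for j \<xi> by (rule gs_bound[OF s])
  have b1': "\<bar>gs \<sigma> 1 \<xi>\<bar> \<le> 2 * (?C * \<bar>gs \<sigma> 0 (\<xi> * ?c)\<bar>)" for \<xi>
  proof -
    have "\<bar>?c * (gs \<sigma> 1 (\<xi> * ?c) * gs \<sigma> 0 (\<xi> * ?c))\<bar> \<le> ?C * \<bar>gs \<sigma> 0 (\<xi> * ?c)\<bar>"
      by (intro abs_weight_le cle abs_mult_le gb) simp
    then show ?thesis unfolding st1[of \<xi>] by (simp add: mult_ac)
  qed
  have b1: "\<bar>gs \<sigma> 1 \<xi>\<bar> \<le> 2 * ?C * G \<xi>" for \<xi>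
    by (rule order_trans[OF b1'], unfold mult.assoc, intro mult_left_mono g0) simp_all
  have b2: "\<bar>gs \<sigma> 2 \<xi>\<bar> \<le> 2 * (?C * G \<xi>) + 2 * (2 * ?C * G \<xi> * ?C)" for \<xi>
  proof -
    have c2': "\<bar>?c\<^sup>2\<bar> \<le> 1" "\<bar>?c * ?c\<bar> \<le> 1" using c2 by (simp_all add: power2_eq_square)
    have 1: "\<bar>?c\<^sup>2 * (gs \<sigma> 2 (\<xi> * ?c) * gs \<sigma> 0 (\<xi> * ?c))\<bar> \<le> ?C * G \<xi>"
      by (intro abs_weight_le c2' abs_mult_le gb g0)
    have 2: "\<bar>?c\<^sup>2 * (gs \<sigma> 0 (\<xi> * ?c) * gs \<sigma> 2 (\<xi> * ?c))\<bar> \<le> G \<xi> * ?C"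
      by (intro abs_weight_le c2' abs_mult_le gb g0)
    have "\<bar>gs \<sigma> 1 (\<xi> * ?c)\<bar> \<le> 2 * ?C * G \<xi>"
      by (rule order_trans[OF b1'], unfold mult.assoc, intro mult_left_mono g0(2)[unfolded mult.assoc]) simp_all
    then have 3: "\<bar>(?c * ?c) * (gs \<sigma> 1 (\<xi> * ?c) * gs \<sigma> 1 (\<xi> * ?c))\<bar> \<le> 2 * ?C * G \<xi> * ?C"
      by (intro abs_weight_le c2' abs_mult_le gb)
    have gen: "\<bar>p1 + p2 - 2 * p3\<bar> \<le> 2 * b + 2 * d" if "\<bar>p1\<bar> \<le> b" "\<bar>p2\<bar> \<le> b" "\<bar>p3\<bar> \<le> d" for p1 p2 p3 b d :: real
      using that by linarith
    show ?thesis unfolding st2[of \<xi>] by (rule gen[OF 1 _ 3]) (use 2 in \<open>simp add: mult.commute\<close>)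
  qed
  obtain K where K: "0 \<le> K" "\<And>\<xi>. G \<xi> \<le> K * om e \<xi>" using exp_le_om[of "\<sigma>\<^sup>2 / 8" e] s e unfolding G_def by auto
  have all: "\<bar>gs \<sigma> j \<xi>\<bar> \<le> 6 * ?C\<^sup>2 * G \<xi>" if "j < 3" for j \<xi>
  proof -
    have gen: "y0 \<le> 6 * c\<^sup>2 * g \<and> y1 \<le> 6 * c\<^sup>2 * g \<and> y2 \<le> 6 * c\<^sup>2 * g"
      if "1 \<le> c" "0 \<le> g" "y0 \<le> c * g" "y1 \<le> 2 * c * g" "y2 \<le> 2 * (c * g) + 2 * (2 * c * g * c)" for c g y0 y1 y2 :: real
    proof -
      have "c \<le> c\<^sup>2" using self_le_power[OF that(1), of 2] by simp
      then have "c * g \<le> c\<^sup>2 * g" by (intro mult_right_mono that(2))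
      moreover have "0 \<le> c * g" using that by simp
      moreover have "2 * (2 * c * g * c) = 4 * (c\<^sup>2 * g)" "6 * c\<^sup>2 * g = 6 * (c\<^sup>2 * g)" "2 * c * g = 2 * (c * g)" by (simp_all add: power2_eq_square)
      ultimately show ?thesis using that by linarith
    qed
    from gen[OF C G[of \<xi>] b0[of \<xi>] b1[of \<xi>] b2[of \<xi>]] show ?thesis using that unfolding nat_less_3 by auto
  qed
  show ?thesis
  proof (intro exI[of _ "6 * ?C\<^sup>2 * K"] conjI allI impI)
    fix j \<xi> assume j: "j < (3::nat)"
    have "\<bar>gs \<sigma> j \<xi>\<bar> \<le> 6 * ?C\<^sup>2 * G \<xi>" by (rule all[OF j])
    also have "\<dots> \<le> 6 * ?C\<^sup>2 * (K * om e \<xi>)" by (intro mult_left_mono K) simp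
    finally show "\<bar>gs \<sigma> j \<xi>\<bar> \<le> 6 * ?C\<^sup>2 * K * om e \<xi>" by (simp add: mult.assoc)
  qed (use K in auto)
qed

text \<open>From \<open>1 + x \<le> exp x\<close> at \<open>x = \<xi>^2\<close>, raised to the power
  \<open>q\<close>; comparing exponents gives the restriction on \<open>q\<close>.\<close>

lemma gs_0_le_om:
  assumes s: "0 < \<sigma>" and q: "q \<le> \<sigma>\<^sup>2 / 2" "0 \<le> q"
  shows "\<bar>gs \<sigma> 0 \<xi>\<bar> \<le> om q \<xi>"
proof -
  have "(1 + \<xi>\<^sup>2) powr q \<le> exp (\<xi>\<^sup>2) powr q" using q exp_ge_add_one_self[of "\<xi>\<^sup>2"] by (intro powr_mono2) auto
  also have "\<dots> = exp (\<xi>\<^sup>2 * q)" by (simp add: exp_powr_real)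
  also have "\<dots> \<le> exp (\<xi>\<^sup>2 * (\<sigma>\<^sup>2 / 2))" using mult_left_mono[OF q(1), of "\<xi>\<^sup>2"] by simp
  finally have le: "(1 + \<xi>\<^sup>2) powr q \<le> exp (\<xi>\<^sup>2 * (\<sigma>\<^sup>2 / 2))" .
  have "inverse (exp (\<xi>\<^sup>2 * (\<sigma>\<^sup>2 / 2))) \<le> inverse ((1 + \<xi>\<^sup>2) powr q)" using le by (intro le_imp_inverse_le) auto
  moreover have "gs \<sigma> 0 \<xi> = inverse (exp (\<xi>\<^sup>2 * (\<sigma>\<^sup>2 / 2)))" unfolding gs_0[OF s] by (simp add: exp_minus[symmetric] power_mult_distrib mult_ac)
  ultimately show ?thesis unfolding om_def by (simp add: powr_minus)
qed

section \<open>From amplitudes to the L1 distance\<close>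

context kac_levels begin

lemma lev_AE_finite: "AE v in lborel. lev d v t < \<infinity>"
  using nn_integral_PInf_AE[OF _ less_imp_neq[OF lev_fin[of d t]]] by (auto simp: less_top)

definition den where "den d t v = enn2real (lev d v t)"

lemma den_nonneg [simp]: "0 \<le> den d t v" by (simp add: den_def)
lemma den_meas [measurable]: "den d t \<in> borel_measurable borel" unfolding den_def[abs_def] by measurable

lemma den_eq: "AE v in lborel. lev d v t = ennreal (den d t v)"
  using lev_AE_finite[of d t] unfolding den_def by eventually_elim simp

lemma mu_den: "mu d t = density lborel (\<lambda>v. ennreal (den d t v))"
  unfolding mu_def by (rule density_cong) (use den_eq in auto)

lemma integral_mu: "f \<in> borel_measurable borel \<Longrightarrow> (LINT v|mu d t. f v) = (LINT v|lborel. den d t v * (f v :: real))"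
  unfolding mu_den by (subst integral_density) auto
lemma integrable_mu: "f \<in> borel_measurable borel \<Longrightarrow> integrable (mu d t) f \<longleftrightarrow> integrable lborel (\<lambda>v. den d t v * (f v :: real))"
  unfolding mu_den by (subst integrable_density) auto

lemma den_integrable: "integrable lborel (den d t)"
proof -
  interpret finite_measure "mu d t" by (rule finite_mu)
  have "integrable (mu d t) (\<lambda>_. 1 :: real)" by (rule integrable_const)
  then show ?thesis by (subst (asm) integrable_mu) simp_all
qed

lemma second_integrable:
  assumes "second s2" shows "integrable (mu d t) (\<lambda>v. 1 + v\<^sup>2)"
  using weight_bounds(1)[OF weight_2, of "1 + s2" d t] assms
  by (auto simp: second_def intro!: integrable_weight_nn[where w="\<lambda>x. 1 + x\<^sup>2"])

lemma Amp_bound: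
  assumes s2: "second s2" "0 \<le> s2" and t: "0 \<le> t"
  shows "\<bar>Amp 0 j \<xi> t\<bar> \<le> 1 + s2"
proof -
  note i = second_integrable[OF s2(1), of 0 t]
  have "\<bar>Amp 0 j \<xi> t\<bar> \<le> (LINT v|mu 0 t. 1 + v\<^sup>2)" unfolding Amp_def
    by (rule abs_integral_le_bound[OF i]) (simp add: tr_bound)
  also have "\<dots> \<le> 1 + s2"
  proof -
    have "ennreal (LINT v|mu 0 t. 1 + v\<^sup>2) = (\<integral>\<^sup>+v. ennreal (1 + v\<^sup>2) \<partial>mu 0 t)"
      using i by (intro nn_integral_eq_integral[symmetric]) auto
    also have "\<dots> \<le> ennreal (1 + s2)" using s2 t by (simp add: second_def)
    finally show ?thesis using s2(2) by (subst (asm) ennreal_le_iff) simp_all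
  qed
  finally show ?thesis .
qed

text \<open>The reason for carrying index 2: the weight \<open>1 + v^2\<close> turns into the sum of
  the amplitudes of indices 0 and 2.\<close>

lemma FT_den:
  assumes "second s2"
  shows "integrable lborel (\<lambda>v. (1 + v\<^sup>2) * den d t v)" "FT (\<lambda>v. (1 + v\<^sup>2) * den d t v) x = complex_of_real (Amp d 0 x t + Amp d 2 x t)"
proof -
  show i: "integrable lborel (\<lambda>v. (1 + v\<^sup>2) * den d t v)"
    using second_integrable[OF assms, of d t] by (subst (asm) integrable_mu) (auto simp: mult.commute)
  have "FT (\<lambda>v. (1 + v\<^sup>2) * den d t v) x = complex_of_real (LINT v|lborel. (1 + v\<^sup>2) * den d t v * cos (x * v))"
    by (rule FT_even[OF i]) (simp add: den_def lev_even del: lev.simps)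
  also have "(LINT v|lborel. (1 + v\<^sup>2) * den d t v * cos (x * v)) = (LINT v|mu d t. tr 0 x v + tr 2 x v)"
    by (subst integral_mu) (auto simp: tr_def algebra_simps)
  also have "\<dots> = Amp d 0 x t + Amp d 2 x t"
    unfolding Amp_def using assms by (intro Bochner_Integration.integral_add Amp_eqs(1)) auto
  finally show "FT (\<lambda>v. (1 + v\<^sup>2) * den d t v) x = complex_of_real (Amp d 0 x t + Amp d 2 x t)" .
qed

text \<open>\<open>lev_le_F\<close> fixes the sign of the difference, so the distance is a loss of
  mass, and mass is the index-0 amplitude at frequency 0.\<close>

lemma L1_levels:
  assumes t: "0 \<le> t"
  shows "(LINT v|lborel. \<bar>den 0 t v - den d t v\<bar>) = Amp 0 0 0 t - Amp d 0 0 t"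
proof -
  have mass: "(LINT v|lborel. den e t v) = Amp e 0 0 t" for e
    unfolding Amp_def by (subst integral_mu) (auto simp: tr_def)
  have "(LINT v|lborel. \<bar>den 0 t v - den d t v\<bar>) = (LINT v|lborel. den 0 t v - den d t v)"
  proof (rule integral_cong_AE)
    show "AE v in lborel. \<bar>den 0 t v - den d t v\<bar> = den 0 t v - den d t v"
      using lev_le_F[of d] lev_AE_finite[of 0 t]
    proof eventually_elim
      case (elim v)
      then have "den d t v \<le> den 0 t v" unfolding den_def using t by (intro enn2real_mono) auto
      then show ?case by simp
    qed
  qed auto
  also have "\<dots> = (LINT v|lborel. den 0 t v) - (LINT v|lborel. den d t v)"
    by (rule Bochner_Integration.integral_diff) (rule den_integrable)+
  also have "\<dots> = Amp 0 0 0 t - Amp d 0 0 t" by (simp only: mass)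
  finally show ?thesis .
qed

lemma FT_normal:
  assumes s: "0 < \<sigma>"
  shows "integrable lborel (\<lambda>v. (1 + v\<^sup>2) * normal_density 0 \<sigma> v)" "FT (\<lambda>v. (1 + v\<^sup>2) * normal_density 0 \<sigma> v) x = complex_of_real (gs \<sigma> 0 x + gs \<sigma> 2 x)"
proof -
  show i: "integrable lborel (\<lambda>v. (1 + v\<^sup>2) * normal_density 0 \<sigma> v)"
    using gauss_weight(1)[OF s] by (subst (asm) integrable_gauss) (auto simp: mult.commute)
  have "FT (\<lambda>v. (1 + v\<^sup>2) * normal_density 0 \<sigma> v) x = complex_of_real (LINT v|lborel. (1 + v\<^sup>2) * normal_density 0 \<sigma> v * cos (x * v))"
    by (rule FT_even[OF i]) (simp add: normal_density_def)
  also have "(LINT v|lborel. (1 + v\<^sup>2) * normal_density 0 \<sigma> v * cos (x * v)) = (LINT v|gauss \<sigma>. tr 0 x v + tr 2 x v)"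
    by (subst integral_gauss) (auto simp: tr_def algebra_simps)
  also have "\<dots> = gs \<sigma> 0 x + gs \<sigma> 2 x"
    unfolding gs_def by (intro Bochner_Integration.integral_add gauss_tr s)
  finally show "FT (\<lambda>v. (1 + v\<^sup>2) * normal_density 0 \<sigma> v) x = complex_of_real (gs \<sigma> 0 x + gs \<sigma> 2 x)" .
qed

text \<open>\<open>R\<close> and \<open>K\<close> are chosen before \<open>A1\<close> and
  \<open>A2\<close>, so the coefficient of the slow rate can later be made small. The condition
  \<open>A2 \<ge> 1\<close> lets the error rate absorb \<open>exp (- t)\<close>, as
  \<open>good\<close> demands.\<close>

theorem L1_convergence:
  assumes s: "0 < \<sigma>" and m2: "(\<integral>\<^sup>+v. ennreal (v\<^sup>2) \<partial>mu 0 0) \<le> ennreal (\<sigma>\<^sup>2)"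
    and q: "0 < q" "q \<le> \<sigma>\<^sup>2 / 2" and init: "\<And>\<xi>. \<bar>Amp 0 0 \<xi> 0\<bar> \<le> om q \<xi>"
  shows "\<exists>R\<ge>1. \<forall>s'. 4 \<le> s' \<and> s' \<le> 6 \<longrightarrow> (\<exists>K\<ge>0. \<forall>A1\<ge>0. \<forall>A2\<ge>1.
     (\<forall>j<3. \<forall>\<xi>. \<bar>Amp 0 j \<xi> 0 - gs \<sigma> j \<xi>\<bar> \<le> A1 * mw R \<xi> powr (4 - real j) + A2 * mw R \<xi> powr (s' - real j)) \<longrightarrow>
     (\<forall>t\<ge>0. (LINT v|lborel. \<bar>den 0 t v - normal_density 0 \<sigma> v\<bar>) \<le> K * (A1 * exp (- (1 - 2 * alpha 4) * t) + A2 * exp (- (1 - 2 * alpha s') * t))))"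
proof -
  have sec: "second (\<sigma>\<^sup>2)" by (rule second_moment[OF _ m2]) simp
  interpret kf: kac_fourier Amp "gs \<sigma>" "1 + \<sigma>\<^sup>2" q
  proof
    show "Amp 0 j \<xi> t = exp (- t) * Amp 0 j \<xi> 0 + (LINT r|ker t. LINT \<theta>|ang. nonlin j (\<lambda>i \<eta>. Amp 0 i \<eta> r) \<xi> \<theta>)" if "j < 3" "0 \<le> t" for j \<xi> t
      using Amp_eqs(5)[of j "\<sigma>\<^sup>2" t \<xi>] Amp_eqs(4)[of j "\<sigma>\<^sup>2" 0 \<xi> t] that sec by simp
    show "Amp (Suc d) j \<xi> t = (LINT r|ker t. LINT \<theta>|ang. nonlin j (\<lambda>i \<eta>. Amp d i \<eta> r) \<xi> \<theta>)" if "j < 3" "0 \<le> t" for d j \<xi> t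
      using Amp_eqs(4)[of j "\<sigma>\<^sup>2" d \<xi> t] that sec by simp
    show "integrable (ker t) (\<lambda>r. LINT \<theta>|ang. nonlin j (\<lambda>i \<eta>. Amp d i \<eta> r) \<xi> \<theta>)" if "j < 3" "0 \<le> t" for d j \<xi> t
      using Amp_eqs(3)[of j "\<sigma>\<^sup>2" t d \<xi>] that sec by simp
    show "integrable ang (nonlin j (\<lambda>i \<eta>. Amp d i \<eta> r) \<xi>)" if "j < 3" "0 \<le> r" for d j \<xi> r
      using Amp_eqs(2)[of j "\<sigma>\<^sup>2" d r \<xi>] that sec by simp
    show "nonlin j (gs \<sigma>) \<xi> \<theta> = gs \<sigma> j \<xi>" if "j < 3" for j \<xi> \<theta> by (rule gs_stat[OF s that])
    show "\<bar>Amp 0 j \<xi> t\<bar> \<le> 1 + \<sigma>\<^sup>2" if "j < 3" "0 \<le> t" for j \<xi> t by (rule Amp_bound[OF sec _ that(2)]) simp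
    show "\<bar>gs \<sigma> j \<xi>\<bar> \<le> 1 + \<sigma>\<^sup>2" for j \<xi> by (rule gs_bound[OF s])
    show "\<bar>Amp 0 0 \<xi> t\<bar> \<le> om q \<xi>" if "0 \<le> t" for \<xi> t using decay_preserved[OF _ init that] q by simp
    show "\<bar>gs \<sigma> 0 \<xi>\<bar> \<le> om q \<xi>" for \<xi> using gs_0_le_om[OF s q(2)] q by simp
    show "\<exists>K\<ge>0. \<forall>j<3. \<forall>\<xi>. \<bar>gs \<sigma> j \<xi>\<bar> \<le> K * om e \<xi>" if "0 \<le> e" for e by (rule gs_decay[OF s that])
  qed (use q in auto)
  obtain R where R: "1 \<le> R" "\<And>\<xi>. R \<le> \<bar>\<xi>\<bar> \<Longrightarrow> (LINT \<theta>|ang. om q (\<xi> * sin \<theta>)) \<le> alpha 7"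
    using choose_R[OF q(1) alpha_pos[of 7]] by auto
  show ?thesis
  proof (rule exI[of _ R], rule conjI[OF R(1)], intro allI impI)
    fix s' :: real assume s': "4 \<le> s' \<and> s' \<le> 6"
    have "\<exists>K\<ge>0. \<forall>A1\<ge>0. \<forall>A2\<ge>0. (\<forall>j<3. \<forall>\<xi>. \<bar>kf.h 0 j \<xi> 0\<bar> \<le> A1 * mw R \<xi> powr (4 - real j) + A2 * mw R \<xi> powr (s' - real j)) \<longrightarrow>
     (\<forall>j<3. \<forall>\<xi>. \<forall>t\<ge>0. \<bar>kf.h 0 j \<xi> t\<bar> \<le> K * (A1 * exp (- (1 - 2 * alpha 4) * t) + A2 * exp (- (1 - 2 * alpha s') * t)))"
      by (rule kf.low_frequency) (use R s' in auto)
    then obtain K0 where K0: "0 \<le> K0" and low: "\<forall>A1\<ge>0. \<forall>A2\<ge>0. (\<forall>j<3. \<forall>\<xi>. \<bar>kf.h 0 j \<xi> 0\<bar> \<le> A1 * mw R \<xi> powr (4 - real j) + A2 * mw R \<xi> powr (s' - real j)) \<longrightarrow>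
     (\<forall>j<3. \<forall>\<xi>. \<forall>t\<ge>0. \<bar>kf.h 0 j \<xi> t\<bar> \<le> K0 * (A1 * exp (- (1 - 2 * alpha 4) * t) + A2 * exp (- (1 - 2 * alpha s') * t)))"
      by (elim exE conjE)
    \<comment> \<open>The kernel integral of \<open>exp (- (1 - 2 * a) * r)\<close> is at most
      \<open>1 / (2 * a)\<close> times the value at the end; the sum serves both rates.\<close>
    define \<kappa> where "\<kappa> = 1 / (2 * alpha 4) + 1 / (2 * alpha s')"
    have al: "0 < alpha 4" "0 < alpha s'" using s' alpha_pos by auto
    have \<kappa>: "1 / (2 * alpha 4) \<le> \<kappa>" "1 / (2 * alpha s') \<le> \<kappa>" "0 \<le> \<kappa>" using al by (simp_all add: \<kappa>_def)
    obtain D where D: "1 \<le> D" "kf.hbound \<kappa> D 1" using kf.hbound_one[OF \<kappa>(3)] by auto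
    from D(2)[unfolded kf.hbound_def] obtain K1 where K1: "0 \<le> K1" and hb: "\<forall>E. kf.good \<kappa> E \<longrightarrow> (\<forall>j<3. \<forall>\<xi>. \<forall>t\<ge>0. \<bar>kf.h 0 j \<xi> t\<bar> \<le> E t) \<longrightarrow>
      (\<forall>j<3. \<forall>\<xi>. \<forall>t\<ge>0. \<bar>kf.h D j \<xi> t\<bar> \<le> K1 * E t * om 1 \<xi>)" by (elim exE conjE)
    define c where "c = 1 / (2 * pi) * om_1_mass\<^sup>2"
    have c: "0 \<le> c" by (simp add: c_def)
    show "\<exists>K\<ge>0. \<forall>A1\<ge>0. \<forall>A2\<ge>1.
     (\<forall>j<3. \<forall>\<xi>. \<bar>Amp 0 j \<xi> 0 - gs \<sigma> j \<xi>\<bar> \<le> A1 * mw R \<xi> powr (4 - real j) + A2 * mw R \<xi> powr (s' - real j)) \<longrightarrow>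
     (\<forall>t\<ge>0. (LINT v|lborel. \<bar>den 0 t v - normal_density 0 \<sigma> v\<bar>) \<le> K * (A1 * exp (- (1 - 2 * alpha 4) * t) + A2 * exp (- (1 - 2 * alpha s') * t)))"
    proof (intro exI[of _ "(1 + 2 * c) * K1 * (1 + K0)"] conjI allI impI)
      show "0 \<le> (1 + 2 * c) * K1 * (1 + K0)" using c K1 K0 by simp
      fix A1 A2 t :: real
      assume A: "0 \<le> A1" "1 \<le> A2" and ini: "\<forall>j<3. \<forall>\<xi>. \<bar>Amp 0 j \<xi> 0 - gs \<sigma> j \<xi>\<bar> \<le> A1 * mw R \<xi> powr (4 - real j) + A2 * mw R \<xi> powr (s' - real j)"
        and t: "0 \<le> t"
      let ?e1 = "\<lambda>t. exp (- (1 - 2 * alpha 4) * t)" and ?e2 = "\<lambda>t. exp (- (1 - 2 * alpha s') * t)"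
      define E0 where "E0 t = A1 * ?e1 t + A2 * ?e2 t" for t
      define E where "E t = (1 + K0) * E0 t" for t
      have E0nn: "0 \<le> E0 t" for t using A by (simp add: E0_def)
      have h0: "\<bar>kf.h 0 j \<xi> t\<bar> \<le> E t" if "j < 3" "0 \<le> t" for j \<xi> t
      proof -
        have "\<bar>kf.h 0 j \<xi> t\<bar> \<le> K0 * E0 t" unfolding E0_def
          using A ini that by (intro low[rule_format]) (auto simp: kf.h_def)
        also have "\<dots> \<le> E t" using E0nn[of t] by (simp add: E_def algebra_simps)
        finally show ?thesis .
      qed
      have good: "kf.good \<kappa> E" unfolding kf.good_def
      proof (intro allI impI conjI)
        fix t :: real assume t: "0 \<le> t"
        have ie: "integrable (ker t) ?e1" "integrable (ker t) ?e2" using al t by (intro ker_exp(1); simp)+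
        show "integrable (ker t) E" unfolding E_def E0_def
          by (intro integrable_mult_right Bochner_Integration.integrable_add ie)
        have b: "(LINT r|ker t. ?e1 r) \<le> \<kappa> * ?e1 t" "(LINT r|ker t. ?e2 r) \<le> \<kappa> * ?e2 t"
        proof -
          have "(LINT r|ker t. exp (- (1 - 2 * a) * r)) \<le> \<kappa> * exp (- (1 - 2 * a) * t)" if a: "0 < a" "1 / (2 * a) \<le> \<kappa>" for a
          proof -
            have "(LINT r|ker t. exp (- (1 - 2 * a) * r)) = (exp (- (1 - 2 * a) * t) - exp (- t)) / (2 * a)"
              using ker_exp(2)[OF t, of "1 - 2 * a"] a by simp
            also have "\<dots> \<le> (1 / (2 * a)) * exp (- (1 - 2 * a) * t)" using a by (simp add: divide_right_mono)
            also have "\<dots> \<le> \<kappa> * exp (- (1 - 2 * a) * t)" using a by (intro mult_right_mono) auto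
            finally show ?thesis .
          qed
          from this[OF al(1) \<kappa>(1)] this[OF al(2) \<kappa>(2)]
          show "(LINT r|ker t. ?e1 r) \<le> \<kappa> * ?e1 t" "(LINT r|ker t. ?e2 r) \<le> \<kappa> * ?e2 t" .
        qed
        have "(LINT r|ker t. E r) = (1 + K0) * (A1 * (LINT r|ker t. ?e1 r) + A2 * (LINT r|ker t. ?e2 r))"
          unfolding E_def E0_def using ie by (simp only: integral_mult_right_zero Bochner_Integration.integral_add integrable_mult_right)
        also have "\<dots> \<le> (1 + K0) * (A1 * (\<kappa> * ?e1 t) + A2 * (\<kappa> * ?e2 t))"
          using A K0 by (intro mult_left_mono add_mono b) auto
        also have "\<dots> = \<kappa> * E t" by (simp add: E_def E0_def algebra_simps)
        finally show "(LINT r|ker t. E r) \<le> \<kappa> * E t" .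
        have "0 \<le> alpha s' * t" using al t by simp
        then have "exp (- t) \<le> ?e2 t" by (simp add: algebra_simps)
        also have "\<dots> \<le> A2 * ?e2 t" using A by simp
        also have "\<dots> \<le> E0 t" using A by (simp add: E0_def)
        also have "\<dots> \<le> E t" using E0nn[of t] K0 by (simp add: E_def distrib_right)
        finally show "exp (- t) \<le> E t" .
      qed
      have hD: "\<bar>kf.h D j \<xi> t\<bar> \<le> K1 * E t * om 1 \<xi>" if "j < 3" for j \<xi>
        using hb[rule_format, OF good h0 that t] .
      have 1: "(LINT v|lborel. \<bar>den 0 t v - den D t v\<bar>) \<le> K1 * E t"
      proof -
        interpret prob_space "mu 0 t" by (rule prob_mu_0)
        have "Amp 0 0 0 t = 1" unfolding Amp_def tr_def using prob_space by simp
        moreover have "gs \<sigma> 0 0 = 1" by (simp add: gs_0[OF s])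
        ultimately have "(LINT v|lborel. \<bar>den 0 t v - den D t v\<bar>) = - kf.h D 0 0 t" unfolding L1_levels[OF t] by (simp add: kf.h_def)
        then show ?thesis using hD[of 0 0] by (simp add: om_def)
      qed
      have 2: "(LINT v|lborel. \<bar>den D t v - normal_density 0 \<sigma> v\<bar>) \<le> c * (2 * K1 * E t)"
        unfolding c_def
      proof (rule L1_from_FT[OF FT_den(1)[OF sec] _ FT_normal(1)[OF s]])
        fix x
        have "norm (FT (\<lambda>v. (1 + v\<^sup>2) * den D t v) x - FT (\<lambda>v. (1 + v\<^sup>2) * normal_density 0 \<sigma> v) x) = \<bar>(Amp D 0 x t + Amp D 2 x t) - (gs \<sigma> 0 x + gs \<sigma> 2 x)\<bar>"
          unfolding FT_den(2)[OF sec] FT_normal(2)[OF s] of_real_diff[symmetric] norm_of_real ..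
        also have "\<dots> \<le> K1 * E t * om 1 x + K1 * E t * om 1 x" using hD[of 0 x] hD[of 2 x] by (simp add: kf.h_def)
        finally show "norm (FT (\<lambda>v. (1 + v\<^sup>2) * den D t v) x - FT (\<lambda>v. (1 + v\<^sup>2) * normal_density 0 \<sigma> v) x) \<le> 2 * K1 * E t * om 1 x" by simp
      qed auto
      have in': "integrable lborel (normal_density 0 \<sigma>)" using s by simp
      have "(LINT v|lborel. \<bar>den 0 t v - normal_density 0 \<sigma> v\<bar>) \<le> (LINT v|lborel. \<bar>den 0 t v - den D t v\<bar> + \<bar>den D t v - normal_density 0 \<sigma> v\<bar>)"
        by (intro integral_mono Bochner_Integration.integrable_add integrable_abs Bochner_Integration.integrable_diff den_integrable in') auto
      also have "\<dots> = (LINT v|lborel. \<bar>den 0 t v - den D t v\<bar>) + (LINT v|lborel. \<bar>den D t v - normal_density 0 \<sigma> v\<bar>)"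
        by (intro Bochner_Integration.integral_add integrable_abs Bochner_Integration.integrable_diff den_integrable in')
      also have "\<dots> \<le> K1 * E t + c * (2 * K1 * E t)" by (intro add_mono 1 2)
      also have "\<dots> = (1 + 2 * c) * K1 * (1 + K0) * E0 t" by (simp add: E_def algebra_simps)
      finally show "(LINT v|lborel. \<bar>den 0 t v - normal_density 0 \<sigma> v\<bar>) \<le> (1 + 2 * c) * K1 * (1 + K0) * (A1 * ?e1 t + A2 * ?e2 t)"
        by (simp add: E0_def)
    qed
  qed
qed

end

section \<open>The mild form of Kac's equation\<close>

text \<open>Time is rounded up to a grid of mesh \<open>1 / (n + 1)\<close>, which leaves countably
  many measurable sections; continuity in time gives the limit.\<close>

lemma caratheodory_measurable:
  fixes \<phi> :: "real \<Rightarrow> real \<Rightarrow> real"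
  assumes m: "\<And>t. (\<lambda>v. \<phi> v t) \<in> borel_measurable borel" and c: "\<And>v. continuous_on UNIV (\<phi> v)"
  shows "(\<lambda>x. \<phi> (fst x) (snd x)) \<in> borel_measurable (borel \<Otimes>\<^sub>M borel)"
proof (rule borel_measurable_LIMSEQ_real)
  fix n
  have [measurable]: "(\<lambda>v. \<phi> v t) \<in> borel_measurable borel" for t by (rule m)
  show "(\<lambda>x. \<phi> (fst x) (real_of_int \<lceil>snd x * real (Suc n)\<rceil> / real (Suc n))) \<in> borel_measurable (borel \<Otimes>\<^sub>M borel)"
    by (rule measurable_compose_countable[where f="\<lambda>i x. \<phi> (fst x) (real_of_int i / real (Suc n))" and g="\<lambda>x. \<lceil>snd x * real (Suc n)\<rceil>"]) measurable
next
  fix x :: "real \<times> real"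
  have "(\<lambda>n. real_of_int \<lceil>snd x * real (Suc n)\<rceil> / real (Suc n)) \<longlonglongrightarrow> snd x"
  proof (rule tendsto_sandwich)
    show "\<forall>\<^sub>F n in sequentially. snd x \<le> real_of_int \<lceil>snd x * real (Suc n)\<rceil> / real (Suc n)"
      by (intro always_eventually allI) (simp add: pos_le_divide_eq del: of_nat_Suc)
    show "\<forall>\<^sub>F n in sequentially. real_of_int \<lceil>snd x * real (Suc n)\<rceil> / real (Suc n) \<le> snd x + inverse (real (Suc n))"
    proof (intro always_eventually allI)
      fix n
      have "real_of_int \<lceil>snd x * real (Suc n)\<rceil> \<le> snd x * real (Suc n) + 1" by linarith
      then have "real_of_int \<lceil>snd x * real (Suc n)\<rceil> / real (Suc n) \<le> (snd x * real (Suc n) + 1) / real (Suc n)"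
        by (rule divide_right_mono) simp
      also have "\<dots> = snd x + inverse (real (Suc n))" by (simp add: add_divide_distrib inverse_eq_divide del: of_nat_Suc)
      finally show "real_of_int \<lceil>snd x * real (Suc n)\<rceil> / real (Suc n) \<le> snd x + inverse (real (Suc n))" .
    qed
    show "(\<lambda>n. snd x + inverse (real (Suc n))) \<longlonglongrightarrow> snd x"
      using tendsto_add[OF tendsto_const LIMSEQ_inverse_real_of_nat, of "snd x"] by simp
  qed simp
  moreover have "isCont (\<phi> (fst x)) (snd x)" using c[of "fst x"] by (simp add: continuous_on_eq_continuous_at)
  ultimately show "(\<lambda>n. \<phi> (fst x) (real_of_int \<lceil>snd x * real (Suc n)\<rceil> / real (Suc n))) \<longlonglongrightarrow> \<phi> (fst x) (snd x)"
    by (rule isCont_tendsto_compose[rotated])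
qed

lemma prob_density_mass:
  assumes "prob_density g" shows "(\<integral>\<^sup>+v. ennreal (g v) \<partial>lborel) = 1"
proof -
  interpret prob_space "density lborel g" using assms by (simp add: prob_density_def)
  have [measurable]: "g \<in> borel_measurable borel" using assms by (simp add: prob_density_def)
  show ?thesis using emeasure_space_1 by (simp add: emeasure_density)
qed

text \<open>Absolute integrability is assumed of gain minus loss only. The loss part is integrable
  because \<open>g\<close> has mass 1, hence so is the gain part, and the two integrals may be
  separated.\<close>

lemma collision_eq_gain:
  assumes g: "prob_density g"
    and i: "set_integrable (lborel \<Otimes>\<^sub>M lborel) ({0..2*pi} \<times> UNIV) (\<lambda>(\<theta>, w). kac_integrand g v \<theta> w)"
  shows "gain (\<lambda>u. ennreal (g u)) v < \<infinity>" "kac_collision g v = enn2real (gain (\<lambda>u. ennreal (g u)) v) - g v"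
proof -
  have [measurable]: "g \<in> borel_measurable borel" and nn: "\<And>v. 0 \<le> g v" using g by (simp_all add: prob_density_def)
  define A where "A z = indicator {0..2*pi} (fst z) * (g (v * cos (fst z) - snd z * sin (fst z)) * g (v * sin (fst z) + snd z * cos (fst z)))" for z :: "real \<times> real"
  define B where "B z = indicator {0..2*pi} (fst z) * (g v * g (snd z))" for z :: "real \<times> real"
  have [measurable]: "A \<in> borel_measurable (lborel \<Otimes>\<^sub>M lborel)" "B \<in> borel_measurable (lborel \<Otimes>\<^sub>M lborel)"
    unfolding A_def[abs_def] B_def[abs_def] by measurable
  have B: "(\<integral>\<^sup>+z. ennreal (B z) \<partial>(lborel \<Otimes>\<^sub>M lborel)) = ennreal (2 * pi * g v)"
  proof -
    have "(\<integral>\<^sup>+z. ennreal (B z) \<partial>(lborel \<Otimes>\<^sub>M lborel)) = (\<integral>\<^sup>+\<theta>. \<integral>\<^sup>+w. ennreal (B (\<theta>, w)) \<partial>lborel \<partial>lborel)"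
      by (rule lborel.nn_integral_fst[symmetric]) measurable
    also have "\<dots> = (\<integral>\<^sup>+\<theta>. \<integral>\<^sup>+w. ennreal (g v) * indicator {0..2*pi} \<theta> * ennreal (g w) \<partial>lborel \<partial>lborel)"
      unfolding B_def using nn by (intro nn_integral_cong) (auto simp: ennreal_mult split: split_indicator)
    also have "\<dots> = (\<integral>\<^sup>+\<theta>. ennreal (g v) * indicator {0..2*pi} \<theta> \<partial>lborel)"
      using prob_density_mass[OF g] by (simp add: nn_integral_cmult)
    also have "\<dots> = ennreal (g v) * ennreal (2 * pi)" by (subst nn_integral_cmult_indicator) simp_all
    finally show ?thesis using nn[of v] by (simp add: ennreal_mult[symmetric] mult.commute)
  qed
  have Bnn: "0 \<le> B z" for z using nn by (simp add: B_def)
  have Ann: "0 \<le> A z" for z using nn by (simp add: A_def)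
  have iB: "integrable (lborel \<Otimes>\<^sub>M lborel) B"
    by (rule integrableI_nonneg) (use B Bnn in auto)
  have vB: "(LINT z|(lborel \<Otimes>\<^sub>M lborel). B z) = 2 * pi * g v"
    using B nn[of v] Bnn by (subst integral_eq_nn_integral) auto
  have H: "indicator ({0..2*pi} \<times> UNIV) z *\<^sub>R (case z of (\<theta>, w) \<Rightarrow> kac_integrand g v \<theta> w) = A z - B z" for z :: "real \<times> real"
    unfolding A_def B_def kac_integrand_def by (cases z) (auto split: split_indicator)
  have iH: "integrable (lborel \<Otimes>\<^sub>M lborel) (\<lambda>z. A z - B z)" using i unfolding set_integrable_def H .
  have iA: "integrable (lborel \<Otimes>\<^sub>M lborel) A" using Bochner_Integration.integrable_add[OF iH iB] by simp
  have A: "(\<integral>\<^sup>+z. ennreal (A z) \<partial>(lborel \<Otimes>\<^sub>M lborel)) = ennreal (2 * pi) * gain (\<lambda>u. ennreal (g u)) v"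
  proof -
    have "(\<integral>\<^sup>+z. ennreal (A z) \<partial>(lborel \<Otimes>\<^sub>M lborel)) = (\<integral>\<^sup>+\<theta>. \<integral>\<^sup>+w. ennreal (A (\<theta>, w)) \<partial>lborel \<partial>lborel)"
      by (rule lborel.nn_integral_fst[symmetric]) measurable
    also have "\<dots> = (\<integral>\<^sup>+\<theta>. \<integral>\<^sup>+w. indicator {0..2*pi} \<theta> * (ennreal (g (v * cos \<theta> - w * sin \<theta>)) * ennreal (g (v * sin \<theta> + w * cos \<theta>))) \<partial>lborel \<partial>lborel)"
      unfolding A_def using nn by (intro nn_integral_cong) (auto simp: ennreal_mult split: split_indicator)
    also have "\<dots> = (\<integral>\<^sup>+\<theta>. indicator {0..2*pi} \<theta> * (\<integral>\<^sup>+w. ennreal (g (v * cos \<theta> - w * sin \<theta>)) * ennreal (g (v * sin \<theta> + w * cos \<theta>)) \<partial>lborel) \<partial>lborel)"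
      by (simp add: nn_integral_cmult)
    also have "\<dots> = (ennreal (2 * pi) * ennreal (1/(2*pi))) * \<dots>" by (simp add: ennreal_mult[symmetric])
    also have "\<dots> = ennreal (2 * pi) * gain (\<lambda>u. ennreal (g u)) v"
      unfolding gain_def by (subst nn_integral_ang) (auto simp: mult.assoc)
    finally show ?thesis .
  qed
  have fin: "(\<integral>\<^sup>+z. ennreal (A z) \<partial>(lborel \<Otimes>\<^sub>M lborel)) < \<infinity>"
    using iA Ann by (simp add: integrable_iff_bounded)
  then show "gain (\<lambda>u. ennreal (g u)) v < \<infinity>" unfolding A by (auto simp: ennreal_mult_less_top)
  have vA: "(LINT z|(lborel \<Otimes>\<^sub>M lborel). A z) = 2 * pi * enn2real (gain (\<lambda>u. ennreal (g u)) v)"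
    using Ann by (subst integral_eq_nn_integral) (auto simp: A enn2real_mult)
  have "(LINT \<theta>:{0..2*pi}|lborel. LINT w|lborel. kac_integrand g v \<theta> w) = (LINT \<theta>|lborel. LINT w|lborel. A (\<theta>, w) - B (\<theta>, w))"
    unfolding set_lebesgue_integral_def
  proof (rule Bochner_Integration.integral_cong)
    fix \<theta> :: real
    have "indicator {0..2*pi} \<theta> *\<^sub>R (LINT w|lborel. kac_integrand g v \<theta> w) = (LINT w|lborel. indicator {0..2*pi} \<theta> *\<^sub>R kac_integrand g v \<theta> w)"
      by simp
    also have "\<dots> = (LINT w|lborel. A (\<theta>, w) - B (\<theta>, w))"
      unfolding H[symmetric] by (intro Bochner_Integration.integral_cong) (auto split: split_indicator)
    finally show "indicator {0..2*pi} \<theta> *\<^sub>R (LINT w|lborel. kac_integrand g v \<theta> w) = (LINT w|lborel. A (\<theta>, w) - B (\<theta>, w))" .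
  qed simp
  also have "\<dots> = (LINT z|(lborel \<Otimes>\<^sub>M lborel). A z - B z)"
    by (rule lborel_pair.integral_fst'[OF iH])
  also have "\<dots> = 2 * pi * (enn2real (gain (\<lambda>u. ennreal (g u)) v) - g v)"
    using iA iB by (simp add: vA vB algebra_simps)
  finally show "kac_collision g v = enn2real (gain (\<lambda>u. ennreal (g u)) v) - g v"
    unfolding kac_collision_def by simp
qed

text \<open>Multiplication by \<open>exp (r - t)\<close> produces an exact derivative. The
  fundamental theorem is used with derivatives in the interior and continuity at the ends, and
  \<open>0 \<le> g r\<close> turns the gauge integral it yields into a Lebesgue integral without any
  bound on \<open>g\<close>.\<close>

lemma duhamel:
  fixes y g :: "real \<Rightarrow> real"
  assumes c: "continuous_on {0..} y" and d: "\<And>r. 0 < r \<Longrightarrow> (y has_real_derivative g r - y r) (at r)"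
    and g: "\<And>r. 0 \<le> g r" "g \<in> borel_measurable borel" and y: "0 \<le> y 0" and t: "0 \<le> t"
  shows "ennreal (y t) = ennreal (exp (- t)) * ennreal (y 0) + (\<integral>\<^sup>+r. ennreal (g r) \<partial>ker t)"
proof -
  note [measurable] = g(2)
  have "((\<lambda>r. exp (r - t) * g r) has_integral (exp (t - t) * y t - exp (0 - t) * y 0)) {0..t}"
  proof (rule fundamental_theorem_of_calculus_interior[OF t])
    show "continuous_on {0..t} (\<lambda>r. exp (r - t) * y r)"
      by (intro continuous_intros continuous_on_subset[OF c]) auto
    fix r assume "r \<in> {0<..<t}"
    then have "((\<lambda>r. exp (r - t) * y r) has_real_derivative exp (r - t) * g r) (at r)"
      by (auto intro!: derivative_eq_intros d simp: algebra_simps)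
    then show "((\<lambda>r. exp (r - t) * y r) has_vector_derivative exp (r - t) * g r) (at r)"
      by (simp add: has_real_derivative_iff_has_vector_derivative)
  qed
  then have I: "((\<lambda>r. exp (r - t) * g r) has_integral (y t - exp (- t) * y 0)) {0..t}" by simp
  have le: "0 \<le> y t - exp (- t) * y 0" by (rule has_integral_nonneg[OF I]) (use g in auto)
  have "(\<integral>\<^sup>+r. ennreal (g r) \<partial>ker t) = (\<integral>\<^sup>+r. ennreal (exp (r - t) * g r) * indicator {0..t} r \<partial>lborel)"
    unfolding ker_def by (subst nn_integral_density) (auto intro!: nn_integral_cong simp: ennreal_mult g split: split_indicator)
  also have "\<dots> = ennreal (y t - exp (- t) * y 0)"
    by (rule nn_integral_has_integral_lebesgue'[OF _ I]) (use g in auto)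
  finally have "ennreal (exp (- t)) * ennreal (y 0) + (\<integral>\<^sup>+r. ennreal (g r) \<partial>ker t) = ennreal (exp (- t) * y 0 + (y t - exp (- t) * y 0))"
    using le y by (simp add: ennreal_mult[symmetric] ennreal_plus[symmetric] del: ennreal_plus)
  then show ?thesis by simp
qed

lemma AE_neg: assumes "AE v in lborel. P (v::real)" shows "AE v in lborel. P (- v)"
proof -
  obtain N where N: "{v \<in> space lborel. \<not> P v} \<subseteq> N" "emeasure lborel N = 0" "N \<in> sets lborel" using assms by (rule AE_E)
  have "(\<integral>\<^sup>+w. indicator N (- w) \<partial>lborel) = (\<integral>\<^sup>+w. indicator N w \<partial>lborel)"
    by (rule nn_integral_lborel_neg) (use N in auto)
  also have "\<dots> = 0" using N by simp
  finally have "AE w in lborel. indicator N (- w) = (0::ennreal)"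
    using N by (subst (asm) nn_integral_0_iff_AE) auto
  then show ?thesis by eventually_elim (use N(1) in \<open>auto split: split_indicator_asm\<close>)
qed

text \<open>Changing \<open>f\<close> on one null set makes it jointly measurable, and the gain does
  not see the change. Averaging the mild forms at v and -v gives \<open>F\<close>; subtracting them
  cancels the integral term, which is even, so the odd part is exactly \<open>exp (- t)\<close>
  times that of the datum.\<close>

lemma kac_solution_levels:
  assumes sol: "kac_solution f0 f"
  obtains F where "kac_levels F"
    "\<And>t. 0 \<le> t \<Longrightarrow> AE v in lborel. F v t = ennreal ((f v t + f (- v) t) / 2)"
    "\<And>t. 0 \<le> t \<Longrightarrow> AE v in lborel. f v t - f (- v) t = exp (- t) * (f0 v - f0 (- v))"
proof -
  define good where "good v \<longleftrightarrow> f v 0 = f0 v \<and> continuous_on {0..} (f v) \<and>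
        (\<forall>t>0. set_integrable (lborel \<Otimes>\<^sub>M lborel) ({0..2*pi} \<times> UNIV) (\<lambda>(\<theta>, w). kac_integrand (\<lambda>u. f u t) v \<theta> w) \<and>
               (f v has_real_derivative kac_collision (\<lambda>u. f u t) v) (at t))" for v
  have pd: "prob_density (\<lambda>v. f v t)" if "0 \<le> t" for t using sol that by (simp add: kac_solution_def)
  have nn: "0 \<le> f v t" if "0 \<le> t" for v t using pd[OF that] by (simp add: prob_density_def)
  have fm: "(\<lambda>v. f v t) \<in> borel_measurable borel" if "0 \<le> t" for t using pd[OF that] by (simp add: prob_density_def)
  have "AE v in lborel. good v" using sol by (simp add: kac_solution_def good_def)
  then have AEg: "AE v in lborel. good v \<and> good (- v)" using AE_neg[of good] by (simp add: AE_conj_iff)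
  then obtain N where N: "{v \<in> space lborel. \<not> (good v \<and> good (- v))} \<subseteq> N" "emeasure lborel N = 0" "N \<in> sets lborel" by (rule AE_E)
  have [measurable]: "N \<in> sets borel" using N by simp
  have AEN: "AE v in lborel. v \<notin> N" using N by (intro AE_not_in) (auto simp: null_sets_def)
  have AEN2: "AE v in lborel. v \<notin> N \<and> - v \<notin> N" using AEN AE_neg[OF AEN] by (simp add: AE_conj_iff)
  \<comment> \<open>The value 0 on \<open>N\<close> makes every section in time continuous, and
    \<open>max 0 t\<close> extends by the initial value to negative times.\<close>
  define \<phi> where "\<phi> v t = (if v \<in> N then 0 else f v (max 0 t))" for v t
  have \<phi>m1: "(\<lambda>v. \<phi> v t) \<in> borel_measurable borel" for t
    unfolding \<phi>_def using fm[of "max 0 t"] by (intro measurable_If_set) auto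
  have gd: "good v" if "v \<notin> N" for v using N that by auto
  have \<phi>m: "(\<lambda>x. \<phi> (fst x) (snd x)) \<in> borel_measurable (borel \<Otimes>\<^sub>M borel)"
  proof (rule caratheodory_measurable[OF \<phi>m1])
    fix v show "continuous_on UNIV (\<phi> v)"
    proof (cases "v \<in> N")
      case False
      then have c: "continuous_on {0..} (f v)" using gd by (auto simp: good_def)
      have "continuous_on UNIV (\<lambda>t. f v (max 0 t))"
        by (rule continuous_on_compose2[OF c]) (auto intro!: continuous_intros)
      then show ?thesis using False by (simp add: \<phi>_def)
    qed (simp add: \<phi>_def)
  qed
  have \<phi>nn: "0 \<le> \<phi> v t" for v t by (simp add: \<phi>_def nn)
  have \<phi>f: "AE v in lborel. \<phi> v t = f v t" if "0 \<le> t" for t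
    using AEN by eventually_elim (use that in \<open>simp add: \<phi>_def\<close>)
  have mass: "(\<integral>\<^sup>+v. ennreal (\<phi> v t) \<partial>lborel) = 1" for t
  proof -
    have "(\<integral>\<^sup>+v. ennreal (\<phi> v t) \<partial>lborel) = (\<integral>\<^sup>+v. ennreal (f v (max 0 t)) \<partial>lborel)"
      by (rule nn_integral_cong_AE) (use AEN in \<open>eventually_elim, simp add: \<phi>_def\<close>)
    then show ?thesis using prob_density_mass[OF pd[of "max 0 t"]] by simp
  qed
  define I where "I v t = (\<integral>\<^sup>+r. gain (\<lambda>u. ennreal (\<phi> u r)) v \<partial>ker t)" for v t
  have [measurable]: "(\<lambda>v. ennreal (\<phi> v t)) \<in> borel_measurable borel" for t using \<phi>m1[of t] by simp
  have gm: "(\<lambda>x. gain (\<lambda>u. ennreal (\<phi> u (snd x))) (fst x)) \<in> borel_measurable (borel \<Otimes>\<^sub>M borel)"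
    by (rule gain_measurable_pair) (use \<phi>m in measurable)
  have gm1 [measurable]: "(\<lambda>r. gain (\<lambda>u. ennreal (\<phi> u r)) v) \<in> borel_measurable borel" for v
    using measurable_compose[OF measurable_Pair[OF measurable_const measurable_ident] gm, of v] by simp
  have mild: "ennreal (\<phi> v t) = ennreal (exp (- t)) * ennreal (\<phi> v 0) + I v t" if v: "v \<notin> N" and t: "0 \<le> t" for v t
  proof -
    define g where "g r = enn2real (gain (\<lambda>u. ennreal (\<phi> u r)) v)" for r
    have gf: "gain (\<lambda>u. ennreal (\<phi> u r)) v < \<infinity>" "(f v has_real_derivative g r - f v r) (at r)" if r: "0 < r" for r
    proof -
      have eq: "gain (\<lambda>u. ennreal (\<phi> u r)) v = gain (\<lambda>u. ennreal (f u r)) v"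
        by (rule gain_cong_AE) (use \<phi>f[of r] r in \<open>auto elim: eventually_mono\<close>)
      have i: "set_integrable (lborel \<Otimes>\<^sub>M lborel) ({0..2*pi} \<times> UNIV) (\<lambda>(\<theta>, w). kac_integrand (\<lambda>u. f u r) v \<theta> w)"
        and d: "(f v has_real_derivative kac_collision (\<lambda>u. f u r) v) (at r)" using gd[OF v] r by (auto simp: good_def)
      note ce = collision_eq_gain[OF pd i]
      show "gain (\<lambda>u. ennreal (\<phi> u r)) v < \<infinity>" unfolding eq by (rule ce(1)) (use r in simp)
      show "(f v has_real_derivative g r - f v r) (at r)" using d ce(2) r by (simp add: g_def eq)
    qed
    have "ennreal (f v t) = ennreal (exp (- t)) * ennreal (f v 0) + (\<integral>\<^sup>+r. ennreal (g r) \<partial>ker t)"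
    proof (rule duhamel[OF _ gf(2)])
      show "continuous_on {0..} (f v)" using gd[OF v] by (simp add: good_def)
      show "g \<in> borel_measurable borel" unfolding g_def[abs_def] by measurable
    qed (auto simp: g_def nn t)
    also have "(\<integral>\<^sup>+r. ennreal (g r) \<partial>ker t) = I v t" unfolding I_def
    proof (rule nn_integral_cong_AE)
      have "AE r in lborel. r \<noteq> (0::real)" by (rule AE_lborel_singleton)
      then have "AE r in ker t. r \<noteq> 0" unfolding ker_def by (subst AE_density) auto
      then show "AE r in ker t. ennreal (g r) = gain (\<lambda>u. ennreal (\<phi> u r)) v"
        using AE_ker[of t] by eventually_elim (use gf(1) in \<open>auto simp: g_def\<close>)
    qed
    finally show ?thesis using v t by (simp add: \<phi>_def)
  qed
  define F where "F v t = (ennreal (\<phi> v t) + ennreal (\<phi> (- v) t)) / 2" for v t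
  have gF: "gain (\<lambda>u. F u r) v = gain (\<lambda>u. ennreal (\<phi> u r)) v" for r v
    unfolding F_def by (rule gain_symmetrize) measurable
  have Ineg: "I (- v) t = I v t" for v t unfolding I_def
    by (rule nn_integral_cong) (rule gain_even, measurable)
  have half: "(a + a) / 2 = (a::ennreal)" for a
    unfolding mult_2_right[symmetric] by (rule ennreal_mult_divide_eq) simp_all
  show thesis
  proof (rule that)
    show "kac_levels F"
    proof
      have [measurable]: "(\<lambda>x. \<phi> (- fst x) (snd x)) \<in> borel_measurable (borel \<Otimes>\<^sub>M borel)"
        using measurable_compose[OF _ \<phi>m, of "\<lambda>x. (- fst x, snd x)" "borel \<Otimes>\<^sub>M borel"] by simp
      note [measurable] = \<phi>m
      show "(\<lambda>x. F (fst x) (snd x)) \<in> borel_measurable (borel \<Otimes>\<^sub>M borel)" unfolding F_def by measurable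
      show "F (- v) t = F v t" for v t by (simp add: F_def add.commute)
      show "F v t = F v 0" if "t < 0" for v t using that by (simp add: F_def \<phi>_def)
      show "(\<integral>\<^sup>+v. F v t \<partial>lborel) = 1" for t
      proof -
        have "(\<integral>\<^sup>+v. F v t \<partial>lborel) = ((\<integral>\<^sup>+v. ennreal (\<phi> v t) \<partial>lborel) + (\<integral>\<^sup>+v. ennreal (\<phi> (- v) t) \<partial>lborel)) / 2"
          unfolding F_def by (subst nn_integral_divide, measurable, subst nn_integral_add) auto
        also have "(\<integral>\<^sup>+v. ennreal (\<phi> (- v) t) \<partial>lborel) = (\<integral>\<^sup>+v. ennreal (\<phi> v t) \<partial>lborel)"
          by (rule nn_integral_lborel_neg) measurable
        finally show ?thesis unfolding mass half .
      qed
      show "AE v in lborel. \<forall>t\<ge>0. F v t = ennreal (exp (- t)) * F v 0 + (\<integral>\<^sup>+r. gain (\<lambda>u. F u r) v \<partial>ker t)"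
        using AEN2
      proof (eventually_elim, intro allI impI)
        fix v t :: real assume v: "v \<notin> N \<and> - v \<notin> N" and t: "0 \<le> t"
        have "F v t = ((ennreal (exp (- t)) * ennreal (\<phi> v 0) + I v t) + (ennreal (exp (- t)) * ennreal (\<phi> (- v) 0) + I v t)) / 2"
          unfolding F_def using mild[of v t] mild[of "- v" t] v t by (simp add: Ineg)
        also have "\<dots> = ennreal (exp (- t)) * F v 0 + (I v t + I v t) / 2"
          unfolding F_def by (simp add: divide_ennreal_def algebra_simps)
        also have "(I v t + I v t) / 2 = (\<integral>\<^sup>+r. gain (\<lambda>u. F u r) v \<partial>ker t)" unfolding half gF I_def ..
        finally show "F v t = ennreal (exp (- t)) * F v 0 + (\<integral>\<^sup>+r. gain (\<lambda>u. F u r) v \<partial>ker t)" .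
      qed
    qed
    fix t :: real assume t: "0 \<le> t"
    show "AE v in lborel. F v t = ennreal ((f v t + f (- v) t) / 2)"
      using AEN2 by eventually_elim (use t in \<open>simp add: F_def \<phi>_def nn ennreal_plus[symmetric] divide_ennreal[symmetric] del: ennreal_plus\<close>)
    show "AE v in lborel. f v t - f (- v) t = exp (- t) * (f0 v - f0 (- v))"
      using AEN2
    proof eventually_elim
      case (elim v)
      have f0: "f0 v = \<phi> v 0" "f0 (- v) = \<phi> (- v) 0" "f v t = \<phi> v t" "f (- v) t = \<phi> (- v) t" using gd elim t by (auto simp: \<phi>_def good_def)
      have e: "ennreal (\<phi> v t) = ennreal (exp (- t) * \<phi> v 0) + I v t" "ennreal (\<phi> (- v) t) = ennreal (exp (- t) * \<phi> (- v) 0) + I v t"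
        using mild[of v t] mild[of "- v" t] elim t by (simp_all add: Ineg ennreal_mult \<phi>nn)
      \<comment> \<open>Finiteness permits passing from \<open>ennreal\<close> to reals, where the
        common term can be subtracted.\<close>
      have "I v t < \<infinity>"
      proof -
        have "I v t \<le> ennreal (\<phi> v t)" unfolding e(1) by simp
        then show ?thesis by (rule le_less_trans) simp
      qed
      then obtain i where i: "I v t = ennreal i" "0 \<le> i" by (cases "I v t") auto
      have "\<phi> v t = exp (- t) * \<phi> v 0 + i" "\<phi> (- v) t = exp (- t) * \<phi> (- v) 0 + i"
        using e i by (simp_all add: \<phi>nn ennreal_plus[symmetric] del: ennreal_plus)
      then show ?case unfolding f0 by (simp add: algebra_simps)
    qed
  qed
qed

section \<open>Initial data\<close>

text \<open>The Taylor polynomial of \<open>tr j \<xi> v\<close>, with slots \<open>a\<close> and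
  \<open>b\<close> for the second and fourth power of v, so that moments can be inserted.\<close>

definition taylor_pol :: "nat \<Rightarrow> real \<Rightarrow> real \<Rightarrow> real \<Rightarrow> real" where
  "taylor_pol j \<xi> a b = (if j = 0 then 1 - \<xi>\<^sup>2 * a / 2 + \<xi>^4 * b / 24 else if j = 1 then \<xi> * a - \<xi>^3 * b / 6 else a - \<xi>\<^sup>2 * b / 2)"

text \<open>Each remainder is bounded by two different powers, so that
  \<open>le_powr_between\<close> can interpolate to a real exponent.\<close>

lemma cos_taylor:
  fixes x :: real
  shows "\<bar>cos x - (1 - x\<^sup>2 / 2)\<bar> \<le> x^4" "\<bar>cos x - (1 - x\<^sup>2 / 2)\<bar> \<le> x\<^sup>2"
    "\<bar>cos x - (1 - x\<^sup>2 / 2 + x^4 / 24)\<bar> \<le> x^6" "\<bar>cos x - (1 - x\<^sup>2 / 2 + x^4 / 24)\<bar> \<le> x^4"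
proof -
  have b: "\<bar>cos x - (\<Sum>m<n. cos_coeff m * x ^ m)\<bar> \<le> \<bar>x\<bar> ^ n / fact n" for n
  proof -
    obtain t where "cos x = (\<Sum>m<n. cos_coeff m * x ^ m) + (cos(t + 1/2 * real n * pi) / fact n) * x ^ n"
      using Maclaurin_cos_expansion by blast
    then have "\<bar>cos x - (\<Sum>m<n. cos_coeff m * x ^ m)\<bar> = \<bar>cos(t + 1/2 * real n * pi)\<bar> * (\<bar>x\<bar> ^ n / fact n)"
      by (simp add: abs_mult power_abs)
    also have "\<dots> \<le> 1 * (\<bar>x\<bar> ^ n / fact n)" by (intro mult_right_mono) auto
    finally show ?thesis by simp
  qed
  have 4: "\<bar>cos x - (1 - x\<^sup>2 / 2)\<bar> \<le> x^4 / 24"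
    using b[of 4] by (simp add: cos_coeff_def lessThan_nat_numeral fact_numeral)
  have 6: "\<bar>cos x - (1 - x\<^sup>2 / 2 + x^4 / 24)\<bar> \<le> x^6 / 720"
    using b[of 6] by (simp add: cos_coeff_def lessThan_nat_numeral fact_numeral add.commute)
  have 2: "\<bar>cos x - 1\<bar> \<le> x\<^sup>2 / 2"
    using b[of 2] by (simp add: cos_coeff_def lessThan_nat_numeral fact_numeral)
  have nn: "0 \<le> x\<^sup>2" "0 \<le> x^4" "0 \<le> x^6" by simp_all
  show "\<bar>cos x - (1 - x\<^sup>2 / 2)\<bar> \<le> x^4" "\<bar>cos x - (1 - x\<^sup>2 / 2 + x^4 / 24)\<bar> \<le> x^4"
    "\<bar>cos x - (1 - x\<^sup>2 / 2 + x^4 / 24)\<bar> \<le> x^6" "\<bar>cos x - (1 - x\<^sup>2 / 2)\<bar> \<le> x\<^sup>2"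
    using 2 4 6 nn by linarith+
qed

lemma sin_taylor:
  fixes x :: real
  shows "\<bar>sin x - (x - x^3 / 6)\<bar> \<le> \<bar>x\<bar>^5" "\<bar>sin x - (x - x^3 / 6)\<bar> \<le> \<bar>x\<bar>^3"
proof -
  have 5: "\<bar>sin x - (x - x^3 / 6)\<bar> \<le> \<bar>x\<bar>^5 / 120"
    using Maclaurin_sin_bound[of x 5] by (simp add: sin_coeff_def lessThan_nat_numeral fact_numeral field_simps)
  have 3: "\<bar>sin x - x\<bar> \<le> \<bar>x\<bar>^3 / 6"
    using Maclaurin_sin_bound[of x 3] by (simp add: sin_coeff_def lessThan_nat_numeral fact_numeral field_simps)
  have nn: "0 \<le> \<bar>x\<bar>^5" "0 \<le> \<bar>x\<bar>^3" "\<bar>x^3\<bar> = \<bar>x\<bar>^3" by (simp_all add: power_abs)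
  show "\<bar>sin x - (x - x^3 / 6)\<bar> \<le> \<bar>x\<bar>^5" "\<bar>sin x - (x - x^3 / 6)\<bar> \<le> \<bar>x\<bar>^3"
    using 3 5 nn by linarith+
qed

lemma le_powr_between:
  assumes "r \<le> y ^ a" "r \<le> y ^ b" "0 \<le> y" "real a \<le> e" "e \<le> real b" "0 < a" "0 < b"
  shows "r \<le> y powr e"
proof (cases "y = 0")
  case False
  then have p: "y ^ a = y powr a" "y ^ b = y powr b" using assms(3) by (simp_all add: powr_realpow)
  show ?thesis
  proof (cases "y \<le> 1")
    case True then show ?thesis using powr_mono'[OF assms(5) assms(3) True] assms(2) p by simp
  next
    case F: False
    then have "y powr a \<le> y powr e" using assms(4) by (intro powr_mono) auto
    then show ?thesis using assms(1) p by simp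
  qed
qed (use assms in \<open>auto simp: zero_power\<close>)

text \<open>After \<open>\<bar>v\<bar> ^ j\<close> is pulled out, the remainder is at most the power
  4 - j and also at most the power 6 - j of \<open>\<bar>\<xi> * v\<bar>\<close>, hence every real
  power in between. This is the origin of the range of s.\<close>

lemma tr_remainder:
  assumes s: "4 \<le> s" "s \<le> 6" and j: "j < 3"
  shows "\<bar>tr j \<xi> v - taylor_pol j \<xi> (v\<^sup>2) (v^4)\<bar> \<le> \<bar>\<xi>\<bar> powr (s - real j) * \<bar>v\<bar> powr s"
proof -
  let ?y = "\<bar>\<xi> * v\<bar>"
  have comb: "\<bar>v\<bar> ^ j * ?y powr (s - real j) = \<bar>\<xi>\<bar> powr (s - real j) * \<bar>v\<bar> powr s"
  proof (cases "v = 0")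
    case False
    then have "\<bar>v\<bar> powr s = \<bar>v\<bar> powr (real j + (s - real j))" by simp
    also have "\<dots> = \<bar>v\<bar> ^ j * \<bar>v\<bar> powr (s - real j)" unfolding powr_add using False by (simp add: powr_realpow)
    finally show ?thesis by (simp add: abs_mult powr_mult)
  qed (use s j in auto)
  consider "j = 0" | "j = 1" | "j = 2" using j by linarith
  then have "\<bar>tr j \<xi> v - taylor_pol j \<xi> (v\<^sup>2) (v^4)\<bar> \<le> \<bar>v\<bar> ^ j * ?y powr (s - real j)"
  proof cases
    case 1
    have "tr 0 \<xi> v - taylor_pol 0 \<xi> (v\<^sup>2) (v^4) = cos (\<xi> * v) - (1 - (\<xi> * v)\<^sup>2 / 2 + (\<xi> * v)^4 / 24)"
      by (simp add: tr_def taylor_pol_def power_mult_distrib)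
    moreover have "\<bar>cos (\<xi> * v) - (1 - (\<xi> * v)\<^sup>2 / 2 + (\<xi> * v)^4 / 24)\<bar> \<le> ?y powr s"
      by (rule le_powr_between[where a=4 and b=6]) (use cos_taylor(3,4)[of "\<xi> * v"] s in \<open>simp_all add: power_even_abs\<close>)
    ultimately show ?thesis using 1 by simp
  next
    case 2
    have "tr 1 \<xi> v - taylor_pol 1 \<xi> (v\<^sup>2) (v^4) = v * (sin (\<xi> * v) - (\<xi> * v - (\<xi> * v)^3 / 6))"
      by (simp add: tr_def taylor_pol_def power_mult_distrib algebra_simps power2_eq_square power3_eq_cube power4_eq_xxxx)
    moreover have "\<bar>sin (\<xi> * v) - (\<xi> * v - (\<xi> * v)^3 / 6)\<bar> \<le> ?y powr (s - 1)"
      by (rule le_powr_between[where a=3 and b=5]) (use sin_taylor[of "\<xi> * v"] s in simp_all)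
    ultimately show ?thesis using 2 mult_left_mono[of _ _ "\<bar>v\<bar>"] by (simp add: abs_mult)
  next
    case 3
    have "tr 2 \<xi> v - taylor_pol 2 \<xi> (v\<^sup>2) (v^4) = v\<^sup>2 * (cos (\<xi> * v) - (1 - (\<xi> * v)\<^sup>2 / 2))"
      by (simp add: tr_def taylor_pol_def power_mult_distrib algebra_simps power2_eq_square power4_eq_xxxx)
    moreover have "\<bar>cos (\<xi> * v) - (1 - (\<xi> * v)\<^sup>2 / 2)\<bar> \<le> ?y powr (s - 2)"
      by (rule le_powr_between[where a=2 and b=4]) (use cos_taylor(1,2)[of "\<xi> * v"] s in \<open>simp_all add: power_even_abs\<close>)
    ultimately show ?thesis using 3 mult_left_mono[of _ _ "\<bar>v\<^sup>2\<bar>"] by (simp add: abs_mult)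
  qed
  then show ?thesis using comb by simp
qed

text \<open>At each v the remainder is charged either to \<open>u1\<close> with the power 4 or to
  \<open>u2\<close> with the power s; the disjunction leaves the choice of the splitting to the
  caller.\<close>

lemma tr_expansion:
  assumes M: "prob_space M" "sets M = sets borel" and i2: "integrable M (\<lambda>v. v\<^sup>2)" and i4: "integrable M (\<lambda>v. v^4)"
    and u: "integrable M u1" "integrable M u2" "\<And>v. 0 \<le> u1 v" "\<And>v. 0 \<le> u2 v" "\<And>v. v^4 \<le> u1 v \<or> \<bar>v\<bar> powr s \<le> u2 v"
    and s: "4 \<le> s" "s \<le> 6" and j: "j < 3"
  shows "\<bar>(LINT v|M. tr j \<xi> v) - taylor_pol j \<xi> (LINT v|M. v\<^sup>2) (LINT v|M. v^4)\<bar>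
     \<le> \<bar>\<xi>\<bar> powr (4 - real j) * (LINT v|M. u1 v) + \<bar>\<xi>\<bar> powr (s - real j) * (LINT v|M. u2 v)"
proof -
  interpret prob_space M by fact
  have it: "integrable M (tr j \<xi>)"
    by (rule integrable_weight[where w="\<lambda>v. 1 + v\<^sup>2"]) (use i2 M(2) in \<open>auto simp: tr_bound\<close>)
  have ip: "integrable M (\<lambda>v. taylor_pol j \<xi> (v\<^sup>2) (v^4))" and vp: "(LINT v|M. taylor_pol j \<xi> (v\<^sup>2) (v^4)) = taylor_pol j \<xi> (LINT v|M. v\<^sup>2) (LINT v|M. v^4)"
    using i2 i4 prob_space unfolding taylor_pol_def by (cases "j = 0"; cases "j = 1"; simp)+
  have "(LINT v|M. tr j \<xi> v) - taylor_pol j \<xi> (LINT v|M. v\<^sup>2) (LINT v|M. v^4) = (LINT v|M. tr j \<xi> v - taylor_pol j \<xi> (v\<^sup>2) (v^4))"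
    using it ip vp by simp
  also have "\<bar>\<dots>\<bar> \<le> (LINT v|M. \<bar>\<xi>\<bar> powr (4 - real j) * u1 v + \<bar>\<xi>\<bar> powr (s - real j) * u2 v)"
  proof (rule abs_integral_le_bound)
    show "AE v in M. \<bar>tr j \<xi> v - taylor_pol j \<xi> (v\<^sup>2) (v^4)\<bar> \<le> \<bar>\<xi>\<bar> powr (4 - real j) * u1 v + \<bar>\<xi>\<bar> powr (s - real j) * u2 v"
    proof (rule AE_I2)
      fix v
      have nn: "0 \<le> \<bar>\<xi>\<bar> powr (4 - real j) * u1 v" "0 \<le> \<bar>\<xi>\<bar> powr (s - real j) * u2 v" using u by simp_all
      have v4: "\<bar>v\<bar> powr 4 = v^4" by (cases "v = 0") (simp_all add: powr_numeral)
      show "\<bar>tr j \<xi> v - taylor_pol j \<xi> (v\<^sup>2) (v^4)\<bar> \<le> \<bar>\<xi>\<bar> powr (4 - real j) * u1 v + \<bar>\<xi>\<bar> powr (s - real j) * u2 v"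
        using u(5)[of v]
      proof
        assume "v^4 \<le> u1 v"
        then have "\<bar>\<xi>\<bar> powr (4 - real j) * \<bar>v\<bar> powr 4 \<le> \<bar>\<xi>\<bar> powr (4 - real j) * u1 v" unfolding v4 by (rule mult_left_mono) simp
        then show ?thesis using tr_remainder[OF _ _ j, of 4 \<xi> v] nn by simp
      next
        assume "\<bar>v\<bar> powr s \<le> u2 v"
        then have "\<bar>\<xi>\<bar> powr (s - real j) * \<bar>v\<bar> powr s \<le> \<bar>\<xi>\<bar> powr (s - real j) * u2 v" by (rule mult_left_mono) simp
        then show ?thesis using tr_remainder[OF s j, of \<xi> v] nn by simp
      qed
    qed
  qed (use u in auto)
  also have "\<dots> = \<bar>\<xi>\<bar> powr (4 - real j) * (LINT v|M. u1 v) + \<bar>\<xi>\<bar> powr (s - real j) * (LINT v|M. u2 v)"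
    using u by simp
  finally show ?thesis .
qed

lemma gauss_abs_moment:
  assumes "0 < \<sigma>" "0 \<le> s" "s \<le> 6" shows "integrable (gauss \<sigma>) (\<lambda>v. \<bar>v\<bar> powr s)"
proof -
  interpret prob_space "gauss \<sigma>" by (rule prob_gauss) fact
  have i: "integrable (gauss \<sigma>) (\<lambda>v. 1 + v^6)" using gauss_moment(1)[OF assms(1), of 3] by simp
  show ?thesis
  proof (rule integrable_weight[OF i])
    fix v :: real
    have nn: "0 \<le> v^6" by simp
    show "\<bar>\<bar>v\<bar> powr s\<bar> \<le> 1 + v^6"
    proof (cases "\<bar>v\<bar> \<le> 1")
      case True then have "\<bar>v\<bar> powr s \<le> 1" using assms by (intro powr_le1) auto
      then have "\<bar>v\<bar> powr s \<le> 1 + v^6" using nn by (rule add_increasing2[rotated])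
      then show ?thesis by simp
    next
      case False
      then have "\<bar>v\<bar> powr s \<le> \<bar>v\<bar> powr 6" using assms by (intro powr_mono) auto
      also have "\<dots> = v^6" using False by (simp add: powr_numeral)
      finally show ?thesis by simp
    qed
  qed auto
qed

text \<open>The two laws share their second and fourth moments, hence \<open>taylor_pol\<close>, and
  only remainders are left. The coefficient of the power 4 is exactly the integral of
  \<open>u1\<close>; everything else goes into \<open>A\<close>.\<close>

lemma initial_bounds:
  assumes \<sigma>: "0 < \<sigma>" and M: "prob_space M" "sets M = sets borel" and i4: "integrable M (\<lambda>v. v^4)"
    and m: "(LINT v|M. v\<^sup>2) = \<sigma>\<^sup>2" "(LINT v|M. v^4) = 3 * \<sigma>^4"
    and u: "integrable M u1" "integrable M u2" "\<And>v. 0 \<le> u1 v" "\<And>v. 0 \<le> u2 v" "\<And>v. v^4 \<le> u1 v \<or> \<bar>v\<bar> powr s \<le> u2 v"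
    and s: "4 \<le> s" "s \<le> 6" and R: "1 \<le> R"
  shows "\<exists>A\<ge>1. \<forall>j<3. \<forall>\<xi>. \<bar>(LINT v|M. tr j \<xi> v) - gs \<sigma> j \<xi>\<bar> \<le> (LINT v|M. u1 v) * mw R \<xi> powr (4 - real j) + A * mw R \<xi> powr (s - real j)"
proof -
  interpret prob_space M by fact
  have i2: "integrable M (\<lambda>v. v\<^sup>2)"
  proof (rule integrable_weight[of _ "\<lambda>v. 1 + v^4"])
    fix v :: real
    \<comment> \<open>Expanded, this gives \<open>v^2 \<le> v^4 + 1/4\<close>.\<close>
    have "0 \<le> (v\<^sup>2 - 1/2)\<^sup>2" by simp
    then show "\<bar>v\<^sup>2\<bar> \<le> 1 + v^4" by (simp add: power2_diff power2_eq_square[of "1/2::real"])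
  qed (use i4 M in auto)
  define U1 where "U1 = (LINT v|M. u1 v)"
  define A0 where "A0 = (LINT v|M. u2 v) + (LINT v|gauss \<sigma>. \<bar>v\<bar> powr s)"
  \<comment> \<open>The last summand covers frequencies beyond \<open>R\<close>: there the
    difference is merely bounded, while the weight is \<open>R powr (s - real j)\<close>, at least
    1.\<close>
  define A where "A = A0 + 2 * (1 + \<sigma>\<^sup>2)"
  have nn: "0 \<le> U1" "0 \<le> A0" unfolding U1_def A0_def using u by (auto intro!: add_nonneg_nonneg Bochner_Integration.integral_nonneg)
  have "0 \<le> \<sigma>\<^sup>2" by simp
  with nn(2) have A: "1 \<le> A" "A0 \<le> A" "2 * (1 + \<sigma>\<^sup>2) \<le> A" unfolding A_def distrib_left by - linarith+
  show ?thesis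
  proof (intro exI[of _ A] conjI allI impI A(1))
    fix j \<xi> assume j: "j < (3::nat)"
    have "\<bar>(LINT v|M. tr j \<xi> v) - taylor_pol j \<xi> (\<sigma>\<^sup>2) (3 * \<sigma>^4)\<bar> \<le> \<bar>\<xi>\<bar> powr (4 - real j) * U1 + \<bar>\<xi>\<bar> powr (s - real j) * (LINT v|M. u2 v)"
      using tr_expansion[OF M i2 i4 u s j, of \<xi>] by (simp add: m U1_def)
    moreover have "\<bar>gs \<sigma> j \<xi> - taylor_pol j \<xi> (\<sigma>\<^sup>2) (3 * \<sigma>^4)\<bar> \<le> \<bar>\<xi>\<bar> powr (s - real j) * (LINT v|gauss \<sigma>. \<bar>v\<bar> powr s)"
      using tr_expansion[OF prob_gauss[OF \<sigma>] sets_gauss gauss_moment_2(1)[OF \<sigma>] gauss_moment_4(1)[OF \<sigma>] _ gauss_abs_moment[OF \<sigma>, of s], of "\<lambda>_. 0" s j \<xi>] s j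
      by (simp add: gs_def gauss_moment_2(2)[OF \<sigma>] gauss_moment_4(2)[OF \<sigma>])
    ultimately have 1: "\<bar>(LINT v|M. tr j \<xi> v) - gs \<sigma> j \<xi>\<bar> \<le> U1 * \<bar>\<xi>\<bar> powr (4 - real j) + A0 * \<bar>\<xi>\<bar> powr (s - real j)"
      unfolding A0_def by (simp add: algebra_simps)
    have 2: "\<bar>(LINT v|M. tr j \<xi> v) - gs \<sigma> j \<xi>\<bar> \<le> 2 * (1 + \<sigma>\<^sup>2)"
    proof -
      have "\<bar>LINT v|M. tr j \<xi> v\<bar> \<le> (LINT v|M. 1 + v\<^sup>2)"
        by (rule abs_integral_le_bound) (use i2 in \<open>auto simp: tr_bound\<close>)
      also have "\<dots> = 1 + \<sigma>\<^sup>2" using i2 m prob_space by simp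
      finally show ?thesis using gs_bound[OF \<sigma>, of j \<xi>] unfolding distrib_left by linarith
    qed
    show "\<bar>(LINT v|M. tr j \<xi> v) - gs \<sigma> j \<xi>\<bar> \<le> (LINT v|M. u1 v) * mw R \<xi> powr (4 - real j) + A * mw R \<xi> powr (s - real j)"
    proof (cases "\<bar>\<xi>\<bar> \<le> R")
      case True
      then have "mw R \<xi> = \<bar>\<xi>\<bar>" by (simp add: mw_def)
      then show ?thesis using 1 mult_right_mono[OF A(2), of "\<bar>\<xi>\<bar> powr (s - real j)"] by (simp add: U1_def)
    next
      case False
      then have mw: "mw R \<xi> = R" by (simp add: mw_def)
      have "1 \<le> R powr (s - real j)" using R s j by (intro ge_one_powr_ge_zero) auto
      then have "A * 1 \<le> A * R powr (s - real j)" using A(1) by (intro mult_left_mono) auto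
      moreover have "0 \<le> U1 * R powr (4 - real j)" using nn by simp
      ultimately show ?thesis using 2 A(3) unfolding mw U1_def by linarith
    qed
  qed
qed

section \<open>Algebraic decay of the initial characteristic function\<close>

lemma cos_integral_doubling:
  fixes M :: "real measure"
  assumes M: "prob_space M" "sets M = sets borel"
  shows "\<bar>LINT v|M. cos (\<xi> * v)\<bar> \<le> 1 - (1 - \<bar>LINT v|M. cos (2 * \<xi> * v)\<bar>) / 4"
proof -
  interpret prob_space M by fact
  define a where "a = (LINT v|M. cos (\<xi> * v))"
  define b where "b = (LINT v|M. cos (2 * \<xi> * v))"
  note [measurable_cong] = M(2)
  have i: "integrable M (\<lambda>v. cos (c * v))" for c
    by (rule integrable_const_bound[where B=1]) (auto intro!: AE_I2)
  \<comment> \<open>The integral of this square is the variance of \<open>cos (\<xi> * v)\<close>.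
    Its nonnegativity and the double-angle formula bound \<open>a^2\<close> by
    \<open>(1 + b) / 2\<close>.\<close>
  have e: "(cos (\<xi> * v) - a)\<^sup>2 = 1/2 + cos (2 * \<xi> * v) / 2 - 2 * a * cos (\<xi> * v) + a\<^sup>2" for v
    using cos_double_cos[of "\<xi> * v"] by (simp add: power2_diff mult.assoc field_simps)
  have "0 \<le> (LINT v|M. (cos (\<xi> * v) - a)\<^sup>2)" by (rule Bochner_Integration.integral_nonneg) simp
  also have "\<dots> = 1/2 + b / 2 - 2 * a * a + a\<^sup>2"
    unfolding e using i prob_space by (simp add: a_def b_def)
  finally have "a\<^sup>2 \<le> (1 + \<bar>b\<bar>) / 2" by (simp add: power2_eq_square)
  also have "\<dots> \<le> (1 - (1 - \<bar>b\<bar>) / 4)\<^sup>2"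
  proof -
    have "(1 + x) / 2 + (1 - x)\<^sup>2 / 16 = (1 - (1 - x) / 4)\<^sup>2" for x :: real
      by (simp add: power2_eq_square field_simps)
    from this[of "\<bar>b\<bar>"] show ?thesis using zero_le_power2[of "1 - \<bar>b\<bar>"] by linarith
  qed
  finally have "\<bar>a\<bar> \<le> \<bar>1 - (1 - \<bar>b\<bar>) / 4\<bar>" by (rule abs_le_square_iff[THEN iffD2])
  moreover have "0 \<le> 1 - (1 - \<bar>b\<bar>) / 4" using abs_ge_zero[of b] by (simp add: field_simps)
  ultimately have "\<bar>a\<bar> \<le> 1 - (1 - \<bar>b\<bar>) / 4" by simp
  then show ?thesis unfolding a_def b_def by simp
qed

text \<open>Decay at infinity gives \<open>\<bar>a \<xi>\<bar> \<le> 1/2\<close> for \<open>\<bar>\<xi>\<bar> \<ge> X\<close>, and repeated halving of \<open>\<xi>\<close> with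
  the doubling inequality yields \<open>\<bar>a \<xi>\<bar> \<le> 1 - \<xi>\<^sup>2 / (8X\<^sup>2)\<close> below \<open>X\<close>.\<close>

lemma cos_decay:
  assumes M: "prob_space M" "sets M = sets borel" and p: "0 < p"
    and o: "char M \<in> o[at_infinity](\<lambda>\<xi>. complex_of_real (\<bar>\<xi>\<bar> powr (- p)))" and c: "0 < c"
  shows "\<exists>q>0. q \<le> c \<and> (\<forall>\<xi>. \<bar>LINT v|M. cos (\<xi> * v)\<bar> \<le> om q \<xi>)"
proof -
  interpret prob_space M by fact
  define a where "a \<xi> = (LINT v|M. cos (\<xi> * v))" for \<xi>
  note [measurable_cong] = M(2)
  have ic: "integrable M (\<lambda>v. iexp (\<xi> * v))" for \<xi>
    by (rule integrable_const_bound[where B=1]) (auto intro!: AE_I2)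
  have a_char: "\<bar>a \<xi>\<bar> \<le> cmod (char M \<xi>)" for \<xi>
  proof -
    have "a \<xi> = Re (char M \<xi>)" unfolding a_def char_def by (subst integral_Re[symmetric, OF ic]) (simp add: Re_exp)
    then show ?thesis using abs_Re_le_cmod by simp
  qed
  have "eventually (\<lambda>\<xi>. cmod (char M \<xi>) \<le> 1 * cmod (complex_of_real (\<bar>\<xi>\<bar> powr (- p)))) at_infinity"
    by (rule landau_o.smallD[OF o]) simp
  then obtain X0 where X0: "\<And>\<xi>. X0 \<le> \<bar>\<xi>\<bar> \<Longrightarrow> cmod (char M \<xi>) \<le> \<bar>\<xi>\<bar> powr (- p)"
    unfolding eventually_at_infinity by auto
  \<comment> \<open>Beyond \<open>X\<close> the lower bound 2 yields
    \<open>1 + \<xi>^2 \<le> \<bar>\<xi>\<bar> ^ 3\<close>, and \<open>2 powr (1/p)\<close> pushes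
    \<open>\<bar>\<xi>\<bar> powr (- p)\<close> below 1/2.\<close>
  define X where "X = max (max X0 2) (2 powr (1/p))"
  have X: "X0 \<le> X" "2 \<le> X" "2 powr (1/p) \<le> X" by (auto simp: X_def)
  have far: "\<bar>a \<xi>\<bar> \<le> \<bar>\<xi>\<bar> powr (- p)" if "X \<le> \<bar>\<xi>\<bar>" for \<xi> using X0[of \<xi>] a_char[of \<xi>] that X by linarith
  have far2: "\<bar>a \<xi>\<bar> \<le> 1/2" if "X \<le> \<bar>\<xi>\<bar>" for \<xi>
  proof -
    have "\<bar>\<xi>\<bar> powr (- p) \<le> (2 powr (1/p)) powr (- p)" using that X p by (intro powr_mono2') auto
    also have "\<dots> = 1/2" using p by (simp add: powr_powr powr_minus)
    finally show ?thesis using far[OF that] by simp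
  qed
  \<comment> \<open>The doubling inequality divides the deficit
    \<open>1 - \<bar>a \<xi>\<bar>\<close> by 4, exactly the factor that \<open>\<xi>^2\<close>
    loses when \<xi> is halved. The range extends to \<open>2 * X\<close> so that
    \<open>2 * \<xi>\<close> stays inside it for \<open>\<bar>\<xi>\<bar> < X\<close>.\<close>
  have near: "\<bar>a \<xi>\<bar> \<le> 1 - \<xi>\<^sup>2 / (8 * X\<^sup>2)" if "X / 2^k \<le> \<bar>\<xi>\<bar>" "\<bar>\<xi>\<bar> \<le> 2 * X" for k \<xi>
    using that
  proof (induction k arbitrary: \<xi>)
    case 0
    have "\<bar>\<xi>\<bar>\<^sup>2 \<le> (2 * X)\<^sup>2" using 0 by (intro power_mono) auto
    then have "\<xi>\<^sup>2 / (8 * X\<^sup>2) \<le> 1/2" using X by (simp add: divide_le_eq power_mult_distrib)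
    then show ?case using far2[of \<xi>] 0 by simp
  next
    case (Suc k)
    show ?case
    proof (cases "X \<le> \<bar>\<xi>\<bar>")
      case True
      have "\<bar>\<xi>\<bar>\<^sup>2 \<le> (2 * X)\<^sup>2" using Suc by (intro power_mono) auto
      then have "\<xi>\<^sup>2 / (8 * X\<^sup>2) \<le> 1/2" using X by (simp add: divide_le_eq power_mult_distrib)
      then show ?thesis using far2[OF True] by simp
    next
      case False
      have "\<bar>a (2 * \<xi>)\<bar> \<le> 1 - (2 * \<xi>)\<^sup>2 / (8 * X\<^sup>2)"
        by (rule Suc.IH) (use Suc.prems False in \<open>auto simp: field_simps abs_mult\<close>)
      moreover have "\<bar>a \<xi>\<bar> \<le> 1 - (1 - \<bar>a (2 * \<xi>)\<bar>) / 4"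
        unfolding a_def by (rule cos_integral_doubling[OF M])
      moreover have "(2 * \<xi>)\<^sup>2 / (8 * X\<^sup>2) = 4 * (\<xi>\<^sup>2 / (8 * X\<^sup>2))" by (simp add: power_mult_distrib)
      ultimately have "\<bar>a (2 * \<xi>)\<bar> \<le> 1 - 4 * (\<xi>\<^sup>2 / (8 * X\<^sup>2))" "\<bar>a \<xi>\<bar> \<le> 1 - (1 - \<bar>a (2 * \<xi>)\<bar>) / 4" by simp_all
      then show ?thesis by (simp add: field_simps)
    qed
  qed
  have a1: "\<bar>a \<xi>\<bar> \<le> 1" for \<xi>
  proof -
    have "\<bar>a \<xi>\<bar> \<le> (LINT v|M. 1)" unfolding a_def by (rule abs_integral_le_bound) auto
    then show ?thesis using prob_space by simp
  qed
  \<comment> \<open>\<open>1 / (8 * X^2)\<close> serves the frequencies below \<open>X\<close>, and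
    \<open>p / 3\<close> those beyond, because of
    \<open>1 + \<xi>^2 \<le> \<bar>\<xi>\<bar> ^ 3\<close>. The bound \<open>c\<close> will be the
    one that \<open>gs_0_le_om\<close> imposes.\<close>
  define q where "q = min c (min (1 / (8 * X\<^sup>2)) (p / 3))"
  have q: "0 < q" "q \<le> c" "q \<le> 1 / (8 * X\<^sup>2)" "q \<le> p / 3" using c p X by (auto simp: q_def)
  show ?thesis
  proof (intro exI[of _ q] conjI allI q(1,2))
    fix \<xi>
    show "\<bar>LINT v|M. cos (\<xi> * v)\<bar> \<le> om q \<xi>"
    proof (cases "X \<le> \<bar>\<xi>\<bar>")
      case True
      then have x2: "2 \<le> \<bar>\<xi>\<bar>" using X by simp
      have "1 + \<xi>\<^sup>2 \<le> \<bar>\<xi>\<bar> ^ 3"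
      proof -
        have "2\<^sup>2 \<le> \<bar>\<xi>\<bar>\<^sup>2" using x2 by (intro power_mono) auto
        then have "1 + \<xi>\<^sup>2 \<le> 2 * \<xi>\<^sup>2" by simp
        also have "\<dots> \<le> \<bar>\<xi>\<bar> * \<xi>\<^sup>2" using x2 by (intro mult_right_mono) auto
        finally show ?thesis by (simp add: power3_eq_cube power2_eq_square)
      qed
      also have "\<bar>\<xi>\<bar> ^ 3 = \<bar>\<xi>\<bar> powr 3" using x2 by (simp add: powr_numeral)
      finally have le: "1 + \<xi>\<^sup>2 \<le> \<bar>\<xi>\<bar> powr 3" .
      have "\<bar>\<xi>\<bar> powr (- p) \<le> \<bar>\<xi>\<bar> powr (3 * (- q))" using x2 q by (intro powr_mono) auto
      also have "\<dots> = (\<bar>\<xi>\<bar> powr 3) powr (- q)" by (simp only: powr_powr)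
      also have "\<dots> \<le> om q \<xi>" unfolding om_def using le q by (intro powr_mono2') auto
      finally show ?thesis using far[OF True] by (simp add: a_def)
    next
      case False
      have "\<bar>a \<xi>\<bar> \<le> 1 - \<xi>\<^sup>2 / (8 * X\<^sup>2)"
      proof (cases "\<xi> = 0")
        case True then show ?thesis using a1[of 0] by simp
      next
        case F: False
        obtain k where "X / \<bar>\<xi>\<bar> < 2 ^ k" using real_arch_pow[of 2 "X / \<bar>\<xi>\<bar>"] by auto
        then have "X / 2^k \<le> \<bar>\<xi>\<bar>" using F by (simp add: field_simps)
        then show ?thesis by (rule near) (use False X in simp)
      qed
      also have "\<dots> \<le> exp (- (\<xi>\<^sup>2 / (8 * X\<^sup>2)))" using exp_ge_add_one_self[of "- (\<xi>\<^sup>2 / (8 * X\<^sup>2))"] by simp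
      also have "\<dots> \<le> exp (- (q * \<xi>\<^sup>2))" using mult_right_mono[OF q(3), of "\<xi>\<^sup>2"] by simp
      also have "\<dots> = exp (\<xi>\<^sup>2) powr (- q)" by (simp add: exp_powr_real mult.commute)
      also have "\<dots> \<le> om q \<xi>" unfolding om_def
        using q exp_ge_add_one_self[of "\<xi>\<^sup>2"] by (intro powr_mono2') (auto intro: add_pos_nonneg)
      finally show ?thesis by (simp add: a_def)
    qed
  qed
qed

section \<open>The symmetrized datum and the bound for the full solution\<close>

lemma symmetrized_density:
  assumes "prob_density g"
  shows "symmetrized (density lborel g) = density lborel (\<lambda>v. ennreal ((g v + g (- v)) / 2))"
proof (rule measure_eqI)
  have [measurable]: "g \<in> borel_measurable borel" and nn: "\<And>v. 0 \<le> g v" using assms by (simp_all add: prob_density_def)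
  fix B assume "B \<in> sets (symmetrized (density lborel g))"
  then have [measurable]: "B \<in> sets borel" by simp
  have 1: "emeasure (density lborel g) B = (\<integral>\<^sup>+v. ennreal (g v) * indicator B v \<partial>lborel)"
    by (simp add: emeasure_density)
  have "emeasure (density lborel g) {x. - x \<in> B} = (\<integral>\<^sup>+v. ennreal (g v) * indicator {x. - x \<in> B} v \<partial>lborel)"
    by (simp add: emeasure_density)
  also have "\<dots> = (\<integral>\<^sup>+v. ennreal (g (- v)) * indicator B v \<partial>lborel)"
    by (subst nn_integral_lborel_neg[symmetric]) (auto intro!: nn_integral_cong split: split_indicator)
  finally have 2: "emeasure (density lborel g) {x. - x \<in> B} = (\<integral>\<^sup>+v. ennreal (g (- v)) * indicator B v \<partial>lborel)" .
  have "emeasure (symmetrized (density lborel g)) B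
      = ((\<integral>\<^sup>+v. ennreal (g v) * indicator B v \<partial>lborel) + (\<integral>\<^sup>+v. ennreal (g (- v)) * indicator B v \<partial>lborel)) / 2"
    by (subst emeasure_symmetrized) (simp_all add: 1 2)
  also have "\<dots> = (\<integral>\<^sup>+v. (ennreal (g v) * indicator B v + ennreal (g (- v)) * indicator B v) / 2 \<partial>lborel)"
    by (subst nn_integral_divide, measurable, subst nn_integral_add) auto
  also have "\<dots> = (\<integral>\<^sup>+v. ennreal ((g v + g (- v)) / 2) * indicator B v \<partial>lborel)"
    by (intro nn_integral_cong) (auto simp: nn ennreal_plus[symmetric] divide_ennreal[symmetric] simp del: ennreal_plus split: split_indicator)
  finally show "emeasure (symmetrized (density lborel g)) B = emeasure (density lborel (\<lambda>v. ennreal ((g v + g (- v)) / 2))) B"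
    by (simp add: emeasure_density)
qed simp

lemma prob_density_integral:
  assumes g: "prob_density g" shows "integrable lborel g" "(LINT v|lborel. g v) = 1"
proof -
  have m: "g \<in> borel_measurable lborel" and nn: "AE v in lborel. 0 \<le> g v" using g by (simp_all add: prob_density_def)
  show "integrable lborel g"
    by (rule integrableI_nonneg[OF m nn]) (simp add: prob_density_mass[OF g])
  show "(LINT v|lborel. g v) = 1"
    unfolding integral_eq_nn_integral[OF m nn] prob_density_mass[OF g] by simp
qed

lemma prob_symmetrized:
  assumes g: "prob_density g" shows "prob_space (symmetrized (density lborel g))"
proof
  have "prob_space (density lborel g)" using g by (simp add: prob_density_def)
  then have "emeasure (density lborel g) UNIV = 1" using prob_space.emeasure_space_1 by fastforce
  moreover have "space (symmetrized (density lborel g)) = UNIV" unfolding symmetrized_density[OF g] by simp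
  ultimately show "emeasure (symmetrized (density lborel g)) (space (symmetrized (density lborel g))) = 1"
    by (simp add: emeasure_symmetrized ennreal_divide_self)
qed

lemma symmetrized_even:
  fixes h :: "real \<Rightarrow> real"
  assumes g: "prob_density g" and [measurable]: "h \<in> borel_measurable borel" and even: "\<And>v. h (- v) = h v"
    and i: "integrable lborel (\<lambda>v. g v * h v)"
  shows "integrable (symmetrized (density lborel g)) h" "(LINT v|symmetrized (density lborel g). h v) = (LINT v|lborel. g v * h v)"
proof -
  have [measurable]: "g \<in> borel_measurable borel" and nn: "\<And>v. 0 \<le> g v" using g by (simp_all add: prob_density_def)
  have e: "(g v + g (- v)) / 2 * h v = (g v * h v) / 2 + (g (- v) * h (- v)) / 2" for v by (simp add: even field_simps)
  have i': "integrable lborel (\<lambda>v. g (- v) * h (- v))" using lborel_integrable_real_affine[OF i, of "-1" 0] by simp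
  have v': "(LINT v|lborel. g (- v) * h (- v)) = (LINT v|lborel. g v * h v)"
    using lborel_integral_real_affine[of "-1" "\<lambda>v. g v * h v" 0] by simp
  have "integrable lborel (\<lambda>v. (g v + g (- v)) / 2 * h v)" unfolding e using i i' by simp
  then show "integrable (symmetrized (density lborel g)) h" unfolding symmetrized_density[OF g]
    by (subst integrable_density) (auto simp: nn)
  have "(LINT v|lborel. (g v + g (- v)) / 2 * h v) = (LINT v|lborel. g v * h v)" unfolding e using i i' v' by simp
  then show "(LINT v|symmetrized (density lborel g). h v) = (LINT v|lborel. g v * h v)" unfolding symmetrized_density[OF g]
    by (subst integral_density) (auto simp: nn)
qed

lemma symmetrized_odd:
  fixes h :: "real \<Rightarrow> real"
  assumes g: "prob_density g" and "h \<in> borel_measurable borel" "\<And>v. h (- v) = - h v"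
  shows "(LINT v|symmetrized (density lborel g). h v) = 0"
proof (rule odd_integral)
  have [measurable]: "g \<in> borel_measurable borel" using g by (simp add: prob_density_def)
  show "distr (symmetrized (density lborel g)) borel uminus = symmetrized (density lborel g)"
    unfolding symmetrized_density[OF g] by (rule distr_density_even) (auto simp: add.commute)
qed (use assms in auto)

text \<open>For \<open>\<delta> = 0\<close> the fourth power is split at a large radius into \<open>u1\<close>, of small integral, and \<open>u2\<close>, which allows \<open>s = 5\<close>.\<close>

lemma kac_L1_bound:
  fixes \<sigma> p :: real
  assumes g: "prob_density f0" and sol: "kac_solution f0 f" and \<sigma>: "0 < \<sigma>"
    and M: "M = symmetrized (density lborel f0)" and i4: "integrable M (\<lambda>v. v^4)"
    and m: "integrable M (\<lambda>v. v\<^sup>2)" "(LINT v|M. v\<^sup>2) = \<sigma>\<^sup>2" "(LINT v|M. v^4) = 3 * \<sigma>^4"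
    and p: "0 < p" and o: "char (density lborel f0) \<in> o[at_infinity](\<lambda>\<xi>. complex_of_real (\<bar>\<xi>\<bar> powr (- p)))"
    and s: "4 \<le> s" "s \<le> 6"
  shows "\<exists>K>0. \<forall>u1 u2. integrable M u1 \<and> integrable M u2 \<and> (\<forall>v. 0 \<le> u1 v \<and> 0 \<le> u2 v \<and> (v^4 \<le> u1 v \<or> \<bar>v\<bar> powr s \<le> u2 v)) \<longrightarrow>
    (\<exists>A\<ge>1. \<forall>t\<ge>0. (LINT v|lborel. \<bar>f v t - normal_density 0 \<sigma> v\<bar>) \<le> K * ((LINT v|M. u1 v) * exp (- t / 4) + A * exp (- (1 - 2 * alpha s) * t)))"
proof -
  have [measurable]: "f0 \<in> borel_measurable borel" and nn0: "\<And>v. 0 \<le> f0 v" using g by (simp_all add: prob_density_def)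
  have pf0: "prob_space (density lborel f0)" using g by (simp add: prob_density_def)
  have pd: "prob_density (\<lambda>v. f v t)" if "0 \<le> t" for t using sol that by (simp add: kac_solution_def)
  have i0: "integrable lborel (\<lambda>v. f0 v)" "(LINT v|lborel. f0 v) = 1"
    using prob_density_integral[OF g] by simp_all
  have pM: "prob_space M" unfolding M by (rule prob_symmetrized[OF g])
  have sM: "sets M = sets borel" by (simp add: M)
  obtain F where "kac_levels F" and Ff: "\<And>t. 0 \<le> t \<Longrightarrow> AE v in lborel. F v t = ennreal ((f v t + f (- v) t) / 2)"
    and dec: "\<And>t. 0 \<le> t \<Longrightarrow> AE v in lborel. f v t - f (- v) t = exp (- t) * (f0 v - f0 (- v))"
    using kac_solution_levels[OF sol] by blast
  interpret kac_levels F by fact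
  have f00: "AE v in lborel. f v 0 = f0 v" using sol unfolding kac_solution_def by (auto elim: eventually_mono)
  have muM: "mu 0 0 = M" unfolding mu_def M symmetrized_density[OF g]
  proof (rule density_cong)
    show "AE v in lborel. lev 0 v 0 = ennreal ((f0 v + f0 (- v)) / 2)"
      using Ff[of 0] f00 AE_neg[OF f00] by auto
  qed (use lev_meas_1[of 0 0] in auto)
  have "(\<integral>\<^sup>+v. ennreal (v\<^sup>2) \<partial>mu 0 0) = ennreal (\<sigma>\<^sup>2)" unfolding muM using m by (subst nn_integral_eq_integral) auto
  then have m2: "(\<integral>\<^sup>+v. ennreal (v\<^sup>2) \<partial>mu 0 0) \<le> ennreal (\<sigma>\<^sup>2)" by simp
  obtain q where q: "0 < q" "q \<le> \<sigma>\<^sup>2 / 2" and cd: "\<And>\<xi>. \<bar>LINT v|density lborel f0. cos (\<xi> * v)\<bar> \<le> om q \<xi>"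
    using cos_decay[OF pf0 _ p o, of "\<sigma>\<^sup>2 / 2"] \<sigma> by auto
  have init: "\<bar>Amp 0 0 \<xi> 0\<bar> \<le> om q \<xi>" for \<xi>
  proof -
    have "integrable lborel (\<lambda>v. f0 v * cos (\<xi> * v))"
      by (rule Bochner_Integration.integrable_bound[OF i0(1)]) (auto simp: abs_mult nn0 intro!: AE_I2 mult_left_le)
    then have "Amp 0 0 \<xi> 0 = (LINT v|lborel. f0 v * cos (\<xi> * v))"
      unfolding Amp_def muM M tr_def using symmetrized_even(2)[OF g, of "\<lambda>v. cos (\<xi> * v)"] by simp
    also have "\<dots> = (LINT v|density lborel f0. cos (\<xi> * v))" by (subst integral_density) (auto simp: nn0)
    finally show ?thesis using cd by simp
  qed
  obtain R where R: "1 \<le> R" and L1: "\<forall>s'. 4 \<le> s' \<and> s' \<le> 6 \<longrightarrow> (\<exists>K\<ge>0. \<forall>A1\<ge>0. \<forall>A2\<ge>1.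
     (\<forall>j<3. \<forall>\<xi>. \<bar>Amp 0 j \<xi> 0 - gs \<sigma> j \<xi>\<bar> \<le> A1 * mw R \<xi> powr (4 - real j) + A2 * mw R \<xi> powr (s' - real j)) \<longrightarrow>
     (\<forall>t\<ge>0. (LINT v|lborel. \<bar>den 0 t v - normal_density 0 \<sigma> v\<bar>) \<le> K * (A1 * exp (- (1 - 2 * alpha 4) * t) + A2 * exp (- (1 - 2 * alpha s') * t))))"
    using L1_convergence[OF \<sigma> m2 q init] by (elim exE conjE)
  from L1[rule_format, OF conjI[OF s]] obtain K where K: "0 \<le> K" and bound: "\<forall>A1\<ge>0. \<forall>A2\<ge>1.
     (\<forall>j<3. \<forall>\<xi>. \<bar>Amp 0 j \<xi> 0 - gs \<sigma> j \<xi>\<bar> \<le> A1 * mw R \<xi> powr (4 - real j) + A2 * mw R \<xi> powr (s - real j)) \<longrightarrow>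
     (\<forall>t\<ge>0. (LINT v|lborel. \<bar>den 0 t v - normal_density 0 \<sigma> v\<bar>) \<le> K * (A1 * exp (- (1 - 2 * alpha 4) * t) + A2 * exp (- (1 - 2 * alpha s) * t)))"
    by (elim exE conjE)
  \<comment> \<open>The even part of the solution has density \<open>den 0 t\<close>; the odd part
    has L1 norm at most \<open>exp (- t)\<close>.\<close>
  have tri: "(LINT v|lborel. \<bar>f v t - normal_density 0 \<sigma> v\<bar>) \<le> (LINT v|lborel. \<bar>den 0 t v - normal_density 0 \<sigma> v\<bar>) + exp (- t)" if t: "0 \<le> t" for t
  proof -
    have in': "integrable lborel (normal_density 0 \<sigma>)" using \<sigma> by simp
    have ig: "integrable lborel (\<lambda>v. \<bar>den 0 t v - normal_density 0 \<sigma> v\<bar>)"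
      by (intro integrable_abs Bochner_Integration.integrable_diff den_integrable in')
    have i0': "integrable lborel (\<lambda>v. f0 (- v))" "(LINT v|lborel. f0 (- v)) = 1"
      using lborel_integrable_real_affine[OF i0(1), of "-1" 0] lborel_integral_real_affine[of "-1" f0 0] i0 by simp_all
    have "(LINT v|lborel. \<bar>f v t - normal_density 0 \<sigma> v\<bar>) \<le> (LINT v|lborel. \<bar>den 0 t v - normal_density 0 \<sigma> v\<bar> + exp (- t) * ((f0 v + f0 (- v)) / 2))"
    proof (rule integral_le_bound)
      show "integrable lborel (\<lambda>v. \<bar>den 0 t v - normal_density 0 \<sigma> v\<bar> + exp (- t) * ((f0 v + f0 (- v)) / 2))"
        using ig i0 i0' by simp
      show "AE v in lborel. 0 \<le> \<bar>den 0 t v - normal_density 0 \<sigma> v\<bar> + exp (- t) * ((f0 v + f0 (- v)) / 2)"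
        using nn0 by (intro AE_I2) simp
      show "AE v in lborel. \<bar>f v t - normal_density 0 \<sigma> v\<bar> \<le> \<bar>den 0 t v - normal_density 0 \<sigma> v\<bar> + exp (- t) * ((f0 v + f0 (- v)) / 2)"
        using Ff[OF t] dec[OF t]
      proof eventually_elim
        case (elim v)
        have "0 \<le> f v t" "0 \<le> f (- v) t" using pd[OF t] by (simp_all add: prob_density_def)
        then have d: "den 0 t v = (f v t + f (- v) t) / 2" using elim(1) by (simp add: den_def)
        have "\<bar>f0 v - f0 (- v)\<bar> \<le> f0 v + f0 (- v)" using nn0[of v] nn0[of "- v"] by linarith
        then have "\<bar>f v t - f (- v) t\<bar> \<le> exp (- t) * (f0 v + f0 (- v))" unfolding elim(2) abs_mult by (simp add: mult_left_mono)
        moreover have "\<bar>x - n\<bar> \<le> \<bar>(x + y) / 2 - n\<bar> + b / 2" if "\<bar>x - y\<bar> \<le> b" for x y n b :: real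
        proof -
          have "x - n = ((x + y) / 2 - n) + (x - y) / 2" by (simp add: field_simps)
          then have "\<bar>x - n\<bar> \<le> \<bar>(x + y) / 2 - n\<bar> + \<bar>(x - y) / 2\<bar>" by (simp only: abs_triangle_ineq)
          then show ?thesis using that by simp
        qed
        ultimately show ?case unfolding d times_divide_eq_right by blast
      qed
    qed
    also have "\<dots> = (LINT v|lborel. \<bar>den 0 t v - normal_density 0 \<sigma> v\<bar>) + exp (- t)"
      using ig i0 i0' by simp
    finally show ?thesis .
  qed
  show ?thesis
  proof (rule exI[of _ "K + 1"], rule conjI, use K in simp, intro allI impI)
    fix u1 u2 :: "real \<Rightarrow> real"
    assume u: "integrable M u1 \<and> integrable M u2 \<and> (\<forall>v. 0 \<le> u1 v \<and> 0 \<le> u2 v \<and> (v^4 \<le> u1 v \<or> \<bar>v\<bar> powr s \<le> u2 v))"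
    obtain A where A: "1 \<le> A" and ib: "\<forall>j<3. \<forall>\<xi>. \<bar>(LINT v|M. tr j \<xi> v) - gs \<sigma> j \<xi>\<bar> \<le> (LINT v|M. u1 v) * mw R \<xi> powr (4 - real j) + A * mw R \<xi> powr (s - real j)"
      using initial_bounds[OF \<sigma> pM sM i4 m(2,3), of u1 u2 s R] u s R by auto
    have U: "0 \<le> (LINT v|M. u1 v)" using u by (intro Bochner_Integration.integral_nonneg) auto
    show "\<exists>A\<ge>1. \<forall>t\<ge>0. (LINT v|lborel. \<bar>f v t - normal_density 0 \<sigma> v\<bar>) \<le> (K + 1) * ((LINT v|M. u1 v) * exp (- t / 4) + A * exp (- (1 - 2 * alpha s) * t))"
    proof (intro exI[of _ A] conjI allI impI A)
      fix t :: real assume t: "0 \<le> t"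
      have "(LINT v|lborel. \<bar>den 0 t v - normal_density 0 \<sigma> v\<bar>) \<le> K * ((LINT v|M. u1 v) * exp (- (1 - 2 * alpha 4) * t) + A * exp (- (1 - 2 * alpha s) * t))"
        using bound[rule_format, of "LINT v|M. u1 v" A t] U A t ib unfolding Amp_def muM by simp
      then have 1: "(LINT v|lborel. \<bar>den 0 t v - normal_density 0 \<sigma> v\<bar>) \<le> K * ((LINT v|M. u1 v) * exp (- t / 4) + A * exp (- (1 - 2 * alpha s) * t))"
        by (simp add: alpha_4)
      have "0 \<le> alpha s * t" using t alpha_nonneg by simp
      \<comment> \<open>\<open>1 \<le> A\<close> lets the fast rate absorb the contribution of the
        odd part.\<close>
      then have "1 * exp (- t) \<le> A * exp (- (1 - 2 * alpha s) * t)" using A by (intro mult_mono) (auto simp: algebra_simps)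
      moreover have "0 \<le> (LINT v|M. u1 v) * exp (- t / 4)" using U by simp
      ultimately have "exp (- t) \<le> 1 * ((LINT v|M. u1 v) * exp (- t / 4) + A * exp (- (1 - 2 * alpha s) * t))" by simp
      then show "(LINT v|lborel. \<bar>f v t - normal_density 0 \<sigma> v\<bar>) \<le> (K + 1) * ((LINT v|M. u1 v) * exp (- t / 4) + A * exp (- (1 - 2 * alpha s) * t))"
        using 1 tri[OF t] unfolding distrib_right[of K 1] by linarith
    qed
  qed
qed

theorem theorem2p2:
  fixes f0 :: "real \<Rightarrow> real" and f :: "real \<Rightarrow> real \<Rightarrow> real"
    and \<mu>0 :: "real measure" and \<sigma> \<delta> p :: real
  assumes "prob_density f0"
    and "\<mu>0 = density lborel f0"
    and "0 \<le> \<sigma>" and "\<sigma>\<^sup>2 = (LINT v|lborel. v\<^sup>2 * f0 v)"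
    and "kac_solution f0 f"
    and "0 \<le> \<delta>" and "\<delta> < 2"
    and "integrable lborel (\<lambda>v. \<bar>v\<bar> powr (4 + \<delta>) * f0 v)"
    and "kappa4 (symmetrized \<mu>0) = 0"
    and "0 < p"
    and "char \<mu>0 \<in> o[at_infinity](\<lambda>\<xi>. complex_of_real (\<bar>\<xi>\<bar> powr (- p)))"
  shows "\<exists>C>0. \<exists>\<rho> :: real \<Rightarrow> real.
      (\<forall>t\<ge>0. 0 \<le> \<rho> t) \<and> (\<rho> \<longlongrightarrow> 0) at_top \<and>
      (0 < \<delta> \<longrightarrow> (\<forall>t\<ge>0. \<rho> t = exp ((- 3 / 4 + 2 * alpha (4 + \<delta>)) * t))) \<and>
      (\<forall>t\<ge>0. (LINT v|lborel. \<bar>f v t - 1 / (\<sigma> * sqrt (2 * pi)) * exp (- v\<^sup>2 / (2 * \<sigma>\<^sup>2))\<bar>)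
                 \<le> C * exp (- t / 4) * \<rho> t)"
proof -
  note g = assms(1)
  have [measurable]: "f0 \<in> borel_measurable borel" and nn0: "\<And>v. 0 \<le> f0 v" using g by (simp_all add: prob_density_def)
  have i0: "integrable lborel f0" "(LINT v|lborel. f0 v) = 1"
    using prob_density_integral[OF g] by simp_all
  let ?s = "4 + \<delta>"
  define M where "M = symmetrized (density lborel f0)"
  have sM [measurable_cong]: "sets M = sets borel" by (simp add: M_def)
  have ish: "integrable lborel (\<lambda>v. f0 v * \<bar>v\<bar> powr ?s)" using assms(8) by (simp add: mult.commute)
  have le: "\<bar>v\<bar> ^ n \<le> 1 + \<bar>v\<bar> powr ?s" if "n \<le> 4" for n and v :: real
  proof (cases "\<bar>v\<bar> \<le> 1")
    case True then show ?thesis using power_le_one[of "\<bar>v\<bar>" n] by (intro add_increasing2) auto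
  next
    case False
    then have "\<bar>v\<bar> ^ n = \<bar>v\<bar> powr n" by (simp add: powr_realpow)
    also have "\<dots> \<le> \<bar>v\<bar> powr ?s" using False that assms(6) by (intro powr_mono) auto
    finally show ?thesis by simp
  qed
  have iw: "integrable lborel (\<lambda>v. f0 v * h v)" if [measurable]: "h \<in> borel_measurable borel" and h: "\<And>v. \<bar>h v\<bar> \<le> 1 + \<bar>v\<bar> powr ?s" for h :: "real \<Rightarrow> real"
  proof (rule Bochner_Integration.integrable_bound)
    show "integrable lborel (\<lambda>v. f0 v + f0 v * \<bar>v\<bar> powr ?s)" using i0 ish by simp
    show "AE v in lborel. norm (f0 v * h v) \<le> norm (f0 v + f0 v * \<bar>v\<bar> powr ?s)"
      using mult_left_mono[OF h nn0] nn0 by (intro AE_I2) (simp add: abs_mult distrib_left)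
  qed simp
  have i2: "integrable lborel (\<lambda>v. f0 v * v\<^sup>2)" by (rule iw) (use le[of 2] in simp_all)
  have i4: "integrable lborel (\<lambda>v. f0 v * v^4)" by (rule iw) (use le[of 4] in \<open>simp_all add: power_even_abs\<close>)
  \<comment> \<open>A vanishing second moment would concentrate the law at 0, which is impossible
    for a density.\<close>
  have \<sigma>: "0 < \<sigma>"
  proof (rule ccontr)
    assume "\<not> 0 < \<sigma>"
    then have "(LINT v|lborel. f0 v * v\<^sup>2) = 0" using assms(3,4) by (simp add: mult.commute)
    then have "AE v in lborel. f0 v * v\<^sup>2 = 0" using i2 nn0 by (subst (asm) integral_nonneg_eq_0_iff_AE) auto
    moreover have "AE v in lborel. v \<noteq> (0::real)" by (rule AE_lborel_singleton)
    ultimately have "AE v in lborel. f0 v = 0" by eventually_elim simp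
    then have "(LINT v|lborel. f0 v) = 0" by (rule integral_eq_zero_AE)
    then show False using i0 by simp
  qed
  note even = symmetrized_even[OF g, folded M_def]
  have M2: "integrable M (\<lambda>v. v\<^sup>2)" "(LINT v|M. v\<^sup>2) = \<sigma>\<^sup>2"
    using even[of "\<lambda>v. v\<^sup>2", OF _ _ i2] assms(4) by (simp_all add: mult.commute)
  have M4: "integrable M (\<lambda>v. v^4)" using even(1)[of "\<lambda>v. v^4", OF _ _ i4] by simp
  \<comment> \<open>With mean 0 the fourth cumulant involves raw moments only, so its vanishing says
    that the fourth moment is the Gaussian one.\<close>
  have m0: "mean M = 0" unfolding mean_def M_def by (rule symmetrized_odd[OF g]) auto
  have M4': "(LINT v|M. v^4) = 3 * \<sigma>^4"
    using assms(9) M2(2) by (simp add: kappa4_def assms(2) M_def[symmetric] m0 power2_eq_square power4_eq_xxxx)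
  have Ms: "integrable M (\<lambda>v. \<bar>v\<bar> powr ?s)" using even(1)[of "\<lambda>v. \<bar>v\<bar> powr ?s", OF _ _ ish] by simp
  define W where "W t = (LINT v|lborel. \<bar>f v t - normal_density 0 \<sigma> v\<bar>)" for t
  have W: "(LINT v|lborel. \<bar>f v t - 1 / (\<sigma> * sqrt (2 * pi)) * exp (- v\<^sup>2 / (2 * \<sigma>\<^sup>2))\<bar>) = W t" for t
    unfolding W_def normal_density_def using \<sigma> by (simp add: real_sqrt_mult mult_ac)
  have Wnn: "0 \<le> W t" for t by (simp add: W_def)
  note L1 = kac_L1_bound[OF g assms(5) \<sigma> M_def M4 M2 M4' assms(10) assms(11)[unfolded assms(2)], folded W_def]
  \<comment> \<open>Splits off the rate 1/4; the other factor is the \<rho> of the case \<delta> >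
    0.\<close>
  have rate: "exp (- (1 - 2 * alpha s) * t) = exp (- t / 4) * exp ((- 3 / 4 + 2 * alpha s) * t)" for s t
    unfolding exp_add[symmetric] by (simp add: algebra_simps)
  have tends: "((\<lambda>t. exp ((- 3 / 4 + 2 * alpha s) * t)) \<longlongrightarrow> 0) at_top" if "4 < s" for s
  proof -
    have "alpha s < alpha 4" using that by (intro alpha_strict_antimono) auto
    then have neg: "- 3 / 4 + 2 * alpha s < 0" by (simp add: alpha_4)
    show ?thesis
      by (rule filterlim_compose[OF exp_at_bot filterlim_tendsto_neg_mult_at_bot[OF tendsto_const neg filterlim_ident]])
  qed
  show ?thesis
  proof (cases "\<delta> = 0")
    case False
    then have d: "0 < \<delta>" using assms(6) by simp
    have s46: "4 \<le> ?s" "?s \<le> 6" using assms(6,7) by simp_all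
    obtain K where K: "0 < K" and b: "\<forall>u1 u2. integrable M u1 \<and> integrable M u2 \<and> (\<forall>v. 0 \<le> u1 v \<and> 0 \<le> u2 v \<and> (v^4 \<le> u1 v \<or> \<bar>v\<bar> powr ?s \<le> u2 v)) \<longrightarrow>
      (\<exists>A\<ge>1. \<forall>t\<ge>0. W t \<le> K * ((LINT v|M. u1 v) * exp (- t / 4) + A * exp (- (1 - 2 * alpha ?s) * t)))"
      using L1[OF s46] by (elim exE conjE)
    \<comment> \<open>For \<delta> > 0 the whole remainder is charged to the power
      \<open>4 + \<delta>\<close>, so the term with the rate 1/4 disappears.\<close>
    obtain A where A: "1 \<le> A" "\<forall>t\<ge>0. W t \<le> K * (A * exp (- (1 - 2 * alpha ?s) * t))"
      using b[rule_format, of "\<lambda>_. 0" "\<lambda>v. \<bar>v\<bar> powr ?s"] Ms by auto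
    show ?thesis unfolding W
    proof (intro exI[of _ "K * A"] exI[of _ "\<lambda>t. exp ((- 3 / 4 + 2 * alpha ?s) * t)"] conjI allI impI tends)
      show "0 < K * A" using K A by simp
      show "4 < ?s" using d by simp
      show "W t \<le> K * A * exp (- t / 4) * exp ((- 3 / 4 + 2 * alpha ?s) * t)" if "0 \<le> t" for t
        using A(2)[rule_format, OF that] unfolding rate by (simp add: mult.assoc)
    qed simp_all
  next
    case True
    \<comment> \<open>Any order above 4 and up to 6 would do: the power 5 is integrated over a
      bounded set only.\<close>
    have s5: "4 \<le> (5::real)" "(5::real) \<le> 6" by simp_all
    obtain K where K: "0 < K" and b: "\<forall>u1 u2. integrable M u1 \<and> integrable M u2 \<and> (\<forall>v. 0 \<le> u1 v \<and> 0 \<le> u2 v \<and> (v^4 \<le> u1 v \<or> \<bar>v\<bar> powr 5 \<le> u2 v)) \<longrightarrow>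
      (\<exists>A\<ge>1. \<forall>t\<ge>0. W t \<le> K * ((LINT v|M. u1 v) * exp (- t / 4) + A * exp (- (1 - 2 * alpha 5) * t)))"
      using L1[OF s5] by (elim exE conjE)
    define tail where "tail n = (LINT v|M. indicator {v. real n < \<bar>v\<bar>} v * v^4)" for n
    have it: "integrable M (\<lambda>v. indicator {v. real n < \<bar>v\<bar>} v * v^4)" for n
      by (rule Bochner_Integration.integrable_bound[OF M4]) (auto split: split_indicator)
    have "tail \<longlonglongrightarrow> (LINT v|M. 0)" unfolding tail_def
    proof (rule integral_dominated_convergence[OF _ _ M4])
      show "AE v in M. (\<lambda>n. indicator {v. real n < \<bar>v\<bar>} v * v^4) \<longlonglongrightarrow> 0"
      proof (rule AE_I2, rule tendsto_eventually)
        fix v :: real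
        obtain n0 where n0: "\<bar>v\<bar> \<le> real n0" using real_arch_simple by blast
        show "\<forall>\<^sub>F n in sequentially. indicator {v. real n < \<bar>v\<bar>} v * v^4 = 0"
          using eventually_ge_at_top[of n0] by eventually_elim (use n0 in \<open>auto split: split_indicator\<close>)
      qed
    qed (auto split: split_indicator)
    then have tail: "tail \<longlonglongrightarrow> 0" by simp
    \<comment> \<open>The rescaled distance itself, so that the estimate holds with constant 1 and
      only the limit has to be proved.\<close>
    define \<rho> where "\<rho> t = exp (t / 4) * W t" for t
    have \<rho>nn: "0 \<le> \<rho> t" for t by (simp add: \<rho>_def Wnn)
    have "(\<rho> \<longlongrightarrow> 0) at_top"
    proof (rule tendstoI)
      fix e :: real assume e: "0 < e"
      have "\<forall>\<^sub>F n in sequentially. tail n < e / (2 * K)"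
        using order_tendstoD(2)[OF tail, of "e / (2 * K)"] e K by simp
      \<comment> \<open>\<open>K\<close> does not depend on the splitting radius \<open>n\<close>,
        so the slow term stays below \<open>e / 2\<close> at all times. The constant
        \<open>A\<close> obtained next depends on \<open>n\<close>, but it multiplies a decaying
        exponential.\<close>
      then obtain n where n: "tail n < e / (2 * K)" by (auto dest: eventually_happens)
      interpret prob_space M unfolding M_def by (rule prob_symmetrized[OF g])
      have i5: "integrable M (\<lambda>v. indicator {v. \<bar>v\<bar> \<le> real n} v * \<bar>v\<bar> powr 5)"
        by (rule integrable_const_bound[where B="real n powr 5"]) (auto intro!: AE_I2 powr_mono2 split: split_indicator)
      obtain A where A: "1 \<le> A" "\<forall>t\<ge>0. W t \<le> K * (tail n * exp (- t / 4) + A * exp (- (1 - 2 * alpha 5) * t))"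
        using b[rule_format, of "\<lambda>v. indicator {v. real n < \<bar>v\<bar>} v * v^4" "\<lambda>v. indicator {v. \<bar>v\<bar> \<le> real n} v * \<bar>v\<bar> powr 5", OF conjI[OF it[of n] conjI[OF i5]]]
        unfolding tail_def[symmetric] by (rule exE) (auto split: split_indicator)
      have le: "\<rho> t \<le> K * tail n + K * A * exp ((- 3 / 4 + 2 * alpha 5) * t)" if "0 \<le> t" for t
      proof -
        have "\<rho> t \<le> exp (t / 4) * (K * (tail n * exp (- t / 4) + A * (exp (- t / 4) * exp ((- 3 / 4 + 2 * alpha 5) * t))))"
          unfolding \<rho>_def using A(2)[rule_format, OF that] unfolding rate by (rule mult_left_mono) simp
        also have "\<dots> = (exp (t / 4) * exp (- t / 4)) * (K * tail n + K * A * exp ((- 3 / 4 + 2 * alpha 5) * t))"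
          by (simp add: algebra_simps)
        also have "exp (t / 4) * exp (- t / 4) = 1" unfolding exp_add[symmetric] by simp
        finally show ?thesis by simp
      qed
      have "((\<lambda>t. K * A * exp ((- 3 / 4 + 2 * alpha 5) * t)) \<longlongrightarrow> K * A * 0) at_top"
        by (intro tendsto_mult tendsto_const tends) simp
      then have "\<forall>\<^sub>F t in at_top. K * A * exp ((- 3 / 4 + 2 * alpha 5) * t) < e / 2"
        using order_tendstoD(2)[of _ "K * A * 0" at_top "e / 2"] e by simp
      then show "\<forall>\<^sub>F t in at_top. dist (\<rho> t) 0 < e"
        using eventually_ge_at_top[of 0]
      proof eventually_elim
        case (elim t)
        have "K * tail n < e / 2" using n K by (simp add: field_simps)
        then show ?case using le[OF elim(2)] elim(1) \<rho>nn[of t] by (simp add: dist_real_def)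
      qed
    qed
    moreover have "W t \<le> 1 * exp (- t / 4) * \<rho> t" for t
      unfolding \<rho>_def by (simp add: mult.assoc[symmetric] exp_add[symmetric])
    ultimately show ?thesis unfolding W using \<rho>nn True
      by (intro exI[of _ 1] exI[of _ \<rho>]) auto
  qed
qed

end
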